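(* Let $q>2$ be a prime power. The Hermitian Singer functional code $C_{\mathcal{L}}(\mathtt{D},\mathtt{G})$ is a linear code over $\mathbb{F}_{q^2}$ with parameters $$\left[\,q(q^2-q+1),\ \tfrac12(q^2-q)+2,\ q^3+1-2(q^2-q+1)\,\right]_{q^2}$$ (length, dimension, minimum distance), and its minimum distance is equal to its designed minimum distance $n-\deg(\mathtt{G})$, where $n=q(q^2-q+1)$ is the length.
   Context: Let $q>2$ be a prime power and let $PG(2,q^6)$ have homogeneous coordinates $(X_1:X_2:X_0)$. Let $\Pi$ be the set of points $(\gamma:\gamma^{q^2+1}:1)$ with $\gamma\in\mathbb{F}_{q^6}$, $\gamma^{q^4+q^2+1}=1$, whose lines are the sections by the lines $sX_1+s^{q^2+1}X_2+X_0=0$ with $s^{q^4+q^2+1}=1$. $\Pi$ is a projective plane of order $q^2$, and there is a projectivity of $PG(2,q^6)$ mapping $\Pi$ onto $PG(2,q^2)$. The Frobenius collineation of $\Pi$, which fixes exactly the points of $\Pi$, is $\Phi_\Pi:(x_1:x_2:x_0)\mapsto(x_0^{q^2}:x_1^{q^2}:x_2^{q^2})$. A curve, divisor or rational function is "defined over $\mathbb{F}_{q^2}$" (equivalently, over $\Pi$) if it is so in the usual sense after applying a projectivity mapping $\Pi$ onto $PG(2,q^2)$. Let $\Gamma$ be the Singer subgroup: the cyclic group of order $q^2-q+1$ generated by the projectivity $(x_1:x_2:x_0)\mapsto(\beta x_1:\beta^{q}x_2:x_0)$, where $\beta$ is a primitive $(q^2-q+1)$-th root of unity in $\mathbb{F}_{q^6}$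 (note $\beta^{q^2+1}=\beta^q$). It preserves $\Pi$ and every curve $H_t$: $tX_1X_2^q+t^{q^2+1}X_2X_0^q+X_0X_1^q=0$ with $t^{q^2+q+1}=1$. Each $H_t$ is a Hermitian curve of $\Pi$: it is non-singular of genus $\mathfrak{g}=\frac12(q^2-q)$, is defined over $\mathbb{F}_{q^2}$ (that is, in the usual sense after applying a projectivity mapping $\Pi$ onto $PG(2,q^2)$), and has exactly $q^3+1$ points in $\Pi$. These points are its $\mathbb{F}_{q^2}$-rational points. Fix $\tau$ with $\tau^{q^2+q+1}=1$. Let $G=\{P_1,\dots,P_N\}$, $N=q^2-q+1$, be the $\Gamma$-orbit of a point of $H_\tau\cap\Pi$, and put $\mathtt{G}=P_1+\cdots+P_N$. Let $D=\{Q_1,\dots,Q_n\}$ be the set of all other points of $H_\tau\cap\Pi$, so $n=q^3+1-(q^2-q+1)$, and put $\mathtt{D}=Q_1+\cdots+Q_n$. Let $\mathcal{L}(\mathtt{G})$ be the Riemann-Roch space over $\mathbb{F}_{q^2}$, i.e. the rational functions $f$ on $H_\tau$ defined over $\mathbb{F}_{q^2}$ with $f=0$ or $\mathrm{div}(f)+\mathtt{G}\succcurlyeq 0$. The Hermitian Singer functional code is $$C_{\mathcal{L}}(\mathtt{D},\mathtt{G})=\{(f(Q_1),\dots,f(Q_n)) : f\in\mathcal{L}(\mathtt{G})\}\subseteq\mathbb{F}_{q^2}^n .$$ Its designed minimum distance is $n-\deg(\mathtt{G})$. *)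

theory Defs
  imports
    "HOL-Analysis.Determinants"
    "HOL-Library.Poly_Mapping"
    "HOL-Computational_Algebra.Polynomial"
    "Jordan_Normal_Form.Missing_VectorSpace"
begin

section \<open>Projective plane over an algebraically closed field\<close>

text \<open>
  The ground field \<open>'a\<close> is algebraically closed of characteristic \<open>p\<close>; the finite field of
  order \<open>r\<close> (a power of \<open>p\<close>) is realised as the subfield of roots of \<open>x ^ r - x\<close>.
  Curves, divisors and orders at points are geometric, i.e. taken over \<open>'a\<close>.
\<close>

definition GF :: "nat \<Rightarrow> 'a::field set" where
  "GF r = {x. x ^ r = x}"

text \<open>
  The components with index 1, 2, 3 of a vector are the homogeneous coordinates
  \<open>(X\<^sub>1 : X\<^sub>2 : X\<^sub>0)\<close>, in this order (in the index type \<open>3\<close> one has \<open>3 = 0\<close>).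
  A point of the plane is a one-dimensional subspace.
\<close>

type_synonym 'a point = "('a ^ 3) set"

definition pt :: "'a::field ^ 3 \<Rightarrow> 'a point" where
  "pt v = vec.span {v}"

definition PG2 :: "'a::field set \<Rightarrow> 'a point set" where
  "PG2 S = {pt v | v. v \<noteq> 0 \<and> (\<forall>i. v $ i \<in> S)}"

definition act :: "'a::field ^ 3 ^ 3 \<Rightarrow> 'a point \<Rightarrow> 'a point" where
  "act M P = (\<lambda>v. M *v v) ` P"

definition Pi_plane :: "nat \<Rightarrow> 'a::field point set" where
  "Pi_plane q = {pt (vector [\<gamma>, \<gamma> ^ (q^2 + 1), 1]) | \<gamma>.
     \<gamma> \<in> GF (q^6) \<and> \<gamma> ^ (q^4 + q^2 + 1) = 1}"

definition projectivity_onto_PG :: "nat \<Rightarrow> 'a::field ^ 3 ^ 3 \<Rightarrow> bool" where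
  "projectivity_onto_PG q M \<longleftrightarrow>
     invertible M \<and> (\<forall>i j. M $ i $ j \<in> GF (q^6)) \<and> act M ` Pi_plane q = PG2 (GF (q^2))"

definition primitive_root_of_unity :: "nat \<Rightarrow> 'a::field \<Rightarrow> bool" where
  "primitive_root_of_unity m \<beta> \<longleftrightarrow> \<beta> ^ m = 1 \<and> (\<forall>i. 0 < i \<and> i < m \<longrightarrow> \<beta> ^ i \<noteq> 1)"

definition singer_generator :: "nat \<Rightarrow> 'a::field \<Rightarrow> 'a ^ 3 ^ 3" where
  "singer_generator q \<beta> = vector [vector [\<beta>, 0, 0], vector [0, \<beta> ^ q, 0], vector [0, 0, 1]]"

text \<open>The generator has finite order, so its powers with natural exponents form a group.\<close>

definition singer_orbit :: "nat \<Rightarrow> 'a::field \<Rightarrow> 'a point \<Rightarrow> 'a point set" where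
  "singer_orbit q \<beta> P = {(act (singer_generator q \<beta>) ^^ i) P | i. True}"


section \<open>Polynomials in three variables\<close>

type_synonym 'a poly3 = "(3 \<Rightarrow>\<^sub>0 nat) \<Rightarrow>\<^sub>0 'a"

definition Const :: "'a::comm_ring_1 \<Rightarrow> 'a poly3" where
  "Const c = Poly_Mapping.single 0 c"

definition Var :: "3 \<Rightarrow> 'a::comm_ring_1 poly3" where
  "Var i = Poly_Mapping.single (Poly_Mapping.single i 1) 1"

definition homogeneous :: "nat \<Rightarrow> 'a::comm_ring_1 poly3 \<Rightarrow> bool" where
  "homogeneous d A \<longleftrightarrow> (\<forall>m\<in>Poly_Mapping.keys A. (\<Sum>i\<in>UNIV. Poly_Mapping.lookup m i) = d)"

definition coeffs_in :: "'a set \<Rightarrow> 'a::comm_ring_1 poly3 \<Rightarrow> bool" where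
  "coeffs_in S A \<longleftrightarrow> (\<forall>m\<in>Poly_Mapping.keys A. Poly_Mapping.lookup A m \<in> S)"

definition eval_poly :: "'a::comm_ring_1 poly3 \<Rightarrow> 'a ^ 3 \<Rightarrow> 'a" where
  "eval_poly A v = (\<Sum>m\<in>Poly_Mapping.keys A.
     Poly_Mapping.lookup A m * (\<Prod>i\<in>UNIV. v $ i ^ Poly_Mapping.lookup m i))"

text \<open>The composition of \<open>A\<close> with the linear map \<open>v \<mapsto> M *v v\<close>.\<close>

definition lin_subst :: "'a::comm_ring_1 ^ 3 ^ 3 \<Rightarrow> 'a poly3 \<Rightarrow> 'a poly3" where
  "lin_subst M A = (\<Sum>m\<in>Poly_Mapping.keys A.
     Const (Poly_Mapping.lookup A m) *
       (\<Prod>i\<in>UNIV. (\<Sum>j\<in>UNIV. Const (M $ i $ j) * Var j) ^ Poly_Mapping.lookup m i))"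

definition vanishes_at :: "'a::field poly3 \<Rightarrow> 'a point \<Rightarrow> bool" where
  "vanishes_at A P \<longleftrightarrow> (\<forall>v\<in>P. eval_poly A v = 0)"

definition curve :: "'a::field poly3 \<Rightarrow> 'a point set" where
  "curve F = {P \<in> PG2 UNIV. vanishes_at F P}"

definition hermitian :: "nat \<Rightarrow> 'a::field \<Rightarrow> 'a poly3" where
  "hermitian q t = Const t * Var 1 * Var 2 ^ q + Const (t ^ (q^2 + 1)) * Var 2 * Var 3 ^ q
     + Var 3 * Var 1 ^ q"


section \<open>Function field, divisors, Riemann-Roch spaces\<close>

text \<open>
  Let \<open>F\<close> be an irreducible form. A rational function on the curve \<open>F = 0\<close> is represented by
  fractions \<open>A / B\<close> of forms of the same degree with \<open>B\<close> not divisible by \<open>F\<close>, where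
  \<open>A / B = C / D\<close> if \<open>F\<close> divides \<open>A * D - C * B\<close>.
\<close>

definition fractions :: "'a::field poly3 \<Rightarrow> ('a poly3 \<times> 'a poly3) set" where
  "fractions F = {(A, B). (\<exists>d. homogeneous d A \<and> homogeneous d B) \<and> \<not> F dvd B}"

definition frac_rel :: "'a::field poly3 \<Rightarrow> (('a poly3 \<times> 'a poly3) \<times> ('a poly3 \<times> 'a poly3)) set" where
  "frac_rel F = {((A, B), (C, D)). (A, B) \<in> fractions F \<and> (C, D) \<in> fractions F \<and>
     F dvd A * D - C * B}"

type_synonym 'a ratfun = "('a poly3 \<times> 'a poly3) set"

definition function_field :: "'a::field poly3 \<Rightarrow> 'a ratfun ring" where
  "function_field F =
     \<lparr>carrier = fractions F // frac_rel F,
      monoid.mult = (\<lambda>f g. \<Union>(A, B)\<in>f. \<Union>(C, D)\<in>g. frac_rel F `` {(A * C, B * D)}),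
      one = frac_rel F `` {(1, 1)},
      zero = frac_rel F `` {(0, 1)},
      add = (\<lambda>f g. \<Union>(A, B)\<in>f. \<Union>(C, D)\<in>g. frac_rel F `` {(A * D + C * B, B * D)})\<rparr>"

definition local_ring :: "'a::field poly3 \<Rightarrow> 'a point \<Rightarrow> 'a ratfun set" where
  "local_ring F P = {f \<in> carrier (function_field F). \<exists>(A, B)\<in>f. \<not> vanishes_at B P}"

definition fun_value :: "'a::field ratfun \<Rightarrow> 'a point \<Rightarrow> 'a" where
  "fun_value f P = (THE c. \<exists>(A, B)\<in>f. \<not> vanishes_at B P \<and>
     (\<forall>v\<in>P. eval_poly A v = c * eval_poly B v))"

definition maximal_ideal :: "'a::field poly3 \<Rightarrow> 'a point \<Rightarrow> 'a ratfun set" where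
  "maximal_ideal F P = {f \<in> local_ring F P. fun_value f P = 0}"

definition uniformizer :: "'a::field poly3 \<Rightarrow> 'a point \<Rightarrow> 'a ratfun \<Rightarrow> bool" where
  "uniformizer F P u \<longleftrightarrow> u \<in> local_ring F P \<and>
     maximal_ideal F P = {u \<otimes>\<^bsub>function_field F\<^esub> h | h. h \<in> local_ring F P}"

text \<open>
  At a non-singular point, \<open>ord_at F P f\<close> is the discrete valuation of the nonzero function \<open>f\<close>:
  the integer \<open>k\<close> with \<open>f = w u\<^sup>k\<close> for a uniformizer \<open>u\<close> and a unit \<open>w\<close> of the local ring.
  For \<open>f = 0\<close> it is unspecified.
\<close>

definition ord_at :: "'a::field poly3 \<Rightarrow> 'a point \<Rightarrow> 'a ratfun \<Rightarrow> int" where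
  "ord_at F P f = (THE k. \<exists>u w. uniformizer F P u \<and> w \<in> local_ring F P - maximal_ideal F P \<and>
     f = w \<otimes>\<^bsub>function_field F\<^esub> (u [^]\<^bsub>function_field F\<^esub> k))"

type_synonym 'a divisor = "'a point \<Rightarrow> int"

definition divisor_of :: "'a::field poly3 \<Rightarrow> 'a ratfun \<Rightarrow> 'a divisor" where
  "divisor_of F f = (\<lambda>P. if P \<in> curve F then ord_at F P f else 0)"

definition sum_of_points :: "'a point set \<Rightarrow> 'a divisor" where
  "sum_of_points S = (\<lambda>P. if P \<in> S then 1 else 0)"

definition deg_divisor :: "'a divisor \<Rightarrow> int" where
  "deg_divisor E = (\<Sum>P | E P \<noteq> 0. E P)"

text \<open>
  If the projectivity \<open>M\<close> maps \<open>\<Pi>\<close> onto \<open>PG(2, q\<^sup>2)\<close>, then \<open>f\<close> is transported to \<open>f \<circ> M\<^sup>-\<^sup>1\<close> on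
  the image curve; this is \<open>A / B\<close> for forms \<open>A\<close>, \<open>B\<close> over \<open>GF(q\<^sup>2)\<close> iff \<open>f\<close> is the
  fraction \<open>(A \<circ> M) / (B \<circ> M)\<close>.
\<close>

definition defined_over_Pi :: "nat \<Rightarrow> 'a::field ratfun \<Rightarrow> bool" where
  "defined_over_Pi q f \<longleftrightarrow> (\<exists>M A B. projectivity_onto_PG q M \<and>
     coeffs_in (GF (q^2)) A \<and> coeffs_in (GF (q^2)) B \<and> (lin_subst M A, lin_subst M B) \<in> f)"

definition riemann_roch_space :: "nat \<Rightarrow> 'a::field poly3 \<Rightarrow> 'a divisor \<Rightarrow> 'a ratfun set" where
  "riemann_roch_space q F E = {f \<in> carrier (function_field F). defined_over_Pi q f \<and>
     (f = \<zero>\<^bsub>function_field F\<^esub> \<or> (\<forall>P. 0 \<le> divisor_of F f P + E P))}"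


section \<open>Linear codes\<close>

text \<open>
  Words of length \<open>n\<close> are the functions in \<open>{1..n} \<rightarrow>\<^sub>E S\<close>, the carrier of
  \<^const>\<open>ring.func_space\<close>.
\<close>

definition subfield_ring :: "'a::field set \<Rightarrow> 'a ring" where
  "subfield_ring S = \<lparr>carrier = S, monoid.mult = (*), one = 1, zero = 0, add = (+)\<rparr>"

definition min_distance :: "nat \<Rightarrow> (nat \<Rightarrow> 'a) set \<Rightarrow> nat" where
  "min_distance n C = Min {card {i \<in> {1..n}. x i \<noteq> y i} | x y. x \<in> C \<and> y \<in> C \<and> x \<noteq> y}"

definition linear_code :: "'a::field set \<Rightarrow> nat \<Rightarrow> nat \<Rightarrow> nat \<Rightarrow> (nat \<Rightarrow> 'a) set \<Rightarrow> bool" where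
  "linear_code S n k d C \<longleftrightarrow>
     (let K = subfield_ring S; V = ring.func_space K {1..n} in
        VectorSpace.subspace K C V \<and> vectorspace.dim K (V\<lparr>carrier := C\<rparr>) = k) \<and>
     min_distance n C = d"

text \<open>The code \<open>C\<^sub>L(D, E)\<close> for \<open>D = Q 1 + \<dots> + Q n\<close>.\<close>

definition functional_code ::
    "nat \<Rightarrow> 'a::field poly3 \<Rightarrow> nat \<Rightarrow> (nat \<Rightarrow> 'a point) \<Rightarrow> 'a divisor \<Rightarrow> (nat \<Rightarrow> 'a) set" where
  "functional_code q F n Q E =
     {(\<lambda>i\<in>{1..n}. fun_value f (Q i)) | f. f \<in> riemann_roch_space q F E}"

end

theory Submission
  imports Defs "HOL-Computational_Algebra.Formal_Laurent_Series"
begin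

text \<open>
  The curve has the branch \<open>(1 : X : zeta)\<close> at \<open>(1 : 0 : 0)\<close>, with a power series \<open>zeta\<close>. Hence the
  forms modulo the curve, and with them the function field, embed into the Laurent series, and all
  local rings are computed inside them. For \<open>x = X\<^sub>2 / X\<^sub>0\<close> and \<open>y = X\<^sub>1 / X\<^sub>0\<close>, the functions
  regular outside \<open>(1 : 0 : 0)\<close> with a pole of order at most \<open>m\<close> there form the span \<open>T m\<close> of the
  monomials \<open>x\<^sup>a y\<^sup>b\<close> of weight \<open>(q - 1) a + q b \<le> m\<close> with \<open>a < q\<close>, \<open>a \<le> (q - 1) b\<close>. A norm to the
  polynomials in \<open>y\<close> bounds by \<open>m\<close> the number of their zeros at points with distinct \<open>y\<close>.

  The Singer orbits on the curve are the sets \<open>GG w\<close> of points of \<open>\<Pi>\<close> with \<open>\<gamma>\<^sup>N = w\<close>, for the \<open>q + 1\<close>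
  roots \<open>w\<close> of \<open>\<tau> w\<^sup>q\<^sup>+\<^sup>1 + t2 w + 1\<close>, \<open>t2 = \<tau> ^ (q\<^sup>2 + 1)\<close>, and \<open>N = q\<^sup>2 - q + 1\<close>.
  The function \<open>D0 w = 1 - w y\<^sup>q / x\<close> has the zero divisor \<open>GG w\<close> and a pole of order \<open>N\<close> at \<open>(1 : 0 : 0)\<close>, so over the algebraic closure the Riemann-Roch
  space is \<open>T N / D0 w\<close>, of dimension \<open>(q\<^sup>2 - q) / 2 + 2\<close>. Being defined over \<open>\<Pi>\<close> means to be a
  fraction of forms fixed by the semilinear map \<open>a \<mapsto> a\<^sup>Q\<close>, \<open>X\<^sub>i \<mapsto> X\<^sub>i\<^sub>+\<^sub>1\<close>, where \<open>Q = q\<^sup>2\<close>; traces of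
  monomials show that such functions span the space, so its dimension does not change over the
  field of order \<open>q\<^sup>2\<close>. For a second root \<open>w'\<close>, the quotient \<open>D0 w' / D0 w\<close> vanishes at the \<open>N\<close>
  points of \<open>GG w'\<close> and attains the designed distance.
\<close>

section \<open>Polynomials in three variables\<close>

text \<open>The embedding turns equality of classes of fractions into equality of series, so that
  local rings, values and orders can be handled inside one field; for this its kernel on forms has
  to consist exactly of the multiples of the curve. The point (1 : 0 : 0) is distinguished because
  the coordinates have the distinct orders 0, 1, q on its branch: pole orders there separate
  monomials, and dimensions become counts of weights. As N = 2 g + 1 for the genus g, the count up
  to N gives the value N + 1 - g that Riemann-Roch predicts, without invoking that theorem. Dividing
  by D0 w moves the pole from (1 : 0 : 0) to the orbit, because both have degree N. The obstacle in
  the descent is that being defined over \<Pi> refers to an arbitrary projectivity; two of them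
  differ by a scalar times a matrix over the small field, and the scalar cancels in fractions.
  Coefficients with respect to a basis then descend through the code itself: values at points of
  \<Pi> are fixed by Frobenius, and evaluation is injective.\<close>

definition ring_morph :: "('a::comm_ring_1 \<Rightarrow> 'b::comm_ring_1) \<Rightarrow> bool" where
  "ring_morph c \<longleftrightarrow> c 0 = 0 \<and> c 1 = 1 \<and> (\<forall>a b. c (a + b) = c a + c b) \<and> (\<forall>a b. c (a * b) = c a * c b)"

lemma ring_morphI:
  assumes "c 0 = 0" "c 1 = 1" "\<And>a b. c (a + b) = c a + c b" "\<And>a b. c (a * b) = c a * c b"
  shows "ring_morph c"
  using assms by (auto simp: ring_morph_def)

lemma ring_morph_simps:
  assumes "ring_morph c"
  shows "c 0 = 0" "c 1 = 1" "c (a + b) = c a + c b" "c (a * b) = c a * c b"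
    "c (- a) = - c a" "c (a - b) = c a - c b" "c (a ^ n) = c a ^ n"
proof -
  show 0: "c 0 = 0" and 1: "c 1 = 1" and p: "\<And>a b. c (a + b) = c a + c b"
    and t: "\<And>a b. c (a * b) = c a * c b"
    using assms by (auto simp: ring_morph_def)
  show m: "c (- a) = - c a" for a
    using p[of a "- a"] 0 by (simp add: eq_neg_iff_add_eq_0 add.commute)
  show "c (a - b) = c a - c b"
    using p[of a "- b"] m by simp
  show "c (a ^ n) = c a ^ n"
    by (induction n) (simp_all add: 1 t)
qed

lemma ring_morph_sum: "ring_morph c \<Longrightarrow> c (\<Sum>i\<in>I. f i) = (\<Sum>i\<in>I. c (f i))"
  by (induction I rule: infinite_finite_induct) (simp_all add: ring_morph_simps)

lemma ring_morph_id: "ring_morph (\<lambda>x. x)"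
  by (simp add: ring_morph_def)

lemma ring_morph_comp: "ring_morph f \<Longrightarrow> ring_morph g \<Longrightarrow> ring_morph (\<lambda>x. f (g x))"
  by (simp add: ring_morph_def)

lemma ring_morph_Const: "ring_morph (Const :: 'a::comm_ring_1 \<Rightarrow> 'a poly3)"
  by (simp add: ring_morph_def Const_def single_add mult_single)

text \<open>Evaluation of polynomials in its universal form, along a coefficient map
  \<open>c\<close> and images \<open>x\<close> of the variables. Its specializations are
  \<open>eval_poly\<close>, \<open>lin_subst\<close>, the embedding \<open>\<phi>\<close>, the
  semilinear map \<open>sg\<close> and Frobenius on coefficients.\<close>

definition poly3_eval :: "('a::comm_ring_1 \<Rightarrow> 'b::comm_ring_1) \<Rightarrow> (3 \<Rightarrow> 'b) \<Rightarrow> 'a poly3 \<Rightarrow> 'b" where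
  "poly3_eval c x A = (\<Sum>m\<in>Poly_Mapping.keys A.
     c (Poly_Mapping.lookup A m) * (\<Prod>i\<in>UNIV. x i ^ Poly_Mapping.lookup m i))"

lemma poly3_eval_superset:
  assumes "c 0 = 0" "finite K" "Poly_Mapping.keys A \<subseteq> K"
  shows "poly3_eval c x A = (\<Sum>m\<in>K.
     c (Poly_Mapping.lookup A m) * (\<Prod>i\<in>UNIV. x i ^ Poly_Mapping.lookup m i))"
  unfolding poly3_eval_def using assms
  by (intro sum.mono_neutral_left) (auto simp: in_keys_iff)

lemma poly3_decomp:
  "A = (\<Sum>m\<in>Poly_Mapping.keys A. Poly_Mapping.single m (Poly_Mapping.lookup A m))"
proof (rule poly_mapping_eqI)
  fix k
  show "Poly_Mapping.lookup A k = Poly_Mapping.lookup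
     (\<Sum>m\<in>Poly_Mapping.keys A. Poly_Mapping.single m (Poly_Mapping.lookup A m)) k"
    by (simp add: lookup_sum lookup_single when_def in_keys_iff)
qed

lemma prod_3: "prod f (UNIV::3 set) = f 1 * f 2 * f 3"
  unfolding UNIV_3 by (simp add: ac_simps)

lemma monomial_eq:
  "Poly_Mapping.single m (a::'a::comm_ring_1)
     = Const a * (\<Prod>i\<in>UNIV. (Var i :: 'a poly3) ^ Poly_Mapping.lookup m i)"
proof -
  have pow: "(Var i :: 'a poly3) ^ k = Poly_Mapping.single (Poly_Mapping.single i k) 1" for i k
    by (induction k) (simp_all add: Var_def mult_single single_add[symmetric])
  have "m = Poly_Mapping.single 1 (Poly_Mapping.lookup m 1) + Poly_Mapping.single 2 (Poly_Mapping.lookup m 2)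
      + Poly_Mapping.single 3 (Poly_Mapping.lookup m 3)"
  proof (rule poly_mapping_eqI)
    fix k show "Poly_Mapping.lookup m k = Poly_Mapping.lookup (Poly_Mapping.single 1 (Poly_Mapping.lookup m 1)
      + Poly_Mapping.single 2 (Poly_Mapping.lookup m 2) + Poly_Mapping.single 3 (Poly_Mapping.lookup m 3)) k"
      using exhaust_3[of k] by (elim disjE) (simp_all add: lookup_add lookup_single)
  qed
  then have "Poly_Mapping.single m a = Poly_Mapping.single (Poly_Mapping.single 1 (Poly_Mapping.lookup m 1)
      + Poly_Mapping.single 2 (Poly_Mapping.lookup m 2) + Poly_Mapping.single 3 (Poly_Mapping.lookup m 3)) a"
    by (rule arg_cong)
  also have "\<dots> = Const a * (\<Prod>i\<in>UNIV. (Var i :: 'a poly3) ^ Poly_Mapping.lookup m i)"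
    unfolding prod_3 pow Const_def mult_single by simp
  finally show ?thesis .
qed

lemma poly3_induct [case_names Const Var add mult]:
  assumes C: "\<And>a. P (Const a)" and V: "\<And>i. P (Var i)"
    and a: "\<And>A B. P A \<Longrightarrow> P B \<Longrightarrow> P (A + B)"
    and m: "\<And>A B. P A \<Longrightarrow> P B \<Longrightarrow> P (A * B)"
  shows "P (A :: 'a::comm_ring_1 poly3)"
proof -
  have 0: "P 0" "P 1"
    using C[of 0] C[of 1] by (simp_all add: ring_morph_simps[OF ring_morph_Const])
  have pw: "P (Var i ^ k)" for i k
    by (induction k) (simp_all add: 0 m V)
  have "P (Poly_Mapping.single k b)" for k b
    unfolding monomial_eq prod_3 by (simp add: m C pw)
  then have "P (\<Sum>k\<in>K. Poly_Mapping.single k (f k))" for K f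
    by (induction K rule: infinite_finite_induct) (simp_all add: 0 a)
  then show ?thesis
    by (subst poly3_decomp)
qed

context
  fixes c :: "'a::comm_ring_1 \<Rightarrow> 'b::comm_ring_1" and x :: "3 \<Rightarrow> 'b"
  assumes c: "ring_morph c"
begin

lemma poly3_eval_single:
  "poly3_eval c x (Poly_Mapping.single m a) = c a * (\<Prod>i\<in>UNIV. x i ^ Poly_Mapping.lookup m i)"
  by (subst poly3_eval_superset[where K = "{m}"])
     (use ring_morph_simps(1)[OF c] in \<open>auto simp: keys_single split: if_splits\<close>)

lemma poly3_eval_add: "poly3_eval c x (A + B) = poly3_eval c x A + poly3_eval c x B"
proof -
  let ?K = "Poly_Mapping.keys A \<union> Poly_Mapping.keys B"
  have c0: "c 0 = 0"
    using c by (rule ring_morph_simps)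
  have "poly3_eval c x (A + B) = (\<Sum>m\<in>?K. c (Poly_Mapping.lookup (A + B) m)
      * (\<Prod>i\<in>UNIV. x i ^ Poly_Mapping.lookup m i))"
    by (intro poly3_eval_superset c0 keys_add) auto
  moreover have "poly3_eval c x A = (\<Sum>m\<in>?K. c (Poly_Mapping.lookup A m)
      * (\<Prod>i\<in>UNIV. x i ^ Poly_Mapping.lookup m i))"
    by (intro poly3_eval_superset c0) auto
  moreover have "poly3_eval c x B = (\<Sum>m\<in>?K. c (Poly_Mapping.lookup B m)
      * (\<Prod>i\<in>UNIV. x i ^ Poly_Mapping.lookup m i))"
    by (intro poly3_eval_superset c0) auto
  ultimately show ?thesis
    by (simp add: lookup_add ring_morph_simps[OF c] distrib_right sum.distrib)
qed

lemma poly3_eval_0: "poly3_eval c x 0 = 0"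
  by (simp add: poly3_eval_def)

lemma poly3_eval_sum: "poly3_eval c x (\<Sum>i\<in>I. f i) = (\<Sum>i\<in>I. poly3_eval c x (f i))"
  by (induction I rule: infinite_finite_induct) (simp_all add: poly3_eval_add poly3_eval_0)

lemma poly3_eval_mult: "poly3_eval c x (A * B) = poly3_eval c x A * poly3_eval c x B"
proof -
  have 1: "poly3_eval c x (Poly_Mapping.single m a * Poly_Mapping.single k b)
      = poly3_eval c x (Poly_Mapping.single m a) * poly3_eval c x (Poly_Mapping.single k b)" for m k a b
    unfolding mult_single poly3_eval_single
    by (simp add: ring_morph_simps[OF c] lookup_add power_add prod.distrib algebra_simps)
  have "A * B = (\<Sum>m\<in>Poly_Mapping.keys A. \<Sum>k\<in>Poly_Mapping.keys B.
     Poly_Mapping.single m (Poly_Mapping.lookup A m) * Poly_Mapping.single k (Poly_Mapping.lookup B k))"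
    by (subst poly3_decomp[of A], subst poly3_decomp[of B]) (simp add: sum_product)
  then have "poly3_eval c x (A * B) = (\<Sum>m\<in>Poly_Mapping.keys A. \<Sum>k\<in>Poly_Mapping.keys B.
     poly3_eval c x (Poly_Mapping.single m (Poly_Mapping.lookup A m)) * poly3_eval c x (Poly_Mapping.single k (Poly_Mapping.lookup B k)))"
    by (simp add: poly3_eval_sum 1)
  also have "\<dots> = poly3_eval c x A * poly3_eval c x B"
    unfolding sum_product[symmetric] poly3_eval_sum[symmetric] poly3_decomp[symmetric] ..
  finally show ?thesis .
qed

lemma poly3_eval_Const [simp]: "poly3_eval c x (Const a) = c a"
  by (simp add: Const_def poly3_eval_single)

lemma poly3_eval_Var [simp]: "poly3_eval c x (Var i) = x i"
  using exhaust_3[of i]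
  by (auto simp: Var_def poly3_eval_single ring_morph_simps[OF c] prod_3 lookup_single)

lemma ring_morph_poly3_eval: "ring_morph (poly3_eval c x)"
proof (rule ring_morphI)
  show "poly3_eval c x 1 = 1"
    using poly3_eval_Const[of 1] by (simp add: ring_morph_simps[OF ring_morph_Const] ring_morph_simps[OF c])
qed (simp_all add: poly3_eval_0 poly3_eval_add poly3_eval_mult)

end

text \<open>Polynomials are generated by constants and variables. The compatibilities between
  substitution, evaluation and Frobenius are reduced by this to a check on generators.\<close>

lemma poly3_eval_unique:
  assumes "ring_morph f" "ring_morph g" "\<And>a. f (Const a) = g (Const a)" "\<And>i. f (Var i) = g (Var i)"
  shows "f A = g A"
  by (induction A rule: poly3_induct) (simp_all add: assms ring_morph_simps[OF assms(1)] ring_morph_simps[OF assms(2)])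

lemma eval_poly_eq: "eval_poly A v = poly3_eval (\<lambda>a. a) (\<lambda>i. v $ i) A"
  by (simp add: eval_poly_def poly3_eval_def)

lemma lin_subst_eq: "lin_subst M A = poly3_eval Const (\<lambda>i. \<Sum>j\<in>UNIV. Const (M $ i $ j) * Var j) A"
  by (simp add: lin_subst_def poly3_eval_def)

lemma ring_morph_eval_poly: "ring_morph (\<lambda>A. eval_poly A v)"
  unfolding eval_poly_eq by (intro ring_morph_poly3_eval ring_morph_id)

lemma ring_morph_lin_subst: "ring_morph (lin_subst M)"
  unfolding lin_subst_eq[abs_def] by (intro ring_morph_poly3_eval ring_morph_Const)

lemmas Const_simps = ring_morph_simps[OF ring_morph_Const]
lemmas eval_poly_simps = ring_morph_simps[OF ring_morph_eval_poly]
lemmas lin_subst_simps = ring_morph_simps[OF ring_morph_lin_subst]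

lemma eval_poly_Const [simp]: "eval_poly (Const a) v = a"
  and eval_poly_Var [simp]: "eval_poly (Var i) v = v $ i"
  by (simp_all add: eval_poly_eq ring_morph_id)

lemma lin_subst_Const [simp]: "lin_subst M (Const a) = Const a"
  and lin_subst_Var: "lin_subst M (Var i) = (\<Sum>j\<in>UNIV. Const (M $ i $ j) * Var j)"
  by (simp_all add: lin_subst_eq ring_morph_Const)

lemma poly3_eval_lin_subst:
  assumes "ring_morph c"
  shows "poly3_eval c x (lin_subst M A) = poly3_eval c (\<lambda>i. \<Sum>j\<in>UNIV. c (M $ i $ j) * x j) A"
  by (rule poly3_eval_unique[of "\<lambda>A. poly3_eval c x (lin_subst M A)"])
     (simp_all add: assms ring_morph_comp[OF ring_morph_poly3_eval ring_morph_lin_subst]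
       ring_morph_poly3_eval lin_subst_Var ring_morph_sum[OF ring_morph_poly3_eval]
       ring_morph_simps[OF ring_morph_poly3_eval])

lemma lin_subst_lin_subst: "lin_subst M (lin_subst N A) = lin_subst (N ** M) A"
proof -
  have "(\<lambda>i. \<Sum>j\<in>UNIV. Const (N $ i $ j) * (\<Sum>k\<in>UNIV. Const (M $ j $ k) * Var k))
      = (\<lambda>i. \<Sum>j\<in>UNIV. Const ((N ** M) $ i $ j) * (Var j :: 'a poly3))"
    by (rule ext) (simp add: matrix_matrix_mult_def sum_3 Const_simps algebra_simps)
  then show ?thesis
    unfolding lin_subst_eq[of M] poly3_eval_lin_subst[OF ring_morph_Const] by (simp add: lin_subst_eq)
qed

lemma lin_subst_one: "lin_subst (mat 1) A = A"
  by (rule poly3_eval_unique[of "lin_subst (mat 1)" "\<lambda>A. A"])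
     (auto simp: ring_morph_lin_subst ring_morph_id lin_subst_Var mat_def if_distrib Const_simps
       if_distribR cong: if_cong)

subsection \<open>Forms\<close>

lemma homogeneous_0 [simp]: "homogeneous d 0"
  by (simp add: homogeneous_def)

lemma homogeneous_Const [simp]: "homogeneous 0 (Const a)"
  by (simp add: homogeneous_def Const_def keys_single)

lemma homogeneous_1 [simp]: "homogeneous 0 1"
  using homogeneous_Const[of 1] by (simp add: Const_simps)

lemma homogeneous_single:
  "(\<Sum>i\<in>UNIV. Poly_Mapping.lookup m i) = d \<Longrightarrow> homogeneous d (Poly_Mapping.single m a)"
  by (simp add: homogeneous_def keys_single)

lemma homogeneous_Var [simp]: "homogeneous 1 (Var i)"
  using exhaust_3[of i] by (auto simp: homogeneous_def Var_def keys_single sum_3 lookup_single)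

lemma homogeneous_add: "homogeneous d A \<Longrightarrow> homogeneous d B \<Longrightarrow> homogeneous d (A + B)"
  using keys_add[of A B] by (auto simp: homogeneous_def)

lemma homogeneous_minus: "homogeneous d A \<Longrightarrow> homogeneous d (- A)"
  by (auto simp: homogeneous_def in_keys_iff)

lemma homogeneous_diff: "homogeneous d A \<Longrightarrow> homogeneous d B \<Longrightarrow> homogeneous d (A - B)"
  using homogeneous_add[OF _ homogeneous_minus] by fastforce

lemma homogeneous_mult: "homogeneous d A \<Longrightarrow> homogeneous k B \<Longrightarrow> homogeneous (d + k) (A * B)"
  using keys_mult[of A B] by (fastforce simp: homogeneous_def lookup_add sum.distrib)

lemma homogeneous_power: "homogeneous d A \<Longrightarrow> homogeneous (d * k) (A ^ k)"
  by (induction k) (auto dest: homogeneous_mult)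

lemma homogeneous_Var_power [simp]: "homogeneous k (Var i ^ k)"
  using homogeneous_power[OF homogeneous_Var[of i], of k] by simp

lemma homogeneous_cmult: "homogeneous d A \<Longrightarrow> homogeneous d (Const a * A)"
  using homogeneous_mult[OF homogeneous_Const] by fastforce

lemma homogeneous_sum: "(\<And>i. i \<in> I \<Longrightarrow> homogeneous d (f i)) \<Longrightarrow> homogeneous d (\<Sum>i\<in>I. f i)"
  by (induction I rule: infinite_finite_induct) (auto intro: homogeneous_add)

lemma poly3_eval_scale:
  assumes "homogeneous d A"
  shows "poly3_eval c (\<lambda>i. k * x i) A = k ^ d * poly3_eval c x A"
  unfolding poly3_eval_def sum_distrib_left
proof (rule sum.cong[OF refl])
  fix m assume "m \<in> Poly_Mapping.keys A"
  then have "(\<Sum>i\<in>UNIV. Poly_Mapping.lookup m i) = d"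
    using assms by (simp add: homogeneous_def)
  then have "k ^ d = k ^ Poly_Mapping.lookup m 1 * k ^ Poly_Mapping.lookup m 2 * k ^ Poly_Mapping.lookup m 3"
    by (simp add: sum_3 power_add[symmetric])
  then show "c (Poly_Mapping.lookup A m) * (\<Prod>i\<in>UNIV. (k * x i) ^ Poly_Mapping.lookup m i)
     = k ^ d * (c (Poly_Mapping.lookup A m) * (\<Prod>i\<in>UNIV. x i ^ Poly_Mapping.lookup m i))"
    by (simp add: prod_3 power_mult_distrib)
qed

lemma eval_poly_scale: "homogeneous d A \<Longrightarrow> eval_poly A (k *s v) = k ^ d * eval_poly A v"
  by (simp add: eval_poly_eq poly3_eval_scale)

lemma homogeneous_poly3_eval:
  assumes "homogeneous d A" "\<And>i. homogeneous 1 (x i)"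
  shows "homogeneous d (poly3_eval (\<lambda>a. Const (h a)) x A)"
  unfolding poly3_eval_def
proof (intro homogeneous_sum homogeneous_cmult)
  fix m assume "m \<in> Poly_Mapping.keys A"
  then have d: "d = Poly_Mapping.lookup m 1 + (Poly_Mapping.lookup m 2 + Poly_Mapping.lookup m 3)"
    using assms(1) by (auto simp: homogeneous_def sum_3)
  have "homogeneous k (x i ^ k)" for i k
    using homogeneous_power[OF assms(2), of k i] by simp
  then show "homogeneous d (\<Prod>i\<in>UNIV. x i ^ Poly_Mapping.lookup m i)"
    unfolding d prod_3 by (simp add: homogeneous_mult mult.assoc)
qed

lemma homogeneous_lin_subst: "homogeneous d A \<Longrightarrow> homogeneous d (lin_subst M A)"
  unfolding lin_subst_eq by (intro homogeneous_poly3_eval homogeneous_sum homogeneous_cmult homogeneous_Var)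

lemma lookup_map_coeffs:
  assumes "h 0 = (0::'b::comm_ring_1)"
  shows "Poly_Mapping.lookup (poly3_eval (\<lambda>a. Const (h a)) Var A) m = h (Poly_Mapping.lookup A m)"
proof -
  have "poly3_eval (\<lambda>a. Const (h a)) Var A
      = (\<Sum>m\<in>Poly_Mapping.keys A. Poly_Mapping.single m (h (Poly_Mapping.lookup A m)))"
    unfolding poly3_eval_def by (simp add: monomial_eq)
  then show ?thesis
    using assms by (simp add: lookup_sum lookup_single when_def in_keys_iff)
qed

lemma pt_vanishes:
  assumes "homogeneous d A"
  shows "vanishes_at A (pt v) \<longleftrightarrow> eval_poly A v = 0"
proof
  assume "vanishes_at A (pt v)"
  then show "eval_poly A v = 0"
    by (auto simp: vanishes_at_def pt_def intro: vec.span_base)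
next
  assume "eval_poly A v = 0"
  then show "vanishes_at A (pt v)"
    by (auto simp: vanishes_at_def pt_def vec.span_singleton eval_poly_scale[OF assms])
qed

lemma pt_eq_iff: "v \<noteq> 0 \<Longrightarrow> w \<noteq> 0 \<Longrightarrow> pt v = pt w \<longleftrightarrow> (\<exists>k. k \<noteq> 0 \<and> w = k *s v)"
proof
  assume "v \<noteq> 0" "w \<noteq> 0" "pt v = pt w"
  then have "w \<in> vec.span {v}"
    by (metis pt_def vec.span_base singletonI)
  with \<open>w \<noteq> 0\<close> show "\<exists>k. k \<noteq> 0 \<and> w = k *s v"
    by (auto simp: vec.span_singleton)
next
  assume "\<exists>k. k \<noteq> 0 \<and> w = k *s v"
  then obtain k where k: "k \<noteq> 0" "w = k *s v" by blast
  have "a *s v = (a / k) *s w" "a *s w = (a * k) *s v" for a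
    by (simp_all add: k vector_smult_assoc)
  then show "pt v = pt w"
    unfolding pt_def vec.span_singleton by (metis (no_types, lifting) image_cong rangeI image_subset_iff subset_antisym)
qed

lemma act_pt: "act M (pt v) = pt (M *v v)"
  by (simp add: act_def pt_def vec.span_singleton image_image vector_scalar_commute)

section \<open>A power series parametrisation of the curve\<close>

text \<open>In characteristic p the q-th power is additive, so it raises each coefficient to the
  power q and stretches the exponents by the factor q. Additivity covers only finite sums; hence the
  series is cut after the term n, and the tail contributes only from degree (n + 1) q > n
  on.\<close>

lemma fps_power_char_nth:
  fixes f :: "'a::field fps"
  assumes "prime CHAR('a)" "q = CHAR('a) ^ e"
  shows "fps_nth (f ^ q) n = (if q dvd n then fps_nth f (n div q) ^ q else 0)"
proof -
  let ?C = "fps_cutoff (Suc n) f" and ?S = "fps_shift (Suc n) f"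
  have q0: "q > 0" using assms prime_gt_0_nat by auto
  have fr: "prime CHAR('a fps)" "q = CHAR('a fps) ^ e"
    using assms by simp_all
  have cut: "?C = (\<Sum>i\<le>n. fps_const (fps_nth f i) * fps_X ^ i)"
    by (rule fps_ext) (auto simp: fps_sum_nth fps_X_power_nth if_distrib cong: if_cong)
  have "f ^ q = (?S * fps_X ^ Suc n + ?C) ^ q"
    by (simp only: fps_shift_cutoff)
  also have "\<dots> = (?S * fps_X ^ Suc n) ^ q + ?C ^ q"
    by (rule freshmans_dream'[OF fr])
  also have "?C ^ q = (\<Sum>i\<le>n. fps_const (fps_nth f i ^ q) * fps_X ^ (i * q))"
    unfolding cut freshmans_dream_sum'[OF fr]
    by (simp add: power_mult_distrib fps_const_power power_mult)
  also have "(?S * fps_X ^ Suc n) ^ q = ?S ^ q * fps_X ^ (Suc n * q)"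
    by (simp only: power_mult_distrib power_mult)
  finally have eq: "f ^ q = ?S ^ q * fps_X ^ (Suc n * q)
      + (\<Sum>i\<le>n. fps_const (fps_nth f i ^ q) * fps_X ^ (i * q))" .
  have "n < Suc n * q"
    using q0 by (cases q) auto
  then have hi: "fps_nth (?S ^ q * fps_X ^ (Suc n * q)) n = 0"
    by (simp only: fps_X_power_mult_right_nth if_True)
  then have "fps_nth (f ^ q) n = (\<Sum>i\<le>n. if n = i * q then fps_nth f i ^ q else 0)"
    unfolding eq fps_add_nth hi by (simp add: fps_sum_nth fps_X_power_nth if_distrib cong: if_cong)
  also have "\<dots> = (if q dvd n then fps_nth f (n div q) ^ q else 0)"
  proof (cases "q dvd n")
    case True
    then have "(n = i * q) = (i = n div q)" for i
      using q0 by auto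
    then show ?thesis
      using True by (simp add: sum.delta)
  next
    case False
    then show ?thesis by (auto intro!: sum.neutral)
  qed
  finally show ?thesis .
qed

text \<open>Comparison of coefficients in \<open>zeta = - a X^q - b X zeta^q\<close>: the
  coefficient of \<open>X^n\<close> in the last product involves the q-th power of the coefficient
  of index \<open>(n - 1) / q\<close>, and only if q divides \<open>n - 1\<close>. Below q all
  coefficients vanish, so n = 1, which would refer to the coefficient 0, falls under the default
  0.\<close>

function zeta_coeff :: "nat \<Rightarrow> 'a::field \<Rightarrow> 'a \<Rightarrow> nat \<Rightarrow> 'a" where
  "zeta_coeff q a b n = (if n = q then - a
     else if n > q \<and> q dvd n - 1 then - b * zeta_coeff q a b ((n - 1) div q) ^ q else 0)"
  by auto
termination
  by (relation "measure (\<lambda>(q, a, b, n). n)") (auto intro: le_less_trans[OF div_le_dividend])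

declare zeta_coeff.simps [simp del]

text \<open>No cancellation occurs between terms of pairwise distinct orders: the coefficient at the
  least order among the terms with nonzero scalar survives. It serves for linear independence and
  for reading off from a function the weights of the monomials in it.\<close>

lemma fls_sum_subdegree:
  fixes z :: "'i \<Rightarrow> 'a::field fls"
  assumes "finite I" "inj_on (\<lambda>i. fls_subdegree (z i)) I" "\<And>i. i \<in> I \<Longrightarrow> z i \<noteq> 0"
    and "j \<in> I" "c j \<noteq> 0"
  shows "(\<Sum>i\<in>I. fls_const (c i) * z i) \<noteq> 0 \<and>
    fls_subdegree (\<Sum>i\<in>I. fls_const (c i) * z i) \<le> fls_subdegree (z j)"
proof -
  let ?J = "{i \<in> I. c i \<noteq> 0}" and ?S = "\<Sum>i\<in>I. fls_const (c i) * z i"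
  obtain k where k: "k \<in> ?J" "\<And>i. i \<in> ?J \<Longrightarrow> fls_subdegree (z k) \<le> fls_subdegree (z i)"
    using assms ex_min_if_finite[of "(\<lambda>i. fls_subdegree (z i)) ` ?J"]
    by (fastforce simp: not_less)
  have "fls_nth ?S (fls_subdegree (z k)) = (\<Sum>i\<in>I. c i * fls_nth (z i) (fls_subdegree (z k)))"
    by (simp add: fls_nth_sum)
  also have "\<dots> = (\<Sum>i\<in>{k}. c i * fls_nth (z i) (fls_subdegree (z k)))"
  proof (rule sum.mono_neutral_right)
    show "\<forall>i\<in>I - {k}. c i * fls_nth (z i) (fls_subdegree (z k)) = 0"
    proof
      fix i assume i: "i \<in> I - {k}"
      then have "fls_subdegree (z i) \<noteq> fls_subdegree (z k)"
        using assms(2) k(1) by (auto dest: inj_onD)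
      then show "c i * fls_nth (z i) (fls_subdegree (z k)) = 0"
        using k(2)[of i] i by (cases "c i = 0") (auto intro: fls_eq0_below_subdegree)
    qed
  qed (use k assms(1) in auto)
  also have "\<dots> \<noteq> 0"
    using k(1) assms(3)[of k] by simp
  finally have nz: "fls_nth ?S (fls_subdegree (z k)) \<noteq> 0" .
  then have "fls_subdegree ?S \<le> fls_subdegree (z k)"
    by (rule fls_subdegree_leI)
  with k(2)[of j] nz assms(4,5) show ?thesis by fastforce
qed

lemma fls_sum_eq_0:
  fixes z :: "'i \<Rightarrow> 'a::field fls"
  assumes "finite I" "inj_on (\<lambda>i. fls_subdegree (z i)) I" "\<And>i. i \<in> I \<Longrightarrow> z i \<noteq> 0"
    and "(\<Sum>i\<in>I. fls_const (c i) * z i) = 0" "j \<in> I"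
  shows "c j = 0"
  using fls_sum_subdegree[OF assms(1-3), of j c] assms(4,5) by blast

locale hermitian_curve =
  fixes p e q :: nat and \<tau> :: "'a::alg_closed_field"
  assumes p: "prime p" and e: "e > 0" and q_def: "q = p ^ e" and q2: "q > 2"
    and CH: "CHAR('a) = p" and \<tau>: "\<tau> ^ (q^2 + q + 1) = 1"
begin

abbreviation "F \<equiv> hermitian q \<tau>"
definition t2 :: 'a where "t2 = \<tau> ^ (q^2 + 1)"
abbreviation "\<c> \<equiv> (fls_const :: 'a \<Rightarrow> 'a fls)"

lemma ring_morph_fls_const: "ring_morph \<c>"
  by (rule ring_morphI) (simp_all add: fls_plus_const)

lemma frob: "(x + y :: 'a) ^ q = x ^ q + y ^ q"
  by (rule freshmans_dream') (use CH p q_def in auto)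

lemma frob_fls: "(x + y :: 'a fls) ^ q = x ^ q + y ^ q"
  by (rule freshmans_dream') (use CH p q_def in auto)

lemma frob_minus_fls: "(- x :: 'a fls) ^ q = - (x ^ q)"
  using frob_fls[of x "- x"] q2 by (simp add: eq_neg_iff_add_eq_0 add.commute power_0_left)

lemma frob_diff_fls: "(x - y :: 'a fls) ^ q = x ^ q - y ^ q"
  using frob_fls[of x "- y"] by (simp add: frob_minus_fls)

lemma \<tau>_nz [simp]: "\<tau> \<noteq> 0"
  using \<tau> by (auto simp: power_0_left)

lemma t2_\<tau>: "t2 * \<tau> ^ q = 1"
  using \<tau> by (simp add: t2_def power_add mult_ac)

lemma t2_nz [simp]: "t2 \<noteq> 0"
  by (simp add: t2_def)

lemma F_eq: "F = Const \<tau> * Var 1 * Var 2 ^ q + Const t2 * Var 2 * Var 3 ^ q + Var 3 * Var 1 ^ q"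
  by (simp only: hermitian_def t2_def)

section \<open>The branch of the curve at (1 : 0 : 0)\<close>

definition zeta :: "'a fls" where
  "zeta = fps_to_fls (Abs_fps (zeta_coeff q \<tau> t2))"

lemma zeta_eq: "\<c> \<tau> * fls_X ^ q + \<c> t2 * fls_X * zeta ^ q + zeta = 0"
proof -
  let ?z = "Abs_fps (zeta_coeff q \<tau> t2)"
  have "fps_const \<tau> * fps_X ^ q + fps_const t2 * fps_X * ?z ^ q + ?z = 0"
  proof (rule fps_ext)
    fix n
    have pw: "fps_nth (?z ^ q) m = (if q dvd m then zeta_coeff q \<tau> t2 (m div q) ^ q else 0)" for m
      by (subst fps_power_char_nth[where e = e]) (use CH p q_def in auto)
    consider "n = 0" | "n > 0" "n < q" | "n = q" | "n > q" by linarith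
    then show "fps_nth (fps_const \<tau> * fps_X ^ q + fps_const t2 * fps_X * ?z ^ q + ?z) n = fps_nth 0 n"
    proof cases
      case 1
      with q2 show ?thesis
        by (simp add: fps_X_power_nth zeta_coeff.simps[of q \<tau> t2 0] mult.assoc)
    next
      case 2
      have "q dvd n - 1 \<Longrightarrow> n = 1"
        using 2 by (auto dest: dvd_imp_le)
      then have "fps_nth (?z ^ q) (n - 1) = 0"
        using q2 by (auto simp: pw zeta_coeff.simps[of q \<tau> t2 0] power_0_left)
      with 2 show ?thesis
        by (simp add: fps_X_power_nth zeta_coeff.simps[of q \<tau> t2 n] mult.assoc)
    next
      case 3
      have "\<not> q dvd q - 1"
        using q2 by (auto dest: dvd_imp_le)
      with 3 q2 show ?thesis
        by (simp add: fps_X_power_nth zeta_coeff.simps[of q \<tau> t2 q] mult.assoc pw)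
    next
      case 4
      then show ?thesis
        by (simp add: fps_X_power_nth zeta_coeff.simps[of q \<tau> t2 n] mult.assoc pw)
    qed
  qed
  then have "fps_to_fls (fps_const \<tau> * fps_X ^ q + fps_const t2 * fps_X * ?z ^ q + ?z) = 0"
    by simp
  then show ?thesis
    by (simp add: zeta_def fls_times_fps_to_fls fps_to_fls_power)
qed

lemma zeta_subdegree: "zeta \<noteq> 0" "fls_subdegree zeta = int q"
proof -
  have "fls_nth zeta (int q) \<noteq> 0"
    by (simp add: zeta_def zeta_coeff.simps)
  moreover have "fls_nth zeta k = 0" if "k < int q" for k
  proof -
    have "nat k < q" using that q2 by linarith
    then show ?thesis by (simp add: zeta_def zeta_coeff.simps[of q \<tau> t2 "nat k"])
  qed
  ultimately show "zeta \<noteq> 0" "fls_subdegree zeta = int q"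
    by (auto intro: fls_subdegree_eqI)
qed

definition \<xi> :: "3 \<Rightarrow> 'a fls" where
  "\<xi> i = (if i = 1 then 1 else if i = 2 then fls_X else zeta)"

lemma \<xi>_simps: "\<xi> 1 = 1" "\<xi> 2 = fls_X" "\<xi> 3 = zeta"
  by (simp_all add: \<xi>_def)

lemma \<xi>_nz [simp]: "\<xi> i \<noteq> 0"
  by (simp add: \<xi>_def zeta_subdegree)

definition \<phi> :: "'a poly3 \<Rightarrow> 'a fls" where
  "\<phi> = poly3_eval \<c> \<xi>"

lemma ring_morph_\<phi>: "ring_morph \<phi>"
  unfolding \<phi>_def by (rule ring_morph_poly3_eval[OF ring_morph_fls_const])

lemmas \<phi>_simps = ring_morph_simps[OF ring_morph_\<phi>]

lemma \<phi>_Const [simp]: "\<phi> (Const a) = \<c> a" and \<phi>_Var [simp]: "\<phi> (Var i) = \<xi> i"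
  by (simp_all add: \<phi>_def ring_morph_fls_const)

lemma homogeneous_F: "homogeneous (q + 1) F"
proof -
  have "homogeneous (1 + q) (Const a * (Var i * Var j ^ q))" for a i j
    using homogeneous_mult[OF homogeneous_Var[of i] homogeneous_Var_power[of q j]] by (rule homogeneous_cmult)
  from homogeneous_add[OF homogeneous_add[OF this[of \<tau> 1 2] this[of t2 2 3]] this[of 1 3 1]]
  show ?thesis
    by (simp add: F_eq mult.assoc Const_simps)
qed

lemma \<phi>_F: "\<phi> F = 0"
  using zeta_eq by (simp add: F_eq \<phi>_simps \<xi>_simps)

lemma eval_F: "eval_poly F v = \<tau> * v $ 1 * v $ 2 ^ q + t2 * v $ 2 * v $ 3 ^ q + v $ 3 * v $ 1 ^ q"
  by (simp add: F_eq eval_poly_simps)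

section \<open>Pseudo-division by the equation of the curve\<close>

abbreviation (input) mono :: "'a \<Rightarrow> nat \<Rightarrow> nat \<Rightarrow> nat \<Rightarrow> 'a poly3" where
  "mono c i j k \<equiv> Const c * (Var 1 ^ i * (Var 2 ^ j * Var 3 ^ k))"

text \<open>Division by F in the variable \<open>Var 2\<close>: the leading coefficient
  \<open>\<tau> X1\<close> is not a unit, so A has to be multiplied by powers of
  \<open>Var 1\<close>. The degree of the remainder is recorded because within one degree a monomial
  is determined by its exponents at \<open>Var 2\<close> and \<open>Var 3\<close>.\<close>

definition reducible_form :: "nat \<Rightarrow> 'a poly3 \<Rightarrow> bool" where
  "reducible_form d A \<longleftrightarrow> (\<exists>m Q R. Var 1 ^ m * A = Q * F + R \<and> homogeneous (m + d) R \<and>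
     (\<forall>k\<in>Poly_Mapping.keys R. Poly_Mapping.lookup k 2 < q))"

lemma keys_Var_power_mult:
  assumes "k \<in> Poly_Mapping.keys (Var 1 ^ m * R :: 'a poly3)"
  shows "\<exists>l\<in>Poly_Mapping.keys R. Poly_Mapping.lookup k 2 = Poly_Mapping.lookup l 2"
  using assms
proof (induction m arbitrary: k)
  case (Suc m)
  then have "k \<in> Poly_Mapping.keys (Var 1 * (Var 1 ^ m * R))"
    by (simp add: mult.assoc)
  then obtain a b where "k = a + b" "a \<in> Poly_Mapping.keys (Var 1 :: 'a poly3)"
      "b \<in> Poly_Mapping.keys (Var 1 ^ m * R)"
    using keys_mult[of "Var 1" "Var 1 ^ m * R"] by blast
  then show ?case
    using Suc.IH[of b] by (auto simp: Var_def keys_single lookup_add lookup_single split: if_splits)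
qed auto

lemma reducible_form_add:
  assumes "reducible_form d A" "reducible_form d B"
  shows "reducible_form d (A + B)"
proof -
  obtain m Q R where 1: "Var 1 ^ m * A = Q * F + R" "homogeneous (m + d) R"
      "\<forall>k\<in>Poly_Mapping.keys R. Poly_Mapping.lookup k 2 < q"
    using assms(1) by (auto simp: reducible_form_def)
  obtain n Q' R' where 2: "Var 1 ^ n * B = Q' * F + R'" "homogeneous (n + d) R'"
      "\<forall>k\<in>Poly_Mapping.keys R'. Poly_Mapping.lookup k 2 < q"
    using assms(2) by (auto simp: reducible_form_def)
  let ?R = "Var 1 ^ n * R + Var 1 ^ m * R'"
  have "Var 1 ^ (m + n) * (A + B) = Var 1 ^ n * (Var 1 ^ m * A) + Var 1 ^ m * (Var 1 ^ n * B)"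
    by (simp add: power_add algebra_simps)
  also have "\<dots> = (Var 1 ^ n * Q + Var 1 ^ m * Q') * F + ?R"
    unfolding 1(1) 2(1) by (simp add: algebra_simps)
  finally have "Var 1 ^ (m + n) * (A + B) = (Var 1 ^ n * Q + Var 1 ^ m * Q') * F + ?R" .
  moreover have "homogeneous (m + n + d) ?R"
    using homogeneous_add[OF homogeneous_mult[OF homogeneous_Var_power[of n 1] 1(2)], of "Var 1 ^ m * R'"]
      homogeneous_mult[OF homogeneous_Var_power[of m 1] 2(2)]
    by (simp add: add_ac)
  moreover have "Poly_Mapping.lookup k 2 < q" if "k \<in> Poly_Mapping.keys ?R" for k
  proof -
    from that keys_add[of "Var 1 ^ n * R" "Var 1 ^ m * R'"]
    consider "k \<in> Poly_Mapping.keys (Var 1 ^ n * R)" | "k \<in> Poly_Mapping.keys (Var 1 ^ m * R')"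
      by blast
    then show ?thesis
      using 1(3) 2(3) by cases (auto dest!: keys_Var_power_mult)
  qed
  ultimately show ?thesis
    unfolding reducible_form_def by blast
qed

lemma reducible_form_step:
  assumes "Var 1 * A = Q * F + B" "reducible_form (Suc d) B"
  shows "reducible_form d A"
proof -
  obtain m Q' R where 1: "Var 1 ^ m * B = Q' * F + R" "homogeneous (m + Suc d) R"
      "\<forall>k\<in>Poly_Mapping.keys R. Poly_Mapping.lookup k 2 < q"
    using assms(2) by (auto simp: reducible_form_def)
  have "Var 1 ^ Suc m * A = Var 1 ^ m * (Var 1 * A)"
    by (simp add: mult_ac)
  also have "\<dots> = (Var 1 ^ m * Q + Q') * F + R"
    unfolding assms(1) distrib_left 1(1) by (simp add: algebra_simps)
  finally show ?thesis
    unfolding reducible_form_def using 1(2,3) by (intro exI[of _ "Suc m"]) auto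
qed

lemma mono_eq_single:
  "mono c i j k = Poly_Mapping.single (Poly_Mapping.single 1 i + (Poly_Mapping.single 2 j + Poly_Mapping.single 3 k)) c"
  unfolding monomial_eq prod_3 by (simp add: lookup_add lookup_single mult.assoc)

text \<open>Multiplication by \<open>Var 1\<close> creates the leading term
  \<open>\<tau> X1 X2^q\<close>, which is traded for the other two terms of F; the exponent q + l of
  \<open>Var 2\<close> drops to l + 1 and l, both smaller because q > 1.\<close>

lemma reducible_form_mono: "reducible_form (i + j + k) (mono c i j k)"
proof (induction j arbitrary: c i k rule: less_induct)
  case (less j)
  show ?case
  proof (cases "j < q")
    case True
    have "homogeneous (i + j + k) (mono c i j k)"
      unfolding mono_eq_single by (rule homogeneous_single) (simp add: sum_3 lookup_add lookup_single)
    moreover have "Poly_Mapping.lookup l 2 < q" if "l \<in> Poly_Mapping.keys (mono c i j k)" for l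
      using that True unfolding mono_eq_single
      by (auto simp: keys_single lookup_add lookup_single split: if_splits)
    ultimately show ?thesis
      unfolding reducible_form_def by (intro exI[of _ 0] exI[of _ "mono c i j k"]) auto
  next
    case False
    then obtain l where j: "j = q + l" by (metis le_add_diff_inverse not_less)
    define d where "d = c / \<tau>"
    have c: "Const c = Const d * Const \<tau>"
      by (simp add: d_def Const_simps(4)[symmetric])
    have "Var 1 * mono c i j k = mono d i l k * (Const \<tau> * Var 1 * Var 2 ^ q)"
      unfolding c j by (simp add: power_add mult_ac)
    also have "Const \<tau> * Var 1 * Var 2 ^ q = F - Const t2 * Var 2 * Var 3 ^ q - Var 3 * Var 1 ^ q"
      by (simp add: F_eq)
    also have "mono d i l k * (F - Const t2 * Var 2 * Var 3 ^ q - Var 3 * Var 1 ^ q)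
       = mono d i l k * F + (mono (- d * t2) i (Suc l) (k + q) + mono (- d) (i + q) l (Suc k))"
      by (simp add: Const_simps power_add algebra_simps)
    finally have 1: "Var 1 * mono c i j k
       = mono d i l k * F + (mono (- d * t2) i (Suc l) (k + q) + mono (- d) (i + q) l (Suc k))" .
    have "reducible_form (i + Suc l + (k + q)) (mono (- d * t2) i (Suc l) (k + q))"
      "reducible_form (i + q + l + Suc k) (mono (- d) (i + q) l (Suc k))"
      by (rule less.IH; use j q2 in simp)+
    then have "reducible_form (Suc (i + j + k)) (mono (- d * t2) i (Suc l) (k + q) + mono (- d) (i + q) l (Suc k))"
      using j by (intro reducible_form_add) (simp_all add: add_ac)
    with 1 show ?thesis
      by (rule reducible_form_step)
  qed
qed

lemma reducible_form_homogeneous: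
  assumes "homogeneous d A"
  shows "reducible_form d A"
proof -
  have "reducible_form d (\<Sum>m\<in>K. Poly_Mapping.single m (Poly_Mapping.lookup A m))"
    if "K \<subseteq> Poly_Mapping.keys A" "finite K" for K
    using that(2,1)
  proof induction
    case empty
    then show ?case
      by (auto simp: reducible_form_def intro!: exI[of _ 0])
  next
    case (insert m K)
    have "d = Poly_Mapping.lookup m 1 + Poly_Mapping.lookup m 2 + Poly_Mapping.lookup m 3"
      using insert.prems assms by (auto simp: homogeneous_def sum_3)
    then have "reducible_form d (Poly_Mapping.single m (Poly_Mapping.lookup A m))"
      unfolding monomial_eq prod_3 using reducible_form_mono by (simp add: mult.assoc)
    with insert show ?case
      by (simp add: reducible_form_add)
  qed
  from this[OF order_refl finite_keys] show ?thesis
    by (simp add: poly3_decomp[symmetric])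
qed

lemma Var_nz: "(Var i :: 'a poly3) \<noteq> 0"
proof
  assume "(Var i :: 'a poly3) = 0"
  then have "eval_poly (Var i :: 'a poly3) (vec 1) = 0"
    by (simp add: eval_poly_simps)
  then show False by simp
qed

lemma Const_eq_0_iff: "Const a = (0 :: 'a poly3) \<longleftrightarrow> a = 0"
  using eval_poly_Const[of a 0] by (auto simp: Const_simps eval_poly_simps simp del: eval_poly_Const)

text \<open>Coprimality of \<open>Var 1\<close> and F: setting the variable to 0 leaves
  \<open>t2 X2 X3^q\<close> of F, which is no zero divisor, so Q becomes 0 under the same
  substitution; and every polynomial is congruent to its substitution modulo
  \<open>Var 1\<close>.\<close>

lemma Var_dvd_if_mult:
  assumes "Var 1 * A = Q * F"
  shows "Var 1 dvd Q"
proof -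
  let ?\<psi> = "poly3_eval Const (\<lambda>i. if i = 1 then 0 else Var i) :: 'a poly3 \<Rightarrow> 'a poly3"
  note \<psi> = ring_morph_poly3_eval[OF ring_morph_Const, of "\<lambda>i. if i = 1 then 0 else Var i"]
  note s = ring_morph_simps[OF \<psi>]
  have z: "(0 :: 'a poly3) ^ q = 0"
    using q2 by simp
  have "?\<psi> Q * ?\<psi> F = ?\<psi> (Var 1 * A)"
    by (simp add: s assms)
  then have "?\<psi> Q * (Const t2 * Var 2 * Var 3 ^ q) = 0"
    by (simp add: F_eq s ring_morph_Const z)
  then have "?\<psi> Q = 0"
    by (simp add: Var_nz Const_eq_0_iff)
  have "Var 1 dvd B - ?\<psi> B" for B
  proof (induction B rule: poly3_induct)
    case (add A B)
    then have "Var 1 dvd (A - ?\<psi> A) + (B - ?\<psi> B)"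
      by (rule dvd_add)
    then show ?case by (simp add: s algebra_simps)
  next
    case (mult A B)
    then have "Var 1 dvd A * (B - ?\<psi> B) + ?\<psi> B * (A - ?\<psi> A)"
      by (intro dvd_add dvd_mult)
    then show ?case by (simp add: s algebra_simps)
  qed (auto simp: ring_morph_Const)
  from this[of Q] show ?thesis
    by (simp add: \<open>?\<psi> Q = 0\<close>)
qed

lemma F_dvd_cancel: "Var 1 ^ m * A = Q * F \<Longrightarrow> F dvd A"
proof (induction m arbitrary: Q)
  case (Suc m)
  then have "Var 1 * (Var 1 ^ m * A) = Q * F"
    by (simp add: mult.assoc)
  moreover from Var_dvd_if_mult[OF this] obtain Q' where "Q = Var 1 * Q'"
    by blast
  ultimately have "Var 1 ^ m * A = Q' * F"
    using Var_nz[of 1] by (simp add: mult.assoc)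
  then show ?case by (rule Suc.IH)
qed auto

text \<open>The monomials of the pseudo-remainder R have the orders b + q c with b < q on the
  branch. These are distinct, so R vanishes with its image; the power of \<open>Var 1\<close> is
  then cancelled, being coprime to F.\<close>

lemma \<phi>_eq_0_iff:
  assumes "homogeneous d A"
  shows "\<phi> A = 0 \<longleftrightarrow> F dvd A"
proof
  assume A: "\<phi> A = 0"
  obtain m Q R where R: "Var 1 ^ m * A = Q * F + R" "homogeneous (m + d) R"
      "\<forall>k\<in>Poly_Mapping.keys R. Poly_Mapping.lookup k 2 < q"
    using reducible_form_homogeneous[OF assms] by (auto simp: reducible_form_def)
  let ?z = "\<lambda>k. fls_X ^ Poly_Mapping.lookup k 2 * zeta ^ Poly_Mapping.lookup k 3"
  have "\<phi> (Var 1 ^ m * A) = \<phi> (Q * F + R)"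
    using R(1) by simp
  then have "\<phi> R = 0"
    by (simp add: \<phi>_simps A \<phi>_F)
  then have 0: "(\<Sum>k\<in>Poly_Mapping.keys R. \<c> (Poly_Mapping.lookup R k) * ?z k) = 0"
    by (simp add: \<phi>_def poly3_eval_def prod_3 \<xi>_simps)
  have sd: "fls_subdegree (?z k) = int (Poly_Mapping.lookup k 2 + q * Poly_Mapping.lookup k 3)" for k :: "3 \<Rightarrow>\<^sub>0 nat"
    by (simp add: zeta_subdegree fls_subdegree_pow)
  have inj: "inj_on (\<lambda>k. fls_subdegree (?z k)) (Poly_Mapping.keys R)"
  proof (rule inj_onI)
    fix k l assume kl: "k \<in> Poly_Mapping.keys R" "l \<in> Poly_Mapping.keys R"
      and "fls_subdegree (?z k) = fls_subdegree (?z l)"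
    then have eq: "Poly_Mapping.lookup k 2 + q * Poly_Mapping.lookup k 3 = Poly_Mapping.lookup l 2 + q * Poly_Mapping.lookup l 3"
      unfolding sd by linarith
    have "Poly_Mapping.lookup k 2 < q" "Poly_Mapping.lookup l 2 < q"
      using R(3) kl by auto
    moreover have "(Poly_Mapping.lookup k 2 + q * Poly_Mapping.lookup k 3) mod q = (Poly_Mapping.lookup l 2 + q * Poly_Mapping.lookup l 3) mod q"
      using eq by simp
    ultimately have 2: "Poly_Mapping.lookup k 2 = Poly_Mapping.lookup l 2"
      by simp
    with eq q2 have 3: "Poly_Mapping.lookup k 3 = Poly_Mapping.lookup l 3"
      by simp
    have "Poly_Mapping.lookup k 1 + Poly_Mapping.lookup k 2 + Poly_Mapping.lookup k 3
       = Poly_Mapping.lookup l 1 + Poly_Mapping.lookup l 2 + Poly_Mapping.lookup l 3"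
      using R(2) kl by (simp add: homogeneous_def sum_3)
    with 2 3 have 1: "Poly_Mapping.lookup k 1 = Poly_Mapping.lookup l 1"
      by simp
    show "k = l"
    proof (rule poly_mapping_eqI)
      fix i show "Poly_Mapping.lookup k i = Poly_Mapping.lookup l i"
        using exhaust_3[of i] 1 2 3 by auto
    qed
  qed
  have "Poly_Mapping.lookup R k = 0" if "k \<in> Poly_Mapping.keys R" for k
    by (rule fls_sum_eq_0[OF _ inj _ 0 that]) (auto simp: zeta_subdegree)
  then have "R = 0"
    by (metis in_keys_iff lookup_zero poly_mapping_eqI)
  with R(1) have "Var 1 ^ m * A = Q * F" by simp
  then show "F dvd A" by (rule F_dvd_cancel)
qed (auto simp: \<phi>_simps \<phi>_F)

end

section \<open>The function field and its local rings inside Laurent series\<close>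

lemma power_int_cases:
  fixes z :: "'b::field"
  obtains (pos) n where "k = int n" "z powi k = z ^ n" | (neg) n where "k = - int n" "z powi k = inverse (z ^ n)"
proof (cases "k \<ge> 0")
  case True
  then have "k = int (nat k)" by simp
  then show ?thesis using pos power_int_of_nat by metis
next
  case False
  then have "k = - int (nat (- k))" by simp
  then show ?thesis using neg power_int_of_nat power_int_minus by metis
qed

context hermitian_curve
begin

abbreviation "FF \<equiv> function_field F"

definition K :: "'a fls set" where
  "K = {\<phi> A / \<phi> B | A B d. homogeneous d A \<and> homogeneous d B \<and> \<phi> B \<noteq> 0}"

text \<open>The class of all fractions with a given image on the branch; each element of the
  function field has this form for exactly one element of \<open>K\<close>.\<close>

definition cls :: "'a fls \<Rightarrow> 'a ratfun" where
  "cls z = {(A, B) \<in> fractions F. \<phi> A / \<phi> B = z}"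

lemma fractions_iff:
  "(A, B) \<in> fractions F \<longleftrightarrow> (\<exists>d. homogeneous d A \<and> homogeneous d B) \<and> \<phi> B \<noteq> 0"
  using \<phi>_eq_0_iff by (auto simp: fractions_def)

lemma K_I: "homogeneous d A \<Longrightarrow> homogeneous d B \<Longrightarrow> \<phi> B \<noteq> 0 \<Longrightarrow> \<phi> A / \<phi> B \<in> K"
  by (auto simp: K_def)

lemma K_E:
  assumes "z \<in> K"
  obtains A B d where "homogeneous d A" "homogeneous d B" "\<phi> B \<noteq> 0" "z = \<phi> A / \<phi> B"
  using assms by (auto simp: K_def)

text \<open>The cross difference \<open>A * D - C * B\<close> is a form, so its divisibility by F is
  the same as vanishing on the branch.\<close>

lemma frac_rel_iff:
  "((A, B), (C, D)) \<in> frac_rel F \<longleftrightarrow>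
     (A, B) \<in> fractions F \<and> (C, D) \<in> fractions F \<and> \<phi> A / \<phi> B = \<phi> C / \<phi> D"
proof (cases "(A, B) \<in> fractions F \<and> (C, D) \<in> fractions F")
  case True
  then obtain d k where d: "homogeneous d A" "homogeneous d B" "\<phi> B \<noteq> 0"
    "homogeneous k C" "homogeneous k D" "\<phi> D \<noteq> 0"
    by (auto simp: fractions_iff)
  have "homogeneous (d + k) (A * D - C * B)"
    using homogeneous_diff[OF homogeneous_mult[OF d(1,5)]] homogeneous_mult[OF d(4,2)]
    by (simp add: add.commute)
  from \<phi>_eq_0_iff[OF this] show ?thesis
    using True d(3,6) by (auto simp: frac_rel_def \<phi>_simps field_simps)
qed (auto simp: frac_rel_def)

lemma frac_rel_Image: "(A, B) \<in> fractions F \<Longrightarrow> frac_rel F `` {(A, B)} = cls (\<phi> A / \<phi> B)"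
  by (auto simp: frac_rel_iff cls_def)

lemma cls_nonempty: "z \<in> K \<Longrightarrow> cls z \<noteq> {}"
  by (auto simp: K_def cls_def fractions_iff)

lemma cls_inj:
  assumes "z \<in> K" "cls z = cls w"
  shows "z = w"
  using cls_nonempty[OF assms(1)] assms(2) by (auto simp: cls_def)

lemma carrier_FF: "carrier FF = cls ` K"
proof -
  have "carrier FF = (\<lambda>(A, B). frac_rel F `` {(A, B)}) ` fractions F"
    by (auto simp: function_field_def quotient_def)
  also have "\<dots> = (\<lambda>(A, B). cls (\<phi> A / \<phi> B)) ` fractions F"
  proof (rule image_cong[OF refl])
    fix x assume "x \<in> fractions F"
    then show "(\<lambda>(A, B). frac_rel F `` {(A, B)}) x = (\<lambda>(A, B). cls (\<phi> A / \<phi> B)) x"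
      using frac_rel_Image by (cases x) (simp only: prod.case)
  qed
  also have "\<dots> = cls ` K"
    by (force simp: K_def fractions_iff)
  finally show ?thesis .
qed

lemma cls_mult:
  assumes "z \<in> K" "w \<in> K"
  shows "cls z \<otimes>\<^bsub>FF\<^esub> cls w = cls (z * w)"
proof -
  have that: "frac_rel F `` {(A * C, B * D)} = cls (z * w)" if "(A, B) \<in> cls z" "(C, D) \<in> cls w" for A B C D
  proof -
    have "(A * C, B * D) \<in> fractions F"
      using that by (auto simp: cls_def fractions_iff \<phi>_simps intro: homogeneous_mult)
    then show ?thesis
      using that by (auto simp: frac_rel_Image \<phi>_simps cls_def)
  qed
  \<comment> \<open>The product is a union over all pairs of representatives. Each pair yields the
    same class, and at least one pair exists.\<close>
  have "(\<Union>(A, B)\<in>cls z. \<Union>(C, D)\<in>cls w. frac_rel F `` {(A * C, B * D)}) = (\<Union>_\<in>cls z. \<Union>_\<in>cls w. cls (z * w))"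
  proof (rule SUP_cong[OF refl])
    fix x assume x: "x \<in> cls z"
    obtain A B where AB: "x = (A, B)" by fastforce
    have "(\<Union>(C, D)\<in>cls w. frac_rel F `` {(A * C, B * D)}) = (\<Union>_\<in>cls w. cls (z * w))"
    proof (rule SUP_cong[OF refl])
      fix y assume y: "y \<in> cls w"
      obtain C D where CD: "y = (C, D)" by fastforce
      show "(case y of (C, D) \<Rightarrow> frac_rel F `` {(A * C, B * D)}) = cls (z * w)"
        using that[of A B C D] x y by (simp only: AB CD prod.case)
    qed
    then show "(case x of (A, B) \<Rightarrow> \<Union>(C, D)\<in>cls w. frac_rel F `` {(A * C, B * D)}) = (\<Union>_\<in>cls w. cls (z * w))"
      by (simp only: AB prod.case)
  qed
  also have "\<dots> = cls (z * w)"
    using assms[THEN cls_nonempty] by auto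
  finally show ?thesis
    by (simp add: function_field_def)
qed

lemma cls_0: "\<zero>\<^bsub>FF\<^esub> = cls 0"
proof -
  have "(0, 1) \<in> fractions F"
    by (auto simp: fractions_iff \<phi>_simps intro!: exI[of _ 0])
  then show ?thesis
    by (simp add: function_field_def frac_rel_Image \<phi>_simps)
qed

lemma cls_1: "\<one>\<^bsub>FF\<^esub> = cls 1"
proof -
  have "(1, 1) \<in> fractions F"
    by (auto simp: fractions_iff \<phi>_simps intro!: exI[of _ 0])
  then show ?thesis
    by (simp add: function_field_def frac_rel_Image \<phi>_simps)
qed

lemma K_add:
  assumes "z \<in> K" "w \<in> K"
  shows "z + w \<in> K"
proof -
  obtain A B d where 1: "homogeneous d A" "homogeneous d B" "\<phi> B \<noteq> 0" "z = \<phi> A / \<phi> B"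
    using assms(1) by (rule K_E)
  obtain C D k where 2: "homogeneous k C" "homogeneous k D" "\<phi> D \<noteq> 0" "w = \<phi> C / \<phi> D"
    using assms(2) by (rule K_E)
  have "z + w = \<phi> (A * D + C * B) / \<phi> (B * D)"
    unfolding 1(4) 2(4) \<phi>_simps using 1(3) 2(3) by (simp add: field_simps)
  moreover have "homogeneous (d + k) (A * D + C * B)" "homogeneous (d + k) (B * D)"
    using 1 2 homogeneous_mult[OF 2(1) 1(2)] by (auto intro!: homogeneous_add homogeneous_mult simp: add.commute)
  ultimately show ?thesis
    using 1(3) 2(3) K_I[of "d + k" "A * D + C * B" "B * D"] by (simp add: \<phi>_simps)
qed

lemma K_mult:
  assumes "z \<in> K" "w \<in> K"
  shows "z * w \<in> K"
proof -
  obtain A B d where 1: "homogeneous d A" "homogeneous d B" "\<phi> B \<noteq> 0" "z = \<phi> A / \<phi> B"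
    using assms(1) by (rule K_E)
  obtain C D k where 2: "homogeneous k C" "homogeneous k D" "\<phi> D \<noteq> 0" "w = \<phi> C / \<phi> D"
    using assms(2) by (rule K_E)
  have "z * w = \<phi> (A * C) / \<phi> (B * D)"
    unfolding 1(4) 2(4) \<phi>_simps by simp
  then show ?thesis
    using K_I[OF homogeneous_mult[OF 1(1) 2(1)] homogeneous_mult[OF 1(2) 2(2)]] 1(3) 2(3)
    by (simp add: \<phi>_simps)
qed

lemma K_inverse: "z \<in> K \<Longrightarrow> inverse z \<in> K"
proof -
  assume "z \<in> K"
  then obtain A B d where 1: "homogeneous d A" "homogeneous d B" "\<phi> B \<noteq> 0" "z = \<phi> A / \<phi> B"
    by (rule K_E)
  show ?thesis
  proof (cases "\<phi> A = 0")
    case True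
    with 1 \<open>z \<in> K\<close> show ?thesis by simp
  next
    case False
    then show ?thesis using K_I[OF 1(2,1)] 1(4) by simp
  qed
qed

lemma K_const: "\<c> a \<in> K"
  using K_I[of 0 "Const a" 1] by (simp add: \<phi>_simps)

lemma K_0: "0 \<in> K" and K_1: "1 \<in> K"
  using K_const[of 0] K_const[of 1] by simp_all

lemma K_\<xi>: "\<xi> i / \<xi> j \<in> K"
  using K_I[OF homogeneous_Var[of i] homogeneous_Var[of j]] by simp

lemma K_power: "z \<in> K \<Longrightarrow> z ^ n \<in> K"
  by (induction n) (auto simp: K_1 K_mult)

lemma K_sum: "(\<And>i. i \<in> I \<Longrightarrow> f i \<in> K) \<Longrightarrow> (\<Sum>i\<in>I. f i) \<in> K"
  by (induction I rule: infinite_finite_induct) (auto simp: K_0 K_add)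

lemma cls_nat_pow: "z \<in> K \<Longrightarrow> cls z [^]\<^bsub>FF\<^esub> (n::nat) = cls (z ^ n)"
  by (induction n) (simp_all add: nat_pow_def cls_1 cls_mult K_power mult.commute)

lemma cls_inv:
  assumes "z \<in> K" "z \<noteq> 0"
  shows "inv\<^bsub>FF\<^esub> (cls z) = cls (inverse z)"
  unfolding m_inv_def
proof (rule the_equality)
  show "cls (inverse z) \<in> carrier FF \<and> cls z \<otimes>\<^bsub>FF\<^esub> cls (inverse z) = \<one>\<^bsub>FF\<^esub> \<and>
      cls (inverse z) \<otimes>\<^bsub>FF\<^esub> cls z = \<one>\<^bsub>FF\<^esub>"
    using assms by (simp add: carrier_FF K_inverse cls_mult cls_1)
next
  fix y assume y: "y \<in> carrier FF \<and> cls z \<otimes>\<^bsub>FF\<^esub> y = \<one>\<^bsub>FF\<^esub> \<and> y \<otimes>\<^bsub>FF\<^esub> cls z = \<one>\<^bsub>FF\<^esub>"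
  then obtain w where w: "y = cls w" "w \<in> K"
    by (auto simp: carrier_FF)
  with y have "cls (z * w) = cls 1"
    by (simp add: assms cls_mult cls_1)
  then have "z * w = 1"
    using cls_inj K_mult assms(1) w(2) by blast
  then show "y = cls (inverse z)"
    using inverse_unique w(1) by blast
qed

lemma cls_int_pow:
  assumes "z \<in> K" "z \<noteq> 0"
  shows "cls z [^]\<^bsub>FF\<^esub> (k::int) = cls (z powi k)"
proof (cases "k < 0")
  case True
  have "z ^ nat (- k) \<noteq> 0"
    using assms(2) by simp
  then have "cls z [^]\<^bsub>FF\<^esub> k = cls (inverse (z ^ nat (- k)))"
    unfolding int_pow_def2 using True assms(1) by (simp only: if_True cls_nat_pow cls_inv[OF K_power[OF assms(1)] \<open>z ^ nat (- k) \<noteq> 0\<close>])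
  moreover have "z powi (- int (nat (- k))) = inverse (z ^ nat (- k))"
    by (simp only: power_int_minus power_int_of_nat)
  moreover have "- int (nat (- k)) = k"
    using True by simp
  ultimately show ?thesis
    by (simp only:)
next
  case False
  have "z powi (int (nat k)) = z ^ nat k"
    by (rule power_int_of_nat)
  moreover have "int (nat k) = k"
    using False by simp
  ultimately show ?thesis
    unfolding int_pow_def2 using False assms(1) by (simp only: if_False cls_nat_pow)
qed

lemma K_powi: "z \<in> K \<Longrightarrow> z powi k \<in> K"
  by (rule power_int_cases[of k z]) (metis K_power, metis K_power K_inverse)

section \<open>Local rings, values and orders at the points of the curve\<close>

definition on_curve :: "'a ^ 3 \<Rightarrow> bool" where
  "on_curve v \<longleftrightarrow> v \<noteq> 0 \<and> eval_poly F v = 0"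

lemma curve_iff: "pt v \<in> curve F \<and> v \<noteq> 0 \<longleftrightarrow> on_curve v"
  by (auto simp: curve_def PG2_def on_curve_def pt_vanishes[OF homogeneous_F])

lemma curveE:
  assumes "P \<in> curve F"
  obtains v where "P = pt v" "on_curve v"
  using assms by (auto simp: curve_def PG2_def on_curve_def pt_vanishes[OF homogeneous_F])

text \<open>The local ring of the point spanned by v, as a subring of the Laurent series. Its
  elements need not be power series: the order on the branch at (1 : 0 : 0) says nothing about
  regularity at other points.\<close>

definition Ol :: "'a ^ 3 \<Rightarrow> 'a fls set" where
  "Ol v = {\<phi> A / \<phi> B | A B d. homogeneous d A \<and> homogeneous d B \<and> eval_poly B v \<noteq> 0}"

definition ev :: "'a ^ 3 \<Rightarrow> 'a fls \<Rightarrow> 'a" where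
  "ev v z = (THE c. \<exists>A B d. homogeneous d A \<and> homogeneous d B \<and> eval_poly B v \<noteq> 0 \<and>
     z = \<phi> A / \<phi> B \<and> c = eval_poly A v / eval_poly B v)"

context
  fixes v
  assumes v: "on_curve v"
begin

lemma \<phi>_nz: "homogeneous d B \<Longrightarrow> eval_poly B v \<noteq> 0 \<Longrightarrow> \<phi> B \<noteq> 0"
  using v by (auto simp: \<phi>_eq_0_iff on_curve_def eval_poly_simps elim!: dvdE)

lemma Ol_I: "homogeneous d A \<Longrightarrow> homogeneous d B \<Longrightarrow> eval_poly B v \<noteq> 0 \<Longrightarrow> \<phi> A / \<phi> B \<in> Ol v"
  by (auto simp: Ol_def)

lemma Ol_K: "z \<in> Ol v \<Longrightarrow> z \<in> K"
  using \<phi>_nz unfolding Ol_def K_def by blast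

text \<open>Equal fractions have a cross difference divisible by F, and F vanishes at v. This makes
  \<open>ev\<close> independent of the representation.\<close>

lemma eval_cong:
  assumes "homogeneous d A" "homogeneous d B" "homogeneous k C" "homogeneous k D"
    and "\<phi> B \<noteq> 0" "\<phi> D \<noteq> 0" "\<phi> A / \<phi> B = \<phi> C / \<phi> D"
  shows "eval_poly A v * eval_poly D v = eval_poly C v * eval_poly B v"
proof -
  have "((A, B), (C, D)) \<in> frac_rel F"
    unfolding frac_rel_iff fractions_iff using assms by auto
  then have "F dvd A * D - C * B"
    by (simp add: frac_rel_def)
  then obtain k where "A * D - C * B = F * k"
    by (rule dvdE)
  then have "eval_poly (A * D - C * B) v = eval_poly (F * k) v"
    by (rule arg_cong)
  then have "eval_poly (A * D - C * B) v = 0"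
    using v by (simp add: on_curve_def eval_poly_simps)
  then show ?thesis
    by (simp add: eval_poly_simps)
qed

lemma ev_eq:
  assumes "homogeneous d A" "homogeneous d B" "eval_poly B v \<noteq> 0"
  shows "ev v (\<phi> A / \<phi> B) = eval_poly A v / eval_poly B v"
  unfolding ev_def
proof (rule the_equality)
  fix c assume "\<exists>C D d. homogeneous d C \<and> homogeneous d D \<and> eval_poly D v \<noteq> 0 \<and>
     \<phi> A / \<phi> B = \<phi> C / \<phi> D \<and> c = eval_poly C v / eval_poly D v"
  then obtain C D k where C: "homogeneous k C" "homogeneous k D" "eval_poly D v \<noteq> 0"
     "\<phi> A / \<phi> B = \<phi> C / \<phi> D" "c = eval_poly C v / eval_poly D v"
    by blast
  from eval_cong[OF assms(1,2) C(1,2) \<phi>_nz[OF assms(2,3)] \<phi>_nz[OF C(2,3)] C(4)]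
  show "c = eval_poly A v / eval_poly B v"
    using C(3,5) assms(3) by (simp add: frac_eq_eq)
qed (use assms in blast)

lemma Ol_E:
  assumes "z \<in> Ol v"
  obtains A B d where "homogeneous d A" "homogeneous d B" "eval_poly B v \<noteq> 0" "\<phi> B \<noteq> 0"
    "z = \<phi> A / \<phi> B" "ev v z = eval_poly A v / eval_poly B v"
  using assms ev_eq \<phi>_nz by (auto simp: Ol_def)

lemma Ol_add_ev:
  assumes "z \<in> Ol v" "w \<in> Ol v"
  shows "z + w \<in> Ol v \<and> ev v (z + w) = ev v z + ev v w"
proof -
  obtain A B d where 1: "homogeneous d A" "homogeneous d B" "eval_poly B v \<noteq> 0" "\<phi> B \<noteq> 0"
    "z = \<phi> A / \<phi> B" "ev v z = eval_poly A v / eval_poly B v"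
    using assms(1) by (rule Ol_E)
  obtain C D k where 2: "homogeneous k C" "homogeneous k D" "eval_poly D v \<noteq> 0" "\<phi> D \<noteq> 0"
    "w = \<phi> C / \<phi> D" "ev v w = eval_poly C v / eval_poly D v"
    using assms(2) by (rule Ol_E)
  have eq: "z + w = \<phi> (A * D + C * B) / \<phi> (B * D)"
    unfolding 1(5) 2(5) \<phi>_simps using 1(4) 2(4) by (simp add: field_simps)
  have h: "homogeneous (d + k) (A * D + C * B)" "homogeneous (d + k) (B * D)" "eval_poly (B * D) v \<noteq> 0"
    using 1 2 homogeneous_mult[OF 2(1) 1(2)]
    by (auto intro!: homogeneous_add homogeneous_mult simp: add.commute eval_poly_simps)
  have "ev v (z + w) = ev v z + ev v w"
    unfolding eq ev_eq[OF h] 1(6) 2(6) eval_poly_simps using 1(3) 2(3) by (simp add: field_simps)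
  with Ol_I[OF h] show ?thesis
    unfolding eq by simp
qed

lemma Ol_mult_ev:
  assumes "z \<in> Ol v" "w \<in> Ol v"
  shows "z * w \<in> Ol v \<and> ev v (z * w) = ev v z * ev v w"
proof -
  obtain A B d where 1: "homogeneous d A" "homogeneous d B" "eval_poly B v \<noteq> 0" "\<phi> B \<noteq> 0"
    "z = \<phi> A / \<phi> B" "ev v z = eval_poly A v / eval_poly B v"
    using assms(1) by (rule Ol_E)
  obtain C D k where 2: "homogeneous k C" "homogeneous k D" "eval_poly D v \<noteq> 0" "\<phi> D \<noteq> 0"
    "w = \<phi> C / \<phi> D" "ev v w = eval_poly C v / eval_poly D v"
    using assms(2) by (rule Ol_E)
  have eq: "z * w = \<phi> (A * C) / \<phi> (B * D)"
    unfolding 1(5) 2(5) \<phi>_simps by simp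
  have h: "homogeneous (d + k) (A * C)" "homogeneous (d + k) (B * D)" "eval_poly (B * D) v \<noteq> 0"
    using 1 2 by (auto intro!: homogeneous_mult simp: eval_poly_simps)
  have "ev v (z * w) = ev v z * ev v w"
    unfolding eq ev_eq[OF h] 1(6) 2(6) eval_poly_simps by simp
  with Ol_I[OF h] show ?thesis
    unfolding eq by simp
qed

lemmas Ol_add = Ol_add_ev[THEN conjunct1] and ev_add = Ol_add_ev[THEN conjunct2]
lemmas Ol_mult = Ol_mult_ev[THEN conjunct1] and ev_mult = Ol_mult_ev[THEN conjunct2]

lemma Ol_const: "\<c> a \<in> Ol v" and ev_const: "ev v (\<c> a) = a"
  using Ol_I[of 0 "Const a" 1] ev_eq[of 0 "Const a" 1] by (simp_all add: \<phi>_simps eval_poly_simps)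

lemma Ol_0: "0 \<in> Ol v" and ev_0: "ev v 0 = 0" and Ol_1: "1 \<in> Ol v" and ev_1: "ev v 1 = 1"
  using Ol_const[of 0] ev_const[of 0] Ol_const[of 1] ev_const[of 1] by simp_all

lemma Ol_uminus: "z \<in> Ol v \<Longrightarrow> - z \<in> Ol v" and ev_uminus: "z \<in> Ol v \<Longrightarrow> ev v (- z) = - ev v z"
  using Ol_mult[OF Ol_const[of "- 1"]] ev_mult[OF Ol_const[of "- 1"]]
  by (simp_all add: fls_const_uminus ev_const[of "- 1", simplified])

lemma Ol_diff: "z \<in> Ol v \<Longrightarrow> w \<in> Ol v \<Longrightarrow> z - w \<in> Ol v"
  and ev_diff: "z \<in> Ol v \<Longrightarrow> w \<in> Ol v \<Longrightarrow> ev v (z - w) = ev v z - ev v w"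
  using Ol_add[OF _ Ol_uminus] ev_add[OF _ Ol_uminus] by (fastforce simp: ev_uminus)+

lemma Ol_power_ev: "z \<in> Ol v \<Longrightarrow> z ^ n \<in> Ol v \<and> ev v (z ^ n) = ev v z ^ n"
  by (induction n) (auto simp: Ol_1 ev_1 Ol_mult ev_mult)

lemmas Ol_power = Ol_power_ev[THEN conjunct1] and ev_power = Ol_power_ev[THEN conjunct2]

lemma Ol_sum_ev:
  "(\<And>i. i \<in> I \<Longrightarrow> f i \<in> Ol v) \<Longrightarrow> (\<Sum>i\<in>I. f i) \<in> Ol v \<and> ev v (\<Sum>i\<in>I. f i) = (\<Sum>i\<in>I. ev v (f i))"
  by (induction I rule: infinite_finite_induct) (auto simp: Ol_0 ev_0 Ol_add ev_add)

lemmas Ol_sum = Ol_sum_ev[THEN conjunct1] and ev_sum = Ol_sum_ev[THEN conjunct2]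

lemma Ol_nz: "z \<in> Ol v \<Longrightarrow> ev v z \<noteq> 0 \<Longrightarrow> z \<noteq> 0"
  using ev_0 by auto

lemma Ol_inverse_ev:
  assumes "z \<in> Ol v" "ev v z \<noteq> 0"
  shows "inverse z \<in> Ol v \<and> ev v (inverse z) = inverse (ev v z)"
proof -
  obtain A B d where 1: "homogeneous d A" "homogeneous d B" "eval_poly B v \<noteq> 0" "\<phi> B \<noteq> 0"
    "z = \<phi> A / \<phi> B" "ev v z = eval_poly A v / eval_poly B v"
    using assms(1) by (rule Ol_E)
  with assms(2) have "eval_poly A v \<noteq> 0" by auto
  with Ol_I[OF 1(2,1)] ev_eq[OF 1(2,1)] 1 show ?thesis by simp
qed

lemmas Ol_inverse = Ol_inverse_ev[THEN conjunct1] and ev_inverse = Ol_inverse_ev[THEN conjunct2]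

lemma Ol_divide: "z \<in> Ol v \<Longrightarrow> w \<in> Ol v \<Longrightarrow> ev v w \<noteq> 0 \<Longrightarrow> z / w \<in> Ol v"
  and ev_divide: "z \<in> Ol v \<Longrightarrow> w \<in> Ol v \<Longrightarrow> ev v w \<noteq> 0 \<Longrightarrow> ev v (z / w) = ev v z / ev v w"
  by (simp_all add: divide_inverse Ol_mult ev_mult Ol_inverse ev_inverse)

lemma Ol_\<xi>: "v $ k \<noteq> 0 \<Longrightarrow> \<xi> l / \<xi> k \<in> Ol v" and ev_\<xi>: "v $ k \<noteq> 0 \<Longrightarrow> ev v (\<xi> l / \<xi> k) = v $ l / v $ k"
  using Ol_I[OF homogeneous_Var[of l] homogeneous_Var[of k]] ev_eq[OF homogeneous_Var[of l] homogeneous_Var[of k]]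
  by simp_all

definition units :: "'a fls set" where "units = {z \<in> Ol v. ev v z \<noteq> 0}"

lemma units_mult: "z \<in> units \<Longrightarrow> w \<in> units \<Longrightarrow> z * w \<in> units"
  by (simp add: units_def Ol_mult ev_mult)

lemma units_inverse: "z \<in> units \<Longrightarrow> inverse z \<in> units"
  by (simp add: units_def Ol_inverse ev_inverse)

lemma units_nz: "z \<in> units \<Longrightarrow> z \<noteq> 0"
  using Ol_nz by (auto simp: units_def)

lemma units_power: "z \<in> units \<Longrightarrow> z ^ n \<in> units"
  by (simp add: units_def Ol_power ev_power)

lemma units_powi: "z \<in> units \<Longrightarrow> z powi k \<in> units"
  by (rule power_int_cases[of k z]) (metis units_power, metis units_power units_inverse)

lemma vanishes_pt: "homogeneous d B \<Longrightarrow> vanishes_at B (pt v) \<longleftrightarrow> eval_poly B v = 0"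
  by (rule pt_vanishes)

lemma local_ring_eq: "local_ring F (pt v) = cls ` Ol v"
proof (rule Set.set_eqI, rule iffI)
  fix f assume "f \<in> local_ring F (pt v)"
  then obtain z A B where z: "z \<in> K" "f = cls z" "(A, B) \<in> f" "\<not> vanishes_at B (pt v)"
    by (auto simp: local_ring_def carrier_FF)
  then show "f \<in> cls ` Ol v"
    using Ol_I by (fastforce simp: cls_def fractions_iff vanishes_pt)
next
  fix f assume "f \<in> cls ` Ol v"
  then obtain z where z: "z \<in> Ol v" "f = cls z" by auto
  from z(1) obtain A B d where 1: "homogeneous d A" "homogeneous d B" "eval_poly B v \<noteq> 0" "\<phi> B \<noteq> 0"
    "z = \<phi> A / \<phi> B"
    by (rule Ol_E)
  then have "(A, B) \<in> f"
    by (auto simp: z(2) cls_def fractions_iff)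
  moreover have "\<not> vanishes_at B (pt v)"
    using 1 by (simp add: vanishes_pt)
  ultimately show "f \<in> local_ring F (pt v)"
    using z Ol_K by (auto simp: local_ring_def carrier_FF)
qed

lemma fun_value_eq:
  assumes "z \<in> Ol v"
  shows "fun_value (cls z) (pt v) = ev v z"
  unfolding fun_value_def
proof (rule the_equality)
  obtain A B d where 1: "homogeneous d A" "homogeneous d B" "eval_poly B v \<noteq> 0" "\<phi> B \<noteq> 0"
    "z = \<phi> A / \<phi> B" "ev v z = eval_poly A v / eval_poly B v"
    using assms by (rule Ol_E)
  have "(A, B) \<in> cls z"
    using 1 by (auto simp: cls_def fractions_iff)
  moreover have "\<not> vanishes_at B (pt v)"
    using 1 by (simp add: vanishes_pt)
  moreover have "\<forall>u\<in>pt v. eval_poly A u = ev v z * eval_poly B u"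
    using 1 by (auto simp: pt_def vec.span_singleton eval_poly_scale)
  ultimately show "\<exists>(A, B)\<in>cls z. \<not> vanishes_at B (pt v) \<and> (\<forall>u\<in>pt v. eval_poly A u = ev v z * eval_poly B u)"
    by auto
next
  fix c assume "\<exists>(A, B)\<in>cls z. \<not> vanishes_at B (pt v) \<and> (\<forall>u\<in>pt v. eval_poly A u = c * eval_poly B u)"
  then obtain A B where AB: "(A, B) \<in> cls z" "\<not> vanishes_at B (pt v)" "\<forall>u\<in>pt v. eval_poly A u = c * eval_poly B u"
    by auto
  from AB(1) obtain d where d: "homogeneous d A" "homogeneous d B" "z = \<phi> A / \<phi> B"
    by (auto simp: cls_def fractions_iff)
  have B: "eval_poly B v \<noteq> 0"
    using AB(2) d(2) by (simp add: vanishes_pt)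
  have "v \<in> pt v"
    by (simp add: pt_def vec.span_base)
  with AB(3) have "eval_poly A v = c * eval_poly B v" by blast
  with B ev_eq[OF d(1,2) B] show "c = ev v z"
    by (simp add: d(3))
qed

lemma maximal_ideal_eq: "maximal_ideal F (pt v) = cls ` {z \<in> Ol v. ev v z = 0}"
  by (auto simp: maximal_ideal_def local_ring_eq fun_value_eq)

text \<open>Transport of \<open>uniformizer\<close> to the Laurent series. That u is nonzero is not
  part of it and is assumed separately wherever powers of u are cancelled.\<close>

definition uni :: "'a fls \<Rightarrow> bool" where
  "uni u \<longleftrightarrow> u \<in> Ol v \<and> {z \<in> Ol v. ev v z = 0} = {u * h | h. h \<in> Ol v}"

lemma inj_cls: "inj_on cls K"
  using cls_inj by (rule inj_onI)

lemma uniformizer_cls: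
  assumes "u \<in> Ol v"
  shows "uniformizer F (pt v) (cls u) \<longleftrightarrow> uni u"
proof -
  have "cls u \<otimes>\<^bsub>FF\<^esub> cls h = cls (u * h)" if "h \<in> Ol v" for h
    using that assms Ol_K by (simp add: cls_mult)
  then have "{cls u \<otimes>\<^bsub>FF\<^esub> h |h. h \<in> cls ` Ol v} = cls ` {u * h | h. h \<in> Ol v}"
    by blast
  moreover have "{u * h | h. h \<in> Ol v} \<subseteq> K" "{z \<in> Ol v. ev v z = 0} \<subseteq> K"
    using Ol_K Ol_mult assms by auto
  ultimately show ?thesis
    using assms by (simp add: uniformizer_def uni_def local_ring_eq maximal_ideal_eq inj_on_image_eq_iff[OF inj_cls])
qed

lemma uni_ev: "uni u \<Longrightarrow> u \<in> Ol v \<and> ev v u = 0"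
  using Ol_1 by (force simp: uni_def set_eq_iff)

lemma uni_associated:
  assumes "uni u" "uni u'" "u \<noteq> 0"
  shows "\<exists>r\<in>units. u' = r * u"
proof -
  obtain r where r: "r \<in> Ol v" "u' = u * r"
    using assms(1) uni_ev[OF assms(2)] by (auto simp: uni_def)
  obtain r' where r': "r' \<in> Ol v" "u = u' * r'"
    using assms(2) uni_ev[OF assms(1)] by (auto simp: uni_def)
  have "u = u * r * r'"
    using r'(2) unfolding r(2) .
  then have "u * (r * r') = u * 1"
    by (simp only: mult.assoc mult_1_right)
  then have "r * r' = 1"
    using mult_left_cancel[OF assms(3)] by blast
  then have "ev v r * ev v r' = 1"
    using ev_mult r(1) r'(1) ev_1 by metis
  then show ?thesis
    using r by (auto simp: units_def mult.commute)
qed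

lemma unit_power_uni:
  assumes "uni u" "u \<noteq> 0" "u powi k \<in> units"
  shows "k = 0"
proof (rule ccontr)
  assume "k \<noteq> 0"
  have nonunit: "u ^ n \<notin> units" if "n > 0" for n
  proof -
    have "ev v (u ^ n) = ev v u ^ n"
      using uni_ev[OF assms(1)] by (intro ev_power) blast
    also have "ev v u = 0"
      using uni_ev[OF assms(1)] by blast
    also have "(0::'a) ^ n = 0"
      using that by (rule zero_power)
    finally show ?thesis
      unfolding units_def by blast
  qed
  have "u ^ nat \<bar>k\<bar> \<in> units"
  proof (cases "k \<ge> 0")
    case True
    then have "int (nat \<bar>k\<bar>) = k" by simp
    then show ?thesis using assms(3) power_int_of_nat[of u "nat \<bar>k\<bar>"] by metis
  next
    case False
    then have "- k = int (nat \<bar>k\<bar>)" by simp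
    moreover have "u powi (- k) \<in> units"
      using units_inverse[OF assms(3)] by (simp only: power_int_minus)
    ultimately show ?thesis using power_int_of_nat[of u "nat \<bar>k\<bar>"] by metis
  qed
  moreover have "nat \<bar>k\<bar> > 0"
    using \<open>k \<noteq> 0\<close> by simp
  ultimately show False
    using nonunit by blast
qed

text \<open>Two uniformizers differ by a unit, so the exponent does not depend on the uniformizer
  used in the description; two exponents for the same function would make a nontrivial power of u a
  unit, although u has the value 0.\<close>

lemma ord_at_eq:
  assumes u: "uni u" "u \<noteq> 0" and w: "w \<in> units"
  shows "ord_at F (pt v) (cls (w * u powi k)) = k"
  unfolding ord_at_def
proof (rule the_equality)
  have uO: "u \<in> Ol v" using uni_ev[OF u(1)] by simp
  have wO: "w \<in> Ol v" "ev v w \<noteq> 0" using w by (auto simp: units_def)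
  have pK: "u powi j \<in> K" for j
    using Ol_K[OF uO] by (rule K_powi)
  have diff: "cls z \<in> local_ring F (pt v) - maximal_ideal F (pt v) \<longleftrightarrow> z \<in> units" if "z \<in> K" for z
  proof -
    have "Ol v \<subseteq> K" "{z \<in> Ol v. ev v z = 0} \<subseteq> K"
      using Ol_K by auto
    with that show ?thesis
      by (auto simp: local_ring_eq maximal_ideal_eq units_def inj_on_image_mem_iff[OF inj_cls])
  qed
  have dw: "cls w \<in> local_ring F (pt v) - maximal_ideal F (pt v)"
    using diff w wO(1) Ol_K by blast
  show "\<exists>x y. uniformizer F (pt v) x \<and> y \<in> local_ring F (pt v) - maximal_ideal F (pt v) \<and>
      cls (w * u powi k) = y \<otimes>\<^bsub>FF\<^esub> (x [^]\<^bsub>FF\<^esub> k)"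
    using u uO w wO Ol_K pK
    by (rule_tac exI[of _ "cls u"], rule_tac exI[of _ "cls w"]) (use dw in \<open>simp add: uniformizer_cls cls_int_pow cls_mult\<close>)
  fix j :: int assume "\<exists>x y. uniformizer F (pt v) x \<and> y \<in> local_ring F (pt v) - maximal_ideal F (pt v) \<and>
      cls (w * u powi k) = y \<otimes>\<^bsub>FF\<^esub> (x [^]\<^bsub>FF\<^esub> j)"
  then obtain x y where x: "uniformizer F (pt v) x" and y: "y \<in> local_ring F (pt v) - maximal_ideal F (pt v)"
    and eq: "cls (w * u powi k) = y \<otimes>\<^bsub>FF\<^esub> (x [^]\<^bsub>FF\<^esub> j)"
    by blast
  from x obtain u' where u': "u' \<in> Ol v" "x = cls u'"
    by (auto simp: uniformizer_def local_ring_eq)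
  with x have uni': "uni u'"
    by (simp add: uniformizer_cls)
  from y obtain w' where w': "w' \<in> K" "y = cls w'" "w' \<in> units"
    using diff Ol_K by (auto simp: local_ring_eq)
  obtain r where r: "r \<in> units" "u' = r * u"
    using uni_associated[OF u(1) uni' u(2)] by blast
  have u'0: "u' \<noteq> 0"
    using r u(2) units_nz by auto
  have "cls (w * u powi k) = cls (w' * u' powi j)"
    using eq Ol_K[OF u'(1)] u'0 w'(1) by (simp add: u'(2) w'(2) cls_int_pow cls_mult K_powi)
  then have "w * u powi k = w' * u' powi j"
    using cls_inj K_mult Ol_K[OF wO(1)] pK by blast
  then have "w * u powi k = (w' * r powi j) * u powi j"
    by (simp add: r(2) power_int_mult_distrib mult.assoc)
  moreover have "u powi k = u powi (k - j) * u powi j"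
    using power_int_add[of u "k - j" j] u(2) by simp
  ultimately have "(w * u powi (k - j)) * u powi j = (w' * r powi j) * u powi j"
    by (simp only: mult.assoc)
  moreover have "u powi j \<noteq> 0"
    using u(2) by simp
  ultimately have "w * u powi (k - j) = w' * r powi j"
    using mult_right_cancel by blast
  then have "inverse w * (w * u powi (k - j)) = inverse w * (w' * r powi j)"
    by (simp only:)
  moreover have "inverse w * (w * u powi (k - j)) = u powi (k - j)"
    using units_nz[OF w] by (simp add: mult.assoc[symmetric])
  ultimately have "u powi (k - j) = inverse w * (w' * r powi j)"
    by (simp only:)
  also have "\<dots> \<in> units"
    by (intro units_mult units_inverse units_powi w w'(3) r(1))
  finally have "k - j = 0"
    by (rule unit_power_uni[OF u])
  then show "j = k" by simp
qed

end

end

section \<open>Uniformizers\<close>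

lemma dehomogenize:
  fixes x y z \<alpha> \<beta> \<gamma> :: "'b::field"
  assumes "z \<noteq> 0" "\<alpha> * x * y ^ q + \<beta> * y * z ^ q + \<gamma> * z * x ^ q = 0"
  shows "\<alpha> * (x / z) * (y / z) ^ q + \<beta> * (y / z) + \<gamma> * (x / z) ^ q = 0"
proof -
  have "\<alpha> * (x / z) * (y / z) ^ q = \<alpha> * x * y ^ q / (z * z ^ q)"
    "\<beta> * (y / z) = \<beta> * y * z ^ q / (z * z ^ q)" "\<gamma> * (x / z) ^ q = \<gamma> * z * x ^ q / (z * z ^ q)"
    using assms(1) by (simp_all add: power_divide)
  then have "\<alpha> * (x / z) * (y / z) ^ q + \<beta> * (y / z) + \<gamma> * (x / z) ^ q
      = (\<alpha> * x * y ^ q + \<beta> * y * z ^ q + \<gamma> * z * x ^ q) / (z * z ^ q)"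
    by (simp only: add_divide_distrib)
  with assms(2) show ?thesis by simp
qed

lemma numeral_mod_3: "(4::3) = 1" "(5::3) = 2"
  by simp_all

lemma cyclic_3: "(l::3) = k \<or> l = k + 1 \<or> l = k + 2"
  using exhaust_3[of l] exhaust_3[of k] by auto

context hermitian_curve
begin

text \<open>The coefficients of the curve, indexed so that its equation is the cyclic sum of the
  terms \<open>tc i X_i X_(i+1)^q\<close>. One computation then covers the charts at all three
  vertices of the coordinate triangle.\<close>

definition tc :: "3 \<Rightarrow> 'a" where
  "tc i = (if i = 1 then \<tau> else if i = 2 then t2 else 1)"

lemma tc_nz [simp]: "tc i \<noteq> 0"
  by (simp add: tc_def)

lemma tc_simps: "tc 1 = \<tau>" "tc 2 = t2" "tc 3 = 1"
  by (simp_all add: tc_def)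

lemma \<xi>_curve_eq:
  "\<c> (tc (k + 1)) * (\<xi> (k + 1) / \<xi> k) * (\<xi> (k + 2) / \<xi> k) ^ q + \<c> (tc (k + 2)) * (\<xi> (k + 2) / \<xi> k)
    + \<c> (tc k) * (\<xi> (k + 1) / \<xi> k) ^ q = 0"
proof (rule dehomogenize)
  have "\<phi> F = \<c> \<tau> * \<xi> 1 * \<xi> 2 ^ q + \<c> t2 * \<xi> 2 * \<xi> 3 ^ q + \<c> 1 * \<xi> 3 * \<xi> 1 ^ q"
    by (simp add: F_eq \<phi>_simps)
  with \<phi>_F have "\<c> \<tau> * \<xi> 1 * \<xi> 2 ^ q + \<c> t2 * \<xi> 2 * \<xi> 3 ^ q + \<c> 1 * \<xi> 3 * \<xi> 1 ^ q = 0"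
    by simp
  then show "\<c> (tc (k + 1)) * \<xi> (k + 1) * \<xi> (k + 2) ^ q + \<c> (tc (k + 2)) * \<xi> (k + 2) * \<xi> k ^ q
     + \<c> (tc k) * \<xi> k * \<xi> (k + 1) ^ q = 0"
    using exhaust_3[of k] by (elim disjE) (simp_all add: tc_simps add_ac numeral_mod_3)
qed simp

lemma \<xi>_subdegree: "fls_subdegree (\<xi> 1) = 0" "fls_subdegree (\<xi> 2) = 1" "fls_subdegree (\<xi> 3) = int q"
  by (simp_all add: \<xi>_simps zeta_subdegree)

text \<open>The coordinates of the branch have the pairwise distinct orders 0, 1 and q.\<close>

lemma \<xi>_ratio_not_const: "\<xi> (k + 1) / \<xi> k \<noteq> \<c> a"
proof
  assume "\<xi> (k + 1) / \<xi> k = \<c> a"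
  then have "\<xi> (k + 1) = \<c> a * \<xi> k"
    by (simp add: field_simps)
  moreover from this have "\<c> a \<noteq> 0"
    using \<xi>_nz[of "k + 1"] by (metis mult_zero_left)
  ultimately have "fls_subdegree (\<xi> (k + 1)) = fls_subdegree (\<xi> k)"
    by (simp add: fls_subdegree_mult)
  then show False
    using q2 exhaust_3[of k] by (elim disjE) (simp_all add: \<xi>_subdegree numeral_mod_3)
qed

lemma on_curve_nz_coord: "on_curve v \<Longrightarrow> \<exists>k. v $ k \<noteq> 0"
  by (auto simp: on_curve_def vec_eq_iff)

lemma \<phi>_dehom:
  assumes "homogeneous d A"
  shows "\<phi> A / \<xi> k ^ d = poly3_eval \<c> (\<lambda>l. \<xi> l / \<xi> k) A"
  using poly3_eval_scale[OF assms, of \<c> "inverse (\<xi> k)" \<xi>]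
  by (simp add: \<phi>_def divide_inverse mult.commute power_inverse)

text \<open>For \<open>a = X_(k+1) / X_k\<close> and \<open>b = X_(k+2) / X_k\<close> the affine
  equation has the nonzero constant derivative \<open>tc (k + 2)\<close> with respect to b, since q
  is 0 in the field. Hence a minus its value is a local parameter at every point with
  \<open>v $ k \<noteq> 0\<close>.\<close>

definition upar :: "'a ^ 3 \<Rightarrow> 3 \<Rightarrow> 'a fls" where
  "upar v k = \<xi> (k + 1) / \<xi> k - \<c> (v $ (k + 1) / v $ k)"

lemma upar_nz: "upar v k \<noteq> 0"
  using \<xi>_ratio_not_const[of k] by (simp add: upar_def)

context
  fixes v
  assumes v: "on_curve v"
begin

text \<open>Subtracting the equation at (a0, b0) and using additivity of q-th powers leaves an
  identity in a - a0 and b - b0 that factors as \<open>(b - b0) D = (a - a0) N\<close>, where D has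
  the value \<beta> and so is a unit. The value of the quotient is recorded because it later shows
  that the zeros of \<open>D0\<close> are simple.\<close>

lemma local_factor:
  assumes a: "a \<in> Ol v" "ev v a = a0" and b: "b \<in> Ol v" "ev v b = b0" and "\<beta> \<noteq> 0"
    and eq: "\<c> \<alpha> * a * b ^ q + \<c> \<beta> * b + \<c> \<gamma> * a ^ q = 0"
  shows "\<exists>r\<in>Ol v. b - \<c> b0 = (a - \<c> a0) * r \<and> ev v r = - (\<alpha> * b0 ^ q) / \<beta>"
proof -
  note O = Ol_add[OF v] Ol_mult[OF v] Ol_const[OF v] Ol_diff[OF v] Ol_power[OF v] Ol_uminus[OF v]
  note E = ev_add[OF v] ev_mult[OF v] ev_const[OF v] ev_diff[OF v] ev_power[OF v] ev_uminus[OF v] O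
  have "ev v (\<c> \<alpha> * a * b ^ q + \<c> \<beta> * b + \<c> \<gamma> * a ^ q) = \<alpha> * a0 * b0 ^ q + \<beta> * b0 + \<gamma> * a0 ^ q"
    using a b by (simp add: E)
  with eq have eq0: "\<alpha> * a0 * b0 ^ q + \<beta> * b0 + \<gamma> * a0 ^ q = 0"
    by (simp add: ev_0[OF v])
  then have "\<c> (\<alpha> * a0 * b0 ^ q + \<beta> * b0 + \<gamma> * a0 ^ q) = \<c> 0"
    by (rule arg_cong)
  then have eq0': "\<c> \<alpha> * \<c> a0 * \<c> b0 ^ q + \<c> \<beta> * \<c> b0 + \<c> \<gamma> * \<c> a0 ^ q = 0"
    by (simp only: ring_morph_simps[OF ring_morph_fls_const])
  define N D where "N = - (\<c> \<alpha> * \<c> b0 ^ q + \<c> \<gamma> * (a - \<c> a0) ^ (q - 1))"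
    and "D = \<c> \<beta> + \<c> \<alpha> * a * (b - \<c> b0) ^ (q - 1)"
  have q: "z * z ^ (q - 1) = z ^ q" for z :: "'a fls"
    using q2 by (cases q) simp_all
  have ND: "N \<in> Ol v" "D \<in> Ol v"
    using a b unfolding N_def D_def by (simp_all only: O)
  have "ev v N = - (\<alpha> * b0 ^ q + \<gamma> * 0 ^ (q - 1))" "ev v D = \<beta> + \<alpha> * a0 * 0 ^ (q - 1)"
    using a b unfolding N_def D_def by (simp_all only: E diff_self)
  then have evs: "ev v N = - (\<alpha> * b0 ^ q)" "ev v D = \<beta>"
    using q2 by (simp_all add: power_0_left)
  have "(b - \<c> b0) * D = \<c> \<beta> * (b - \<c> b0) + \<c> \<alpha> * a * ((b - \<c> b0) * (b - \<c> b0) ^ (q - 1))"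
    unfolding D_def by (simp add: algebra_simps)
  also have "\<dots> = \<c> \<beta> * (b - \<c> b0) + \<c> \<alpha> * a * (b ^ q - \<c> b0 ^ q)"
    unfolding q frob_diff_fls ..
  also have "\<dots> = (\<c> \<alpha> * a * b ^ q + \<c> \<beta> * b + \<c> \<gamma> * a ^ q) - (\<c> \<alpha> * \<c> a0 * \<c> b0 ^ q + \<c> \<beta> * \<c> b0 + \<c> \<gamma> * \<c> a0 ^ q)
     - (\<c> \<alpha> * \<c> b0 ^ q * (a - \<c> a0) + \<c> \<gamma> * (a ^ q - \<c> a0 ^ q))"
    by (simp add: algebra_simps)
  also have "\<dots> = - (\<c> \<alpha> * \<c> b0 ^ q * (a - \<c> a0) + \<c> \<gamma> * ((a - \<c> a0) * (a - \<c> a0) ^ (q - 1)))"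
    unfolding q frob_diff_fls eq eq0' by simp
  also have "\<dots> = (a - \<c> a0) * N"
    unfolding N_def by (simp add: algebra_simps)
  finally have "(b - \<c> b0) * D = (a - \<c> a0) * N" .
  moreover have "D \<noteq> 0"
    using Ol_nz[OF v ND(2)] evs(2) \<open>\<beta> \<noteq> 0\<close> by simp
  ultimately have "b - \<c> b0 = (a - \<c> a0) * (N / D)"
    by (simp add: eq_divide_eq)
  moreover have "N / D \<in> Ol v" "ev v (N / D) = - (\<alpha> * b0 ^ q) / \<beta>"
    using Ol_divide[OF v ND] ev_divide[OF v ND] evs \<open>\<beta> \<noteq> 0\<close> by simp_all
  ultimately show ?thesis by blast
qed

lemma \<xi>_local_factor:
  assumes "v $ k \<noteq> 0"
  shows "\<exists>r\<in>Ol v. \<xi> (k + 2) / \<xi> k - \<c> (v $ (k + 2) / v $ k) = upar v k * r \<and>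
     ev v r = - (tc (k + 1) * (v $ (k + 2) / v $ k) ^ q) / tc (k + 2)"
  unfolding upar_def
  by (rule local_factor[OF Ol_\<xi>[OF v assms] ev_\<xi>[OF v assms] Ol_\<xi>[OF v assms] ev_\<xi>[OF v assms] tc_nz \<xi>_curve_eq])

lemma upar_Ol: "v $ k \<noteq> 0 \<Longrightarrow> upar v k \<in> Ol v \<and> ev v (upar v k) = 0"
  unfolding upar_def
  by (simp add: Ol_diff[OF v] ev_diff[OF v] Ol_\<xi>[OF v] ev_\<xi>[OF v] Ol_const[OF v] ev_const[OF v])

text \<open>Taylor expansion to first order: modulo the parameter, a polynomial in the affine
  coordinates equals its value. Sums and products inherit this; for the third coordinate it is
  \<open>\<xi>_local_factor\<close>.\<close>

lemma poly3_eval_mod_upar: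
  assumes k: "v $ k \<noteq> 0"
  shows "poly3_eval \<c> (\<lambda>l. \<xi> l / \<xi> k) A \<in> Ol v \<and>
    (\<exists>h\<in>Ol v. poly3_eval \<c> (\<lambda>l. \<xi> l / \<xi> k) A - \<c> (poly3_eval (\<lambda>a. a) (\<lambda>l. v $ l / v $ k) A) = upar v k * h)"
proof -
  let ?f = "poly3_eval \<c> (\<lambda>l. \<xi> l / \<xi> k)" and ?g = "poly3_eval (\<lambda>a. a) (\<lambda>l. v $ l / v $ k)"
  note f = ring_morph_simps[OF ring_morph_poly3_eval[OF ring_morph_fls_const, of "\<lambda>l. \<xi> l / \<xi> k"]]
  note g = ring_morph_simps[OF ring_morph_poly3_eval[OF ring_morph_id, of "\<lambda>l. v $ l / v $ k"]]
  note c = ring_morph_simps[OF ring_morph_fls_const]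
  show ?thesis
  proof (induction A rule: poly3_induct)
    case (Const a)
    show ?case
      using Ol_const[OF v, of a] Ol_0[OF v] by (auto simp: ring_morph_fls_const ring_morph_id intro!: bexI[of _ 0])
  next
    case (Var l)
    have "\<exists>h\<in>Ol v. \<xi> l / \<xi> k - \<c> (v $ l / v $ k) = upar v k * h"
      using cyclic_3[of l k]
    proof (elim disjE)
      assume "l = k"
      then have "\<xi> l / \<xi> k - \<c> (v $ l / v $ k) = upar v k * 0"
        using k by simp
      with Ol_0[OF v] show ?thesis by blast
    next
      assume "l = k + 1"
      then have "\<xi> l / \<xi> k - \<c> (v $ l / v $ k) = upar v k * 1"
        by (simp add: upar_def)
      with Ol_1[OF v] show ?thesis by blast
    next
      assume "l = k + 2"
      with \<xi>_local_factor[OF k] show ?thesis by blast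
    qed
    with Ol_\<xi>[OF v k, of l] show ?case
      by (simp add: ring_morph_fls_const ring_morph_id)
  next
    case (add A B)
    then obtain h i where "h \<in> Ol v" "?f A - \<c> (?g A) = upar v k * h" "i \<in> Ol v" "?f B - \<c> (?g B) = upar v k * i"
      by blast
    then have "?f (A + B) - \<c> (?g (A + B)) = upar v k * (h + i)" "h + i \<in> Ol v"
      by (simp_all add: f g c Ol_add[OF v] distrib_left add_diff_add)
    with add Ol_add[OF v] show ?case
      by (auto simp: f)
  next
    case (mult A B)
    then obtain h i where hi: "h \<in> Ol v" "?f A - \<c> (?g A) = upar v k * h" "i \<in> Ol v" "?f B - \<c> (?g B) = upar v k * i"
      by blast
    have "?f (A * B) - \<c> (?g (A * B)) = ?f A * (?f B - \<c> (?g B)) + \<c> (?g B) * (?f A - \<c> (?g A))"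
      unfolding f(4) g(4) c(4) by (simp add: algebra_simps)
    also have "\<dots> = upar v k * (?f A * i + \<c> (?g B) * h)"
      unfolding hi(2,4) by (simp add: algebra_simps)
    finally have "?f (A * B) - \<c> (?g (A * B)) = upar v k * (?f A * i + \<c> (?g B) * h)" .
    moreover have "?f A * i + \<c> (?g B) * h \<in> Ol v"
      using mult hi by (intro Ol_add[OF v] Ol_mult[OF v] Ol_const[OF v]) auto
    moreover have "?f (A * B) \<in> Ol v"
      unfolding f(4) using mult by (intro Ol_mult[OF v]) auto
    ultimately show ?case by blast
  qed
qed

lemma eval_dehom:
  assumes "homogeneous d A"
  shows "eval_poly A v / v $ k ^ d = poly3_eval (\<lambda>a. a) (\<lambda>l. v $ l / v $ k) A"
  using poly3_eval_scale[OF assms, of "\<lambda>a. a" "inverse (v $ k)" "\<lambda>l. v $ l"]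
  by (simp add: eval_poly_eq divide_inverse mult.commute power_inverse)

lemma uni_upar:
  assumes k: "v $ k \<noteq> 0"
  shows "uni v (upar v k)"
  unfolding uni_def[OF v]
proof (intro conjI equalityI subsetI)
  show u: "upar v k \<in> Ol v"
    using upar_Ol[OF k] by blast
  fix z assume z: "z \<in> {z \<in> Ol v. ev v z = 0}"
  then have zO: "z \<in> Ol v" by blast
  obtain A B d where 1: "homogeneous d A" "homogeneous d B" "eval_poly B v \<noteq> 0" "\<phi> B \<noteq> 0"
    "z = \<phi> A / \<phi> B" "ev v z = eval_poly A v / eval_poly B v"
    using zO by (rule Ol_E[OF v])
  from 1 z have A0: "eval_poly A v = 0" by simp
  obtain h where h: "h \<in> Ol v" "\<phi> A / \<xi> k ^ d = upar v k * h"
    using poly3_eval_mod_upar[OF k, of A] unfolding \<phi>_dehom[OF 1(1), of k, symmetric] eval_dehom[OF 1(1), of k, symmetric] A0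
    by auto
  have kd: "homogeneous d (Var k ^ d)" "eval_poly (Var k ^ d) v \<noteq> 0" "\<phi> (Var k ^ d) = \<xi> k ^ d"
    using k by (simp_all add: eval_poly_simps \<phi>_simps)
  have "\<xi> k ^ d / \<phi> B \<in> Ol v"
    using Ol_I[OF v kd(1) 1(2,3)] unfolding kd(3) .
  moreover have "z = upar v k * (h * (\<xi> k ^ d / \<phi> B))"
  proof -
    have "\<phi> A = upar v k * h * \<xi> k ^ d"
      using h(2) by (simp add: divide_eq_eq)
    then show ?thesis
      unfolding 1(5) by simp
  qed
  ultimately show "z \<in> {upar v k * h |h. h \<in> Ol v}"
    using h(1) Ol_mult[OF v] by blast
next
  fix z assume "z \<in> {upar v k * h |h. h \<in> Ol v}"
  then obtain h where "h \<in> Ol v" "z = upar v k * h" by blast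
  then show "z \<in> {z \<in> Ol v. ev v z = 0}"
    using upar_Ol[OF k] by (simp add: Ol_mult[OF v] ev_mult[OF v])
qed

text \<open>Where X_(k+1) vanishes, the equation leaves only a constant times b, so the point is a
  vertex of the coordinate triangle. There \<open>b D = - tc k a^q\<close> with a unit D, that is, b
  has order q in the parameter a.\<close>

lemma fundamental_point:
  assumes k: "v $ k \<noteq> 0" and k1: "v $ (k + 1) = 0"
  shows "v $ (k + 2) = 0" "upar v k = \<xi> (k + 1) / \<xi> k"
    "\<exists>\<epsilon>\<in>units v. \<xi> (k + 2) / \<xi> k = upar v k ^ q * \<epsilon>"
proof -
  let ?a = "\<xi> (k + 1) / \<xi> k" and ?b = "\<xi> (k + 2) / \<xi> k"
  have a: "?a \<in> Ol v" "ev v ?a = 0" and b: "?b \<in> Ol v" "ev v ?b = v $ (k + 2) / v $ k"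
    using k k1 by (simp_all add: Ol_\<xi>[OF v] ev_\<xi>[OF v])
  note O = Ol_add[OF v] Ol_mult[OF v] Ol_const[OF v] Ol_power[OF v]
  note E = ev_add[OF v] ev_mult[OF v] ev_const[OF v] ev_power[OF v] O
  have "ev v (\<c> (tc (k + 1)) * ?a * ?b ^ q + \<c> (tc (k + 2)) * ?b + \<c> (tc k) * ?a ^ q)
      = tc (k + 1) * 0 * ev v ?b ^ q + tc (k + 2) * ev v ?b + tc k * 0 ^ q"
    using a b by (simp only: E)
  then have "ev v ?b = 0"
    using q2 unfolding \<xi>_curve_eq by (simp add: ev_0[OF v] power_0_left)
  then show v2: "v $ (k + 2) = 0"
    using b(2) k by simp
  show u: "upar v k = ?a"
    using k1 by (simp add: upar_def)
  define D where "D = \<c> (tc (k + 2)) + \<c> (tc (k + 1)) * ?a * ?b ^ (q - 1)"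
  have D: "D \<in> Ol v" "ev v D = tc (k + 2)"
  proof -
    show "D \<in> Ol v"
      unfolding D_def using a b by (simp only: O)
    have "ev v D = tc (k + 2) + tc (k + 1) * 0 * ev v ?b ^ (q - 1)"
      unfolding D_def using a b by (simp only: E)
    then show "ev v D = tc (k + 2)" by simp
  qed
  then have "D \<in> units v"
    by (simp add: units_def[OF v])
  then have i: "inverse D \<in> units v" and "D \<noteq> 0"
    using units_inverse[OF v] units_nz[OF v] by blast+
  have q: "z * z ^ (q - 1) = z ^ q" for z :: "'a fls"
    using q2 by (cases q) simp_all
  have "?b * D = \<c> (tc (k + 1)) * ?a * (?b * ?b ^ (q - 1)) + \<c> (tc (k + 2)) * ?b"
    unfolding D_def by (simp add: algebra_simps)
  also have "\<dots> = (\<c> (tc (k + 1)) * ?a * ?b ^ q + \<c> (tc (k + 2)) * ?b + \<c> (tc k) * ?a ^ q) - \<c> (tc k) * ?a ^ q"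
    unfolding q by simp
  also have "\<dots> = ?a ^ q * \<c> (- tc k)"
    unfolding \<xi>_curve_eq by (simp add: ring_morph_simps[OF ring_morph_fls_const])
  finally have "?b = ?a ^ q * (\<c> (- tc k) * inverse D)"
    using \<open>D \<noteq> 0\<close> by (simp add: field_simps)
  moreover have "\<c> (- tc k) * inverse D \<in> units v"
  proof (rule units_mult[OF v _ i])
    show "\<c> (- tc k) \<in> units v"
      unfolding units_def[OF v] using Ol_const[OF v, of "- tc k"] ev_const[OF v, of "- tc k"] by simp
  qed
  ultimately show "\<exists>\<epsilon>\<in>units v. ?b = upar v k ^ q * \<epsilon>"
    unfolding u by blast
qed

text \<open>A factor u is split off g as long as g vanishes at v, which lowers n. This yields the
  order of a form from that of a multiple which is known explicitly.\<close>

lemma dvr_factor: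
  assumes u: "uni v u" "u \<noteq> 0"
  shows "g \<in> Ol v \<Longrightarrow> g' \<in> Ol v \<Longrightarrow> w \<in> units v \<Longrightarrow> g * g' = w * u ^ n \<Longrightarrow>
    \<exists>j. \<exists>w'\<in>units v. g = w' * u ^ j"
proof (induction n arbitrary: g)
  case 0
  then have "ev v g * ev v g' = ev v w"
    using ev_mult[OF v, of g g'] by simp
  then have "g \<in> units v"
    using 0 by (auto simp: units_def[OF v])
  then show ?case
    by (intro exI[of _ 0] bexI[of _ g]) simp_all
next
  case (Suc n)
  show ?case
  proof (cases "ev v g = 0")
    case True
    then obtain g1 where g1: "g1 \<in> Ol v" "g = u * g1"
      using Suc.prems(1) u(1) by (auto simp: uni_def[OF v])
    have "u * (g1 * g') = u * (w * u ^ n)"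
      using Suc.prems(4) by (simp add: g1(2) mult_ac)
    then have "g1 * g' = w * u ^ n"
      using u(2) by simp
    from Suc.IH[OF g1(1) Suc.prems(2,3) this] obtain j w' where "w' \<in> units v" "g1 = w' * u ^ j"
      by blast
    then show ?thesis
      by (intro exI[of _ "Suc j"] bexI[of _ w']) (simp_all add: g1(2) mult_ac)
  next
    case False
    then have "g \<in> units v"
      using Suc.prems by (simp add: units_def[OF v])
    then show ?thesis
      by (intro exI[of _ 0] bexI[of _ g]) simp_all
  qed
qed

end

end

section \<open>Functions with poles only at the point (1 : 0 : 0)\<close>

text \<open>Gaussian elimination: an unknown \<open>j0\<close> with nonzero coefficient in the
  equation \<open>i0\<close> is eliminated from the remaining equations.\<close>

lemma underdetermined_system:
  fixes M :: "'j \<Rightarrow> 'i \<Rightarrow> 'a::field"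
  assumes "finite I" "finite J" "card I < card J"
  shows "\<exists>x. (\<exists>j\<in>J. x j \<noteq> 0) \<and> (\<forall>i\<in>I. (\<Sum>j\<in>J. x j * M j i) = 0)"
  using assms
proof (induction I arbitrary: J M rule: finite_induct)
  case empty
  then obtain j where "j \<in> J"
    by fastforce
  then show ?case
    by (intro exI[of _ "\<lambda>_. 1"]) auto
next
  case (insert i0 I)
  show ?case
  proof (cases "\<forall>j\<in>J. M j i0 = 0")
    case True
    from insert.IH[of J M] insert.prems insert.hyps obtain x
      where "\<exists>j\<in>J. x j \<noteq> 0" "\<forall>i\<in>I. (\<Sum>j\<in>J. x j * M j i) = 0"
      by auto
    with True show ?thesis
      by (intro exI[of _ x]) auto
  next
    case False
    then obtain j0 where j0: "j0 \<in> J" "M j0 i0 \<noteq> 0" by blast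
    let ?J = "J - {j0}" and ?N = "\<lambda>j i. M j i - M j i0 / M j0 i0 * M j0 i"
    have "card I < card ?J"
      using insert.prems insert.hyps j0 by simp
    from insert.IH[OF _ this, of ?N] insert.prems obtain x
      where x: "\<exists>j\<in>?J. x j \<noteq> 0" "\<forall>i\<in>I. (\<Sum>j\<in>?J. x j * ?N j i) = 0"
      by auto
    \<comment> \<open>The equation \<open>i0\<close> forces the value - s of the pivot
      unknown.\<close>
    define s where "s = (\<Sum>j\<in>?J. x j * (M j i0 / M j0 i0))"
    let ?x = "\<lambda>j. if j = j0 then - s else x j"
    have split: "(\<Sum>j\<in>J. ?x j * M j i) = - s * M j0 i + (\<Sum>j\<in>?J. x j * M j i)" for i
    proof -
      have "(\<Sum>j\<in>J. ?x j * M j i) = ?x j0 * M j0 i + (\<Sum>j\<in>?J. ?x j * M j i)"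
        using insert.prems(1) j0(1) by (rule sum.remove)
      also have "(\<Sum>j\<in>?J. ?x j * M j i) = (\<Sum>j\<in>?J. x j * M j i)"
        by (rule sum.cong) auto
      finally show ?thesis by simp
    qed
    have "(\<Sum>j\<in>J. ?x j * M j i) = 0" if "i \<in> insert i0 I" for i
    proof (cases "i = i0")
      case True
      have "s * M j0 i0 = (\<Sum>j\<in>?J. x j * M j i0)"
        using j0(2) by (simp add: s_def sum_distrib_right)
      then show ?thesis
        unfolding split True by simp
    next
      case False
      with that x(2) have "(\<Sum>j\<in>?J. x j * ?N j i) = 0" by blast
      moreover have "(\<Sum>j\<in>?J. x j * ?N j i) = (\<Sum>j\<in>?J. x j * M j i) - s * M j0 i"
      proof -
        have "x j * ?N j i = x j * M j i - x j * (M j i0 / M j0 i0) * M j0 i" for j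
          by (simp add: algebra_simps)
        then show ?thesis
          by (simp only: s_def sum_distrib_right sum_subtractf)
      qed
      ultimately show ?thesis
        unfolding split by simp
    qed
    moreover have "\<exists>j\<in>J. ?x j \<noteq> 0"
      using x(1) by auto
    ultimately show ?thesis
      by (intro exI[of _ ?x]) blast
  qed
qed

context hermitian_curve
begin

lemmas c_simps = ring_morph_simps[OF ring_morph_fls_const]

definition xf :: "'a fls" where "xf = \<xi> 2 / \<xi> 3"
definition yf :: "'a fls" where "yf = \<xi> 1 / \<xi> 3"

lemma xf_nz [simp]: "xf \<noteq> 0" and yf_nz [simp]: "yf \<noteq> 0"
  by (simp_all add: xf_def yf_def)

lemma xy_eq: "\<c> \<tau> * yf * xf ^ q + \<c> t2 * xf + yf ^ q = 0"
  using \<xi>_curve_eq[of 3] by (simp add: xf_def yf_def tc_simps numeral_mod_3)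

definition mon :: "nat \<times> nat \<Rightarrow> 'a fls" where
  "mon i = xf ^ fst i * yf ^ snd i"

text \<open>The pole order of the monomial at (1 : 0 : 0), where x and y have poles of orders q - 1
  and q.\<close>

definition wt :: "nat \<times> nat \<Rightarrow> nat" where
  "wt i = (q - 1) * fst i + q * snd i"

lemma mon_nz [simp]: "mon i \<noteq> 0"
  by (simp add: mon_def)

lemma mon_add: "mon i * mon j = mon (fst i + fst j, snd i + snd j)"
  by (simp add: mon_def power_add mult_ac)

lemma subdegree_mon: "fls_subdegree (mon i) = - int (wt i)"
proof -
  have "fls_subdegree xf = 1 - int q" "fls_subdegree yf = - int q"
    by (simp_all add: xf_def yf_def fls_divide_subdegree \<xi>_subdegree)
  moreover have "int (q - 1) = int q - 1"
    using q2 by simp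
  ultimately show ?thesis
    unfolding mon_def wt_def
    by (simp add: fls_subdegree_mult fls_subdegree_pow) (simp add: algebra_simps)
qed

definition Sp :: "(nat \<times> nat) set \<Rightarrow> 'a fls set" where
  "Sp J = {\<Sum>i\<in>J. \<c> (f i) * mon i | f. True}"

lemma SpI: "(\<Sum>i\<in>J. \<c> (f i) * mon i) \<in> Sp J"
  by (auto simp: Sp_def)

lemma SpE:
  assumes "z \<in> Sp J"
  obtains f where "z = (\<Sum>i\<in>J. \<c> (f i) * mon i)"
  using assms by (auto simp: Sp_def)

lemma Sp_0: "0 \<in> Sp J"
  using SpI[where J = J and f = "\<lambda>_. 0"] by simp

lemma Sp_add:
  assumes "z \<in> Sp J" "w \<in> Sp J"
  shows "z + w \<in> Sp J"
proof -
  obtain f where f: "z = (\<Sum>i\<in>J. \<c> (f i) * mon i)" using assms(1) by (rule SpE)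
  obtain g where g: "w = (\<Sum>i\<in>J. \<c> (g i) * mon i)" using assms(2) by (rule SpE)
  have "z + w = (\<Sum>i\<in>J. \<c> (f i + g i) * mon i)"
    unfolding f g sum.distrib[symmetric] c_simps distrib_right ..
  then show ?thesis by (simp only: SpI)
qed

lemma Sp_cmult:
  assumes "z \<in> Sp J"
  shows "\<c> a * z \<in> Sp J"
proof -
  obtain f where f: "z = (\<Sum>i\<in>J. \<c> (f i) * mon i)" using assms(1) by (rule SpE)
  have "\<c> a * z = (\<Sum>i\<in>J. \<c> (a * f i) * mon i)"
    unfolding f sum_distrib_left c_simps mult.assoc ..
  then show ?thesis by (simp only: SpI)
qed

lemma Sp_sum: "(\<And>i. i \<in> I \<Longrightarrow> g i \<in> Sp J) \<Longrightarrow> (\<Sum>i\<in>I. g i) \<in> Sp J"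
  by (induction I rule: infinite_finite_induct) (auto simp: Sp_0 Sp_add)

lemma Sp_mon:
  assumes "finite J" "i \<in> J"
  shows "mon i \<in> Sp J"
proof -
  have "(\<Sum>j\<in>J. \<c> (if j = i then 1 else 0) * mon j) = (\<Sum>j\<in>J. if j = i then mon j else 0)"
    by (rule sum.cong) auto
  also have "\<dots> = mon i"
    using assms by (simp add: sum.delta)
  finally show ?thesis
    using SpI[where J = J and f = "\<lambda>j. if j = i then 1 else 0"] by (simp only:)
qed

lemma Sp_subset:
  assumes "z \<in> Sp I" "\<And>i. i \<in> I \<Longrightarrow> mon i \<in> Sp J"
  shows "z \<in> Sp J"
proof -
  obtain f where f: "z = (\<Sum>i\<in>I. \<c> (f i) * mon i)" using assms(1) by (rule SpE)
  show ?thesis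
    unfolding f using assms(2) by (intro Sp_sum Sp_cmult)
qed

text \<open>The first condition is regularity at (0 : 1 : 0), where x has a simple pole and y a zero
  of order q - 1; the second limits the pole at (1 : 0 : 0). Both conditions are compatible with
  addition of exponents, which makes products easy; distinctness of weights needs the smaller sets
  \<open>Bi\<close>.\<close>

definition Ai :: "nat \<Rightarrow> (nat \<times> nat) set" where
  "Ai m = {i. fst i \<le> (q - 1) * snd i \<and> wt i \<le> m}"

definition Bi :: "nat \<Rightarrow> (nat \<times> nat) set" where
  "Bi m = {i \<in> Ai m. fst i < q}"

lemma finite_Ai [simp]: "finite (Ai m)"
proof (rule finite_subset)
  show "Ai m \<subseteq> {0..m} \<times> {0..m}"
  proof
    fix i assume "i \<in> Ai m"
    then have "(q - 1) * fst i + q * snd i \<le> m"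
      by (simp add: Ai_def wt_def)
    moreover have "1 * fst i \<le> (q - 1) * fst i" "1 * snd i \<le> q * snd i"
      using q2 by (intro mult_right_mono; simp)+
    ultimately have "fst i \<le> m" "snd i \<le> m"
      by linarith+
    then show "i \<in> {0..m} \<times> {0..m}"
      by (cases i) simp
  qed
qed simp

lemma finite_Bi [simp]: "finite (Bi m)"
  by (rule finite_subset[OF _ finite_Ai[of m]]) (auto simp: Bi_def)

definition T :: "nat \<Rightarrow> 'a fls set" where
  "T m = Sp (Ai m)"

lemma T_mult:
  assumes "z \<in> T m" "w \<in> T n"
  shows "z * w \<in> T (m + n)"
proof -
  obtain f where f: "z = (\<Sum>i\<in>Ai m. \<c> (f i) * mon i)" using assms(1) unfolding T_def by (rule SpE)
  obtain g where g: "w = (\<Sum>i\<in>Ai n. \<c> (g i) * mon i)" using assms(2) unfolding T_def by (rule SpE)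
  have "z * w = (\<Sum>i\<in>Ai m. \<Sum>j\<in>Ai n. \<c> (f i * g j) * (mon i * mon j))"
    unfolding f g sum_product c_simps by (simp only: mult_ac)
  also have "\<dots> \<in> Sp (Ai (m + n))"
  proof (intro Sp_sum Sp_cmult)
    fix i j assume "i \<in> Ai m" "j \<in> Ai n"
    then have "(fst i + fst j, snd i + snd j) \<in> Ai (m + n)"
      by (auto simp: Ai_def wt_def distrib_left)
    then show "mon i * mon j \<in> Sp (Ai (m + n))"
      unfolding mon_add by (intro Sp_mon finite_Ai)
  qed
  finally show ?thesis by (simp only: T_def)
qed

text \<open>The relation \<open>\<tau> y x\<^sup>q = - t2 x - y\<^sup>q\<close> lowers the exponent of \<open>x\<close> without increasing the weight.\<close>

lemma mon_reduce: "(a, b) \<in> Ai m \<Longrightarrow> mon (a, b) \<in> Sp (Bi m)"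
proof (induction a arbitrary: b rule: less_induct)
  case (less a)
  show ?case
  proof (cases "a < q")
    case True
    with less.prems show ?thesis
      by (intro Sp_mon finite_Bi) (simp add: Bi_def)
  next
    case False
    from less.prems have 1: "a \<le> (q - 1) * b" and 2: "(q - 1) * a + q * b \<le> m"
      by (simp_all add: Ai_def wt_def)
    from False 1 q2 have "b \<noteq> 0" by (cases b) auto
    then obtain b' where b: "b = Suc b'" by (cases b) auto
    obtain a' where a: "a = q + a'" using False by (metis le_add_diff_inverse not_less)
    define r where "r = q - 1"
    have r: "q = r + 1" using q2 by (simp add: r_def)
    have 1: "q + a' \<le> r * b' + r" and 2: "r * q + r * a' + (q * b' + q) \<le> m"
      using 1 2 unfolding a b r_def[symmetric] by (simp_all add: distrib_left)
    have 1: "a' + 1 \<le> r * b'"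
      using 1 unfolding r by simp
    have qq: "q * q = r * q + q" "r * 1 \<le> r * q"
      using q2 by (simp_all add: r)
    have A1: "(a' + 1, b') \<in> Ai m"
    proof -
      have "a' + 1 \<le> r * b' \<and> r * a' + r * 1 + q * b' \<le> m"
        using 1 2 qq(2) by linarith
      then show ?thesis
        unfolding Ai_def wt_def r_def[symmetric] by (simp add: distrib_left)
    qed
    have A2: "(a', b' + q) \<in> Ai m"
      using 1 2 qq unfolding Ai_def wt_def r_def[symmetric] by (simp add: distrib_left)
    have "mon (a' + 1, b') \<in> Sp (Bi m)" "mon (a', b' + q) \<in> Sp (Bi m)"
      using less.IH[OF _ A1] less.IH[OF _ A2] a q2 by simp_all
    then have S: "\<c> (- t2 / \<tau>) * mon (a' + 1, b') + \<c> (- 1 / \<tau>) * mon (a', b' + q) \<in> Sp (Bi m)"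
      by (intro Sp_add Sp_cmult)
    have k: "\<c> (1 / \<tau>) * \<c> \<tau> = 1"
      unfolding c_simps(4)[symmetric] by simp
    have "mon (a, b) = xf ^ a' * yf ^ b' * (yf * xf ^ q)"
      unfolding mon_def a b by (simp add: power_add mult_ac)
    also have "yf * xf ^ q = \<c> (1 / \<tau>) * (\<c> \<tau> * yf * xf ^ q)"
      using k by (simp only: mult.assoc[symmetric] mult_1_left)
    also have "\<c> \<tau> * yf * xf ^ q = - (\<c> t2 * xf + yf ^ q)"
      using xy_eq unfolding add.assoc by (rule eq_neg_iff_add_eq_0[THEN iffD2])
    also have "xf ^ a' * yf ^ b' * (\<c> (1 / \<tau>) * - (\<c> t2 * xf + yf ^ q))
        = - (\<c> (1 / \<tau>) * \<c> t2) * (xf ^ a' * xf * yf ^ b') + - \<c> (1 / \<tau>) * (xf ^ a' * (yf ^ b' * yf ^ q))"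
    proof -
      have "s * v * (k * - (l * w + t)) = - (k * l) * (s * w * v) + - k * (s * (v * t))" for s v k l w t :: "'a fls"
        by (simp add: algebra_simps)
      then show ?thesis .
    qed
    also have "\<dots> = \<c> (- t2 / \<tau>) * mon (a' + 1, b') + \<c> (- 1 / \<tau>) * mon (a', b' + q)"
      unfolding c_simps(4)[symmetric] c_simps(5)[symmetric] mon_def by (simp add: power_add mult_ac)
    finally show ?thesis
      using S by (simp only:)
  qed
qed

lemma T_eq: "T m = Sp (Bi m)"
proof (intro equalityI subsetI)
  fix z assume "z \<in> T m"
  then show "z \<in> Sp (Bi m)"
    unfolding T_def by (rule Sp_subset) (use mon_reduce in \<open>metis prod.collapse\<close>)
next
  fix z assume "z \<in> Sp (Bi m)"
  then show "z \<in> T m"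
    unfolding T_def by (rule Sp_subset) (auto simp: Bi_def intro: Sp_mon)
qed

text \<open>The weight is q (a + b) - a, which determines a modulo q.\<close>

lemma wt_inj:
  assumes "fst i < q" "fst j < q" "wt i = wt j"
  shows "i = j"
proof -
  have r: "q * k = (q - 1) * k + k" for k
    using q2 by (cases q) auto
  have eq: "q * (fst i + snd i) + fst j = q * (fst j + snd j) + fst i"
    using assms(3) r[of "fst i"] r[of "fst j"] unfolding wt_def distrib_left by linarith
  then have "(q * (fst i + snd i) + fst j) mod q = (q * (fst j + snd j) + fst i) mod q"
    by simp
  then have "fst j = fst i"
    using assms by simp
  with eq q2 show ?thesis
    by (auto intro: prod_eqI)
qed

lemma inj_wt_Bi: "inj_on (\<lambda>i. fls_subdegree (mon i)) (Bi m)"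
  using wt_inj by (intro inj_onI) (auto simp: Bi_def subdegree_mon)

lemma Bi_independent: "(\<Sum>i\<in>Bi m. \<c> (f i) * mon i) = 0 \<Longrightarrow> i \<in> Bi m \<Longrightarrow> f i = 0"
  by (rule fls_sum_eq_0[OF finite_Bi inj_wt_Bi]) auto

text \<open>By distinctness, each of the m new weights belongs to at most one monomial.\<close>

lemma card_Bi_diff: "card (Bi (k + m)) \<le> card (Bi k) + m"
proof -
  have "Bi (k + m) \<subseteq> Bi k \<union> (Bi (k + m) - Bi k)" by blast
  then have "card (Bi (k + m)) \<le> card (Bi k \<union> (Bi (k + m) - Bi k))"
    by (intro card_mono) auto
  also have "\<dots> \<le> card (Bi k) + card (Bi (k + m) - Bi k)"
    by (rule card_Un_le)
  also have "card (Bi (k + m) - Bi k) \<le> card {k<..k + m}"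
  proof (rule card_inj_on_le[of wt])
    show "inj_on wt (Bi (k + m) - Bi k)"
      using wt_inj by (intro inj_onI) (auto simp: Bi_def)
    show "wt ` (Bi (k + m) - Bi k) \<subseteq> {k<..k + m}"
      by (auto simp: Bi_def Ai_def)
  qed simp
  finally show ?thesis by simp
qed

section \<open>Polynomials in y and norms\<close>

definition py :: "'a poly \<Rightarrow> 'a fls" where
  "py P = poly (map_poly \<c> P) yf"

lemma py_0 [simp]: "py 0 = 0"
  by (simp add: py_def)

lemma py_pCons: "py (pCons a P) = \<c> a + yf * py P"
  by (cases "a = 0 \<and> P = 0") (auto simp: py_def map_poly_pCons)

lemma py_add: "py (P + Q) = py P + py Q"
  by (induction P Q rule: poly_induct2) (simp_all add: py_pCons c_simps(3) algebra_simps)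

lemma py_smult: "py (Polynomial.smult a P) = \<c> a * py P"
proof (induction P)
  case (pCons b P)
  show ?case
    unfolding smult_pCons py_pCons pCons.IH c_simps(4) by (simp only: distrib_left mult_ac)
qed simp

lemma py_mult: "py (P * Q) = py P * py Q"
proof (induction P)
  case (pCons b P)
  have "py (pCons b P * Q) = \<c> b * py Q + (\<c> 0 + yf * (py P * py Q))"
    unfolding mult_pCons_left py_add py_smult py_pCons pCons.IH ..
  also have "\<dots> = py (pCons b P) * py Q"
    unfolding py_pCons by (simp only: fls_const_0 add_0_left distrib_right mult.assoc)
  finally show ?case .
qed simp

lemma ring_morph_py: "ring_morph py"
proof (rule ring_morphI)
  show "py 1 = 1"
    using py_pCons[of 1 0] by (simp add: one_pCons)
qed (simp_all add: py_add py_mult)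

lemma py_const: "py [:a:] = \<c> a" and py_linear: "py [:- a, 1:] = yf - \<c> a"
  by (simp_all add: py_pCons c_simps(5))

lemma py_monom: "py (monom a k) = \<c> a * yf ^ k"
  by (induction k) (simp_all add: monom_0 monom_Suc py_pCons mult_ac)

lemma py_sum: "py (\<Sum>i\<in>I. f i) = (\<Sum>i\<in>I. py (f i))"
  by (rule ring_morph_sum[OF ring_morph_py])

text \<open>Counting dimensions, \<open>h T(qm - m)\<close> meets the polynomials in \<open>y\<close> of degree at most \<open>m\<close>
  inside \<open>T(qm)\<close>, because \<open>T(qm)\<close> has at most \<open>m\<close> dimensions more than \<open>T(qm - m)\<close>.\<close>

lemma norm_exists:
  assumes h: "h \<in> T m" "h \<noteq> 0"
  shows "\<exists>g P. g \<in> T (q * m - m) \<and> P \<noteq> 0 \<and> degree P \<le> m \<and> h * g = py P"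
proof -
  let ?k = "q * m - m"
  have km: "?k + m = q * m"
    using q2 by (cases q) auto
  \<comment> \<open>The unknowns are the coefficients of g on the left and of P on the right, where
    P enters with the sign - 1; the equations are the coefficients of \<open>h g - P\<close> on
    \<open>Bi (q * m)\<close>.\<close>
  let ?J = "Inl ` Bi ?k \<union> Inr ` {..m} :: ((nat \<times> nat) + nat) set"
  let ?e = "\<lambda>j. case j of Inl i \<Rightarrow> h * mon i | Inr l \<Rightarrow> \<c> (- 1) * mon (0, l)"
  have e: "?e j \<in> Sp (Bi (q * m))" if "j \<in> ?J" for j
  proof (cases j)
    case (Inl i)
    then have "i \<in> Ai ?k"
      using that by (auto simp: Bi_def)
    then have "mon i \<in> T ?k"
      unfolding T_def by (intro Sp_mon finite_Ai)
    from T_mult[OF h(1) this] show ?thesis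
      using km by (simp add: Inl T_eq add.commute)
  next
    case (Inr l)
    with that have "l \<le> m" by auto
    then have "(0, l) \<in> Bi (q * m)"
      using q2 by (simp add: Bi_def Ai_def wt_def)
    with Inr show ?thesis
      by (simp only: sum.case) (intro Sp_cmult Sp_mon finite_Bi)
  qed
  then have "\<exists>M. \<forall>j\<in>?J. ?e j = (\<Sum>i\<in>Bi (q * m). \<c> (M j i) * mon i)"
    unfolding Sp_def by (intro bchoice) blast
  then obtain M where M: "\<And>j. j \<in> ?J \<Longrightarrow> ?e j = (\<Sum>i\<in>Bi (q * m). \<c> (M j i) * mon i)"
    by blast
  have cJ: "card ?J = card (Bi ?k) + Suc m"
    by (subst card_Un_disjoint) (auto simp: card_image)
  have "card (Bi (q * m)) < card ?J"
    using card_Bi_diff[of ?k m] unfolding km cJ by simp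
  from underdetermined_system[OF finite_Bi _ this, of M]
  obtain x where x: "\<exists>j\<in>?J. x j \<noteq> 0" "\<forall>i\<in>Bi (q * m). (\<Sum>j\<in>?J. x j * M j i) = 0"
    by auto
  have "(\<Sum>j\<in>?J. \<c> (x j) * ?e j) = (\<Sum>j\<in>?J. \<Sum>i\<in>Bi (q * m). \<c> (x j * M j i) * mon i)"
  proof (rule sum.cong[OF refl])
    fix j assume "j \<in> ?J"
    from M[OF this] show "\<c> (x j) * ?e j = (\<Sum>i\<in>Bi (q * m). \<c> (x j * M j i) * mon i)"
      by (simp only: sum_distrib_left c_simps mult.assoc)
  qed
  also have "\<dots> = (\<Sum>i\<in>Bi (q * m). \<c> (\<Sum>j\<in>?J. x j * M j i) * mon i)"
    by (subst sum.swap) (simp only: ring_morph_sum[OF ring_morph_fls_const] sum_distrib_right)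
  also have "\<dots> = 0"
    using x(2) by (intro sum.neutral) auto
  finally have 0: "(\<Sum>j\<in>?J. \<c> (x j) * ?e j) = 0" .
  define g where "g = (\<Sum>i\<in>Bi ?k. \<c> (x (Inl i)) * mon i)"
  define P where "P = (\<Sum>l\<le>m. monom (x (Inr l)) l)"
  have py: "py P = (\<Sum>l\<le>m. \<c> (x (Inr l)) * yf ^ l)"
    by (simp add: P_def py_sum py_monom)
  have "(\<Sum>j\<in>?J. \<c> (x j) * ?e j) = (\<Sum>i\<in>Bi ?k. \<c> (x (Inl i)) * (h * mon i)) + (\<Sum>l\<le>m. \<c> (x (Inr l)) * (\<c> (- 1) * mon (0, l)))"
    by (subst sum.union_disjoint) (auto simp: sum.reindex)
  also have "(\<Sum>i\<in>Bi ?k. \<c> (x (Inl i)) * (h * mon i)) = h * g"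
    unfolding g_def sum_distrib_left by (simp only: mult_ac)
  also have "(\<Sum>l\<le>m. \<c> (x (Inr l)) * (\<c> (- 1) * mon (0, l))) = - py P"
    unfolding py sum_negf[symmetric] by (rule sum.cong) (simp_all add: mon_def)
  finally have hg: "h * g = py P"
    using 0 by simp
  have coeffP: "coeff P l = x (Inr l)" if "l \<le> m" for l
    using that by (simp add: P_def coeff_sum)
  \<comment> \<open>With P = 0 also g = 0, as h is nonzero, and independence of the monomials makes
    the whole solution trivial.\<close>
  have "P \<noteq> 0"
  proof
    assume P0: "P = 0"
    with hg h(2) have "g = 0" by simp
    then have "x (Inl i) = 0" if "i \<in> Bi ?k" for i
      using Bi_independent[where m = ?k and f = "\<lambda>i. x (Inl i)"] that by (simp add: g_def)
    moreover have "x (Inr l) = 0" if "l \<le> m" for l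
      using coeffP[OF that] P0 by simp
    ultimately show False
      using x(1) by auto
  qed
  moreover have "degree P \<le> m"
    unfolding P_def by (intro degree_sum_le) (auto intro: order_trans[OF degree_monom_le])
  moreover have "g \<in> T ?k"
    unfolding T_eq g_def by (rule SpI)
  ultimately show ?thesis
    using hg by blast
qed

end

section \<open>Valuations and divisors\<close>

context hermitian_curve
begin

lemma xf_\<xi>: "xf * \<xi> 3 = \<xi> 2" and yf_\<xi>: "yf * \<xi> 3 = \<xi> 1"
  by (simp_all add: xf_def yf_def)

lemma Ai_bound: "i \<in> Ai m \<Longrightarrow> fst i + snd i \<le> 2 * m"
proof -
  assume "i \<in> Ai m"
  then have "(q - 1) * fst i + q * snd i \<le> m"
    by (simp add: Ai_def wt_def)
  moreover have "1 * fst i \<le> (q - 1) * fst i" "1 * snd i \<le> q * snd i"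
    using q2 by (intro mult_right_mono; simp)+
  ultimately show ?thesis by linarith
qed

lemma T_form:
  assumes "z \<in> T m"
  shows "\<exists>A. homogeneous (2 * m) A \<and> z * \<xi> 3 ^ (2 * m) = \<phi> A"
proof -
  obtain f where f: "z = (\<Sum>i\<in>Ai m. \<c> (f i) * mon i)" using assms unfolding T_def by (rule SpE)
  define M where "M i = (Var 2 ^ fst i * (Var 1 ^ snd i * Var 3 ^ (2 * m - (fst i + snd i))) :: 'a poly3)" for i
  let ?A = "\<Sum>i\<in>Ai m. Const (f i) * M i"
  have m: "mon i * \<xi> 3 ^ (2 * m) = \<phi> (M i) \<and> homogeneous (2 * m) (M i)" if "i \<in> Ai m" for i
    unfolding M_def
  proof
    let ?m = "\<lambda>i. Var 2 ^ fst i * (Var 1 ^ snd i * Var 3 ^ (2 * m - (fst i + snd i))) :: 'a poly3"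
    let ?r = "2 * m - (fst i + snd i)"
    have e: "2 * m = fst i + (snd i + ?r)"
      using Ai_bound[OF that] by simp
    have "mon i * \<xi> 3 ^ (fst i + (snd i + ?r)) = (xf * \<xi> 3) ^ fst i * ((yf * \<xi> 3) ^ snd i * \<xi> 3 ^ ?r)"
      unfolding mon_def power_mult_distrib power_add by (simp only: mult_ac)
    then show "mon i * \<xi> 3 ^ (2 * m) = \<phi> (?m i)"
      unfolding e[symmetric] xf_\<xi> yf_\<xi> by (simp only: \<phi>_simps \<phi>_Var)
    have "homogeneous (fst i + (snd i + ?r)) (?m i)"
      by (intro homogeneous_mult homogeneous_Var_power)
    then show "homogeneous (2 * m) (?m i)"
      unfolding e[symmetric] .
  qed
  have "homogeneous (2 * m) ?A"
    using m by (intro homogeneous_sum homogeneous_cmult) blast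
  moreover have "z * \<xi> 3 ^ (2 * m) = \<phi> ?A"
    unfolding f sum_distrib_right ring_morph_sum[OF ring_morph_\<phi>] \<phi>_simps(4) \<phi>_Const
    by (rule sum.cong) (simp_all only: mult.assoc m)
  ultimately show ?thesis by blast
qed

text \<open>The factor \<open>yf ^ d\<close> compensates the poles at (0 : 1 : 0): x occurs with
  exponent at most d and y with exponent at least d. The weight 3 q d is a crude bound.\<close>

lemma form_T:
  assumes "homogeneous d A"
  shows "\<phi> A / \<xi> 3 ^ d * yf ^ d \<in> T (3 * q * d)"
proof -
  have "\<phi> A / \<xi> 3 ^ d * yf ^ d = (\<Sum>k\<in>Poly_Mapping.keys A. \<c> (Poly_Mapping.lookup A k) *
      mon (Poly_Mapping.lookup k 2, Poly_Mapping.lookup k 1 + d))"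
    unfolding \<phi>_dehom[OF assms] poly3_eval_def prod_3 sum_distrib_right mon_def
    by (rule sum.cong) (simp_all add: xf_def[symmetric] yf_def[symmetric] power_add mult_ac)
  also have "\<dots> \<in> Sp (Ai (3 * q * d))"
  proof (intro Sp_sum Sp_cmult Sp_mon finite_Ai)
    fix k assume "k \<in> Poly_Mapping.keys A"
    then have "Poly_Mapping.lookup k 1 + Poly_Mapping.lookup k 2 + Poly_Mapping.lookup k 3 = d"
      using assms by (auto simp: homogeneous_def sum_3)
    then have k: "Poly_Mapping.lookup k 2 \<le> d" "Poly_Mapping.lookup k 1 + d \<le> 2 * d"
      by simp_all
    have "Poly_Mapping.lookup k 2 \<le> 1 * (Poly_Mapping.lookup k 1 + d)"
      using k by simp
    also have "\<dots> \<le> (q - 1) * (Poly_Mapping.lookup k 1 + d)"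
      using q2 by (intro mult_right_mono) simp_all
    finally have 1: "Poly_Mapping.lookup k 2 \<le> (q - 1) * (Poly_Mapping.lookup k 1 + d)" .
    have "(q - 1) * Poly_Mapping.lookup k 2 + q * (Poly_Mapping.lookup k 1 + d) \<le> q * d + q * (2 * d)"
      using k by (intro add_mono mult_mono) simp_all
    also have "\<dots> = 3 * q * d"
      by simp
    finally have 2: "(q - 1) * Poly_Mapping.lookup k 2 + q * (Poly_Mapping.lookup k 1 + d) \<le> 3 * q * d" .
    with 1 show "(Poly_Mapping.lookup k 2, Poly_Mapping.lookup k 1 + d) \<in> Ai (3 * q * d)"
      unfolding Ai_def wt_def by (simp only: mem_Collect_eq fst_conv snd_conv simp_thms)
  qed
  finally show ?thesis
    by (simp only: T_def)
qed

text \<open>Products of n lines through (0 : 1 : 0), restricted to the branch. The norm of a form is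
  a polynomial in y, which splits into such factors over the algebraically closed field, and the
  order of each factor can be computed directly at every point.\<close>

inductive lin_prod :: "nat \<Rightarrow> 'a fls \<Rightarrow> bool" where
  const: "a \<noteq> 0 \<Longrightarrow> lin_prod 0 (\<c> a)"
| mult: "lin_prod n z \<Longrightarrow> \<alpha> \<noteq> 0 \<or> \<beta> \<noteq> 0 \<Longrightarrow> lin_prod (Suc n) (z * (\<c> \<alpha> * \<xi> 1 + \<c> \<beta> * \<xi> 3))"

text \<open>Homogenization of the split polynomial; missing degree is filled up with the line X3 =
  0.\<close>

lemma lin_prod_py: "P \<noteq> 0 \<Longrightarrow> degree P \<le> N \<Longrightarrow> lin_prod N (py P * \<xi> 3 ^ N)"
proof (induction N arbitrary: P)
  case 0
  then obtain a where "P = [:a:]" "a \<noteq> 0"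
    by (cases P) (auto split: if_splits)
  then show ?case
    using lin_prod.const[of a] by (simp add: py_const)
next
  case (Suc N)
  show ?case
  proof (cases "degree P \<le> N")
    case True
    have "lin_prod (Suc N) (py P * \<xi> 3 ^ N * (\<c> 0 * \<xi> 1 + \<c> 1 * \<xi> 3))"
      by (rule lin_prod.mult[OF Suc.IH[OF Suc.prems(1) True]]) simp
    then show ?thesis
      by (simp add: mult_ac)
  next
    case False
    with Suc.prems have "degree P = Suc N" by simp
    then obtain \<rho> where "poly P \<rho> = 0"
      using alg_closed_imp_poly_has_root[of P] by auto
    then obtain P' where P': "P = [:- \<rho>, 1:] * P'"
      by (auto simp: poly_eq_0_iff_dvd)
    with Suc.prems have "P' \<noteq> 0" by auto
    moreover have "degree P' \<le> N"
      using \<open>degree P = Suc N\<close> \<open>P' \<noteq> 0\<close> unfolding P' by (subst (asm) degree_mult_eq) auto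
    ultimately have "lin_prod (Suc N) (py P' * \<xi> 3 ^ N * (\<c> 1 * \<xi> 1 + \<c> (- \<rho>) * \<xi> 3))"
      by (intro lin_prod.mult Suc.IH) simp_all
    also have "py P' * \<xi> 3 ^ N * (\<c> 1 * \<xi> 1 + \<c> (- \<rho>) * \<xi> 3) = py P * \<xi> 3 ^ Suc N"
      unfolding P' py_mult py_linear yf_\<xi>[symmetric] c_simps(5)
      by (simp add: algebra_simps)
    finally show ?thesis .
  qed
qed

text \<open>Divided by a power of X3 and multiplied by a power of y, the form lies in some
  \<open>T m\<close> and has a norm P(y). Clearing denominators in the cofactor turns this into a
  multiple of the form that is a product of lines.\<close>

lemma norm_form:
  assumes A: "homogeneous d A" "\<phi> A \<noteq> 0"
  shows "\<exists>A' n. homogeneous n A' \<and> lin_prod (d + n) (\<phi> A * \<phi> A')"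
proof -
  let ?h = "\<phi> A / \<xi> 3 ^ d * yf ^ d"
  have "?h \<noteq> 0"
    using A(2) by simp
  from norm_exists[OF form_T[OF A(1)] this] obtain g P k
    where g: "g \<in> T k" "P \<noteq> 0" "?h * g = py P" by blast
  obtain A1 where A1: "homogeneous (2 * k) A1" "g * \<xi> 3 ^ (2 * k) = \<phi> A1"
    using T_form[OF g(1)] by blast
  let ?A' = "A1 * (Var 1 ^ d * Var 3 ^ degree P)"
  let ?n = "2 * k + (d + degree P)"
  have "homogeneous ?n ?A'"
    by (intro homogeneous_mult A1 homogeneous_Var_power)
  moreover have "\<phi> A * \<phi> ?A' = py P * \<xi> 3 ^ (d + ?n)"
  proof -
    define a where "a = \<phi> A / \<xi> 3 ^ d"
    have a: "\<phi> A = a * \<xi> 3 ^ d"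
      by (simp add: a_def)
    have "\<phi> A * \<phi> ?A' = a * \<xi> 3 ^ d * (g * \<xi> 3 ^ (2 * k)) * ((yf * \<xi> 3) ^ d * \<xi> 3 ^ degree P)"
      unfolding A1(2) yf_\<xi> a \<phi>_simps \<phi>_Var by (simp only: mult.assoc)
    also have "\<dots> = (a * yf ^ d * g) * \<xi> 3 ^ (d + ?n)"
      unfolding power_mult_distrib power_add by (simp only: mult_ac)
    also have "a * yf ^ d * g = py P"
      using g(3) by (simp only: a_def)
    finally show ?thesis .
  qed
  moreover have "lin_prod (d + ?n) (py P * \<xi> 3 ^ (d + ?n))"
    using g(2) by (intro lin_prod_py) simp_all
  ultimately show ?thesis
    by (intro exI[of _ ?A'] exI[of _ ?n]) (simp only: simp_thms)
qed

text \<open>On the curve, chart 3 serves all affine points, and charts 1 and 2 only the vertices (1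
  : 0 : 0) and (0 : 1 : 0), where the parameter is the plain quotient of two coordinates.\<close>

definition chart :: "'a ^ 3 \<Rightarrow> 3 \<Rightarrow> bool" where
  "chart v k \<longleftrightarrow> v $ k \<noteq> 0 \<and> (k = 3 \<or> v $ (k + 1) = 0)"

lemma chart_exists:
  assumes "on_curve v"
  shows "\<exists>k. chart v k"
proof (cases "v $ 3 = 0")
  case False
  then show ?thesis by (auto simp: chart_def)
next
  case True
  then have "v $ 1 = 0 \<or> v $ 2 = 0"
    using assms q2 by (auto simp: on_curve_def eval_F power_0_left)
  moreover obtain k where "v $ k \<noteq> 0"
    using on_curve_nz_coord[OF assms] by blast
  ultimately have "chart v 1 \<or> chart v 2"
    using True exhaust_3[of k] by (auto simp: chart_def)
  then show ?thesis by blast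
qed

context
  fixes v k
  assumes v: "on_curve v" and k: "chart v k"
begin

lemma vk: "v $ k \<noteq> 0"
  using k by (simp add: chart_def)

lemma const_unit: "a \<noteq> 0 \<Longrightarrow> \<c> a \<in> units v"
  using Ol_const[OF v, of a] ev_const[OF v, of a] by (simp add: units_def[OF v])

lemma unit_plus:
  assumes "a \<noteq> 0" "z \<in> Ol v" "ev v z = 0"
  shows "\<c> a + z \<in> units v"
  using assms Ol_add[OF v Ol_const[OF v]] ev_add[OF v Ol_const[OF v]] ev_const[OF v] by (simp add: units_def[OF v])

text \<open>At an affine point the quotient is a constant plus a multiple of the parameter. At (1 :
  0 : 0) the two terms have orders 0 and q, at (0 : 1 : 0) orders q and 1; the lowest one with
  nonzero coefficient dominates.\<close>

lemma linear_form_order: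
  assumes "\<alpha> \<noteq> 0 \<or> \<beta> \<noteq> 0"
  shows "\<exists>j. \<exists>w\<in>units v. (\<c> \<alpha> * \<xi> 1 + \<c> \<beta> * \<xi> 3) / \<xi> k = w * upar v k ^ j"
proof -
  let ?u = "upar v k"
  have u: "?u \<in> Ol v" "ev v ?u = 0"
    using upar_Ol[OF v vk] by simp_all
  have Y: "(\<c> \<alpha> * \<xi> 1 + \<c> \<beta> * \<xi> 3) / \<xi> k = \<c> \<alpha> * (\<xi> 1 / \<xi> k) + \<c> \<beta> * (\<xi> 3 / \<xi> k)"
    by (simp only: add_divide_distrib times_divide_eq_right)
  show ?thesis
  proof (cases "k = 3")
    case True
    let ?y = "v $ 1 / v $ 3"
    have "\<xi> 1 / \<xi> 3 = \<c> ?y + ?u"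
      by (simp add: upar_def True numeral_mod_3)
    then have Z: "(\<c> \<alpha> * \<xi> 1 + \<c> \<beta> * \<xi> 3) / \<xi> k = \<c> (\<alpha> * ?y + \<beta>) + \<c> \<alpha> * ?u"
      using Y unfolding True c_simps(3,4) by (simp only: divide_self[OF \<xi>_nz] mult_1_right distrib_left add_ac)
    show ?thesis
    proof (cases "\<alpha> * ?y + \<beta> = 0")
      case True
      with assms have "\<alpha> \<noteq> 0" by auto
      have "(\<c> \<alpha> * \<xi> 1 + \<c> \<beta> * \<xi> 3) / \<xi> k = \<c> \<alpha> * ?u ^ 1"
        unfolding Z True by simp
      with const_unit[OF \<open>\<alpha> \<noteq> 0\<close>] show ?thesis by blast
    next
      case False
      have "\<c> \<alpha> * ?u \<in> Ol v" "ev v (\<c> \<alpha> * ?u) = 0"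
        using u by (simp_all add: Ol_mult[OF v Ol_const[OF v]] ev_mult[OF v Ol_const[OF v]])
      from unit_plus[OF False this] show ?thesis
        unfolding Z by (metis mult_1_right power_0)
    qed
  next
    case False
    with k have k1: "v $ (k + 1) = 0"
      by (auto simp: chart_def)
    obtain \<epsilon> where \<epsilon>: "\<epsilon> \<in> units v" "\<xi> (k + 2) / \<xi> k = ?u ^ q * \<epsilon>"
      using fundamental_point(3)[OF v vk k1] by blast
    have ue: "\<xi> (k + 1) / \<xi> k = ?u"
      using fundamental_point(2)[OF v vk k1] by simp
    have \<epsilon>O: "\<epsilon> \<in> Ol v" using \<epsilon>(1) by (simp add: units_def[OF v])
    have uq: "?u * ?u ^ (q - 1) = ?u ^ q"
      using q2 by (cases q) simp_all
    from False consider "k = 1" | "k = 2" using exhaust_3[of k] by blast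
    then show ?thesis
    proof cases
      case 1
      have Z: "(\<c> \<alpha> * \<xi> 1 + \<c> \<beta> * \<xi> 3) / \<xi> k = \<c> \<alpha> + \<c> \<beta> * (?u ^ q * \<epsilon>)"
        unfolding Y \<epsilon>(2)[symmetric] by (simp add: 1)
      have z: "\<c> \<beta> * (?u ^ q * \<epsilon>) \<in> Ol v" "ev v (\<c> \<beta> * (?u ^ q * \<epsilon>)) = 0"
      proof -
        note O = Ol_mult[OF v] Ol_const[OF v] Ol_power[OF v] \<epsilon>O u(1)
        show "\<c> \<beta> * (?u ^ q * \<epsilon>) \<in> Ol v"
          by (intro O)
        have "ev v (\<c> \<beta> * (?u ^ q * \<epsilon>)) = ev v (\<c> \<beta>) * (ev v ?u ^ q * ev v \<epsilon>)"
          by (simp only: ev_mult[OF v] ev_power[OF v] O)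
        then show "ev v (\<c> \<beta> * (?u ^ q * \<epsilon>)) = 0"
          using u(2) q2 by (simp add: power_0_left)
      qed
      show ?thesis
      proof (cases "\<alpha> = 0")
        case True
        with assms have "\<beta> \<noteq> 0" by simp
        have "(\<c> \<alpha> * \<xi> 1 + \<c> \<beta> * \<xi> 3) / \<xi> k = \<c> \<beta> * \<epsilon> * ?u ^ q"
          using Z by (simp add: True mult_ac)
        moreover have "\<c> \<beta> * \<epsilon> \<in> units v"
          by (intro units_mult[OF v] const_unit \<epsilon>(1) \<open>\<beta> \<noteq> 0\<close>)
        ultimately show ?thesis by blast
      next
        case False
        from unit_plus[OF False z] show ?thesis
          unfolding Z by (metis mult_1_right power_0)
      qed
    next
      case 2
      have "\<xi> 3 / \<xi> k = ?u" "\<xi> 1 / \<xi> k = ?u ^ q * \<epsilon>"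
        using ue \<epsilon>(2) by (simp_all add: 2 numeral_mod_3)
      then have Z: "(\<c> \<alpha> * \<xi> 1 + \<c> \<beta> * \<xi> 3) / \<xi> k = \<c> \<alpha> * (?u ^ q * \<epsilon>) + \<c> \<beta> * ?u"
        unfolding Y by (simp only:)
      show ?thesis
      proof (cases "\<beta> = 0")
        case True
        with assms have "\<alpha> \<noteq> 0" by simp
        have "(\<c> \<alpha> * \<xi> 1 + \<c> \<beta> * \<xi> 3) / \<xi> k = \<c> \<alpha> * \<epsilon> * ?u ^ q"
          using Z by (simp add: True mult_ac)
        moreover have "\<c> \<alpha> * \<epsilon> \<in> units v"
          by (intro units_mult[OF v] const_unit \<epsilon>(1) \<open>\<alpha> \<noteq> 0\<close>)
        ultimately show ?thesis by blast
      next
        case False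
        have z: "\<c> \<alpha> * (?u ^ (q - 1) * \<epsilon>) \<in> Ol v" "ev v (\<c> \<alpha> * (?u ^ (q - 1) * \<epsilon>)) = 0"
        proof -
          note O = Ol_mult[OF v] Ol_const[OF v] Ol_power[OF v] \<epsilon>O u(1)
          show "\<c> \<alpha> * (?u ^ (q - 1) * \<epsilon>) \<in> Ol v"
            by (intro O)
          have "ev v (\<c> \<alpha> * (?u ^ (q - 1) * \<epsilon>)) = ev v (\<c> \<alpha>) * (ev v ?u ^ (q - 1) * ev v \<epsilon>)"
            by (simp only: ev_mult[OF v] ev_power[OF v] O)
          then show "ev v (\<c> \<alpha> * (?u ^ (q - 1) * \<epsilon>)) = 0"
            using u(2) q2 by (simp add: power_0_left)
        qed
        have "(\<c> \<alpha> * \<xi> 1 + \<c> \<beta> * \<xi> 3) / \<xi> k = (\<c> \<beta> + \<c> \<alpha> * (?u ^ (q - 1) * \<epsilon>)) * ?u ^ 1"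
        proof -
          have "s * (u * p * e) + t * u = (t + s * (p * e)) * u ^ 1" for s t u p e :: "'a fls"
            by (simp add: algebra_simps)
          then show ?thesis unfolding Z uq[symmetric] .
        qed
        with unit_plus[OF False z] show ?thesis by blast
      qed
    qed
  qed
qed

lemma lin_prod_order: "lin_prod n z \<Longrightarrow> \<exists>j. \<exists>w\<in>units v. z / \<xi> k ^ n = w * upar v k ^ j"
proof (induction rule: lin_prod.induct)
  case (const a)
  from const_unit[OF const] show ?case
    by (intro exI[of _ 0] bexI[of _ "\<c> a"]) simp_all
next
  case (mult n z \<alpha> \<beta>)
  from mult.IH obtain j w where 1: "w \<in> units v" "z / \<xi> k ^ n = w * upar v k ^ j" by blast
  from linear_form_order[OF mult.hyps(2)] obtain i w' where
    2: "w' \<in> units v" "(\<c> \<alpha> * \<xi> 1 + \<c> \<beta> * \<xi> 3) / \<xi> k = w' * upar v k ^ i" by blast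
  have "z * (\<c> \<alpha> * \<xi> 1 + \<c> \<beta> * \<xi> 3) / \<xi> k ^ Suc n = z / \<xi> k ^ n * ((\<c> \<alpha> * \<xi> 1 + \<c> \<beta> * \<xi> 3) / \<xi> k)"
    by (simp only: times_divide_times_eq power_Suc2)
  also have "\<dots> = (w * w') * upar v k ^ (j + i)"
    unfolding 1 2 power_add by (simp only: mult_ac)
  finally show ?case
    using units_mult[OF v 1(1) 2(1)] by blast
qed

text \<open>A multiple of the form has known order by \<open>norm_form\<close>, and in the local
  ring every divisor of a unit times a power of the parameter is again of that shape.\<close>

lemma form_order:
  assumes A: "homogeneous d A" "\<phi> A \<noteq> 0"
  shows "\<exists>j. \<exists>w\<in>units v. \<phi> A / \<xi> k ^ d = w * upar v k ^ j"
proof -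
  obtain A' n where A': "homogeneous n A'" "lin_prod (d + n) (\<phi> A * \<phi> A')"
    using norm_form[OF A] by blast
  obtain j w where w: "w \<in> units v" "\<phi> A * \<phi> A' / \<xi> k ^ (d + n) = w * upar v k ^ j"
    using lin_prod_order[OF A'(2)] by blast
  have O: "\<phi> B / \<xi> k ^ m \<in> Ol v" if "homogeneous m B" for B m
    using poly3_eval_mod_upar[OF v vk, of B] unfolding \<phi>_dehom[OF that, symmetric] by blast
  have "\<phi> A / \<xi> k ^ d * (\<phi> A' / \<xi> k ^ n) = w * upar v k ^ j"
    unfolding w(2)[symmetric] power_add by (simp only: times_divide_times_eq)
  from dvr_factor[OF v uni_upar[OF v vk] upar_nz O[OF A(1)] O[OF A'(1)] w(1) this]
  show ?thesis .
qed

lemma K_order: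
  assumes "z \<in> K" "z \<noteq> 0"
  shows "\<exists>i j. \<exists>w\<in>units v. z * upar v k ^ i = w * upar v k ^ j"
proof -
  obtain A B d where AB: "homogeneous d A" "homogeneous d B" "\<phi> B \<noteq> 0" "z = \<phi> A / \<phi> B"
    using assms(1) by (rule K_E)
  with assms(2) have "\<phi> A \<noteq> 0" by auto
  obtain j w where w: "w \<in> units v" "\<phi> A / \<xi> k ^ d = w * upar v k ^ j"
    using form_order[OF AB(1) \<open>\<phi> A \<noteq> 0\<close>] by blast
  obtain i w' where w': "w' \<in> units v" "\<phi> B / \<xi> k ^ d = w' * upar v k ^ i"
    using form_order[OF AB(2,3)] by blast
  have "z = (\<phi> A / \<xi> k ^ d) / (\<phi> B / \<xi> k ^ d)"
    unfolding AB(4) by simp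
  then have "z * (w' * upar v k ^ i) = w * upar v k ^ j"
    unfolding w w' using units_nz[OF v w'(1)] upar_nz[of v k] by simp
  then have "inverse w' * (z * (w' * upar v k ^ i)) = inverse w' * (w * upar v k ^ j)"
    by (simp only:)
  moreover have "inverse w' * (z * (w' * upar v k ^ i)) = z * upar v k ^ i * (inverse w' * w')"
    by (simp only: mult_ac)
  moreover have "inverse w' * w' = 1"
    using units_nz[OF v w'(1)] by simp
  ultimately have "z * upar v k ^ i = inverse w' * w * upar v k ^ j"
    by (simp only: mult_1_right mult.assoc)
  then show ?thesis
    using units_mult[OF v units_inverse[OF v w'(1)] w(1)] by blast
qed

end

text \<open>Conditions on orders become membership in local rings, in which the Riemann-Roch space
  is then computed. Multiplication by \<open>u ^ n\<close> avoids negative exponents.\<close>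

lemma ord_at_ge_iff:
  assumes v: "on_curve v" and z: "z \<in> K" "z \<noteq> 0" and u: "uni v u" "u \<noteq> 0"
  shows "0 \<le> ord_at F (pt v) (cls z) + int n \<longleftrightarrow> u ^ n * z \<in> Ol v"
proof -
  obtain k where k: "chart v k" using chart_exists[OF v] by blast
  obtain i j w where w: "w \<in> units v" "z * upar v k ^ i = w * upar v k ^ j"
    using K_order[OF v k z] by blast
  obtain r where r: "r \<in> units v" "upar v k = r * u"
    using uni_associated[OF v u(1) uni_upar[OF v vk[OF v k]] u(2)] by blast
  have rO: "r ^ m \<in> units v" for m by (rule units_power[OF v r(1)])
  define w' where "w' = w * r ^ j * inverse (r ^ i)"
  have w': "w' \<in> units v"
    unfolding w'_def by (intro units_mult[OF v] w(1) rO units_inverse[OF v])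
  have "(z * (r * u) ^ i) * inverse (r ^ i) = (w * (r * u) ^ j) * inverse (r ^ i)"
    using w(2) unfolding r(2) by (simp only:)
  then have "z * u ^ i * (r ^ i * inverse (r ^ i)) = w' * u ^ j"
    unfolding power_mult_distrib w'_def by (simp only: mult_ac)
  moreover have "r ^ i * inverse (r ^ i) = 1"
    using units_nz[OF v rO] by simp
  ultimately have eq: "z * u ^ i = w' * u ^ j"
    by (simp only: mult_1_right)
  have "u powi int j = u powi (int j - int i) * u powi int i"
    using power_int_add[of u "int j - int i" "int i"] u(2) by simp
  then have "z * u ^ i = w' * u powi (int j - int i) * u ^ i"
    using eq by (simp only: power_int_of_nat mult.assoc)
  then have z_eq: "z = w' * u powi (int j - int i)"
    using u(2) by simp
  have ord: "ord_at F (pt v) (cls z) = int j - int i"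
    unfolding z_eq by (rule ord_at_eq[OF v u w'])
  have uO: "u \<in> Ol v" "ev v u = 0" using uni_ev[OF v u(1)] by simp_all
  have wO: "w' \<in> Ol v" "ev v w' \<noteq> 0" using w' by (simp_all add: units_def[OF v])
  have eqn: "(u ^ n * z) * u ^ i = w' * u ^ (j + n)"
  proof -
    have "(u ^ n * z) * u ^ i = (z * u ^ i) * u ^ n" by (simp only: mult_ac)
    then show ?thesis unfolding eq power_add by (simp only: mult.assoc)
  qed
  show ?thesis
  proof (cases "i \<le> j + n")
    case True
    then obtain m where m: "j + n = m + i" by (metis add.commute le_Suc_ex)
    have "(u ^ n * z) * u ^ i = (w' * u ^ m) * u ^ i"
      unfolding eqn m power_add by (simp only: mult.assoc)
    then have "u ^ n * z = w' * u ^ m"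
      using u(2) by simp
    also have "\<dots> \<in> Ol v"
      by (intro Ol_mult[OF v] Ol_power[OF v] uO(1) wO(1))
    finally show ?thesis
      using True unfolding ord by simp
  next
    case False
    then obtain m where m: "i = (j + n) + m" "m > 0"
      by (metis less_imp_add_positive not_le)
    have "((u ^ n * z) * u ^ m) * u ^ (j + n) = w' * u ^ (j + n)"
      using eqn unfolding m(1) power_add by (simp only: mult_ac)
    then have *: "(u ^ n * z) * u ^ m = w'"
      using u(2) by simp
    have "u ^ n * z \<notin> Ol v"
    proof
      assume "u ^ n * z \<in> Ol v"
      then have "ev v ((u ^ n * z) * u ^ m) = ev v (u ^ n * z) * ev v u ^ m"
        using ev_mult[OF v _ Ol_power[OF v uO(1)]] ev_power[OF v uO(1)] by (simp only:)
      then show False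
        using m(2) wO(2) unfolding * uO(2) by (simp add: power_0_left)
    qed
    then show ?thesis
      using False unfolding ord by simp
  qed
qed

lemma divisor_condition_iff:
  assumes z: "z \<in> K" "z \<noteq> 0"
  shows "(\<forall>P. 0 \<le> divisor_of F (cls z) P + sum_of_points G P) \<longleftrightarrow>
    (\<forall>(v :: 'a ^ 3) k. on_curve v \<longrightarrow> chart v k \<longrightarrow> (if pt v \<in> G then upar v k * z else z) \<in> Ol v)"
proof
  assume *: "\<forall>P. 0 \<le> divisor_of F (cls z) P + sum_of_points G P"
  show "\<forall>(v :: 'a ^ 3) k. on_curve v \<longrightarrow> chart v k \<longrightarrow> (if pt v \<in> G then upar v k * z else z) \<in> Ol v"
  proof (intro allI impI)
    fix v :: "'a ^ 3" and k assume v: "on_curve v" and ch: "chart v k"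
    have k: "v $ k \<noteq> 0"
      using ch by (simp add: chart_def)
    have "pt v \<in> curve F"
      using curve_iff v by blast
    then have "0 \<le> ord_at F (pt v) (cls z) + (if pt v \<in> G then 1 else 0)"
      using *[rule_format, of "pt v"] by (simp add: divisor_of_def sum_of_points_def)
    then show "(if pt v \<in> G then upar v k * z else z) \<in> Ol v"
      using ord_at_ge_iff[OF v z uni_upar[OF v k] upar_nz, of 0]
        ord_at_ge_iff[OF v z uni_upar[OF v k] upar_nz, of 1]
      by (cases "pt v \<in> G") simp_all
  qed
next
  assume *: "\<forall>(v :: 'a ^ 3) k. on_curve v \<longrightarrow> chart v k \<longrightarrow> (if pt v \<in> G then upar v k * z else z) \<in> Ol v"
  show "\<forall>P. 0 \<le> divisor_of F (cls z) P + sum_of_points G P"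
  proof
    fix P
    show "0 \<le> divisor_of F (cls z) P + sum_of_points G P"
    proof (cases "P \<in> curve F")
      case False
      then show ?thesis by (simp add: divisor_of_def sum_of_points_def)
    next
      case True
      then obtain v where v: "P = pt v" "on_curve v" by (rule curveE)
      obtain k where ch: "chart v k" using chart_exists[OF v(2)] by blast
      then have k: "v $ k \<noteq> 0" by (simp add: chart_def)
      have "(if pt v \<in> G then upar v k * z else z) \<in> Ol v"
        using * v(2) ch by blast
      then have "0 \<le> ord_at F (pt v) (cls z) + (if pt v \<in> G then 1 else 0)"
        using ord_at_ge_iff[OF v(2) z uni_upar[OF v(2) k] upar_nz, of 0]
          ord_at_ge_iff[OF v(2) z uni_upar[OF v(2) k] upar_nz, of 1]
        by (cases "pt v \<in> G") simp_all
      with True show ?thesis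
        by (simp add: divisor_of_def sum_of_points_def v(1))
    qed
  qed
qed

end

section \<open>The geometric Riemann-Roch space\<close>

text \<open>When a root r is split off, the derivative at r is the value of the cofactor, so r is
  not a root of the cofactor, and separability passes on to it.\<close>

lemma card_roots_separable:
  fixes P :: "'b::alg_closed_field poly"
  assumes "P \<noteq> 0" "\<And>x. poly P x = 0 \<Longrightarrow> poly (pderiv P) x \<noteq> 0"
  shows "card {x. poly P x = 0} = degree P"
  using assms
proof (induction "degree P" arbitrary: P)
  case 0
  then obtain a where "P = [:a:]" "a \<noteq> 0"
    by (cases P) (auto split: if_splits)
  then show ?case by simp
next
  case (Suc n)
  then obtain r where "poly P r = 0"
    using alg_closed_imp_poly_has_root[of P] by auto
  then obtain P' where P': "P = [:- r, 1:] * P'"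
    by (auto simp: poly_eq_0_iff_dvd)
  have P'0: "P' \<noteq> 0" using P' Suc.prems by auto
  have deg: "degree P = Suc (degree P')"
    unfolding P' by (subst degree_mult_eq) (use P'0 in auto)
  have pd: "pderiv P = P' + [:- r, 1:] * pderiv P'"
    unfolding P' pderiv_mult by (simp add: pderiv_pCons)
  have r: "poly P' r \<noteq> 0"
    using Suc.prems(2)[OF \<open>poly P r = 0\<close>] unfolding pd by simp
  have "card {x. poly P' x = 0} = degree P'"
  proof (rule Suc.hyps(1))
    show "n = degree P'" using Suc.hyps(2) deg by simp
    fix x assume "poly P' x = 0"
    then show "poly (pderiv P') x \<noteq> 0"
      using Suc.prems(2)[of x] unfolding pd by (auto simp: P')
  qed (rule P'0)
  moreover have "{x. poly P x = 0} = insert r {x. poly P' x = 0}"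
    unfolding P' by auto
  ultimately show ?case
    using r poly_roots_finite[OF P'0] by (simp add: deg)
qed

context hermitian_curve
begin

definition NN :: nat where "NN = q^2 - q + 1"

lemma NN: "NN = (q - 1) * q + 1"
  by (simp add: NN_def power2_eq_square diff_mult_distrib)

text \<open>The second coordinate is the one of \<Pi>, since y^(q^2 + 1) = y^N y^q. Written in this
  way it shows that the orbit satisfies x = w y^q, the relation behind \<open>D0\<close>.\<close>

definition GG :: "'a \<Rightarrow> 'a point set" where
  "GG w = {pt (vector [y, w * y ^ q, 1]) | y. y ^ NN = w}"

lemma vector_nz: "(vector [a, b, 1] :: 'a ^ 3) \<noteq> 0"
proof
  assume "(vector [a, b, 1] :: 'a ^ 3) = 0"
  then have "(vector [a, b, 1] :: 'a ^ 3) $ 3 = (0 :: 'a ^ 3) $ 3" by (rule arg_cong)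
  then show False by simp
qed

lemma pt_affine_eq:
  fixes v :: "'a ^ 3"
  assumes "v \<noteq> 0"
  shows "pt v = pt (vector [a, b, 1]) \<longleftrightarrow> v $ 3 \<noteq> 0 \<and> v $ 1 / v $ 3 = a \<and> v $ 2 / v $ 3 = b"
proof
  assume "pt v = pt (vector [a, b, 1])"
  then obtain k where "k \<noteq> 0" "v = k *s vector [a, b, 1]"
    using pt_eq_iff[OF vector_nz assms, of a b] by metis
  then show "v $ 3 \<noteq> 0 \<and> v $ 1 / v $ 3 = a \<and> v $ 2 / v $ 3 = b"
    by simp
next
  assume *: "v $ 3 \<noteq> 0 \<and> v $ 1 / v $ 3 = a \<and> v $ 2 / v $ 3 = b"
  then have "v = v $ 3 *s vector [a, b, 1]"
    by (auto simp: vec_eq_iff forall_3)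
  with * show "pt v = pt (vector [a, b, 1])"
    using pt_eq_iff[OF vector_nz assms, of a b] by metis
qed

lemma GG_iff:
  fixes v :: "'a ^ 3"
  assumes "v \<noteq> 0"
  shows "pt v \<in> GG w \<longleftrightarrow> v $ 3 \<noteq> 0 \<and> (v $ 1 / v $ 3) ^ NN = w \<and> v $ 2 / v $ 3 = w * (v $ 1 / v $ 3) ^ q"
  unfolding GG_def mem_Collect_eq pt_affine_eq[OF assms] by auto

lemma on_curve_affine: "on_curve (vector [y, x, 1]) \<longleftrightarrow> \<tau> * y * x ^ q + t2 * x + y ^ q = 0"
  by (simp add: on_curve_def eval_F vector_nz)

lemma chart_cases:
  fixes v :: "'a ^ 3"
  assumes "on_curve v" "chart v k"
  obtains (affine) "k = 3" "v $ 3 \<noteq> 0" | (E1) "k = 1" "v $ 1 \<noteq> 0" "v $ 2 = 0" "v $ 3 = 0"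
    | (E2) "k = 2" "v $ 2 \<noteq> 0" "v $ 3 = 0" "v $ 1 = 0"
proof -
  have k: "v $ k \<noteq> 0" "k = 3 \<or> v $ (k + 1) = 0"
    using assms(2) by (simp_all add: chart_def)
  show thesis
  proof (cases "k = 3")
    case True
    with k affine show thesis by simp
  next
    case False
    with k fundamental_point(1)[OF assms(1) k(1)] have *: "v $ (k + 1) = 0" "v $ (k + 2) = 0" by auto
    from False consider "k = 1" | "k = 2" using exhaust_3[of k] by blast
    then show thesis
    proof cases
      case 1
      with * k E1 show thesis by simp
    next
      case 2
      with * k E2 show thesis by (simp add: numeral_mod_3)
    qed
  qed
qed

subsection \<open>Monomials at the points of the curve\<close>

lemma affine_Ol:
  fixes v :: "'a ^ 3"
  assumes v: "on_curve v" "v $ 3 \<noteq> 0"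
  shows "xf \<in> Ol v" "yf \<in> Ol v" "ev v xf = v $ 2 / v $ 3" "ev v yf = v $ 1 / v $ 3"
  unfolding xf_def yf_def by (simp_all only: Ol_\<xi>[OF v] ev_\<xi>[OF v])

lemma affine_T:
  fixes v :: "'a ^ 3"
  assumes v: "on_curve v" "v $ 3 \<noteq> 0" and "z \<in> T m"
  shows "z \<in> Ol v"
proof -
  obtain f where f: "z = (\<Sum>i\<in>Ai m. \<c> (f i) * mon i)" using assms(3) unfolding T_def by (rule SpE)
  show ?thesis
    unfolding f mon_def
    by (intro Ol_sum[OF v(1)] Ol_mult[OF v(1)] Ol_const[OF v(1)] Ol_power[OF v(1)] affine_Ol[OF v])
qed

lemma py_ev:
  fixes v :: "'a ^ 3"
  assumes "on_curve v" "yf \<in> Ol v"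
  shows "py P \<in> Ol v \<and> ev v (py P) = poly P (ev v yf)"
proof (induction P)
  case 0
  show ?case by (simp add: Ol_0[OF assms(1)] ev_0[OF assms(1)])
next
  case (pCons a P)
  note v = assms(1)
  have m: "yf * py P \<in> Ol v" using pCons.IH by (intro Ol_mult[OF v] assms(2)) blast
  have "ev v (\<c> a + yf * py P) = a + ev v yf * ev v (py P)"
    using ev_add[OF v Ol_const[OF v] m] ev_mult[OF v assms(2)] pCons.IH ev_const[OF v] by simp
  with pCons.IH Ol_add[OF v Ol_const[OF v] m] show ?case
    by (simp add: py_pCons)
qed

lemma zeros_bound:
  assumes h: "h \<in> T m" "h \<noteq> 0"
    and Y: "\<And>y. y \<in> Y \<Longrightarrow> \<exists>x. on_curve (vector [y, x, 1]) \<and> ev (vector [y, x, 1]) h = 0"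
  shows "finite Y \<and> card Y \<le> m"
proof -
  obtain g P where g: "g \<in> T (q * m - m)" "P \<noteq> 0" "degree P \<le> m" "h * g = py P"
    using norm_exists[OF h] by blast
  have "Y \<subseteq> {y. poly P y = 0}"
  proof
    fix y assume "y \<in> Y"
    then obtain x where x: "on_curve (vector [y, x, 1])" "ev (vector [y, x, 1]) h = 0"
      using Y by blast
    let ?v = "vector [y, x, 1] :: 'a ^ 3"
    have v3: "?v $ 3 \<noteq> 0" by simp
    have "ev ?v (h * g) = 0"
      using ev_mult[OF x(1) affine_T[OF x(1) v3 h(1)] affine_T[OF x(1) v3 g(1)]] x(2) by simp
    then have "poly P (ev ?v yf) = 0"
      using py_ev[OF x(1) affine_Ol(2)[OF x(1) v3]] by (simp add: g(4))
    then show "y \<in> {y. poly P y = 0}"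
      using affine_Ol(4)[OF x(1) v3] by simp
  qed
  then have "finite Y" "card Y \<le> card {y. poly P y = 0}"
    using poly_roots_finite[OF g(2)] by (auto intro: finite_subset card_mono)
  with card_poly_roots_bound[OF g(2)] g(3) show ?thesis by linarith
qed

definition E1 :: "'a ^ 3" where "E1 = vector [1, 0, 0]"
definition E2 :: "'a ^ 3" where "E2 = vector [0, 1, 0]"

lemma on_curve_E2: "on_curve E2"
proof -
  have "E2 \<noteq> 0"
  proof
    assume "E2 = 0"
    then have "E2 $ 2 = (0 :: 'a ^ 3) $ 2" by (rule arg_cong)
    then show False by (simp add: E2_def)
  qed
  then show ?thesis
    using q2 by (simp add: on_curve_def eval_F E2_def power_0_left)
qed

text \<open>At (0 : 1 : 0) the parameter is X3 / X2 = 1 / x, and X1 / X2 has order q in it; hence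
  their quotient y has order q - 1.\<close>

lemma at_E2:
  fixes v :: "'a ^ 3"
  assumes v: "on_curve v" and "v $ 2 \<noteq> 0" "v $ 3 = 0" "v $ 1 = 0"
  shows "xf = inverse (upar v 2)" "\<exists>\<epsilon>\<in>units v. yf = upar v 2 ^ (q - 1) * \<epsilon>"
proof -
  have k: "v $ 2 \<noteq> 0" "v $ (2 + 1) = 0"
    using assms by simp_all
  obtain \<epsilon> where \<epsilon>: "\<epsilon> \<in> units v" "\<xi> (2 + 2) / \<xi> 2 = upar v 2 ^ q * \<epsilon>"
    using fundamental_point(3)[OF v k] by blast
  have u: "\<xi> 3 / \<xi> 2 = upar v 2"
    using fundamental_point(2)[OF v k] by simp
  then show "xf = inverse (upar v 2)"
    by (simp add: xf_def flip: u)
  have "yf = (\<xi> (2 + 2) / \<xi> 2) / (\<xi> 3 / \<xi> 2)"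
    by (simp add: yf_def numeral_mod_3)
  also have "\<dots> = upar v 2 ^ q * \<epsilon> / upar v 2"
    unfolding \<epsilon>(2) u ..
  also have "upar v 2 ^ q = upar v 2 * upar v 2 ^ (q - 1)"
    using q2 by (cases q) simp_all
  finally have "yf = upar v 2 ^ (q - 1) * \<epsilon>"
    using upar_nz[of v 2] by simp
  with \<epsilon>(1) show "\<exists>\<epsilon>\<in>units v. yf = upar v 2 ^ (q - 1) * \<epsilon>" by blast
qed

lemma power_cancel_inverse:
  fixes u :: "'b::field"
  assumes "u \<noteq> 0" "a \<le> n"
  shows "inverse u ^ a * u ^ n = u ^ (n - a)"
proof -
  have "u ^ n = u ^ a * u ^ (n - a)"
    using assms(2) by (simp add: power_add[symmetric])
  then have "inverse u ^ a * u ^ n = (inverse u * u) ^ a * u ^ (n - a)"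
    by (simp only: power_mult_distrib mult.assoc)
  with assms(1) show ?thesis by simp
qed

lemma E2_T:
  fixes v :: "'a ^ 3"
  assumes v: "on_curve v" and "v $ 2 \<noteq> 0" "v $ 3 = 0" "v $ 1 = 0" and "z \<in> T m"
  shows "z \<in> Ol v"
proof -
  obtain f where f: "z = (\<Sum>i\<in>Ai m. \<c> (f i) * mon i)" using assms(5) unfolding T_def by (rule SpE)
  obtain \<epsilon> where \<epsilon>: "\<epsilon> \<in> units v" "yf = upar v 2 ^ (q - 1) * \<epsilon>"
    using at_E2(2)[OF assms(1-4)] by blast
  have \<epsilon>O: "\<epsilon> \<in> Ol v" using \<epsilon>(1) by (simp add: units_def[OF v])
  have u: "upar v 2 \<in> Ol v" using upar_Ol[OF v assms(2)] by simp
  have "mon i \<in> Ol v" if "i \<in> Ai m" for i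
  proof -
    have i: "fst i \<le> (q - 1) * snd i"
      using that by (simp add: Ai_def)
    have "mon i = inverse (upar v 2) ^ fst i * upar v 2 ^ ((q - 1) * snd i) * \<epsilon> ^ snd i"
      unfolding mon_def at_E2(1)[OF assms(1-4)] \<epsilon>(2) power_mult_distrib power_mult by (simp only: mult.assoc)
    also have "\<dots> = upar v 2 ^ ((q - 1) * snd i - fst i) * \<epsilon> ^ snd i"
      unfolding power_cancel_inverse[OF upar_nz i] ..
    also have "\<dots> \<in> Ol v"
      by (intro Ol_mult[OF v] Ol_power[OF v] u \<epsilon>O)
    finally show ?thesis .
  qed
  then show ?thesis
    unfolding f by (intro Ol_sum[OF v] Ol_mult[OF v] Ol_const[OF v])
qed

text \<open>The same unit occurs in both equations because x = u y for the parameter u = X2 /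
  X1.\<close>

lemma at_E1:
  fixes v :: "'a ^ 3"
  assumes v: "on_curve v" and "v $ 1 \<noteq> 0" "v $ 2 = 0"
  shows "\<exists>\<epsilon>\<in>units v. yf * upar v 1 ^ q = \<epsilon> \<and> xf * upar v 1 ^ (q - 1) = \<epsilon>"
proof -
  have k: "v $ 1 \<noteq> 0" "v $ (1 + 1) = 0"
    using assms by simp_all
  obtain \<epsilon> where \<epsilon>: "\<epsilon> \<in> units v" "\<xi> (1 + 2) / \<xi> 1 = upar v 1 ^ q * \<epsilon>"
    using fundamental_point(3)[OF v k] by blast
  have u: "\<xi> 2 / \<xi> 1 = upar v 1"
    using fundamental_point(2)[OF v k] by simp
  have nz: "\<epsilon> \<noteq> 0" "upar v 1 \<noteq> 0" using units_nz[OF v \<epsilon>(1)] upar_nz by simp_all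
  have "yf = inverse (\<xi> (1 + 2) / \<xi> 1)"
    by (simp add: yf_def)
  then have y: "yf = inverse (upar v 1 ^ q * \<epsilon>)"
    unfolding \<epsilon>(2) .
  have "xf = (\<xi> 2 / \<xi> 1) * yf"
    by (simp add: xf_def yf_def)
  then have x: "xf = upar v 1 * yf"
    unfolding u .
  have y': "yf * upar v 1 ^ q = inverse \<epsilon>"
    unfolding y using nz by (simp add: field_simps)
  moreover have "xf * upar v 1 ^ (q - 1) = yf * upar v 1 ^ q"
    unfolding x using q2 by (cases q) (simp_all add: mult_ac)
  ultimately show ?thesis
    using units_inverse[OF v \<epsilon>(1)] by metis
qed

lemma E1_T:
  fixes v :: "'a ^ 3"
  assumes v: "on_curve v" and "v $ 1 \<noteq> 0" "v $ 2 = 0" and "z \<in> T m"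
  shows "z * upar v 1 ^ m \<in> Ol v"
proof -
  obtain f where f: "z = (\<Sum>i\<in>Ai m. \<c> (f i) * mon i)" using assms(4) unfolding T_def by (rule SpE)
  obtain \<epsilon> where \<epsilon>: "\<epsilon> \<in> units v" "yf * upar v 1 ^ q = \<epsilon>" "xf * upar v 1 ^ (q - 1) = \<epsilon>"
    using at_E1[OF assms(1-3)] by blast
  have \<epsilon>O: "\<epsilon> \<in> Ol v" using \<epsilon>(1) by (simp add: units_def[OF v])
  have u: "upar v 1 \<in> Ol v" using upar_Ol[OF v assms(2)] by simp
  have "mon i * upar v 1 ^ m \<in> Ol v" if "i \<in> Ai m" for i
  proof -
    have i: "wt i \<le> m"
      using that by (simp add: Ai_def)
    then have "upar v 1 ^ m = upar v 1 ^ ((q - 1) * fst i) * upar v 1 ^ (q * snd i) * upar v 1 ^ (m - wt i)"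
      by (simp add: power_add[symmetric] wt_def)
    then have "mon i * upar v 1 ^ m = (xf * upar v 1 ^ (q - 1)) ^ fst i * (yf * upar v 1 ^ q) ^ snd i * upar v 1 ^ (m - wt i)"
      unfolding mon_def power_mult_distrib power_mult by (simp only: mult_ac)
    also have "\<dots> \<in> Ol v"
      unfolding \<epsilon>(2,3) by (intro Ol_mult[OF v] Ol_power[OF v] u \<epsilon>O)
    finally show ?thesis .
  qed
  then have "\<c> a * (mon i * upar v 1 ^ m) \<in> Ol v" if "i \<in> Ai m" for a i
    using that by (intro Ol_mult[OF v Ol_const[OF v]]) blast
  then show ?thesis
    unfolding f sum_distrib_right mult.assoc by (intro Ol_sum[OF v])
qed

subsection \<open>Functions regular outside (1 : 0 : 0)\<close>

text \<open>Generators, over the polynomials in y, of the functions regular outside (1 : 0 : 0): at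
  (0 : 1 : 0) the pole of x^a of order a < q is cancelled by the zero of y of order q - 1.\<close>

definition bb :: "nat \<Rightarrow> 'a fls" where
  "bb a = (if a = 0 then 1 else yf * xf ^ a)"

definition Rmod :: "'a fls set" where
  "Rmod = {\<Sum>a<q. py (d a) * bb a | d. True}"

lemma Rmod_sum:
  assumes "\<And>i. i \<in> I \<Longrightarrow> z i \<in> Rmod"
  shows "(\<Sum>i\<in>I. z i) \<in> Rmod"
proof -
  have "\<exists>d. \<forall>i\<in>I. z i = (\<Sum>a<q. py (d i a) * bb a)"
    using assms unfolding Rmod_def by (intro bchoice) blast
  then obtain d where d: "\<And>i. i \<in> I \<Longrightarrow> z i = (\<Sum>a<q. py (d i a) * bb a)" by blast
  have "(\<Sum>i\<in>I. z i) = (\<Sum>i\<in>I. \<Sum>a<q. py (d i a) * bb a)"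
    using d by (rule sum.cong[OF refl])
  also have "\<dots> = (\<Sum>a<q. py (\<Sum>i\<in>I. d i a) * bb a)"
    by (subst sum.swap) (simp only: py_sum sum_distrib_right)
  finally show ?thesis
    unfolding Rmod_def by (intro CollectI exI[of _ "\<lambda>a. \<Sum>i\<in>I. d i a"]) simp
qed

lemma Rmod_single: "a < q \<Longrightarrow> py P * bb a \<in> Rmod"
proof -
  assume "a < q"
  then have "(\<Sum>i<q. py (if i = a then P else 0) * bb i) = (\<Sum>i<q. if i = a then py P * bb a else 0)"
    by (intro sum.cong) auto
  also have "\<dots> = py P * bb a"
    using \<open>a < q\<close> by (simp add: sum.delta)
  finally show ?thesis
    unfolding Rmod_def by (intro CollectI exI[of _ "\<lambda>i. if i = a then P else 0"]) simp
qed

lemma T_Rmod: "z \<in> T m \<Longrightarrow> z \<in> Rmod"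
proof -
  assume "z \<in> T m"
  then obtain f where f: "z = (\<Sum>i\<in>Bi m. \<c> (f i) * mon i)" unfolding T_eq by (rule SpE)
  have "\<c> (f i) * mon i \<in> Rmod" if "i \<in> Bi m" for i
  proof -
    obtain a b where i: "i = (a, b)" by fastforce
    have a: "a < q" "a \<le> (q - 1) * b"
      using that by (auto simp: Bi_def Ai_def i)
    show ?thesis
    proof (cases "a = 0")
      case True
      have "py (monom (f i) b) * bb a \<in> Rmod"
        using a(1) by (rule Rmod_single)
      then show ?thesis
        by (simp add: py_monom bb_def True mon_def i)
    next
      case False
      with a obtain b' where b: "b = Suc b'" by (cases b) auto
      have "py (monom (f i) b') * bb a \<in> Rmod"
        using a(1) by (rule Rmod_single)
      then show ?thesis
        using False by (simp add: py_monom bb_def mon_def i b mult_ac)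
    qed
  qed
  then show ?thesis
    unfolding f by (rule Rmod_sum)
qed

lemma Rmod_T: "z \<in> Rmod \<Longrightarrow> \<exists>m. z \<in> T m"
proof -
  assume "z \<in> Rmod"
  then obtain d where d: "z = (\<Sum>a<q. py (d a) * bb a)" unfolding Rmod_def by blast
  let ?M = "\<Sum>a<q. wt (a, Suc (degree (d a)))"
  have "py (d a) * bb a \<in> T ?M" if "a < q" for a
  proof -
    have dd: "d a = (\<Sum>k\<le>degree (d a). monom (coeff (d a) k) k)"
      by (rule poly_as_sum_of_monoms[symmetric])
    have e: "py (d a) = (\<Sum>k\<le>degree (d a). \<c> (coeff (d a) k) * yf ^ k)"
      by (subst dd) (simp only: py_sum py_monom)
    have "\<c> (coeff (d a) k) * yf ^ k * bb a \<in> Sp (Ai ?M)" if "k \<le> degree (d a)" for k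
    proof -
      have "wt (a, Suc k) \<le> wt (a, Suc (degree (d a)))"
        using that by (simp add: wt_def)
      also have "\<dots> \<le> ?M"
        using \<open>a < q\<close> by (intro member_le_sum) auto
      finally have w: "wt (a, Suc k) \<le> ?M" .
      have i: "(if a = 0 then (0, k) else (a, Suc k)) \<in> Ai ?M"
      proof (cases "a = 0")
        case True
        with w show ?thesis by (simp add: Ai_def wt_def)
      next
        case False
        have "a \<le> (q - 1) * Suc k" using \<open>a < q\<close> by simp
        with w False show ?thesis by (simp add: Ai_def)
      qed
      have "yf ^ k * bb a = mon (if a = 0 then (0, k) else (a, Suc k))"
        by (simp add: bb_def mon_def mult_ac)
      then have "\<c> (coeff (d a) k) * yf ^ k * bb a = \<c> (coeff (d a) k) * mon (if a = 0 then (0, k) else (a, Suc k))"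
        by (simp only: mult.assoc)
      then show ?thesis
        using Sp_cmult[OF Sp_mon[OF finite_Ai i]] by (simp only:)
    qed
    then show ?thesis
      unfolding T_def e sum_distrib_right by (intro Sp_sum) blast
  qed
  then have "z \<in> T ?M"
    unfolding d T_def by (intro Sp_sum) blast
  then show ?thesis by blast
qed

text \<open>The constant term is the value at v of a multiple of u, hence 0; then one factor u is
  cancelled on both sides.\<close>

lemma uniformizer_poly:
  fixes v :: "'a ^ 3"
  assumes v: "on_curve v" and u: "uni v u" "u \<noteq> 0"
  shows "(\<Sum>j<n. \<c> (f j) * u ^ j) = u ^ n * t \<Longrightarrow> t \<in> Ol v \<Longrightarrow> j < n \<Longrightarrow> f j = 0"
proof (induction n arbitrary: f j)
  case (Suc n)
  have uO: "u \<in> Ol v" "ev v u = 0" using uni_ev[OF v u(1)] by simp_all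
  have split: "(\<Sum>j<Suc n. \<c> (f j) * u ^ j) = \<c> (f 0) + u * (\<Sum>j<n. \<c> (f (Suc j)) * u ^ j)"
    unfolding sum.lessThan_Suc_shift sum_distrib_left by (simp add: mult_ac)
  have S: "(\<Sum>j<n. \<c> (f (Suc j)) * u ^ j) \<in> Ol v"
    by (intro Ol_sum[OF v] Ol_mult[OF v] Ol_const[OF v] Ol_power[OF v] uO(1))
  have "ev v (\<c> (f 0) + u * (\<Sum>j<n. \<c> (f (Suc j)) * u ^ j)) = f 0"
    using ev_add[OF v Ol_const[OF v] Ol_mult[OF v uO(1) S]] ev_mult[OF v uO(1) S] uO(2) ev_const[OF v] by simp
  moreover have "ev v (u ^ Suc n * t) = 0"
    using ev_mult[OF v Ol_power[OF v uO(1), of "Suc n"] Suc.prems(2)] ev_power[OF v uO(1), of "Suc n"] uO(2) by simp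
  ultimately have f0: "f 0 = 0"
    using Suc.prems(1) unfolding split by simp
  with Suc.prems(1) have "u * (\<Sum>j<n. \<c> (f (Suc j)) * u ^ j) = u * (u ^ n * t)"
    unfolding split by (simp add: mult_ac)
  then have "(\<Sum>j<n. \<c> (f (Suc j)) * u ^ j) = u ^ n * t"
    using u(2) by simp
  from Suc.IH[OF this Suc.prems(2)] have "f (Suc i) = 0" if "i < n" for i
    using that by blast
  with f0 Suc.prems(3) show ?case
    by (cases j) auto
qed simp

text \<open>The polynomial in x has the constant derivative t2, since q is 0 in the field, so its q
  roots are distinct.\<close>

lemma fibre_card:
  assumes "y \<noteq> 0"
  shows "card {x. \<tau> * y * x ^ q + t2 * x + y ^ q = 0} = q"
proof -
  let ?P = "monom (\<tau> * y) q + [:y ^ q, t2:] :: 'a poly"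
  have "coeff ?P q = \<tau> * y"
    using q2 by (simp add: coeff_pCons split: nat.split)
  with assms have "coeff ?P q \<noteq> 0"
    by simp
  then have nz: "?P \<noteq> 0"
    by (metis coeff_0)
  have deg: "degree ?P = q"
    using assms q2 by (subst degree_add_eq_left) (auto simp: degree_monom_eq)
  have "of_nat q = (0 :: 'a)"
    unfolding q_def using CH e of_nat_CHAR[where 'a = 'a] by (simp add: power_0_left)
  then have "poly (pderiv ?P) x = t2" for x
    by (simp add: pderiv_add pderiv_monom pderiv_pCons poly_monom)
  then have "card {x. poly ?P x = 0} = degree ?P"
    using nz by (intro card_roots_separable) simp_all
  moreover have "poly ?P x = \<tau> * y * x ^ q + t2 * x + y ^ q" for x
    by (simp add: poly_monom algebra_simps)
  ultimately show ?thesis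
    by (simp only: deg)
qed

text \<open>The denominator is removed one linear factor \<open>y - y\<^sub>0\<close> at a time: for \<open>y\<^sub>0 \<noteq> 0\<close> the \<open>q\<close> distinct
  points over \<open>y\<^sub>0\<close> show that all coefficients of the numerator vanish at \<open>y\<^sub>0\<close>; for \<open>y\<^sub>0 = 0\<close> the
  points (0 : 0 : 1) and (0 : 1 : 0) do.\<close>

lemma coefficients_vanish:
  assumes reg: "\<And>v :: 'a ^ 3. on_curve v \<Longrightarrow> v $ 3 \<noteq> 0 \<or> v = E2 \<Longrightarrow> g \<in> Ol v"
    and eq: "(yf - \<c> y0) * g = (\<Sum>a<q. py (d a) * bb a)" and a: "a < q"
  shows "poly (d a) y0 = 0"
proof (cases "y0 = 0")
  case False
  \<comment> \<open>Over y0 the right-hand side becomes this polynomial in x of degree below q; the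
    factor \<open>yf - \<c> y0\<close> on the left makes it vanish at the q points of the
    fibre.\<close>
  let ?S = "\<Sum>a<q. monom (if a = 0 then poly (d 0) y0 else y0 * poly (d a) y0) a"
  let ?X = "{x. \<tau> * y0 * x ^ q + t2 * x + y0 ^ q = 0}"
  have roots: "poly ?S x = 0" if "x \<in> ?X" for x
  proof -
    let ?v = "vector [y0, x, 1] :: 'a ^ 3"
    have v: "on_curve ?v" "?v $ 3 \<noteq> 0"
      using that by (simp_all add: on_curve_affine)
    note A = affine_Ol[OF v]
    have py: "py P \<in> Ol ?v" "ev ?v (py P) = poly P y0" for P
      using py_ev[OF v(1) A(2)] A(4) by simp_all
    have bb: "bb a \<in> Ol ?v" "ev ?v (bb a) = (if a = 0 then 1 else y0 * x ^ a)" for a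
    proof -
      show "bb a \<in> Ol ?v"
        unfolding bb_def using Ol_1[OF v(1)] Ol_mult[OF v(1) A(2) Ol_power[OF v(1) A(1)]] by simp
      show "ev ?v (bb a) = (if a = 0 then 1 else y0 * x ^ a)"
        unfolding bb_def using ev_1[OF v(1)] ev_mult[OF v(1) A(2) Ol_power[OF v(1) A(1)]]
          ev_power[OF v(1) A(1)] A(3,4) by simp
    qed
    have "ev ?v (\<Sum>a<q. py (d a) * bb a) = (\<Sum>a<q. poly (d a) y0 * (if a = 0 then 1 else y0 * x ^ a))"
      using ev_sum[OF v(1), of "{..<q}" "\<lambda>a. py (d a) * bb a"] Ol_mult[OF v(1) py(1) bb(1)]
        ev_mult[OF v(1) py(1) bb(1)] py(2) bb(2) by (simp only:)
    also have "\<dots> = poly ?S x"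
      by (simp only: poly_sum poly_monom) (intro sum.cong, auto)
    finally have "poly ?S x = ev ?v ((yf - \<c> y0) * g)"
      unfolding eq ..
    also have "\<dots> = ev ?v (yf - \<c> y0) * ev ?v g"
      using ev_mult[OF v(1) Ol_diff[OF v(1) A(2) Ol_const[OF v(1)]]] reg v by blast
    also have "ev ?v (yf - \<c> y0) = 0"
      using ev_diff[OF v(1) A(2) Ol_const[OF v(1)]] A(4) ev_const[OF v(1)] by simp
    finally show ?thesis by simp
  qed
  have deg: "degree ?S < q"
  proof -
    have "degree ?S \<le> q - 1"
      by (intro degree_sum_le) (auto intro: order_trans[OF degree_monom_le])
    with q2 show ?thesis by simp
  qed
  have "?S = 0"
  proof (rule ccontr)
    assume nz: "?S \<noteq> 0"
    have "card ?X \<le> card {x. poly ?S x = 0}"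
      using roots poly_roots_finite[OF nz] by (intro card_mono) auto
    also have "\<dots> \<le> degree ?S"
      by (rule card_poly_roots_bound[OF nz])
    finally show False
      using fibre_card[OF False] deg by simp
  qed
  then have "coeff ?S a = 0" by simp
  then have "(if a = 0 then poly (d 0) y0 else y0 * poly (d a) y0) = 0"
    using a by (simp add: coeff_sum)
  then show ?thesis
    using False by (auto split: if_splits)
next
  case True
  have eq: "yf * g = (\<Sum>a<q. py (d a) * bb a)"
    using eq by (simp add: True)
  have "\<exists>d'. \<forall>a. d a = pCons (poly (d a) 0) (d' a)"
    by (intro choice allI) (metis poly_0_coeff_0 coeff_pCons_0 pCons_cases)
  then obtain d' where d': "\<And>a. d a = pCons (poly (d a) 0) (d' a)" by blast
  define c where "c a = poly (d a) 0" for a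
  have py_d: "py (d a) = \<c> (c a) + yf * py (d' a)" for a
    unfolding c_def by (subst d') (rule py_pCons)
  have q0: "{..<q} = insert 0 {1..<q}" using q2 by auto
  \<comment> \<open>At (0 : 0 : 1) the left-hand side and all terms on the right except
    \<open>d 0\<close> carry the factor y, which vanishes there.\<close>
  have c0: "c 0 = 0"
  proof -
    let ?v = "vector [0, 0, 1] :: 'a ^ 3"
    have v: "on_curve ?v" "?v $ 3 \<noteq> 0"
      using q2 by (simp_all add: on_curve_affine power_0_left)
    note A = affine_Ol[OF v]
    have y: "ev ?v yf = 0" using A(4) by simp
    have py: "py P \<in> Ol ?v" for P using py_ev[OF v(1) A(2)] by blast
    have t: "py (d a) * xf ^ a \<in> Ol ?v" for a
      by (intro Ol_mult[OF v(1)] py Ol_power[OF v(1)] A(1))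
    have R: "(\<Sum>a=1..<q. py (d a) * xf ^ a) \<in> Ol ?v"
      by (intro Ol_sum[OF v(1)] t)
    have "(\<Sum>a<q. py (d a) * bb a) = py (d 0) + yf * (\<Sum>a=1..<q. py (d a) * xf ^ a)"
      unfolding q0 sum_distrib_left by (simp add: bb_def mult_ac)
    then have "ev ?v (\<Sum>a<q. py (d a) * bb a) = ev ?v (py (d 0)) + ev ?v yf * ev ?v (\<Sum>a=1..<q. py (d a) * xf ^ a)"
      using ev_add[OF v(1) py Ol_mult[OF v(1) A(2) R]] ev_mult[OF v(1) A(2) R] by (simp only:)
    moreover have "ev ?v (yf * g) = ev ?v yf * ev ?v g"
      using reg v by (intro ev_mult[OF v(1) A(2)]) blast
    ultimately have "ev ?v (py (d 0)) = 0"
      using y unfolding eq by simp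
    then show ?thesis
      using py_ev[OF v(1) A(2), of "d 0"] y by (simp add: c_def)
  qed
  let ?v = E2 and ?u = "upar E2 2"
  note v = on_curve_E2
  have v123: "E2 $ 2 \<noteq> 0" "E2 $ 3 = 0" "E2 $ 1 = 0" by (simp_all add: E2_def)
  have u: "?u \<in> Ol ?v" using upar_Ol[OF v v123(1)] by simp
  obtain \<epsilon> where \<epsilon>: "\<epsilon> \<in> units ?v" "yf = ?u ^ (q - 1) * \<epsilon>"
    using at_E2(2)[OF v v123] by blast
  have \<epsilon>O: "\<epsilon> \<in> Ol ?v" and \<epsilon>0: "\<epsilon> \<noteq> 0"
    using \<epsilon>(1) units_nz[OF v] by (simp_all add: units_def[OF v])
  have yO: "yf \<in> Ol ?v"
    unfolding \<epsilon>(2) by (intro Ol_mult[OF v] Ol_power[OF v] u \<epsilon>O)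
  have bbu: "bb a = ?u ^ (q - 1 - a) * \<epsilon>" if "1 \<le> a" "a < q" for a
  proof -
    have "bb a = (inverse ?u ^ a * ?u ^ (q - 1)) * \<epsilon>"
      using that by (simp add: bb_def at_E2(1)[OF v v123] \<epsilon>(2) mult_ac)
    also have "inverse ?u ^ a * ?u ^ (q - 1) = ?u ^ (q - 1 - a)"
      using that by (intro power_cancel_inverse upar_nz) simp
    finally show ?thesis .
  qed
  have bbO: "bb a \<in> Ol ?v" if "a < q" for a
  proof (cases "a = 0")
    case True
    then show ?thesis by (simp add: bb_def Ol_1[OF v])
  next
    case False
    then have "bb a = ?u ^ (q - 1 - a) * \<epsilon>" using that by (intro bbu) simp_all
    then show ?thesis by (simp only:) (intro Ol_mult[OF v] Ol_power[OF v] u \<epsilon>O)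
  qed
  \<comment> \<open>In terms of t, which is regular at (0 : 1 : 0), the constant terms satisfy
    \<open>\<Sum> c_a y x^a = y t\<close>. Divided by a unit, the left side is a polynomial in the
    parameter of degree below q - 1 and the right side is divisible by its power q - 1.\<close>
  define t where "t = g - (\<Sum>a<q. py (d' a) * bb a)"
  have tO: "t \<in> Ol ?v"
    unfolding t_def using reg[OF v] py_ev[OF v yO] bbO
    by (intro Ol_diff[OF v] Ol_sum[OF v] Ol_mult[OF v]) auto
  have "yf * g = (\<Sum>a<q. \<c> (c a) * bb a) + yf * (\<Sum>a<q. py (d' a) * bb a)"
    unfolding eq py_d distrib_right sum.distrib sum_distrib_left by (simp only: mult.assoc)
  then have "(\<Sum>a<q. \<c> (c a) * bb a) = yf * t"
    unfolding t_def right_diff_distrib by simp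
  moreover have "(\<Sum>a<q. \<c> (c a) * bb a) = (\<Sum>a=1..<q. \<c> (c a) * bb a)"
    unfolding q0 by (simp add: c0)
  moreover have "(\<Sum>a=1..<q. \<c> (c a) * bb a) = (\<Sum>a=1..<q. \<c> (c a) * ?u ^ (q - 1 - a)) * \<epsilon>"
    unfolding sum_distrib_right by (rule sum.cong) (simp_all add: bbu mult.assoc)
  moreover have "(\<Sum>a=1..<q. \<c> (c a) * ?u ^ (q - 1 - a)) = (\<Sum>j<q - 1. \<c> (c (q - 1 - j)) * ?u ^ j)"
    by (rule sum.reindex_bij_witness[of _ "\<lambda>j. q - 1 - j" "\<lambda>a. q - 1 - a"]) auto
  ultimately have "(\<Sum>j<q - 1. \<c> (c (q - 1 - j)) * ?u ^ j) * \<epsilon> = (?u ^ (q - 1) * t) * \<epsilon>"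
    unfolding \<epsilon>(2) by (simp only: mult_ac)
  then have "(\<Sum>j<q - 1. \<c> (c (q - 1 - j)) * ?u ^ j) = ?u ^ (q - 1) * t"
    using \<epsilon>0 by simp
  from uniformizer_poly[OF v uni_upar[OF v v123(1)] upar_nz this tO]
  have cz: "c (q - 1 - j) = 0" if "j < q - 1" for j using that by blast
  have "c a = 0"
  proof (cases "a = 0")
    case False
    with a cz[of "q - 1 - a"] show ?thesis by simp
  qed (simp add: c0)
  then show ?thesis
    by (simp add: c_def True)
qed

lemma regular_Rmod:
  assumes reg: "\<And>v :: 'a ^ 3. on_curve v \<Longrightarrow> v $ 3 \<noteq> 0 \<or> v = E2 \<Longrightarrow> h \<in> Ol v"
  shows "P \<noteq> 0 \<Longrightarrow> h * py P \<in> Rmod \<Longrightarrow> h \<in> Rmod"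
proof (induction "degree P" arbitrary: P)
  case 0
  then obtain a where P: "P = [:a:]" "a \<noteq> 0"
    by (cases P) (auto split: if_splits)
  obtain d where d: "h * py P = (\<Sum>a<q. py (d a) * bb a)" using 0 unfolding Rmod_def by blast
  have "\<c> (1 / a) * \<c> a = 1"
    unfolding c_simps(4)[symmetric] using P(2) by simp
  then have "h = \<c> (1 / a) * (h * py P)"
    by (simp only: P(1) py_const mult.assoc[symmetric] mult.commute[of _ h] mult_1_right) (simp only: mult.assoc mult_1_right)
  also have "\<dots> = (\<Sum>i<q. py (Polynomial.smult (1 / a) (d i)) * bb i)"
    unfolding d sum_distrib_left py_smult by (simp only: mult.assoc)
  finally show ?case
    unfolding Rmod_def by (intro CollectI exI[of _ "\<lambda>i. Polynomial.smult (1 / a) (d i)"]) simp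
next
  case (Suc n)
  then obtain y0 where "poly P y0 = 0"
    using alg_closed_imp_poly_has_root[of P] by auto
  then obtain P' where P': "P = [:- y0, 1:] * P'"
    by (auto simp: poly_eq_0_iff_dvd)
  have P'0: "P' \<noteq> 0" using P' Suc.prems by auto
  have deg: "degree P = Suc (degree P')"
    unfolding P' by (subst degree_mult_eq) (use P'0 in auto)
  obtain d where d: "h * py P = (\<Sum>a<q. py (d a) * bb a)" using Suc.prems(2) unfolding Rmod_def by blast
  have eq: "(yf - \<c> y0) * (h * py P') = (\<Sum>a<q. py (d a) * bb a)"
    unfolding d[symmetric] P' py_mult py_linear by (simp only: mult_ac)
  have yE2: "yf \<in> Ol E2"
  proof -
    have v123: "E2 $ 2 \<noteq> 0" "E2 $ 3 = 0" "E2 $ 1 = 0" by (simp_all add: E2_def)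
    obtain \<epsilon> where \<epsilon>: "\<epsilon> \<in> units E2" "yf = upar E2 2 ^ (q - 1) * \<epsilon>"
      using at_E2(2)[OF on_curve_E2 v123] by blast
    then have "\<epsilon> \<in> Ol E2" by (simp add: units_def[OF on_curve_E2])
    then show ?thesis
      unfolding \<epsilon>(2) using upar_Ol[OF on_curve_E2 v123(1)]
      by (intro Ol_mult[OF on_curve_E2] Ol_power[OF on_curve_E2]) blast+
  qed
  have reg': "h * py P' \<in> Ol v" if v: "on_curve v" and "v $ 3 \<noteq> 0 \<or> v = E2" for v :: "'a ^ 3"
  proof -
    have "yf \<in> Ol v" using that yE2 affine_Ol(2)[OF v] by blast
    then show ?thesis using py_ev[OF v] reg[OF that] by (intro Ol_mult[OF v]) blast+
  qed
  have "\<exists>d'. \<forall>a\<in>{..<q}. d a = [:- y0, 1:] * d' a"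
    using coefficients_vanish[OF reg' eq] by (intro bchoice ballI) (simp add: poly_eq_0_iff_dvd dvd_def)
  then obtain d' where d': "\<And>a. a < q \<Longrightarrow> d a = [:- y0, 1:] * d' a" by blast
  have "(yf - \<c> y0) * (h * py P') = (\<Sum>a<q. py ([:- y0, 1:] * d' a) * bb a)"
    unfolding eq by (rule sum.cong) (simp_all only: d' lessThan_iff)
  also have "\<dots> = (yf - \<c> y0) * (\<Sum>a<q. py (d' a) * bb a)"
    unfolding py_mult py_linear sum_distrib_left by (simp only: mult.assoc)
  finally have "h * py P' = (\<Sum>a<q. py (d' a) * bb a)"
    using \<xi>_ratio_not_const[of 3 y0] by (simp add: yf_def numeral_mod_3)
  then have "h * py P' \<in> Rmod"
    unfolding Rmod_def by blast
  with Suc.hyps(1)[of P'] Suc.hyps(2) deg P'0 show ?case by simp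
qed

text \<open>On \<open>Bi M\<close> the orders are distinct, so a bound for the order of z bounds the
  weight of every monomial that occurs in it.\<close>

lemma T_subdegree:
  assumes "z \<in> T M" "- int m \<le> fls_subdegree z"
  shows "z \<in> T m"
proof -
  obtain f where f: "z = (\<Sum>i\<in>Bi M. \<c> (f i) * mon i)" using assms(1) unfolding T_eq by (rule SpE)
  have "\<c> (f i) * mon i \<in> T m" if i: "i \<in> Bi M" for i
  proof (cases "f i = 0")
    case True
    then show ?thesis by (simp add: T_def Sp_0)
  next
    case False
    have "fls_subdegree z \<le> fls_subdegree (mon i)"
      unfolding f using fls_sum_subdegree[where I = "Bi M" and z = mon and c = f and j = i] inj_wt_Bi i False by simp
    with assms(2) have "wt i \<le> m"
      by (simp add: subdegree_mon)
    with i have "i \<in> Ai m"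
      by (simp add: Bi_def Ai_def)
    then show ?thesis
      unfolding T_def by (intro Sp_cmult Sp_mon finite_Ai)
  qed
  then show ?thesis
    unfolding f T_def by (intro Sp_sum)
qed

text \<open>A norm of the denominator makes h times a polynomial in y a member of
  \<open>Rmod\<close>; \<open>regular_Rmod\<close> removes the polynomial, and the order of the
  Laurent series bounds the weights.\<close>

lemma regular_T:
  assumes "h \<in> K" and reg: "\<And>v :: 'a ^ 3. on_curve v \<Longrightarrow> v $ 3 \<noteq> 0 \<or> v = E2 \<Longrightarrow> h \<in> Ol v"
    and "- int m \<le> fls_subdegree h"
  shows "h \<in> T m"
proof -
  obtain A B d where AB: "homogeneous d A" "homogeneous d B" "\<phi> B \<noteq> 0" "h = \<phi> A / \<phi> B"
    using assms(1) by (rule K_E)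
  have "\<phi> B / \<xi> 3 ^ d * yf ^ d \<noteq> 0"
    using AB(3) by simp
  from norm_exists[OF form_T[OF AB(2)] this] obtain g P k
    where g: "g \<in> T k" "P \<noteq> 0" "\<phi> B / \<xi> 3 ^ d * yf ^ d * g = py P" by blast
  have "h * py P = \<phi> A / \<xi> 3 ^ d * yf ^ d * g"
    unfolding g(3)[symmetric] AB(4) using AB(3) by simp
  then have "h * py P \<in> Rmod"
    using T_Rmod[OF T_mult[OF form_T[OF AB(1)] g(1)]] by (simp only:)
  from Rmod_T[OF regular_Rmod[OF reg g(2) this]] show ?thesis
    using T_subdegree assms(3) by blast
qed

text \<open>The branch is centred at (1 : 0 : 0), so the constant terms of the series are values at
  that point. This links its local ring with the Laurent order.\<close>

lemma \<phi>_fps: "\<exists>f. \<phi> A = fps_to_fls f \<and> fps_nth f 0 = eval_poly A E1"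
proof (induction A rule: poly3_induct)
  case (Const a)
  show ?case
    by (intro exI[of _ "fps_const a"]) simp
next
  case (Var i)
  consider "i = 1" | "i = 2" | "i = 3" using exhaust_3[of i] by blast
  then show ?case
  proof cases
    case 1
    then show ?thesis by (intro exI[of _ 1]) (simp add: \<xi>_simps E1_def)
  next
    case 2
    then show ?thesis by (intro exI[of _ fps_X]) (simp add: \<xi>_simps E1_def)
  next
    case 3
    then show ?thesis
      using q2 by (intro exI[of _ "Abs_fps (zeta_coeff q \<tau> t2)"]) (simp add: \<xi>_simps zeta_def E1_def zeta_coeff.simps[of q \<tau> t2 0])
  qed
next
  case (add A B)
  then obtain f g where fg: "\<phi> A = fps_to_fls f" "fps_nth f 0 = eval_poly A E1" "\<phi> B = fps_to_fls g" "fps_nth g 0 = eval_poly B E1"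
    by blast
  then show ?case by (intro exI[of _ "f + g"]) (simp add: \<phi>_simps eval_poly_simps)
next
  case (mult A B)
  then obtain f g where fg: "\<phi> A = fps_to_fls f" "fps_nth f 0 = eval_poly A E1" "\<phi> B = fps_to_fls g" "fps_nth g 0 = eval_poly B E1"
    by blast
  then show ?case by (intro exI[of _ "f * g"]) (simp add: \<phi>_simps eval_poly_simps fls_times_fps_to_fls)
qed

lemma E1_subdegree:
  assumes "z \<in> Ol E1" "z \<noteq> 0"
  shows "0 \<le> fls_subdegree z"
proof -
  obtain A B d where AB: "homogeneous d A" "homogeneous d B" "eval_poly B E1 \<noteq> 0" "z = \<phi> A / \<phi> B"
    using assms(1) unfolding Ol_def by blast
  obtain f where f: "\<phi> A = fps_to_fls f" using \<phi>_fps[of A] by blast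
  obtain g where g: "\<phi> B = fps_to_fls g" "fps_nth g 0 = eval_poly B E1" using \<phi>_fps[of B] by blast
  have "subdegree g = 0"
    using AB(3) g(2) by (simp add: subdegree_eq_0_iff)
  moreover have "fps_to_fls f \<noteq> 0" "fps_to_fls g \<noteq> 0"
    using assms(2) unfolding AB(4) f g(1) by auto
  ultimately show ?thesis
    unfolding AB(4) f g(1) by (simp add: fls_divide_subdegree fls_subdegree_fls_to_fps)
qed

end

context hermitian_curve
begin

section \<open>The function that vanishes on a Singer orbit\<close>

definition orbit_eq :: "'a \<Rightarrow> bool" where
  "orbit_eq w \<longleftrightarrow> \<tau> * w ^ (q + 1) + t2 * w + 1 = 0"

text \<open>The quotient y^q / x is eliminated by the equation of the curve. As a combination of
  monomials the function lies in \<open>T NN\<close>, for (q - 1, 1) has the weight (q - 1)^2 + q =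
  N, and it can be evaluated also where x = 0.\<close>

definition D0 :: "'a \<Rightarrow> 'a fls" where
  "D0 w = \<c> (1 + w * t2) * mon (0, 0) + \<c> (w * \<tau>) * mon (q - 1, 1)"

lemma orbit_eq_nz: "orbit_eq w \<Longrightarrow> w \<noteq> 0"
  by (auto simp: orbit_eq_def)

lemma NN_gt: "NN > 0"
  by (simp add: NN)

lemma D0_xf: "xf * D0 w = xf - \<c> w * yf ^ q"
proof -
  have "xf * D0 w = xf + \<c> w * (\<c> \<tau> * yf * (xf * xf ^ (q - 1)) + \<c> t2 * xf)"
  proof -
    have "x * ((1 + w * t) * (x ^ 0 * y ^ 0) + (w * s) * (x ^ (q - 1) * y ^ 1)) = x + w * (s * y * (x * x ^ (q - 1)) + t * x)"
      for x y w s t :: "'a fls"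
      by (simp add: algebra_simps)
    then show ?thesis
      unfolding D0_def mon_def c_simps fst_conv snd_conv .
  qed
  also have "xf * xf ^ (q - 1) = xf ^ q"
    using q2 by (cases q) simp_all
  also have "\<c> \<tau> * yf * xf ^ q + \<c> t2 * xf = - (yf ^ q)"
    using xy_eq by (simp add: eq_neg_iff_add_eq_0)
  finally show ?thesis
    by simp
qed

lemma D0_T: "D0 w \<in> T NN"
proof -
  have "(0, 0) \<in> Ai NN" "(q - 1, 1) \<in> Ai NN"
    using q2 by (simp_all add: Ai_def wt_def NN algebra_simps power2_eq_square)
  then show ?thesis
    unfolding D0_def T_def by (intro Sp_add Sp_cmult Sp_mon finite_Ai)
qed

lemma D0_nz: "D0 w \<noteq> 0"
proof
  assume "D0 w = 0"
  then have eq: "xf = \<c> w * yf ^ q"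
    using D0_xf[of w] by simp
  then have "w \<noteq> 0"
    using xf_nz by auto
  then have "fls_subdegree (\<c> w * yf ^ q) = fls_subdegree (mon (0, q))"
    by (simp add: fls_subdegree_mult mon_def)
  moreover have "xf = mon (1, 0)"
    by (simp add: mon_def)
  ultimately have "wt (1, 0) = wt (0, q)"
    using eq subdegree_mon[of "(1, 0)"] subdegree_mon[of "(0, q)"] by simp
  then have "q - 1 = q * q"
    by (simp add: wt_def)
  moreover have "q * 1 \<le> q * q"
    using q2 by (intro mult_left_mono) simp_all
  ultimately show False
    using q2 by linarith
qed

lemma T_subdegree_ge:
  assumes "z \<in> T m" "z \<noteq> 0"
  shows "- int m \<le> fls_subdegree z"
proof -
  obtain f where f: "z = (\<Sum>i\<in>Ai m. \<c> (f i) * mon i)" using assms(1) unfolding T_def by (rule SpE)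
  show ?thesis
  proof (rule fls_subdegree_geI[OF assms(2)])
    fix n assume n: "n < - int m"
    have "fls_nth (\<c> (f i) * mon i) n = 0" if "i \<in> Ai m" for i
    proof -
      have "n < fls_subdegree (mon i)"
        using n that by (simp add: subdegree_mon Ai_def)
      then show ?thesis
        by (simp add: fls_eq0_below_subdegree)
    qed
    then show "fls_nth z n = 0"
      unfolding f fls_nth_sum by (rule sum.neutral[OF ballI])
  qed
qed

lemma xf_K: "xf \<in> K" and yf_K: "yf \<in> K"
  by (simp_all add: xf_def yf_def K_\<xi>)

lemma T_K: "z \<in> T m \<Longrightarrow> z \<in> K"
proof -
  assume "z \<in> T m"
  then obtain f where f: "z = (\<Sum>i\<in>Ai m. \<c> (f i) * mon i)" unfolding T_def by (rule SpE)
  show ?thesis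
    unfolding f mon_def by (intro K_sum K_mult K_const K_power xf_K yf_K)
qed

lemma affine_D0:
  fixes v :: "'a ^ 3"
  assumes v: "on_curve v" "v $ 3 \<noteq> 0"
  shows "D0 w \<in> Ol v" "v $ 2 / v $ 3 * ev v (D0 w) = v $ 2 / v $ 3 - w * (v $ 1 / v $ 3) ^ q"
    "ev v (D0 w) = 1 + w * t2 + w * \<tau> * (v $ 2 / v $ 3) ^ (q - 1) * (v $ 1 / v $ 3)"
proof -
  note A = affine_Ol[OF v]
  show D: "D0 w \<in> Ol v"
    by (rule affine_T[OF v D0_T])
  have y: "yf ^ q \<in> Ol v" using Ol_power[OF v(1) A(2)] .
  have "ev v (xf * D0 w) = ev v (xf - \<c> w * yf ^ q)"
    by (simp only: D0_xf)
  then show "v $ 2 / v $ 3 * ev v (D0 w) = v $ 2 / v $ 3 - w * (v $ 1 / v $ 3) ^ q"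
    using ev_mult[OF v(1) A(1) D] ev_diff[OF v(1) A(1) Ol_mult[OF v(1) Ol_const[OF v(1)] y]]
      ev_mult[OF v(1) Ol_const[OF v(1)] y] ev_const[OF v(1)] ev_power[OF v(1) A(2)] A(3,4) by simp
  note O = Ol_mult[OF v(1)] Ol_power[OF v(1)] Ol_const[OF v(1)] A(1,2)
  have "ev v (D0 w) = (1 + w * t2) * (ev v xf ^ 0 * ev v yf ^ 0) + w * \<tau> * (ev v xf ^ (q - 1) * ev v yf ^ 1)"
    unfolding D0_def mon_def fst_conv snd_conv
    by (simp only: ev_add[OF v(1)] ev_mult[OF v(1)] ev_power[OF v(1)] ev_const[OF v(1)] O)
  then show "ev v (D0 w) = 1 + w * t2 + w * \<tau> * (v $ 2 / v $ 3) ^ (q - 1) * (v $ 1 / v $ 3)"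
    by (simp add: A(3,4) mult.assoc)
qed

text \<open>If D0 vanishes, then x = w y^q by \<open>D0_xf\<close>, and the orbit equation turns the
  constant term 1 + w t2 into - \<tau> w^(q+1), which leads to y^N = w. Conversely x D0 = x - w y^q
  vanishes on the orbit, where x is nonzero.\<close>

lemma D0_zero_iff:
  fixes v :: "'a ^ 3"
  assumes v: "on_curve v" "v $ 3 \<noteq> 0" and w: "orbit_eq w"
  shows "ev v (D0 w) = 0 \<longleftrightarrow> pt v \<in> GG w"
proof -
  define x y where "x = v $ 2 / v $ 3" and "y = v $ 1 / v $ 3"
  have v0: "v \<noteq> 0" using v(1) by (simp add: on_curve_def)
  note D = affine_D0[OF v, of w, folded x_def y_def]
  have w0: "w \<noteq> 0" using orbit_eq_nz[OF w] .
  have we: "1 + w * t2 = - (\<tau> * w ^ (q + 1))"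
    using w by (simp add: orbit_eq_def eq_neg_iff_add_eq_0 add_ac mult_ac)
  have qs: "z * z ^ (q - 1) = z ^ q" "z ^ (q - 1) * z = z ^ q" for z :: 'a
    using q2 by (cases q; simp add: mult.commute)+
  show ?thesis
  proof
    assume 0: "ev v (D0 w) = 0"
    then have xx: "x = w * y ^ q"
      using D(2) by simp
    have "w * \<tau> * x ^ (q - 1) * y = \<tau> * w ^ (q + 1)"
      using 0 unfolding D(3) we by simp
    then have "(w * \<tau>) * (x ^ (q - 1) * y) = (w * \<tau>) * w ^ q"
      by (simp add: mult_ac)
    then have "x ^ (q - 1) * y = w ^ q"
      using w0 by simp
    then have "w ^ (q - 1) * (y ^ (q * (q - 1)) * y) = w ^ (q - 1) * w"
      unfolding xx power_mult_distrib power_mult[symmetric] qs by (simp only: mult.assoc)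
    then have "y ^ (q * (q - 1)) * y = w"
      using w0 by simp
    moreover have "y ^ NN = y ^ (q * (q - 1)) * y"
      unfolding NN by (simp add: mult.commute)
    ultimately show "pt v \<in> GG w"
      unfolding GG_iff[OF v0, folded x_def y_def] using v(2) xx by simp
  next
    assume "pt v \<in> GG w"
    then have xy: "y ^ NN = w" "x = w * y ^ q"
      unfolding GG_iff[OF v0, folded x_def y_def] by simp_all
    then have "y \<noteq> 0"
      using w0 NN_gt by (auto simp: power_0_left)
    then have "x \<noteq> 0" using xy(2) w0 by simp
    have "x * ev v (D0 w) = 0"
      using D(2) xy(2) by (simp only: diff_self)
    then show "ev v (D0 w) = 0"
      using \<open>x \<noteq> 0\<close> by (metis mult_eq_0_iff)
  qed
qed

lemma GG_x_nz:
  fixes v :: "'a ^ 3"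
  assumes "on_curve v" "pt v \<in> GG w" "w \<noteq> 0"
  shows "v $ 3 \<noteq> 0" "v $ 1 / v $ 3 \<noteq> 0" "v $ 2 / v $ 3 \<noteq> 0" "v $ 2 / v $ 3 = w * (v $ 1 / v $ 3) ^ q"
proof -
  have v0: "v \<noteq> 0" using assms(1) by (simp add: on_curve_def)
  have xy: "v $ 3 \<noteq> 0" "(v $ 1 / v $ 3) ^ NN = w" "v $ 2 / v $ 3 = w * (v $ 1 / v $ 3) ^ q"
    using assms(2) unfolding GG_iff[OF v0] by simp_all
  then show "v $ 3 \<noteq> 0" "v $ 2 / v $ 3 = w * (v $ 1 / v $ 3) ^ q" by simp_all
  show y: "v $ 1 / v $ 3 \<noteq> 0"
  proof
    assume "v $ 1 / v $ 3 = 0"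
    then have "w = 0" using xy(2)[symmetric] NN_gt by (simp only: power_0_left) simp
    with assms(3) show False by simp
  qed
  show "v $ 2 / v $ 3 \<noteq> 0"
    using y assms(3) unfolding xy(3) by simp
qed

text \<open>A simple pole of z on the orbit is cancelled by the zero of D0; at (0 : 1 : 0) both
  factors are regular, and at (1 : 0 : 0) only D0 has a pole, of order at most N.\<close>

lemma RR_forward:
  assumes w: "orbit_eq w" and z: "z \<in> K" "z \<noteq> 0"
    and cond: "\<And>(v :: 'a ^ 3) k. on_curve v \<Longrightarrow> chart v k \<Longrightarrow> (if pt v \<in> GG w then upar v k * z else z) \<in> Ol v"
  shows "z * D0 w \<in> T NN"
proof (rule regular_T)
  show "z * D0 w \<in> K"
    using z(1) T_K[OF D0_T] by (rule K_mult)
next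
  fix v :: "'a ^ 3" assume v: "on_curve v" and v3: "v $ 3 \<noteq> 0 \<or> v = E2"
  have v0: "v \<noteq> 0" using v by (simp add: on_curve_def)
  show "z * D0 w \<in> Ol v"
  proof (cases "v $ 3 = 0")
    case False
    have ch: "chart v 3" using False by (simp add: chart_def)
    note D = affine_D0(1)[OF v False, of w]
    show ?thesis
    proof (cases "pt v \<in> GG w")
      case True
      then have "ev v (D0 w) = 0"
        using D0_zero_iff[OF v False w] by simp
      then obtain r where r: "r \<in> Ol v" "D0 w = upar v 3 * r"
        using uni_upar[OF v False] D unfolding uni_def[OF v] by blast
      have "upar v 3 * z \<in> Ol v"
        using cond[OF v ch] True by simp
      then have "(upar v 3 * z) * r \<in> Ol v"
        using r(1) by (rule Ol_mult[OF v])
      then show ?thesis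
        unfolding r(2) by (simp only: mult_ac)
    next
      case F: False
      then have "z \<in> Ol v" using cond[OF v ch] by simp
      then show ?thesis using D by (rule Ol_mult[OF v])
    qed
  next
    case True
    with v3 have vE: "v = E2" by simp
    have v123: "v $ 2 \<noteq> 0" "v $ 3 = 0" "v $ 1 = 0" by (simp_all add: vE E2_def)
    have "pt v \<notin> GG w"
      unfolding GG_iff[OF v0] using True by simp
    moreover have "chart v 2" using v123 by (simp add: chart_def)
    ultimately have "z \<in> Ol v" using cond[OF v] by (metis (full_types))
    then show ?thesis
      using E2_T[OF v v123 D0_T] by (rule Ol_mult[OF v])
  qed
next
  have E1: "E1 $ 1 = 1" "E1 $ 2 = 0" "E1 $ 3 = 0" by (simp_all add: E1_def)
  have v0: "E1 \<noteq> 0"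
    using E1(1) by (metis zero_index zero_neq_one)
  have v: "on_curve E1"
    using v0 q2 by (simp add: on_curve_def eval_F E1 power_0_left)
  have "chart E1 1" by (simp add: chart_def E1)
  moreover have "pt E1 \<notin> GG w"
    unfolding GG_iff[OF v0] by (simp add: E1)
  ultimately have "z \<in> Ol E1" using cond[OF v] by (metis (full_types))
  then have "0 \<le> fls_subdegree z"
    using z(2) by (rule E1_subdegree)
  moreover have "- int NN \<le> fls_subdegree (D0 w)"
    by (rule T_subdegree_ge[OF D0_T D0_nz])
  ultimately show "- int NN \<le> fls_subdegree (z * D0 w)"
    using z(2) D0_nz by (simp add: fls_subdegree_mult)
qed

text \<open>Division by D0 is controlled at every point: D0 is a unit at the affine points off the
  orbit and at (0 : 1 : 0), has a pole of order exactly N at (1 : 0 : 0), and has simple zeros on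
  the orbit.\<close>

lemma RR_backward:
  fixes v :: "'a ^ 3"
  assumes w: "orbit_eq w" and h: "z * D0 w \<in> T NN" and v: "on_curve v" and k: "chart v k"
  shows "(if pt v \<in> GG w then upar v k * z else z) \<in> Ol v"
  using v k
proof (cases rule: chart_cases)
  case affine
  note hO = affine_T[OF v affine(2) h] and D = affine_D0[OF v affine(2), of w]
  show ?thesis
  proof (cases "pt v \<in> GG w")
    case False
    then have "ev v (D0 w) \<noteq> 0"
      using D0_zero_iff[OF v affine(2) w] by simp
    then have "(z * D0 w) / D0 w \<in> Ol v"
      by (intro Ol_divide[OF v] hO D)
    then show ?thesis
      using False D0_nz[of w] by simp
  next
    case True
    note xy = GG_x_nz[OF v True orbit_eq_nz[OF w]]
    let ?u = "upar v 3"
    obtain r where r: "r \<in> Ol v" "\<xi> (3 + 2) / \<xi> 3 - \<c> (v $ (3 + 2) / v $ 3) = ?u * r"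
      "ev v r = - (tc (3 + 1) * (v $ (3 + 2) / v $ 3) ^ q) / tc (3 + 2)"
      using \<xi>_local_factor[OF v affine(2)] by blast
    have r2: "xf - \<c> (v $ 2 / v $ 3) = ?u * r"
      using r(2) by (simp add: xf_def numeral_mod_3)
    have r3: "ev v r \<noteq> 0"
      using r(3) xy(3) by (simp add: numeral_mod_3)
    have u: "?u = yf - \<c> (v $ 1 / v $ 3)"
      by (simp add: upar_def yf_def numeral_mod_3)
    have uO: "?u \<in> Ol v" "ev v ?u = 0"
      using upar_Ol[OF v affine(2)] by simp_all
    \<comment> \<open>The cofactor in \<open>xf * D0 w = u s\<close>: the summand r comes from x and
      has a nonzero value because x is nonzero at the point; the other comes from y^q and vanishes
      there. So s is a unit and the zero is simple.\<close>
    define s where "s = r - \<c> w * ?u ^ (q - 1)"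
    have sO: "s \<in> Ol v"
      unfolding s_def by (intro Ol_diff[OF v] r(1) Ol_mult[OF v] Ol_const[OF v] Ol_power[OF v] uO(1))
    have "ev v s = ev v r - w * ev v ?u ^ (q - 1)"
    proof -
      have p: "?u ^ (q - 1) \<in> Ol v" by (intro Ol_power[OF v] uO(1))
      show ?thesis
        unfolding s_def using ev_diff[OF v r(1) Ol_mult[OF v Ol_const[OF v] p]] ev_mult[OF v Ol_const[OF v] p]
          ev_const[OF v] ev_power[OF v uO(1)] by simp
    qed
    then have s0: "ev v s \<noteq> 0"
      using r3 q2 uO(2) by (simp add: power_0_left)
    have uq: "?u * ?u ^ (q - 1) = ?u ^ q"
      using q2 by (cases q) simp_all
    have "xf * D0 w = (xf - \<c> (v $ 2 / v $ 3)) - \<c> w * (yf ^ q - \<c> (v $ 1 / v $ 3) ^ q)"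
    proof -
      have "\<c> (v $ 2 / v $ 3) = \<c> w * \<c> (v $ 1 / v $ 3) ^ q"
        unfolding xy(4) c_simps ..
      then show ?thesis
        unfolding D0_xf by (simp only: right_diff_distrib) simp
    qed
    also have "\<dots> = ?u * r - \<c> w * ?u ^ q"
      unfolding r2 u frob_diff_fls ..
    also have "\<dots> = ?u * s"
      unfolding s_def uq[symmetric] by (simp only: right_diff_distrib mult_ac)
    finally have eq: "xf * D0 w = ?u * s" .
    have "s \<noteq> 0" using Ol_nz[OF v sO s0] .
    have "(?u * z) * s = (z * D0 w) * xf"
      using eq by (metis mult.assoc mult.commute)
    then have "?u * z = (z * D0 w) * xf / s"
      using \<open>s \<noteq> 0\<close> by (simp add: eq_divide_eq)
    moreover have "(z * D0 w) * xf / s \<in> Ol v"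
      by (intro Ol_divide[OF v] Ol_mult[OF v] hO affine_Ol(1)[OF v affine(2)] sO s0)
    ultimately show ?thesis
      using True by (simp add: affine(1))
  qed
next
  case E2
  have v0: "v \<noteq> 0" using v by (simp add: on_curve_def)
  have nG: "pt v \<notin> GG w"
    unfolding GG_iff[OF v0] using E2 by simp
  let ?u = "upar v 2"
  obtain \<epsilon> where \<epsilon>: "\<epsilon> \<in> units v" "yf = ?u ^ (q - 1) * \<epsilon>"
    using at_E2(2)[OF v E2(2,3,4)] by blast
  have \<epsilon>O: "\<epsilon> \<in> Ol v" using \<epsilon>(1) by (simp add: units_def[OF v])
  have uO: "?u \<in> Ol v" "ev v ?u = 0" using upar_Ol[OF v E2(2)] by simp_all
  have yO: "yf \<in> Ol v" "ev v yf = 0"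
  proof -
    have p: "?u ^ (q - 1) \<in> Ol v" by (intro Ol_power[OF v] uO(1))
    show "yf \<in> Ol v" unfolding \<epsilon>(2) using p \<epsilon>O by (rule Ol_mult[OF v])
    show "ev v yf = 0"
      unfolding \<epsilon>(2) ev_mult[OF v p \<epsilon>O] ev_power[OF v uO(1)] uO(2) using q2 by (simp add: power_0_left)
  qed
  \<comment> \<open>Here x = 1 / u, so \<open>D0_xf\<close> becomes D0 = 1 - u w y^q, a unit with
    the value 1.\<close>
  have "inverse ?u * D0 w = inverse ?u - \<c> w * yf ^ q"
    using D0_xf[of w] unfolding at_E2(1)[OF v E2(2,3,4)] .
  then have "?u * (inverse ?u * D0 w) = ?u * (inverse ?u - \<c> w * yf ^ q)"
    by (simp only:)
  moreover have "?u * inverse ?u = 1"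
    using upar_nz[of v 2] by simp
  ultimately have D: "D0 w = 1 - ?u * (\<c> w * yf ^ q)"
    by (simp only: right_diff_distrib mult.assoc[symmetric] mult_1_left)
  have t: "\<c> w * yf ^ q \<in> Ol v"
    by (intro Ol_mult[OF v] Ol_const[OF v] Ol_power[OF v] yO(1))
  have "ev v (D0 w) = 1"
    unfolding D using ev_diff[OF v Ol_1[OF v] Ol_mult[OF v uO(1) t]] ev_mult[OF v uO(1) t] uO(2) ev_1[OF v] by simp
  then have "(z * D0 w) / D0 w \<in> Ol v"
    by (intro Ol_divide[OF v] E2_T[OF v E2(2,3,4) h] E2_T[OF v E2(2,3,4) D0_T]) simp
  then show ?thesis
    using nG D0_nz[of w] by simp
next
  case E1
  have v0: "v \<noteq> 0" using v by (simp add: on_curve_def)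
  have nG: "pt v \<notin> GG w"
    unfolding GG_iff[OF v0] using E1 by simp
  let ?u = "upar v 1"
  obtain \<epsilon> where \<epsilon>: "\<epsilon> \<in> units v" "yf * ?u ^ q = \<epsilon>" "xf * ?u ^ (q - 1) = \<epsilon>"
    using at_E1[OF v E1(2,3)] by blast
  have \<epsilon>O: "\<epsilon> \<in> Ol v" "ev v \<epsilon> \<noteq> 0" using \<epsilon>(1) by (simp_all add: units_def[OF v])
  have uO: "?u \<in> Ol v" "ev v ?u = 0" using upar_Ol[OF v E1(2)] by simp_all
  \<comment> \<open>The pole orders at (1 : 0 : 0) that meet in \<open>D0_xf\<close>: q^2 for y^q, q
    - 1 for x, N for D0.\<close>
  have e2: "q * q = (q - 1) + NN"
    using q2 unfolding NN by (cases q) simp_all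
  have "(xf * D0 w) * ?u ^ (q * q) = (xf - \<c> w * yf ^ q) * ?u ^ (q * q)"
    by (simp only: D0_xf)
  also have "(xf * D0 w) * ?u ^ (q * q) = (xf * ?u ^ (q - 1)) * (D0 w * ?u ^ NN)"
    unfolding e2 power_add by (simp only: mult_ac)
  also have "(xf - \<c> w * yf ^ q) * ?u ^ (q * q) = (xf * ?u ^ (q - 1)) * ?u ^ NN - \<c> w * (yf * ?u ^ q) ^ q"
    unfolding left_diff_distrib power_mult_distrib power_mult[symmetric] e2 power_add by (simp only: mult.assoc)
  finally have eq: "\<epsilon> * (D0 w * ?u ^ NN) = \<epsilon> * ?u ^ NN - \<c> w * \<epsilon> ^ q"
    unfolding \<epsilon>(2,3) .
  have DO: "D0 w * ?u ^ NN \<in> Ol v"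
    by (rule E1_T[OF v E1(2,3) D0_T])
  have p: "?u ^ NN \<in> Ol v" "\<epsilon> ^ q \<in> Ol v" by (intro Ol_power[OF v] uO(1) \<epsilon>O(1))+
  have "ev v \<epsilon> * ev v (D0 w * ?u ^ NN) = ev v (\<epsilon> * ?u ^ NN - \<c> w * \<epsilon> ^ q)"
    unfolding eq[symmetric] ev_mult[OF v \<epsilon>O(1) DO] ..
  also have "\<dots> = ev v \<epsilon> * ev v ?u ^ NN - w * ev v \<epsilon> ^ q"
    using ev_diff[OF v Ol_mult[OF v \<epsilon>O(1) p(1)] Ol_mult[OF v Ol_const[OF v] p(2)]]
      ev_mult[OF v \<epsilon>O(1) p(1)] ev_mult[OF v Ol_const[OF v] p(2)] ev_const[OF v]
      ev_power[OF v uO(1)] ev_power[OF v \<epsilon>O(1)] by simp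
  also have "\<dots> \<noteq> 0"
    using uO(2) NN_gt \<epsilon>O(2) orbit_eq_nz[OF w] by (simp add: power_0_left)
  finally have D0e: "ev v (D0 w * ?u ^ NN) \<noteq> 0"
    by auto
  have "(z * D0 w) * ?u ^ NN / (D0 w * ?u ^ NN) \<in> Ol v"
    by (intro Ol_divide[OF v] E1_T[OF v E1(2,3)] h DO D0e)
  moreover have "(z * D0 w) * ?u ^ NN / (D0 w * ?u ^ NN) = z"
    using D0_nz[of w] upar_nz[of v 1] by simp
  ultimately show ?thesis
    using nG by simp
qed

theorem RR_condition:
  assumes w: "orbit_eq w" and z: "z \<in> K" "z \<noteq> 0"
  shows "(\<forall>P. 0 \<le> divisor_of F (cls z) P + sum_of_points (GG w) P) \<longleftrightarrow> z * D0 w \<in> T NN"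
  unfolding divisor_condition_iff[OF z]
  using RR_forward[OF w z] RR_backward[OF w] by meson

lemma ev_quotient:
  fixes v :: "'a ^ 3"
  assumes w: "orbit_eq w" and h: "z * D0 w \<in> T NN" and v: "on_curve v" "v $ 3 \<noteq> 0" "pt v \<notin> GG w"
  shows "z \<in> Ol v" "ev v (D0 w) \<noteq> 0" "ev v z = ev v (z * D0 w) / ev v (D0 w)"
proof -
  note D = affine_D0(1)[OF v(1,2), of w] and hO = affine_T[OF v(1,2) h]
  show D0: "ev v (D0 w) \<noteq> 0"
    using D0_zero_iff[OF v(1,2) w] v(3) by simp
  have eq: "(z * D0 w) / D0 w = z"
    using D0_nz[of w] by simp
  show "z \<in> Ol v" "ev v z = ev v (z * D0 w) / ev v (D0 w)"
    using Ol_divide[OF v(1) hO D D0] ev_divide[OF v(1) hO D D0] unfolding eq by simp_all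
qed

subsection \<open>The dimension\<close>

text \<open>The weight (q - 1) (a + b) + b is compared with q (q - 1) + 1. For a + b < q it is small
  enough, for a + b = q only b = 1 remains, and a + b > q is too large because q - 1 > 1. The case b
  = 0 forces a = 0.\<close>

lemma Bi_NN: "Bi NN = {(0, 0), (q - 1, 1)} \<union> (\<lambda>(b, a). (a, b)) ` (SIGMA b:{1..<q}. {..<q - b})"
proof (intro equalityI subsetI)
  fix i assume "i \<in> Bi NN"
  then obtain a b where i: "i = (a, b)" "a < q" "a \<le> (q - 1) * b" "(q - 1) * a + q * b \<le> (q - 1) * q + 1"
    by (cases i) (auto simp: Bi_def Ai_def wt_def NN)
  have e: "(q - 1) * a + q * b = (q - 1) * (a + b) + b"
    using q2 by (cases q) (simp_all add: algebra_simps)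
  consider "b = 0" | "b \<ge> 1" "a + b < q" | "b \<ge> 1" "a + b = q" | "a + b > q" by linarith
  then show "i \<in> {(0, 0), (q - 1, 1)} \<union> (\<lambda>(b, a). (a, b)) ` (SIGMA b:{1..<q}. {..<q - b})"
  proof cases
    case 1
    with i show ?thesis by simp
  next
    case 2
    then have "(b, a) \<in> (SIGMA b:{1..<q}. {..<q - b})" by auto
    then show ?thesis unfolding i(1) by (intro UnI2 image_eqI[of _ _ "(b, a)"]) simp_all
  next
    case 3
    then have "b \<le> 1"
      using i(4) unfolding e by simp
    with 3 i show ?thesis by auto
  next
    case 4
    then have "(q - 1) * (q + 1) \<le> (q - 1) * (a + b)"
      by (intro mult_left_mono) simp_all
    then have "(q - 1) * q + (q - 1) \<le> (q - 1) * q + 1"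
      using i(4) unfolding e distrib_left by linarith
    with q2 show ?thesis by simp
  qed
next
  fix i assume "i \<in> {(0, 0), (q - 1, 1)} \<union> (\<lambda>(b, a). (a, b)) ` (SIGMA b:{1..<q}. {..<q - b})"
  then consider "i = (0, 0)" | "i = (q - 1, 1)" | a b where "i = (a, b)" "1 \<le> b" "a + b < q"
    by auto
  then show "i \<in> Bi NN"
  proof cases
    case 1
    then show ?thesis using q2 by (simp add: Bi_def Ai_def wt_def)
  next
    case 2
    have "(q - 1) * (q - 1) + q \<le> (q - 1) * q + 1"
      using q2 by (cases q) simp_all
    with 2 show ?thesis using q2 by (simp add: Bi_def Ai_def wt_def NN)
  next
    case 3
    have e: "(q - 1) * a + q * b = (q - 1) * (a + b) + b"
      using q2 by (cases q) (simp_all add: algebra_simps)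
    have "(q - 1) * (a + b) \<le> (q - 1) * (q - 1)" "b \<le> q - 1"
      using 3 by (auto intro: mult_left_mono)
    moreover have "(q - 1) * (q - 1) + (q - 1) = (q - 1) * q"
      using q2 by (cases q) simp_all
    ultimately have "(q - 1) * a + q * b \<le> (q - 1) * q + 1"
      unfolding e by linarith
    moreover have "a \<le> (q - 1) * 1" "(q - 1) * 1 \<le> (q - 1) * b"
      using 3 by (auto intro: mult_left_mono)
    ultimately have "(q - 1) * a + q * b \<le> (q - 1) * q + 1" "a \<le> (q - 1) * b"
      by linarith+
    then show ?thesis
      using 3 by (simp add: Bi_def Ai_def wt_def NN)
  qed
qed

lemma card_Bi_NN: "card (Bi NN) = (q^2 - q) div 2 + 2"
proof -
  let ?S = "SIGMA b:{1..<q}. {..<q - b}"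
  have inj: "inj_on (\<lambda>(b, a). (a, b)) ?S"
    by (auto simp: inj_on_def)
  have "card ?S = (\<Sum>b\<in>{1..<q}. q - b)"
    by (subst card_SigmaI) auto
  also have "\<dots> = (\<Sum>b\<in>{1..<q}. b)"
    by (rule sum.reindex_bij_witness[of _ "\<lambda>b. q - b" "\<lambda>b. q - b"]) auto
  also have "\<dots> = (\<Sum>b<q. b)"
    by (rule sum.mono_neutral_left) auto
  also have "\<dots> = q * (q - 1) div 2"
    using Sum_Ico_nat[of 0 q] by (simp add: atLeast0LessThan)
  finally have "card ((\<lambda>(b, a). (a, b)) ` ?S) = (q^2 - q) div 2"
    using inj by (simp add: card_image power2_eq_square diff_mult_distrib2)
  moreover have "{(0, 0), (q - 1, 1)} \<inter> (\<lambda>(b, a). (a, b)) ` ?S = {}"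
    by auto
  moreover have "card {(0::nat, 0::nat), (q - 1, 1)} = 2"
    by simp
  moreover have "finite ((\<lambda>(b, a). (a, b)) ` ?S)"
    by auto
  ultimately show ?thesis
    unfolding Bi_NN by (subst card_Un_disjoint) auto
qed

end

no_notation fps_nth (infixl \<open>$\<close> 75)

section \<open>Descent to the subplane\<close>

lemma matrix_vector_3:
  fixes M :: "'b::comm_ring_1 ^ 3 ^ 3"
  shows "(M *v v) $ i = M $ i $ 1 * v $ 1 + M $ i $ 2 * v $ 2 + M $ i $ 3 * v $ 3"
  by (simp add: matrix_vector_mult_def sum_3)

lemma add_1_2_3: "(i::3) + 1 + 2 = i"
  using exhaust_3[of i] by auto

lemma sum_shift_3: "(\<Sum>i\<in>(UNIV::3 set). f (i + 1)) = (\<Sum>i\<in>UNIV. f i)"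
  by (simp add: sum_3 add_ac numeral_mod_3)

definition mapm :: "('b \<Rightarrow> 'b) \<Rightarrow> 'b ^ 3 ^ 3 \<Rightarrow> 'b::comm_ring_1 ^ 3 ^ 3" where
  "mapm h M = (\<chi> i j. h (M $ i $ j))"

definition mapv :: "('b \<Rightarrow> 'b) \<Rightarrow> 'b ^ 3 \<Rightarrow> 'b::comm_ring_1 ^ 3" where
  "mapv h v = (\<chi> i. h (v $ i))"

lemma mapm_mult: "ring_morph h \<Longrightarrow> mapm h (A ** B) = mapm h A ** mapm h B"
  by (simp add: vec_eq_iff mapm_def matrix_matrix_mult_def ring_morph_sum ring_morph_simps)

lemma mapm_one: "ring_morph h \<Longrightarrow> mapm h (mat 1) = mat 1"
  by (auto simp: vec_eq_iff mapm_def mat_def ring_morph_simps)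

lemma mapv_mult: "ring_morph h \<Longrightarrow> mapv h (A *v v) = mapm h A *v mapv h v"
  by (simp add: vec_eq_iff mapm_def mapv_def matrix_vector_mult_def ring_morph_sum ring_morph_simps)

definition map_coeffs :: "('b \<Rightarrow> 'b) \<Rightarrow> 'b poly3 \<Rightarrow> 'b::comm_ring_1 poly3" where
  "map_coeffs h = poly3_eval (\<lambda>a. Const (h a)) Var"

lemma coeffs_in_fixed:
  assumes "h 0 = 0"
  shows "coeffs_in {x. h x = x} A \<longleftrightarrow> map_coeffs h A = A"
proof -
  have "coeffs_in {x. h x = x} A \<longleftrightarrow> (\<forall>m. h (Poly_Mapping.lookup A m) = Poly_Mapping.lookup A m)"
    using assms by (auto simp: coeffs_in_def in_keys_iff)
  also have "\<dots> \<longleftrightarrow> map_coeffs h A = A"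
    by (simp add: poly_mapping_eq_iff fun_eq_iff map_coeffs_def lookup_map_coeffs[of h, OF assms])
  finally show ?thesis .
qed

lemma ring_morph_Const_comp: "ring_morph h \<Longrightarrow> ring_morph (\<lambda>a. Const (h a))"
  using ring_morph_comp[OF ring_morph_Const] by blast

lemma map_coeffs_lin_subst:
  assumes h: "ring_morph h"
  shows "map_coeffs h (lin_subst M A) = lin_subst (mapm h M) (map_coeffs h A)"
proof (rule poly3_eval_unique[of "\<lambda>A. map_coeffs h (lin_subst M A)" "\<lambda>A. lin_subst (mapm h M) (map_coeffs h A)"])
  note c = ring_morph_Const_comp[OF h]
  show "ring_morph (\<lambda>A. map_coeffs h (lin_subst M A))" "ring_morph (\<lambda>A. lin_subst (mapm h M) (map_coeffs h A))"
    unfolding map_coeffs_def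
    by (intro ring_morph_comp[OF ring_morph_poly3_eval[OF c] ring_morph_lin_subst]
       ring_morph_comp[OF ring_morph_lin_subst ring_morph_poly3_eval[OF c]])+
qed (simp_all add: map_coeffs_def ring_morph_Const_comp[OF h] lin_subst_Var mapm_def ring_morph_sum[OF ring_morph_poly3_eval] ring_morph_simps[OF ring_morph_poly3_eval])

lemma lin_subst_scale:
  assumes "homogeneous d A"
  shows "lin_subst (\<chi> i j. k * M $ i $ j) A = Const (k ^ d) * lin_subst M A"
proof -
  have "(\<lambda>i. \<Sum>j\<in>UNIV. Const ((\<chi> i j. k * M $ i $ j) $ i $ j) * Var j)
      = (\<lambda>i. Const k * (\<Sum>j\<in>UNIV. Const (M $ i $ j) * (Var j :: 'a poly3)))"
    by (simp add: fun_eq_iff Const_simps sum_distrib_left mult.assoc)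
  then show ?thesis
    unfolding lin_subst_eq using poly3_eval_scale[OF assms, of Const "Const k"] by (simp add: Const_simps)
qed

lemma PG2I: "v \<noteq> 0 \<Longrightarrow> \<forall>i. v $ i \<in> S \<Longrightarrow> pt v \<in> PG2 S"
  unfolding PG2_def by blast

lemma PG2E:
  assumes "P \<in> PG2 S"
  obtains v where "P = pt v" "v \<noteq> 0" "\<forall>i. v $ i \<in> S"
  using assms unfolding PG2_def mem_Collect_eq by (elim exE conjE) (rule that; assumption)

lemma PG2_rep:
  fixes w :: "'b::field ^ 3"
  assumes "pt w \<in> PG2 S" "w \<noteq> 0"
  shows "\<exists>k a. k \<noteq> 0 \<and> (\<forall>i. a $ i \<in> S) \<and> w = k *s a"
proof -
  obtain v where v: "pt w = pt v" "v \<noteq> 0" "\<forall>i. v $ i \<in> S"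
    using assms(1) by (rule PG2E)
  from pt_eq_iff[OF v(2) assms(2)] v(1) obtain k where "k \<noteq> 0" "w = k *s v"
    by metis
  with v(3) show ?thesis by (intro exI[of _ k] exI[of _ v]) simp
qed

text \<open>The images of the points \<open>e\<^sub>1, e\<^sub>2, e\<^sub>3, e\<^sub>1 + e\<^sub>2 + e\<^sub>3\<close> determine the matrix up to a scalar.\<close>

lemma projectivity_of_subplane:
  fixes T :: "'b::field ^ 3 ^ 3"
  assumes h: "ring_morph h" and inj: "\<And>x. T *v x = 0 \<Longrightarrow> x = 0"
    and T: "\<And>v. v \<noteq> 0 \<Longrightarrow> (\<forall>i. h (v $ i) = v $ i) \<Longrightarrow> pt (T *v v) \<in> PG2 {x. h x = x}"
  shows "\<exists>k T0. k \<noteq> 0 \<and> mapm h T0 = T0 \<and> T = (\<chi> i j. k * T0 $ i $ j)"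
proof -
  note hs = ring_morph_simps[OF h]
  have col: "\<exists>k a. k \<noteq> 0 \<and> (\<forall>i. h (a $ i) = a $ i) \<and> T *v v = k *s a"
    if "v \<noteq> 0" "\<forall>i. h (v $ i) = v $ i" for v
    using PG2_rep[OF T[OF that]] inj[of v] that(1) by auto
  have ax: "axis j 1 \<noteq> (0 :: 'b ^ 3)" "\<forall>i. h ((axis j 1 :: 'b ^ 3) $ i) = axis j 1 $ i" for j :: 3
    by (auto simp: axis_def vec_eq_iff hs)
  have "\<forall>j. \<exists>k a. k \<noteq> 0 \<and> (\<forall>i. h (a $ i) = a $ i) \<and> T *v axis j 1 = k *s a"
    using col[OF ax] by blast
  then obtain l a where la: "\<And>j. l j \<noteq> 0" "\<And>j i. h (a j $ i) = a j $ i" "\<And>j. T *v axis j 1 = l j *s a j"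
    by metis
  have Tij: "T $ i $ j = l j * a j $ i" for i j
  proof -
    have "(T *v axis j 1) $ i = T $ i $ j"
      by (simp add: matrix_vector_mult_def axis_def if_distrib cong: if_cong)
    then show ?thesis unfolding la(3) by simp
  qed
  have one: "(vec 1 :: 'b ^ 3) \<noteq> 0" "\<forall>i. h ((vec 1 :: 'b ^ 3) $ i) = vec 1 $ i"
    by (auto simp: vec_eq_iff hs)
  from col[OF this] obtain k b where kb: "k \<noteq> 0" "\<And>i. h (b $ i) = b $ i" "T *v vec 1 = k *s b"
    by auto
  define m where "m j = l j / k" for j
  have bm: "b $ i = (\<Sum>j\<in>UNIV. m j * a j $ i)" for i
  proof -
    have "k * b $ i = (T *v vec 1) $ i"
      unfolding kb(3) by simp
    also have "\<dots> = (\<Sum>j\<in>UNIV. l j * a j $ i)"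
      by (simp add: matrix_vector_mult_def Tij)
    also have "\<dots> = k * (\<Sum>j\<in>UNIV. m j * a j $ i)"
      using kb(1) by (simp add: m_def sum_distrib_left)
    finally show ?thesis using kb(1) by simp
  qed
  have hm: "h (m j) = m j" for j
  proof -
    \<comment> \<open>Dividing by l turns the columns of T into the fixed vectors a, so T x is the
      difference between the relation for b and its image under h, which is 0.\<close>
    define x where "x = (\<chi> j. (h (m j) - m j) / l j)"
    have "(T *v x) $ i = 0" for i
    proof -
      have "(T *v x) $ i = (\<Sum>j\<in>UNIV. (h (m j) - m j) * a j $ i)"
        using la(1) by (simp add: matrix_vector_mult_def Tij x_def mult.commute)
      also have "\<dots> = h (b $ i) - b $ i"
        unfolding bm ring_morph_sum[OF h] by (simp add: hs la(2) left_diff_distrib sum_subtractf)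
      finally show ?thesis by (simp add: kb(2))
    qed
    then have "x = 0"
      using inj[of x] by (simp add: vec_eq_iff)
    then have "x $ j = 0" by simp
    then show ?thesis
      using la(1)[of j] by (simp add: x_def)
  qed
  let ?T0 = "\<chi> i j. m j * a j $ i"
  have "mapm h ?T0 = ?T0"
    by (simp add: vec_eq_iff mapm_def hs hm la(2))
  moreover have "T = (\<chi> i j. k * ?T0 $ i $ j)"
    using kb(1) by (simp add: vec_eq_iff Tij m_def)
  ultimately show ?thesis
    using kb(1) by blast
qed

context hermitian_curve
begin

lemma frobQ: "ring_morph (\<lambda>x :: 'a. x ^ q^2)"
proof (rule ring_morphI)
  have q2': "x ^ q^2 = (x ^ q) ^ q" for x :: 'a
    by (simp add: power_mult[symmetric] power2_eq_square)
  show "(a + b) ^ q^2 = a ^ q^2 + b ^ q^2" for a b :: 'a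
    unfolding q2' frob ..
  show "(0::'a) ^ q^2 = 0" using q2 by simp
qed (simp_all add: power_mult_distrib)

lemma GF_eq: "GF (q^2) = {x :: 'a. x ^ q^2 = x}"
  by (simp add: GF_def)

section \<open>The Frobenius collineation on forms, vectors and functions\<close>

definition sg :: "'a poly3 \<Rightarrow> 'a poly3" where
  "sg = poly3_eval (\<lambda>a. Const (a ^ q^2)) (\<lambda>i. Var (i + 1))"

lemma ring_morph_ConstQ: "ring_morph (\<lambda>a :: 'a. Const (a ^ q^2))"
  by (rule ring_morph_Const_comp[OF frobQ])

lemma ring_morph_sg: "ring_morph sg"
  unfolding sg_def by (rule ring_morph_poly3_eval[OF ring_morph_ConstQ])

lemmas sg_simps = ring_morph_simps[OF ring_morph_sg]

lemma sg_Const [simp]: "sg (Const a) = Const (a ^ q^2)" and sg_Var [simp]: "sg (Var i) = Var (i + 1)"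
  by (simp_all add: sg_def ring_morph_ConstQ)

lemma homogeneous_sg: "homogeneous d A \<Longrightarrow> homogeneous d (sg A)"
  unfolding sg_def by (intro homogeneous_poly3_eval homogeneous_Var)

text \<open>A lift of the Frobenius collineation of \<Pi> to vectors; \<open>sg\<close> is its
  action on forms.\<close>

definition Phi :: "'a ^ 3 \<Rightarrow> 'a ^ 3" where
  "Phi v = vector [(v $ 3) ^ q^2, (v $ 1) ^ q^2, (v $ 2) ^ q^2]"

lemma Phi_nth: "Phi v $ (i + 1) = (v $ i) ^ q^2"
  using exhaust_3[of i] by (auto simp: Phi_def numeral_mod_3)

lemma eval_sg: "eval_poly (sg A) (Phi v) = eval_poly A v ^ q^2"
proof (rule poly3_eval_unique[of "\<lambda>A. eval_poly (sg A) (Phi v)" "\<lambda>A. eval_poly A v ^ q^2"])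
  show "ring_morph (\<lambda>A. eval_poly (sg A) (Phi v))" "ring_morph (\<lambda>A. eval_poly A v ^ q^2)"
    by (intro ring_morph_comp[OF ring_morph_eval_poly ring_morph_sg] ring_morph_comp[OF frobQ ring_morph_eval_poly])+
qed (simp_all add: Phi_nth)

lemma norm_one_power:
  assumes "(a :: 'a) ^ (1 + q^2 + q^2 * q^2) = 1"
  shows "a ^ q^6 = a"
proof -
  have "q^6 = (1 + q^2 + q^2 * q^2) * (q^2 - 1) + 1"
  proof -
    obtain r where r: "q^2 = Suc r" using q2 by (cases "q^2") auto
    have "q^6 = q^2 * q^2 * q^2" by (simp add: power_add[symmetric])
    then show ?thesis unfolding r by (simp add: algebra_simps)
  qed
  moreover have "a ^ (m * n + 1) = (a ^ m) ^ n * a" for m n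
    by (simp add: power_mult mult.commute)
  ultimately show ?thesis
    by (simp only: assms power_one mult_1)
qed

lemma order_dvd:
  assumes "(a :: 'a) ^ (q^2 + q + 1) = 1"
  shows "a ^ (1 + q^2 + q^2 * q^2) = 1"
proof -
  have e: "1 + q^2 + q^2 * q^2 = (q^2 + q + 1) * NN"
    unfolding NN using q2 by (cases q) (simp_all add: power2_eq_square algebra_simps)
  show ?thesis
    unfolding e power_mult assms by simp
qed

text \<open>The collineation permutes the three terms of the curve cyclically, and the coefficients
  agree after scaling by \<tau> because \<tau>^(1 + q^2 + q^4) = 1. So the curve is
  invariant.\<close>

lemma sg_F: "Const \<tau> * sg F = F"
proof -
  have a: "\<tau> * \<tau> ^ q^2 = t2"
    by (simp add: t2_def)
  have "\<tau> * t2 ^ q^2 = \<tau> ^ (1 + q^2 + q^2 * q^2)"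
    by (simp add: t2_def power_mult_distrib power_add power_mult[symmetric] mult_ac)
  then have b: "\<tau> * t2 ^ q^2 = 1"
    using order_dvd[OF \<tau>] by simp
  have "Const \<tau> * sg F = Const (\<tau> * \<tau> ^ q^2) * Var 2 * Var 3 ^ q + Const (\<tau> * t2 ^ q^2) * Var 3 * Var 1 ^ q + Const \<tau> * Var 1 * Var 2 ^ q"
    unfolding F_eq by (simp add: sg_simps Const_simps(4) numeral_mod_3 distrib_left mult_ac)
  then show ?thesis
    unfolding a b F_eq by (simp add: Const_simps(2) add_ac)
qed

text \<open>Since \<open>sg F\<close> is a scalar multiple of F, the map \<open>sg\<close> descends
  to forms modulo the curve.\<close>

lemma \<phi>_sg_0:
  assumes "homogeneous d A" "\<phi> A = 0"
  shows "\<phi> (sg A) = 0"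
proof -
  obtain k where "A = F * k"
    using \<phi>_eq_0_iff[OF assms(1)] assms(2) by (auto elim: dvdE)
  then have "\<phi> (sg A) = \<phi> (sg F) * \<phi> (sg k)"
    by (simp only: sg_simps \<phi>_simps)
  moreover have "\<phi> (Const \<tau> * sg F) = 0"
    unfolding sg_F \<phi>_F ..
  then have "\<phi> (sg F) = 0"
    unfolding \<phi>_simps by simp
  ultimately show ?thesis by simp
qed

text \<open>Being defined over \<Pi>, expressed without a projectivity;
  \<open>defined_over_Pi_iff\<close> compares it with the original notion.\<close>

definition Pi_rep :: "'a fls \<Rightarrow> bool" where
  "Pi_rep z \<longleftrightarrow> (\<exists>A B d. homogeneous d A \<and> homogeneous d B \<and> \<phi> B \<noteq> 0 \<and> sg A = A \<and> sg B = B \<and> z = \<phi> A / \<phi> B)"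

lemma Pi_rep_K: "Pi_rep z \<Longrightarrow> z \<in> K"
  unfolding Pi_rep_def using K_I by blast

lemma Pi_rep_add:
  assumes "Pi_rep z" "Pi_rep w"
  shows "Pi_rep (z + w)"
proof -
  obtain A B d where 1: "homogeneous d A" "homogeneous d B" "\<phi> B \<noteq> 0" "sg A = A" "sg B = B" "z = \<phi> A / \<phi> B"
    using assms(1) unfolding Pi_rep_def by blast
  obtain C D k where 2: "homogeneous k C" "homogeneous k D" "\<phi> D \<noteq> 0" "sg C = C" "sg D = D" "w = \<phi> C / \<phi> D"
    using assms(2) unfolding Pi_rep_def by blast
  have "z + w = \<phi> (A * D + C * B) / \<phi> (B * D)"
    unfolding 1(6) 2(6) \<phi>_simps using 1(3) 2(3) by (simp add: field_simps)
  moreover have "homogeneous (d + k) (A * D + C * B)" "homogeneous (d + k) (B * D)"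
    using 1 2 homogeneous_mult[OF 2(1) 1(2)] by (auto intro!: homogeneous_add homogeneous_mult simp: add.commute)
  moreover have "sg (A * D + C * B) = A * D + C * B" "sg (B * D) = B * D"
    using 1 2 by (simp_all add: sg_simps)
  moreover have "\<phi> (B * D) \<noteq> 0"
    using 1(3) 2(3) by (simp add: \<phi>_simps)
  ultimately show ?thesis
    unfolding Pi_rep_def by blast
qed

lemma Pi_rep_cmult:
  assumes "Pi_rep z" "a ^ q^2 = a"
  shows "Pi_rep (\<c> a * z)"
proof -
  obtain A B d where 1: "homogeneous d A" "homogeneous d B" "\<phi> B \<noteq> 0" "sg A = A" "sg B = B" "z = \<phi> A / \<phi> B"
    using assms(1) unfolding Pi_rep_def by blast
  have "\<c> a * z = \<phi> (Const a * A) / \<phi> B" "sg (Const a * A) = Const a * A"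
    using 1 assms(2) by (simp_all add: \<phi>_simps sg_simps)
  with 1 homogeneous_cmult[OF 1(1)] show ?thesis
    unfolding Pi_rep_def by blast
qed

lemma Pi_rep_0: "Pi_rep 0"
  unfolding Pi_rep_def
  by (intro exI[of _ 0] exI[of _ 1]) (simp add: \<phi>_simps sg_simps)

text \<open>A numerator and denominator that are fixed by \<open>sg\<close> need not be regular at a given point of the
  subplane, but applying \<open>sg\<close> to a regular representation yields another one.\<close>

lemma Pi_rep_value:
  assumes z: "Pi_rep z" and v: "on_curve v" "Phi v = k *s v" "k \<noteq> 0" and zO: "z \<in> Ol v"
  shows "ev v z ^ q^2 = ev v z"
proof -
  obtain A B d where 1: "homogeneous d A" "homogeneous d B" "\<phi> B \<noteq> 0" "sg A = A" "sg B = B" "z = \<phi> A / \<phi> B"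
    using z unfolding Pi_rep_def by blast
  obtain C D m where 2: "homogeneous m C" "homogeneous m D" "eval_poly D v \<noteq> 0" "\<phi> D \<noteq> 0"
    "z = \<phi> C / \<phi> D" "ev v z = eval_poly C v / eval_poly D v"
    using zO by (rule Ol_E[OF v(1)])
  have "homogeneous (d + m) (A * D - C * B)"
    using homogeneous_diff[OF homogeneous_mult[OF 1(1) 2(2)]] homogeneous_mult[OF 2(1) 1(2)]
    by (simp add: add.commute)
  moreover have "\<phi> (A * D - C * B) = 0"
    using 1(3,6) 2(4,5) by (simp add: \<phi>_simps field_simps)
  ultimately have "\<phi> (sg (A * D - C * B)) = 0"
    by (rule \<phi>_sg_0)
  then have eq: "\<phi> A * \<phi> (sg D) = \<phi> (sg C) * \<phi> B"
    using 1(4,5) by (simp add: sg_simps \<phi>_simps)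
  \<comment> \<open>As v is fixed by \<open>Phi\<close> up to k, the value of \<open>sg E\<close> at
    v is the Frobenius power of the value of E up to k^m, with the same exponent m for numerator and
    denominator.\<close>
  have sgv: "eval_poly (sg E) v * k ^ m = eval_poly E v ^ q^2" if "homogeneous m E" for E
    using eval_sg[of E v] eval_poly_scale[OF homogeneous_sg[OF that], of k v] unfolding v(2)
    by (simp add: mult.commute)
  have Dv: "eval_poly (sg D) v \<noteq> 0"
    using sgv[OF 2(2)] 2(3) by auto
  have "\<phi> (sg D) \<noteq> 0"
    by (rule \<phi>_nz[OF v(1) homogeneous_sg[OF 2(2)] Dv])
  with eq 1(3) have "z = \<phi> (sg C) / \<phi> (sg D)"
    unfolding 1(6) by (simp add: frac_eq_eq)
  then have "ev v z = eval_poly (sg C) v / eval_poly (sg D) v"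
    using ev_eq[OF v(1) homogeneous_sg[OF 2(1)] homogeneous_sg[OF 2(2)] Dv] by simp
  also have "\<dots> = (eval_poly (sg C) v * k ^ m) / (eval_poly (sg D) v * k ^ m)"
    using v(3) by simp
  also have "\<dots> = ev v z ^ q^2"
    unfolding sgv[OF 2(1)] sgv[OF 2(2)] 2(6) power_divide ..
  finally show ?thesis by simp
qed

end

locale singer = hermitian_curve p e q \<tau> for p e q :: nat and \<tau> :: "'a::alg_closed_field" +
  fixes \<beta> :: 'a
  assumes \<beta>_GF: "\<beta> \<in> GF (q^6)" and \<beta>_prim: "primitive_root_of_unity (q^2 - q + 1) \<beta>"
begin

lemma \<beta>_pow: "\<beta> ^ NN = 1" "0 < i \<Longrightarrow> i < NN \<Longrightarrow> \<beta> ^ i \<noteq> 1"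
  using \<beta>_prim by (simp_all add: primitive_root_of_unity_def NN_def)

lemma pow_q6: "x ^ q^6 = ((x ^ q^2) ^ q^2) ^ q^2" for x :: 'a
proof -
  have "q^6 = q^2 * q^2 * q^2" by (simp add: power_add[symmetric])
  then show ?thesis by (simp only: power_mult)
qed

lemma \<beta>6: "((\<beta> ^ q^2) ^ q^2) ^ q^2 = \<beta>"
  using \<beta>_GF pow_q6[of \<beta>] by (simp add: GF_def)

text \<open>As q^2 = N + q - 1, equality would give \<beta>^(q - 2) = 1, which is impossible since 0
  < q - 2 < N.\<close>

lemma \<beta>_ne: "\<beta> ^ q^2 \<noteq> \<beta>"
proof
  assume eq: "\<beta> ^ q^2 = \<beta>"
  have \<beta>0: "\<beta> \<noteq> 0" using \<beta>_pow(1) NN_gt by (auto simp: power_0_left)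
  have "q^2 = NN + (q - 2) + 1"
    unfolding NN_def using q2 self_le_power[of q 2] by simp
  then have "\<beta> ^ (q - 2) * \<beta> = \<beta>"
    using eq \<beta>_pow(1) by (simp add: power_add)
  then have "\<beta> ^ (q - 2) = 1"
    using \<beta>0 by simp
  moreover have "0 < q - 2" "q - 2 < NN"
  proof -
    have "(q - 1) * 1 \<le> (q - 1) * q" using q2 by (intro mult_left_mono) simp_all
    then show "q - 2 < NN" unfolding NN by linarith
  qed (use q2 in simp)
  ultimately show False using \<beta>_pow(2) by blast
qed

lemma frobQ_inj: "x ^ q^2 = y ^ q^2 \<Longrightarrow> x = y" for x y :: 'a
proof -
  assume "x ^ q^2 = y ^ q^2"
  then have "(x - y) ^ q^2 = 0" using ring_morph_simps(6)[OF frobQ, of x y] by simp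
  then show ?thesis using q2 by simp
qed

lemma \<beta>_distinct: "(\<beta> ^ q^2) ^ q^2 \<noteq> \<beta> ^ q^2" "(\<beta> ^ q^2) ^ q^2 \<noteq> \<beta>"
proof -
  show 1: "(\<beta> ^ q^2) ^ q^2 \<noteq> \<beta> ^ q^2"
    using frobQ_inj \<beta>_ne by blast
  show "(\<beta> ^ q^2) ^ q^2 \<noteq> \<beta>"
  proof
    assume "(\<beta> ^ q^2) ^ q^2 = \<beta>"
    then have "((\<beta> ^ q^2) ^ q^2) ^ q^2 = \<beta> ^ q^2" by simp
    then show False using \<beta>6 \<beta>_ne by simp
  qed
qed

section \<open>Coordinates in which \<Pi> becomes PG(2, q^2)\<close>

definition bs :: "3 \<Rightarrow> 'a" where
  "bs j = (if j = 1 then 1 else if j = 2 then \<beta> else \<beta>^2)"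

text \<open>The conjugates of 1, \<beta>, \<beta>^2 under the power Q = q^2. For s over the field of
  order Q, the vector U s consists of the Q-th power of a, its Q-th power and a itself, with a = s1
  + s2 \<beta> + s3 \<beta>^2; these vectors are fixed by \<open>Phi\<close>.\<close>

definition U :: "'a ^ 3 ^ 3" where
  "U = (\<chi> i j. if i = 3 then bs j else if i = 1 then bs j ^ q^2 else (bs j ^ q^2) ^ q^2)"

lemma bs6: "((bs j ^ q^2) ^ q^2) ^ q^2 = bs j"
proof -
  have "((((\<beta>^2) ^ q^2) ^ q^2) ^ q^2) = (((\<beta> ^ q^2) ^ q^2) ^ q^2)^2"
    by (simp only: power_mult[symmetric] mult_ac)
  then show ?thesis using \<beta>6 by (simp add: bs_def)
qed

lemma U_shift: "U $ (i + 1) $ j = (U $ i $ j) ^ q^2"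
  using exhaust_3[of i] bs6[of j] by (auto simp: U_def numeral_mod_3)

text \<open>A kernel vector is the coefficient vector of a polynomial of degree at most 2 with three
  distinct roots, the conjugates of \<beta>.\<close>

lemma U_inj: "U *v x = 0 \<Longrightarrow> x = 0"
proof -
  assume U0: "U *v x = 0"
  let ?P = "[:x $ 1, x $ 2, x $ 3:]"
  have bs2: "(\<beta>^2) ^ q^2 = (\<beta> ^ q^2)^2" "((\<beta>^2) ^ q^2) ^ q^2 = ((\<beta> ^ q^2) ^ q^2)^2"
    by (simp_all only: power_mult[symmetric] mult_ac)
  have "(U *v x) $ 3 = poly ?P \<beta>" "(U *v x) $ 1 = poly ?P (\<beta> ^ q^2)" "(U *v x) $ 2 = poly ?P ((\<beta> ^ q^2) ^ q^2)"
    by (simp_all add: matrix_vector_3 U_def bs_def bs2 power2_eq_square algebra_simps)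
  then have r: "{\<beta>, \<beta> ^ q^2, (\<beta> ^ q^2) ^ q^2} \<subseteq> {y. poly ?P y = 0}"
    unfolding U0 by simp
  have "?P = 0"
  proof (rule ccontr)
    assume nz: "?P \<noteq> 0"
    have "card {\<beta>, \<beta> ^ q^2, (\<beta> ^ q^2) ^ q^2} = 3"
      using \<beta>_ne \<beta>_distinct by (auto simp: card_insert_if)
    then have "3 \<le> card {y. poly ?P y = 0}"
      using card_mono[OF poly_roots_finite[OF nz] r] by simp
    also have "\<dots> \<le> degree ?P" by (rule card_poly_roots_bound[OF nz])
    also have "\<dots> \<le> 2" by simp
    finally show False by simp
  qed
  then show "x = 0"
    by (simp add: vec_eq_iff forall_3)
qed

definition M0 :: "'a ^ 3 ^ 3" where "M0 = (SOME B. B ** U = mat 1)"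

lemma M0_U: "M0 ** U = mat 1"
proof -
  have "\<exists>B. B ** U = mat 1"
    using U_inj matrix_left_invertible_ker[of U] by blast
  then show ?thesis unfolding M0_def by (rule someI_ex)
qed

lemma U_M0: "U ** M0 = mat 1"
  using M0_U matrix_left_right_inverse by blast

lemma left_inverse_unique: "B ** U = mat 1 \<Longrightarrow> B = M0"
  by (metis U_M0 matrix_mul_assoc matrix_mul_lid matrix_mul_rid)

text \<open>Frobenius permutes the rows of U cyclically. Hence M0, with Frobenius applied and the
  columns shifted, is again a left inverse of U and so equals M0.\<close>

lemma M0_shift: "M0 $ j $ (i + 1) = (M0 $ j $ i) ^ q^2"
proof -
  let ?B = "\<chi> j i. (M0 $ j $ (i + 2)) ^ q^2"
  have "?B ** U = mapm (\<lambda>x. x ^ q^2) (M0 ** U)"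
  proof -
    have "(?B ** U) $ a $ b = (mapm (\<lambda>x. x ^ q^2) M0 ** mapm (\<lambda>x. x ^ q^2) U) $ a $ b" for a b
    proof -
      have "(?B ** U) $ a $ b = (\<Sum>k\<in>UNIV. (M0 $ a $ (k + 2)) ^ q^2 * U $ k $ b)"
        by (simp add: matrix_matrix_mult_def)
      also have "\<dots> = (\<Sum>k\<in>UNIV. (M0 $ a $ (k + 1 + 2)) ^ q^2 * U $ (k + 1) $ b)"
        by (rule sum_shift_3[symmetric])
      also have "\<dots> = (\<Sum>k\<in>UNIV. (M0 $ a $ k) ^ q^2 * (U $ k $ b) ^ q^2)"
        unfolding U_shift add_1_2_3 ..
      finally show ?thesis by (simp add: matrix_matrix_mult_def mapm_def)
    qed
    then show ?thesis
      unfolding mapm_mult[OF frobQ] by (simp add: vec_eq_iff)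
  qed
  then have "?B ** U = mat 1"
    unfolding M0_U mapm_one[OF frobQ] .
  from left_inverse_unique[OF this] have "M0 $ j $ (i + 1) = ?B $ j $ (i + 1)"
    by (rule arg_cong[of _ _ "\<lambda>B. B $ j $ (i + 1)", OF sym])
  then show ?thesis unfolding vec_lambda_beta add_1_2_3 .
qed

lemma M0_GF: "M0 $ i $ j \<in> GF (q^6)"
proof -
  have "(((M0 $ i $ j) ^ q^2) ^ q^2) ^ q^2 = M0 $ i $ (j + 1 + 1 + 1)"
    by (simp only: M0_shift)
  also have "j + 1 + 1 + 1 = j"
    using exhaust_3[of j] by auto
  finally show ?thesis
    using pow_q6[of "M0 $ i $ j"] by (simp add: GF_def)
qed

lemma mapv_U: "mapv (\<lambda>x. x ^ q^2) s = s \<Longrightarrow> Phi (U *v s) = U *v s"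
proof -
  assume s: "mapv (\<lambda>x. x ^ q^2) s = s"
  have "Phi (U *v s) $ (i + 1) = (U *v s) $ (i + 1)" for i
  proof -
    have "Phi (U *v s) $ (i + 1) = mapv (\<lambda>x. x ^ q^2) (U *v s) $ i"
      by (simp add: Phi_nth mapv_def)
    also have "\<dots> = (mapm (\<lambda>x. x ^ q^2) U *v s) $ i"
      unfolding mapv_mult[OF frobQ] s ..
    also have "\<dots> = (U *v s) $ (i + 1)"
      by (simp add: matrix_vector_mult_def mapm_def U_shift)
    finally show ?thesis .
  qed
  then have "Phi (U *v s) $ i = (U *v s) $ i" for i
    by (metis diff_add_cancel)
  then show ?thesis by (simp add: vec_eq_iff)
qed

lemma Phi_fixed_M0: "Phi v = v \<Longrightarrow> mapv (\<lambda>x. x ^ q^2) (M0 *v v) = M0 *v v"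
proof -
  assume v: "Phi v = v"
  have "mapv (\<lambda>x. x ^ q^2) (M0 *v v) $ j = (M0 *v v) $ j" for j
  proof -
    have "mapv (\<lambda>x. x ^ q^2) (M0 *v v) $ j = (\<Sum>i\<in>UNIV. M0 $ j $ (i + 1) * Phi v $ (i + 1))"
      unfolding mapv_mult[OF frobQ] by (simp add: matrix_vector_mult_def mapm_def mapv_def M0_shift Phi_nth)
    also have "\<dots> = (M0 *v v) $ j"
      unfolding v sum_shift_3[of "\<lambda>i. M0 $ j $ i * v $ i"] by (simp add: matrix_vector_mult_def)
    finally show ?thesis .
  qed
  then show ?thesis by (simp add: vec_eq_iff)
qed

lemma Pi_plane_iff:
  "Pi_plane q = {pt (vector [\<gamma>, \<gamma> ^ (q^2 + 1), 1]) | \<gamma> :: 'a. \<gamma> ^ (1 + q^2 + q^2 * q^2) = 1}"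
proof -
  have e: "q^4 + q^2 + 1 = 1 + q^2 + q^2 * q^2"
    by (simp add: power_add[symmetric])
  show ?thesis
    unfolding Pi_plane_def GF_def e mem_Collect_eq by (intro Collect_cong ex_cong1 conj_cong refl) (use norm_one_power in auto)
qed

lemma power_power_eq:
  assumes "\<gamma> * a = (a :: 'a) ^ Q"
  shows "(a ^ Q) ^ Q = a * \<gamma> ^ (Q + 1)" "((a ^ Q) ^ Q) ^ Q = \<gamma> ^ (1 + Q + Q * Q) * a"
proof -
  have 1: "(a ^ Q) ^ Q = \<gamma> ^ Q * (\<gamma> * a)"
    by (metis assms power_mult_distrib)
  then show "(a ^ Q) ^ Q = a * \<gamma> ^ (Q + 1)"
    by simp
  have "((a ^ Q) ^ Q) ^ Q = (\<gamma> ^ Q) ^ Q * (a ^ Q) ^ Q"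
    by (metis assms power_mult_distrib 1)
  then show "((a ^ Q) ^ Q) ^ Q = \<gamma> ^ (1 + Q + Q * Q) * a"
    unfolding 1 by (simp add: power_add power_mult mult_ac)
qed

text \<open>The vectors fixed by \<open>Phi\<close> are \<open>(a\<^sup>Q, a\<^sup>Q\<^sup>Q, a)\<close> with \<open>Q = q\<^sup>2\<close> and \<open>a\<close> in the field of order
  \<open>Q\<^sup>3\<close>; dividing by \<open>a\<close> gives the points of \<open>\<Pi>\<close> with \<open>\<gamma> = a\<^sup>Q\<^sup>-\<^sup>1\<close>.\<close>

lemma Phi_fixed_point:
  assumes v: "Phi v = v" "v \<noteq> 0"
  shows "pt v \<in> Pi_plane q"
proof -
  define a where "a = v $ 3"
  have v1: "v $ 1 = a ^ q^2" and v2: "v $ 2 = (a ^ q^2) ^ q^2" and v3: "v $ 3 = a"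
    and a6: "((a ^ q^2) ^ q^2) ^ q^2 = a"
  proof -
    show 3: "v $ 3 = a" by (simp only: a_def)
    show 1: "v $ 1 = a ^ q^2"
      using Phi_nth[of v 3] unfolding v(1) 3 by (simp add: numeral_mod_3)
    show 2: "v $ 2 = (a ^ q^2) ^ q^2"
      using Phi_nth[of v 1] unfolding v(1) 1 by (simp add: numeral_mod_3)
    show "((a ^ q^2) ^ q^2) ^ q^2 = a"
      using Phi_nth[of v 2] 3 unfolding v(1) 2 by (simp add: numeral_mod_3)
  qed
  have a0: "a \<noteq> 0"
  proof
    assume "a = 0"
    then have "(v :: 'a ^ 3) = 0"
      using v1 v2 v3 q2 by (simp add: vec_eq_iff forall_3 power_0_left)
    with v(2) show False by simp
  qed
  obtain r where r: "q^2 = Suc r" using q2 by (cases "q^2") auto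
  define \<gamma> where "\<gamma> = a ^ r"
  have g: "\<gamma> * a = a ^ q^2"
    by (simp add: \<gamma>_def r)
  have "v = a *s vector [\<gamma>, \<gamma> ^ (q^2 + 1), 1]"
  proof -
    have "v $ 2 = a * \<gamma> ^ (q^2 + 1)"
      unfolding v2 by (rule power_power_eq[OF g])
    moreover have "v $ 1 = a * \<gamma>"
      unfolding v1 g[symmetric] by (rule mult.commute)
    ultimately show ?thesis by (simp add: vec_eq_iff forall_3 v3)
  qed
  then have p: "pt v = pt (vector [\<gamma>, \<gamma> ^ (q^2 + 1), 1])"
    using pt_eq_iff[OF vector_nz v(2)] a0 by metis
  note a6
  moreover note power_power_eq(2)[OF g]
  ultimately have "\<gamma> ^ (1 + q^2 + q^2 * q^2) = 1"
    using a0 by simp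
  then show ?thesis unfolding p Pi_plane_iff mem_Collect_eq by (intro exI[of _ \<gamma>] conjI refl)
qed

text \<open>An instance of Hilbert 90: \<gamma> is the power q^2 - 1 of some a in the closed field,
  and the norm condition on \<gamma> says that a lies in the field of order q^6.\<close>

lemma Pi_plane_fixed:
  assumes "P \<in> Pi_plane q"
  shows "\<exists>v. P = pt v \<and> v \<noteq> 0 \<and> Phi v = v"
proof -
  obtain \<gamma> where \<gamma>: "P = pt (vector [\<gamma>, \<gamma> ^ (q^2 + 1), 1])" "\<gamma> ^ (1 + q^2 + q^2 * q^2) = 1"
    using assms unfolding Pi_plane_iff mem_Collect_eq by (elim exE conjE) (rule that; assumption)
  obtain r where r: "q^2 = Suc r" "r > 0"
  proof -
    have "q^2 > 1" using q2 by (intro one_less_power) auto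
    then show thesis using that[of "q^2 - 1"] by simp
  qed
  obtain a where a: "a ^ r = \<gamma>"
    using nth_root_exists[OF r(2)] by blast
  have "\<gamma> \<noteq> 0" using \<gamma>(2) by (auto simp: power_0_left)
  then have a0: "a \<noteq> 0" using a r(2) by (auto simp: power_0_left)
  have g: "\<gamma> * a = a ^ q^2"
    using a by (simp add: r(1) mult.commute)
  have a6: "((a ^ q^2) ^ q^2) ^ q^2 = a"
    unfolding power_power_eq(2)[OF g] \<gamma>(2) by simp
  let ?v = "vector [a ^ q^2, (a ^ q^2) ^ q^2, a] :: 'a ^ 3"
  have "Phi ?v = ?v"
    by (simp add: Phi_def a6)
  moreover have "?v = a *s vector [\<gamma>, \<gamma> ^ (q^2 + 1), 1]"
    unfolding power_power_eq(1)[OF g] unfolding g[symmetric] by (simp add: vec_eq_iff forall_3 mult_ac)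
  moreover have "?v \<noteq> 0"
  proof
    assume "?v = 0"
    then have "?v $ 3 = (0 :: 'a ^ 3) $ 3" by (rule arg_cong)
    with a0 show False by simp
  qed
  ultimately show ?thesis
    using pt_eq_iff[OF vector_nz, of ?v] a0 \<gamma>(1) by (intro exI[of _ ?v]) auto
qed

lemma act_U: "act U ` PG2 (GF (q^2)) = Pi_plane q"
proof (intro equalityI subsetI)
  fix P :: "'a point" assume "P \<in> act U ` PG2 (GF (q^2))"
  then obtain P' where P': "P' \<in> PG2 (GF (q^2))" "P = act U P'"
    by (elim imageE) (rule that; assumption)
  from P'(1) obtain s where "P' = pt s" "s \<noteq> 0" "\<forall>i. s $ i \<in> GF (q^2)"
    by (rule PG2E)
  then have s: "P = pt (U *v s)" "s \<noteq> 0" "mapv (\<lambda>x. x ^ q^2) s = s"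
    using P'(2) by (simp_all add: act_pt GF_eq mapv_def vec_eq_iff)
  have "U *v s \<noteq> 0" using U_inj s(2) by metis
  with Phi_fixed_point[OF mapv_U[OF s(3)]] show "P \<in> Pi_plane q"
    unfolding s(1) by simp
next
  fix P :: "'a point" assume "P \<in> Pi_plane q"
  from Pi_plane_fixed[OF this] obtain v where v: "P = pt v" "v \<noteq> 0" "Phi v = v"
    by (elim exE conjE) (rule that; assumption)
  let ?s = "M0 *v v"
  have Us: "U *v ?s = v"
    by (simp only: matrix_vector_mul_assoc U_M0 matrix_vector_mul_lid)
  then have "?s \<noteq> 0" using v(2) by (metis matrix_vector_mult_0_right)
  moreover have "\<forall>i. ?s $ i \<in> GF (q^2)"
    using Phi_fixed_M0[OF v(3)] by (simp add: GF_eq mapv_def vec_eq_iff)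
  ultimately have "pt ?s \<in> PG2 (GF (q^2))"
    by (rule PG2I)
  moreover have "P = act U (pt ?s)"
    unfolding act_pt Us v(1) ..
  ultimately show "P \<in> act U ` PG2 (GF (q^2))" by simp
qed

lemma projectivity_M0: "projectivity_onto_PG q M0"
proof -
  have "invertible M0"
    unfolding invertible_def using M0_U U_M0 by blast
  moreover have "act M0 (act U P) = P" if "P \<in> PG2 (GF (q^2))" for P :: "'a point"
  proof -
    from \<open>P \<in> PG2 (GF (q^2))\<close> obtain v where "P = pt v" by (rule PG2E)
    then show ?thesis by (simp only: act_pt matrix_vector_mul_assoc M0_U matrix_vector_mul_lid)
  qed
  then have "act M0 ` act U ` PG2 (GF (q^2)) = PG2 (GF (q^2))"
    by (simp only: image_image image_ident cong: image_cong)
  then have "act M0 ` Pi_plane q = PG2 (GF (q^2))"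
    unfolding act_U .
  ultimately show ?thesis
    unfolding projectivity_onto_PG_def using M0_GF by simp
qed

text \<open>By \<open>M0_shift\<close>, substitution of M0 intertwines Frobenius on coefficients
  with \<open>sg\<close>. Substitution of U goes in the opposite direction.\<close>

lemma sg_lin_subst_M0:
  assumes "map_coeffs (\<lambda>x. x ^ q^2) A = A"
  shows "sg (lin_subst M0 A) = lin_subst M0 A"
proof -
  have "sg (lin_subst M0 A) = lin_subst M0 (map_coeffs (\<lambda>x. x ^ q^2) A)"
  proof (rule poly3_eval_unique[of "\<lambda>A. sg (lin_subst M0 A)" "\<lambda>A. lin_subst M0 (map_coeffs (\<lambda>x. x ^ q^2) A)"])
    show "ring_morph (\<lambda>A. sg (lin_subst M0 A))"
      by (rule ring_morph_comp[OF ring_morph_sg ring_morph_lin_subst])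
    show "ring_morph (\<lambda>A. lin_subst M0 (map_coeffs (\<lambda>x. x ^ q^2) A))"
      unfolding map_coeffs_def
      by (rule ring_morph_comp[OF ring_morph_lin_subst ring_morph_poly3_eval[OF ring_morph_ConstQ]])
    show "sg (lin_subst M0 (Const a)) = lin_subst M0 (map_coeffs (\<lambda>x. x ^ q^2) (Const a))" for a
      by (simp add: map_coeffs_def ring_morph_ConstQ)
    show "sg (lin_subst M0 (Var j)) = lin_subst M0 (map_coeffs (\<lambda>x. x ^ q^2) (Var j))" for j
    proof -
      have "sg (lin_subst M0 (Var j)) = (\<Sum>i\<in>UNIV. Const (M0 $ j $ (i + 1)) * Var (i + 1))"
        by (simp add: lin_subst_Var ring_morph_sum[OF ring_morph_sg] sg_simps M0_shift)
      also have "\<dots> = lin_subst M0 (Var j)"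
        unfolding sum_shift_3[of "\<lambda>i. Const (M0 $ j $ i) * Var i"] by (simp add: lin_subst_Var)
      finally show ?thesis
        by (simp add: map_coeffs_def ring_morph_ConstQ)
    qed
  qed
  with assms show ?thesis by simp
qed

lemma map_coeffs_lin_subst_U:
  assumes "sg A = A"
  shows "map_coeffs (\<lambda>x. x ^ q^2) (lin_subst U A) = lin_subst U A"
proof -
  have "map_coeffs (\<lambda>x. x ^ q^2) (lin_subst U A) = lin_subst U (sg A)"
  proof (rule poly3_eval_unique[of "\<lambda>A. map_coeffs (\<lambda>x. x ^ q^2) (lin_subst U A)" "\<lambda>A. lin_subst U (sg A)"])
    show "ring_morph (\<lambda>A. map_coeffs (\<lambda>x. x ^ q^2) (lin_subst U A))"
      unfolding map_coeffs_def
      by (rule ring_morph_comp[OF ring_morph_poly3_eval[OF ring_morph_ConstQ] ring_morph_lin_subst])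
    show "ring_morph (\<lambda>A. lin_subst U (sg A))"
      by (rule ring_morph_comp[OF ring_morph_lin_subst ring_morph_sg])
    show "map_coeffs (\<lambda>x. x ^ q^2) (lin_subst U (Const a)) = lin_subst U (sg (Const a))" for a
      by (simp add: map_coeffs_def ring_morph_ConstQ)
    show "map_coeffs (\<lambda>x. x ^ q^2) (lin_subst U (Var i)) = lin_subst U (sg (Var i))" for i
      by (simp add: map_coeffs_def lin_subst_Var ring_morph_sum[OF ring_morph_poly3_eval[OF ring_morph_ConstQ]]
          ring_morph_simps[OF ring_morph_poly3_eval[OF ring_morph_ConstQ]] ring_morph_ConstQ U_shift)
  qed
  with assms show ?thesis by simp
qed

text \<open>For an arbitrary projectivity M onto the subplane, M U maps PG(2, q^2) to itself, so it
  is a scalar k times a matrix over the subfield. On forms of degree d the scalar contributes k^d to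
  numerator and denominator alike.\<close>

theorem defined_over_Pi_iff:
  assumes z: "z \<in> K"
  shows "defined_over_Pi q (cls z) \<longleftrightarrow> Pi_rep z"
proof
  assume "Pi_rep z"
  then obtain A B d where 1: "homogeneous d A" "homogeneous d B" "\<phi> B \<noteq> 0" "sg A = A" "sg B = B" "z = \<phi> A / \<phi> B"
    unfolding Pi_rep_def by blast
  have inv_subst: "lin_subst M0 (lin_subst U C) = C" for C
    by (simp add: lin_subst_lin_subst U_M0 lin_subst_one)
  have co: "coeffs_in (GF (q^2)) (lin_subst U C)" if "sg C = C" for C
    unfolding GF_eq using coeffs_in_fixed[of "\<lambda>x :: 'a. x ^ q^2"] map_coeffs_lin_subst_U[OF that] q2 by simp
  have "(A, B) \<in> cls z"
    using 1 by (auto simp: cls_def fractions_iff)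
  then have "(lin_subst M0 (lin_subst U A), lin_subst M0 (lin_subst U B)) \<in> cls z"
    unfolding inv_subst .
  with projectivity_M0 co[OF 1(4)] co[OF 1(5)] show "defined_over_Pi q (cls z)"
    unfolding defined_over_Pi_def by (intro exI conjI)
next
  assume "defined_over_Pi q (cls z)"
  then obtain M A B where M: "projectivity_onto_PG q M" and AB: "coeffs_in (GF (q^2)) A" "coeffs_in (GF (q^2)) B"
    and c: "(lin_subst M A, lin_subst M B) \<in> cls z"
    unfolding defined_over_Pi_def by (elim exE conjE) (rule that; assumption)
  note M' = M[unfolded projectivity_onto_PG_def]
  have M2: "act M ` Pi_plane q = PG2 (GF (q^2))"
    by (rule conjunct2[OF conjunct2[OF M']])
  obtain N where "M ** N = mat 1 \<and> N ** M = mat 1"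
    using conjunct1[OF M'] unfolding invertible_def by (rule exE)
  then have N: "M ** N = mat 1" "N ** M = mat 1"
    by (rule conjunct1, rule conjunct2)
  let ?h = "\<lambda>x :: 'a. x ^ q^2"
  let ?T = "M ** U"
  have injT: "x = 0" if "?T *v x = 0" for x
  proof -
    have "U *v x = N *v (?T *v x)"
      by (simp only: matrix_vector_mul_assoc matrix_mul_assoc N matrix_mul_lid)
    then have "U *v x = 0"
      unfolding that by simp
    then show ?thesis by (rule U_inj)
  qed
  have "pt (?T *v v) \<in> PG2 {x. ?h x = x}" if "v \<noteq> 0" "\<forall>i. ?h (v $ i) = v $ i" for v
  proof -
    have "pt v \<in> PG2 (GF (q^2))"
      using that by (auto simp: GF_eq intro: PG2I)
    then have "act M (act U (pt v)) \<in> act M ` act U ` PG2 (GF (q^2))"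
      by (intro imageI)
    then have "act M (act U (pt v)) \<in> PG2 (GF (q^2))"
      unfolding act_U M2 .
    then show ?thesis
      by (simp only: act_pt matrix_vector_mul_assoc GF_eq)
  qed
  from projectivity_of_subplane[OF frobQ injT this]
  obtain k T0 where T: "k \<noteq> 0" "mapm ?h T0 = T0" "?T = (\<chi> i j. k * T0 $ i $ j)"
    by blast
  have M_eq: "M = ?T ** M0"
    by (simp only: matrix_mul_assoc[symmetric] U_M0 matrix_mul_rid)
  have h: "lin_subst M C = lin_subst M0 (lin_subst ?T C)" for C
    by (simp add: lin_subst_lin_subst M_eq[symmetric])
  obtain d where d: "homogeneous d (lin_subst M A)" "homogeneous d (lin_subst M B)" "\<phi> (lin_subst M B) \<noteq> 0"
    "z = \<phi> (lin_subst M A) / \<phi> (lin_subst M B)"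
    using c by (auto simp: cls_def fractions_iff)
  have inv_subst: "lin_subst N (lin_subst M C) = C" for C
    by (simp add: lin_subst_lin_subst N lin_subst_one)
  \<comment> \<open>Homogeneity of A and B is recovered from that of their substitutions by means of
    the inverse of M.\<close>
  have hom: "homogeneous d A" "homogeneous d B"
    using homogeneous_lin_subst[OF d(1), of N] homogeneous_lin_subst[OF d(2), of N] unfolding inv_subst .
  let ?G = "\<lambda>C. lin_subst M0 (lin_subst T0 C)"
  have scale: "lin_subst M C = Const (k ^ d) * ?G C" if "homogeneous d C" for C
    unfolding h T(3) lin_subst_scale[OF that] by (simp add: lin_subst_simps)
  have fixed: "sg (?G C) = ?G C" if "coeffs_in (GF (q^2)) C" for C
  proof (rule sg_lin_subst_M0)
    have "map_coeffs ?h C = C"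
      using that coeffs_in_fixed[of ?h C] q2 unfolding GF_eq by simp
    then show "map_coeffs ?h (lin_subst T0 C) = lin_subst T0 C"
      unfolding map_coeffs_lin_subst[OF frobQ] T(2) by simp
  qed
  have "z = \<phi> (?G A) / \<phi> (?G B)" "\<phi> (?G B) \<noteq> 0"
    using d(3,4) T(1) unfolding scale[OF hom(1)] scale[OF hom(2)] by (auto simp: \<phi>_simps)
  then show "Pi_rep z"
    unfolding Pi_rep_def using fixed[OF AB(1)] fixed[OF AB(2)] homogeneous_lin_subst[OF homogeneous_lin_subst[OF hom(1)]]
      homogeneous_lin_subst[OF homogeneous_lin_subst[OF hom(2)]] by blast
qed

end

section \<open>The points of the Hermitian curve in the subplane\<close>

context hermitian_curve
begin

lemma of_nat_q: "of_nat q = (0 :: 'a)"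
  using e CH of_nat_CHAR[where 'a = 'a] by (simp add: q_def)

lemma of_nat_NN: "of_nat NN = (1 :: 'a)"
  unfolding NN by (simp add: of_nat_q)

lemma q_NN: "q^2 + 1 = NN + q"
proof -
  obtain r where "q = Suc r" using q2 by (cases q) auto
  then show ?thesis unfolding NN by (simp add: power2_eq_square)
qed

text \<open>The q-th power of the orbit equation, multiplied by t2 w, becomes w^(q^2+q+1) + \<tau>
  w^(q+1) + t2 w = 0 through t2 \<tau>^q = 1 and t2^(q+1) = \<tau>; comparison with the equation
  itself gives the claim. It places the points with y^N = w in \<Pi>.\<close>

lemma orbit_norm:
  assumes "orbit_eq w"
  shows "w ^ (q^2 + q + 1) = 1"
proof -
  have o: "\<tau> * w ^ (q + 1) + t2 * w + 1 = 0"
    using assms by (simp only: orbit_eq_def)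
  have t: "t2 * t2 ^ q = \<tau>"
  proof -
    have 1: "\<tau> ^ (q^2) * \<tau> ^ q * \<tau> = 1"
      using \<tau> by (simp only: power_add power_one_right)
    have 2: "t2 ^ q * \<tau> ^ (q^2) = 1"
      using arg_cong[OF t2_\<tau>, of "\<lambda>x. x ^ q"]
      by (simp only: power_mult_distrib power_one power_mult[symmetric] power2_eq_square)
    have "t2 * t2 ^ q = t2 * t2 ^ q * (\<tau> ^ (q^2) * \<tau> ^ q * \<tau>)"
      unfolding 1 by simp
    also have "\<dots> = (t2 ^ q * \<tau> ^ (q^2)) * (t2 * \<tau> ^ q) * \<tau>"
      by (simp only: mult_ac)
    finally show ?thesis unfolding 2 t2_\<tau> by simp
  qed
  have "(\<tau> * w ^ (q + 1) + t2 * w + 1) ^ q = 0"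
    unfolding o using q2 by simp
  then have 0: "\<tau> ^ q * (w ^ (q + 1)) ^ q + t2 ^ q * w ^ q + 1 = 0"
    by (simp only: frob power_mult_distrib power_one)
  have "t2 * w * (\<tau> ^ q * (w ^ (q + 1)) ^ q + t2 ^ q * w ^ q + 1)
      = (t2 * \<tau> ^ q) * (w * (w ^ (q + 1)) ^ q) + (t2 * t2 ^ q) * w ^ (q + 1) + t2 * w"
    by (simp add: algebra_simps)
  then have "w * (w ^ (q + 1)) ^ q + \<tau> * w ^ (q + 1) + t2 * w = 0"
    unfolding 0 t t2_\<tau> by simp
  then have "w * (w ^ (q + 1)) ^ q = 1"
    using o by (metis add.assoc add_left_cancel add.commute)
  moreover have "w * (w ^ (q + 1)) ^ q = w ^ (q^2 + q + 1)"
    by (simp add: power_add power_mult power2_eq_square power_mult_distrib mult_ac)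
  ultimately show ?thesis by simp
qed

text \<open>The roots are simple: q + 1 is 1 in the field, so w P'(w) = P(w) - 1.\<close>

lemma card_orbit_eq: "card {w. orbit_eq w} = q + 1" "finite {w. orbit_eq w}"
proof -
  define P where "P = monom \<tau> (q + 1) + [:1, t2:]"
  have ev: "poly P w = \<tau> * w ^ (q + 1) + t2 * w + 1" for w
    by (simp add: P_def poly_monom algebra_simps)
  have deg: "degree P = q + 1"
    unfolding P_def using q2 by (subst degree_add_eq_left) (simp_all add: degree_monom_eq)
  then have nz: "P \<noteq> 0" by auto
  have "pderiv P = monom \<tau> q + [:t2:]"
    using of_nat_q by (simp add: P_def pderiv_add pderiv_monom pderiv_pCons)
  then have d: "w * poly (pderiv P) w = \<tau> * w ^ (q + 1) + t2 * w" for w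
    by (simp add: poly_monom algebra_simps)
  have s: "{w. orbit_eq w} = {w. poly P w = 0}"
    by (simp add: orbit_eq_def ev)
  show "card {w. orbit_eq w} = q + 1"
    unfolding s deg[symmetric]
  proof (rule card_roots_separable[OF nz])
    fix x assume "poly P x = 0"
    then have "x * poly (pderiv P) x + 1 = 0"
      unfolding ev d .
    then show "poly (pderiv P) x \<noteq> 0" by auto
  qed
  show "finite {w. orbit_eq w}"
    unfolding s by (rule poly_roots_finite[OF nz])
qed

text \<open>As N is 1 in the field, the derivative is y^(N - 1), and the roots are nonzero.\<close>

lemma card_roots_NN:
  assumes "w \<noteq> (0 :: 'a)"
  shows "card {y. y ^ NN = w} = NN" "finite {y. y ^ NN = w}"
proof -
  define P where "P = monom 1 NN + [:- w:]"
  have deg: "degree P = NN"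
    unfolding P_def using NN_gt by (subst degree_add_eq_left) (simp_all add: degree_monom_eq)
  then have nz: "P \<noteq> 0" using NN_gt by auto
  have ev: "poly P y = y ^ NN - w" for y
    by (simp add: P_def poly_monom)
  have s: "{y. y ^ NN = w} = {y. poly P y = 0}"
    by (simp add: ev)
  have d: "poly (pderiv P) y = y ^ (NN - 1)" for y
    by (simp add: P_def pderiv_add pderiv_monom pderiv_pCons poly_monom of_nat_NN)
  show "card {y. y ^ NN = w} = NN"
  proof -
    have "card {y. poly P y = 0} = degree P"
    proof (rule card_roots_separable[OF nz])
      fix x assume "poly P x = 0"
      then have "x \<noteq> 0" using assms NN_gt by (auto simp: ev power_0_left)
      then show "poly (pderiv P) x \<noteq> 0" by (simp add: d)
    qed
    then show ?thesis unfolding s deg .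
  qed
  show "finite {y. y ^ NN = w}"
    unfolding s by (rule poly_roots_finite[OF nz])
qed

text \<open>The point of \<open>\<Pi>\<close> with parameter \<open>y\<close>, written as a member of \<open>GG (y ^ NN)\<close>.\<close>

definition vv :: "'a \<Rightarrow> 'a ^ 3" where
  "vv y = vector [y, y ^ NN * y ^ q, 1]"

text \<open>The parameters of the evaluation points, that is, of the curve points in \<Pi> outside
  the orbit of w.\<close>

definition Yw :: "'a \<Rightarrow> 'a set" where
  "Yw w = {y. orbit_eq (y ^ NN) \<and> y ^ NN \<noteq> w}"

lemma vv_nz: "vv y \<noteq> 0"
  unfolding vv_def by (rule vector_nz)

lemma vv_inj: "pt (vv x) = pt (vv y) \<Longrightarrow> x = y"
  using pt_affine_eq[OF vv_nz, of x y "y ^ NN * y ^ q"] by (simp add: vv_def)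

lemma inj_vv: "inj_on (\<lambda>y. pt (vv y)) S"
  by (intro inj_onI vv_inj)

lemma GG_vv: "GG w = (\<lambda>y. pt (vv y)) ` {y. y ^ NN = w}"
proof (intro equalityI subsetI)
  fix P assume "P \<in> GG w"
  then obtain y where "P = pt (vector [y, w * y ^ q, 1])" "y ^ NN = w"
    unfolding GG_def mem_Collect_eq by (elim exE conjE) (rule that; assumption)
  then show "P \<in> (\<lambda>y. pt (vv y)) ` {y. y ^ NN = w}"
    by (intro image_eqI[of _ _ y]) (simp_all add: vv_def)
next
  fix P assume "P \<in> (\<lambda>y. pt (vv y)) ` {y. y ^ NN = w}"
  then obtain y where "P = pt (vv y)" "y ^ NN = w"
    by (elim imageE) (rule that; simp)
  then show "P \<in> GG w"
    unfolding GG_def mem_Collect_eq by (intro exI[of _ y]) (simp add: vv_def)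
qed

lemma vv_GG_iff: "pt (vv y) \<in> GG w \<longleftrightarrow> y ^ NN = w"
proof
  assume "pt (vv y) \<in> GG w"
  then obtain x where "pt (vv y) = pt (vv x)" "x ^ NN = w"
    unfolding GG_vv by (elim imageE) (rule that; simp)
  with vv_inj show "y ^ NN = w" by metis
qed (simp add: GG_vv)

text \<open>Substituting x = w y^q and q^2 + 1 = N + q in the affine equation leaves y^q times the
  orbit equation; this is the origin of \<open>orbit_eq\<close>.\<close>

lemma on_curve_vv:
  assumes "y \<noteq> 0"
  shows "on_curve (vv y) \<longleftrightarrow> orbit_eq (y ^ NN)"
proof -
  let ?w = "y ^ NN"
  have e: "y * (y ^ q) ^ q = y ^ NN * y ^ q"
  proof -
    have "y * (y ^ q) ^ q = y ^ (q^2 + 1)"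
      by (simp add: power_mult[symmetric] power2_eq_square)
    then show ?thesis unfolding q_NN power_add .
  qed
  have "\<tau> * y * (?w * y ^ q) ^ q + t2 * (?w * y ^ q) + y ^ q
      = \<tau> * ?w ^ q * (y * (y ^ q) ^ q) + t2 * ?w * y ^ q + y ^ q"
    by (simp only: power_mult_distrib mult_ac)
  also have "\<dots> = (\<tau> * ?w ^ (q + 1) + t2 * ?w + 1) * y ^ q"
    unfolding e by (simp add: algebra_simps)
  finally show ?thesis
    unfolding vv_def on_curve_affine orbit_eq_def using assms by simp
qed

lemma orbit_eq_y_nz: "orbit_eq (y ^ NN) \<Longrightarrow> y \<noteq> 0"
  using orbit_eq_nz NN_gt by (metis power_0_left neq0_conv)

lemma vv_Pi: "y \<noteq> 0 \<Longrightarrow> vv y = vector [y, y ^ (q^2 + 1), 1]"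
  unfolding vv_def q_NN power_add ..

lemma norm_NN: "1 + q^2 + q^2 * q^2 = NN * (q^2 + q + 1)"
  unfolding NN using q2 by (cases q) (simp_all add: power2_eq_square algebra_simps)

lemma card_Yw:
  assumes "orbit_eq w"
  shows "card (Yw w) = q * NN" "finite (Yw w)"
proof -
  let ?W = "{u. orbit_eq u} - {w}"
  have Y: "Yw w = (\<Union>u\<in>?W. {y. y ^ NN = u})"
    by (auto simp: Yw_def)
  have nz: "u \<noteq> 0" if "u \<in> ?W" for u
    using that orbit_eq_nz by blast
  have "card (Yw w) = (\<Sum>u\<in>?W. card {y. y ^ NN = u})"
    unfolding Y using card_orbit_eq(2) nz card_roots_NN(2)
    by (intro card_UN_disjoint) auto
  also have "\<dots> = (\<Sum>u\<in>?W. NN)"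
    using nz card_roots_NN(1) by (intro sum.cong) auto
  also have "\<dots> = q * NN"
    using card_orbit_eq assms by simp
  finally show "card (Yw w) = q * NN" .
  show "finite (Yw w)"
    unfolding Y using card_orbit_eq(2) nz card_roots_NN(2) by (intro finite_UN_I) auto
qed

lemma card_GG: "w \<noteq> 0 \<Longrightarrow> card (GG w) = NN"
  unfolding GG_vv using card_roots_NN by (simp_all add: card_image[OF inj_vv])

lemma deg_divisor_GG: "w \<noteq> 0 \<Longrightarrow> deg_divisor (sum_of_points (GG w)) = int NN"
  unfolding deg_divisor_def sum_of_points_def by (simp add: card_GG)

end

context singer
begin

lemma curve_Pi: "curve F \<inter> Pi_plane q = (\<lambda>y. pt (vv y)) ` {y. orbit_eq (y ^ NN)}"
proof (intro equalityI subsetI)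
  fix P assume P: "P \<in> curve F \<inter> Pi_plane q"
  then obtain y where y: "P = pt (vector [y, y ^ (q^2 + 1), 1])" "y ^ (1 + q^2 + q^2 * q^2) = 1"
    unfolding Pi_plane_iff mem_Collect_eq by (elim IntE CollectE exE conjE) (rule that; assumption)
  have "y \<noteq> 0" using y(2) by (auto simp: power_0_left)
  have Pv: "P = pt (vv y)" unfolding y(1) vv_Pi[OF \<open>y \<noteq> 0\<close>] ..
  then have "on_curve (vv y)"
    using P curve_iff[of "vv y"] vv_nz[of y] by simp
  then have "orbit_eq (y ^ NN)" using on_curve_vv[OF \<open>y \<noteq> 0\<close>] by simp
  with Pv show "P \<in> (\<lambda>y. pt (vv y)) ` {y. orbit_eq (y ^ NN)}" by simp
next
  fix P assume "P \<in> (\<lambda>y. pt (vv y)) ` {y. orbit_eq (y ^ NN)}"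
  then obtain y where y: "P = pt (vv y)" "orbit_eq (y ^ NN)"
    by (elim imageE) (rule that; simp)
  have y0: "y \<noteq> 0" by (rule orbit_eq_y_nz[OF y(2)])
  have "P \<in> curve F"
    using curve_iff[of "vv y"] on_curve_vv[OF y0] y by simp
  moreover have "y ^ (1 + q^2 + q^2 * q^2) = 1"
    unfolding norm_NN power_mult by (rule orbit_norm[OF y(2)])
  then have "P \<in> Pi_plane q"
    unfolding y(1) vv_Pi[OF y0] Pi_plane_iff mem_Collect_eq by (intro exI[of _ y] conjI refl)
  ultimately show "P \<in> curve F \<inter> Pi_plane q" by simp
qed

lemma curve_Pi_diff: "curve F \<inter> Pi_plane q - GG w = (\<lambda>y. pt (vv y)) ` Yw w"
proof -
  have "curve F \<inter> Pi_plane q - GG w = (\<lambda>y. pt (vv y)) ` ({y. orbit_eq (y ^ NN)} - {y. y ^ NN = w})"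
    unfolding curve_Pi GG_vv by (rule inj_on_image_set_diff[OF inj_vv[of UNIV], symmetric]) simp_all
  also have "{y. orbit_eq (y ^ NN)} - {y. y ^ NN = w} = Yw w"
    by (auto simp: Yw_def)
  finally show ?thesis .
qed

text \<open>The generator multiplies the parameter by \<beta>, which preserves its N-th power; the N
  distinct multiples exhaust the roots of y^N = w by count.\<close>

lemma singer_orbit_eq:
  assumes "y \<noteq> 0"
  shows "singer_orbit q \<beta> (pt (vv y)) = GG (y ^ NN)"
proof -
  let ?w = "y ^ NN" and ?g = "singer_generator q \<beta>"
  have step: "act ?g (pt (vv x)) = pt (vv (\<beta> * x))" for x
  proof -
    have "?g *v vv x = vv (\<beta> * x)"
      using \<beta>_pow(1) by (simp add: vec_eq_iff forall_3 matrix_vector_3 singer_generator_def vv_def power_mult_distrib)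
    then show ?thesis unfolding act_pt by simp
  qed
  have it: "(act ?g ^^ i) (pt (vv y)) = pt (vv (\<beta> ^ i * y))" for i
    by (induction i) (simp_all add: step mult.assoc)
  have "singer_orbit q \<beta> (pt (vv y)) = (\<lambda>x. pt (vv x)) ` range (\<lambda>i. \<beta> ^ i * y)"
    unfolding singer_orbit_def it by (simp add: full_SetCompr_eq image_image)
  also have "range (\<lambda>i. \<beta> ^ i * y) = {x. x ^ NN = ?w}"
  proof (rule sym, rule card_seteq[symmetric])
    have "y ^ NN \<noteq> 0" using assms by simp
    note c = card_roots_NN[OF this]
    show sub: "range (\<lambda>i. \<beta> ^ i * y) \<subseteq> {x. x ^ NN = ?w}"
    proof safe
      fix i
      have "(\<beta> ^ i) ^ NN = (\<beta> ^ NN) ^ i" by (simp only: power_mult[symmetric] mult.commute)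
      then show "(\<beta> ^ i * y) ^ NN = ?w"
        unfolding power_mult_distrib \<beta>_pow(1) by simp
    qed
    show "finite {x. x ^ NN = ?w}" by (rule c)
    have inj: "inj_on (\<lambda>i. \<beta> ^ i * y) {..<NN}"
    proof (rule linorder_inj_onI')
      fix i j assume ij: "i \<in> {..<NN}" "j \<in> {..<NN}" "i < j"
      have "\<beta> \<noteq> 0" using \<beta>_pow(1) NN_gt by (auto simp: power_0_left)
      moreover have "\<beta> ^ (j - i) \<noteq> 1" using \<beta>_pow(2)[of "j - i"] ij by simp
      moreover have "\<beta> ^ j = \<beta> ^ i * \<beta> ^ (j - i)" using ij by (simp add: power_add[symmetric])
      ultimately show "\<beta> ^ i * y \<noteq> \<beta> ^ j * y" using assms by simp
    qed
    have "card {x. x ^ NN = ?w} = card ((\<lambda>i. \<beta> ^ i * y) ` {..<NN})"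
      using c(1) card_image[OF inj] by simp
    also have "\<dots> \<le> card (range (\<lambda>i. \<beta> ^ i * y))"
      using finite_subset[OF sub] c(2) by (intro card_mono) auto
    finally show "card {x. x ^ NN = ?w} \<le> card (range (\<lambda>i. \<beta> ^ i * y))" .
  qed
  finally show ?thesis unfolding GG_vv .
qed

end

section \<open>The Riemann-Roch space over the subfield\<close>

context singer
begin

text \<open>The trace; \<open>sg\<close> has order dividing 3 on forms with coefficients in the
  field of order q^6.\<close>

definition sgtr :: "'a poly3 \<Rightarrow> 'a poly3" where
  "sgtr A = A + sg A + sg (sg A)"

lemma sg_sgtr: "sg (sg (sg A)) = A \<Longrightarrow> sg (sgtr A) = sgtr A"
  by (simp add: sgtr_def sg_simps add_ac)

lemma homogeneous_sgtr: "homogeneous d A \<Longrightarrow> homogeneous d (sgtr A)"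
  unfolding sgtr_def by (intro homogeneous_add homogeneous_sg)

text \<open>A column of the inverse of the matrix of conjugates, which is the basis dual to 1,
  \<beta>, \<beta>^2 for the trace.\<close>

definition xs :: "3 \<Rightarrow> 'a" where "xs j = M0 $ j $ 3"

lemma xs_bs:
  "(\<Sum>j\<in>UNIV. xs j * bs j) = 1" "(\<Sum>j\<in>UNIV. xs j * bs j ^ q^2) = 0"
  "(\<Sum>j\<in>UNIV. xs j * (bs j ^ q^2) ^ q^2) = 0"
proof -
  have "(U ** M0) $ i $ 3 = (mat 1 :: 'a ^ 3 ^ 3) $ i $ 3" for i
    unfolding U_M0 ..
  then have c: "(\<Sum>j\<in>UNIV. xs j * U $ i $ j) = (if i = 3 then 1 else 0)" for i
    by (simp add: matrix_matrix_mult_def mat_def xs_def mult.commute)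
  show "(\<Sum>j\<in>UNIV. xs j * bs j) = 1"
    using c[of 3] by (simp add: U_def)
  show "(\<Sum>j\<in>UNIV. xs j * bs j ^ q^2) = 0"
    using c[of 1] by (simp add: U_def)
  show "(\<Sum>j\<in>UNIV. xs j * (bs j ^ q^2) ^ q^2) = 0"
    using c[of 2] by (simp add: U_def)
qed

text \<open>Every form is a combination of traces, by the dual basis \<open>xs\<close> of \<open>bs\<close>.\<close>

lemma sum_sgtr: "(\<Sum>j\<in>UNIV. \<c> (xs j) * \<phi> (sgtr (Const (bs j) * A))) = \<phi> A"
proof -
  have "\<c> (xs j) * \<phi> (sgtr (Const (bs j) * A)) = \<c> (xs j * bs j) * \<phi> A
      + \<c> (xs j * bs j ^ q^2) * \<phi> (sg A) + \<c> (xs j * (bs j ^ q^2) ^ q^2) * \<phi> (sg (sg A))" for j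
    unfolding sgtr_def sg_simps sg_Const \<phi>_simps \<phi>_Const c_simps(4) by (simp only: distrib_left mult.assoc)
  then have e: "(\<Sum>j\<in>UNIV. \<c> (xs j) * \<phi> (sgtr (Const (bs j) * A))) = (\<Sum>j\<in>UNIV. \<c> (xs j * bs j)) * \<phi> A
      + (\<Sum>j\<in>UNIV. \<c> (xs j * bs j ^ q^2)) * \<phi> (sg A) + (\<Sum>j\<in>UNIV. \<c> (xs j * (bs j ^ q^2) ^ q^2)) * \<phi> (sg (sg A))"
    by (simp only: sum.distrib sum_distrib_right)
  show ?thesis
    unfolding e ring_morph_sum[OF ring_morph_fls_const, symmetric] xs_bs by simp
qed

lemma sg3_bs: "sg (sg (sg A)) = A \<Longrightarrow> sg (sg (sg (Const (bs j) * A))) = Const (bs j) * A"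
  by (simp only: sg_simps sg_Const bs6)

definition mm :: "nat \<Rightarrow> nat \<Rightarrow> nat \<Rightarrow> 'a poly3" where
  "mm a b c = Var 1 ^ a * Var 2 ^ b * Var 3 ^ c"

text \<open>The triples with positive entries and the three monomials of the curve equation. The
  conditions are cyclic, so the set is stable under \<open>sg\<close>; the q (q - 1) / 2 positive
  triples and the three others, with one relation, account for the dimension.\<close>

definition MM :: "nat \<Rightarrow> nat \<Rightarrow> nat \<Rightarrow> bool" where
  "MM a b c \<longleftrightarrow> a + b + c = q + 1 \<and> (a = 0 \<longrightarrow> b = 1) \<and> (b = 0 \<longrightarrow> c = 1) \<and> (c = 0 \<longrightarrow> a = 1)"

lemma homogeneous_mm: "homogeneous (a + b + c) (mm a b c)"
  unfolding mm_def by (intro homogeneous_mult homogeneous_Var_power)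

lemma homogeneous_MM: "MM a b c \<Longrightarrow> homogeneous (q + 1) (mm a b c)"
  using homogeneous_mm[of a b c] by (simp add: MM_def)

lemma sg_mm: "sg (mm a b c) = mm c a b"
  unfolding mm_def by (simp add: sg_simps numeral_mod_3 mult_ac)

lemma sg3_mm: "sg (sg (sg (mm a b c))) = mm a b c"
  by (simp only: sg_mm)

lemma MM_cyclic: "MM a b c \<Longrightarrow> MM c a b"
  by (auto simp: MM_def)

definition dn :: "'a fls" where "dn = \<xi> 2 * \<xi> 3 ^ q"

lemma dn_nz: "dn \<noteq> 0"
  by (simp add: dn_def)

lemma \<phi>_mm: "\<phi> (mm a b c) = \<xi> 1 ^ a * \<xi> 2 ^ b * \<xi> 3 ^ c"
  by (simp add: mm_def \<phi>_simps)

lemma \<phi>_mm_mon: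
  assumes "b \<ge> 1" "a + b + c = q + 1"
  shows "\<phi> (mm a b c) / dn = mon (b - 1, a)"
proof -
  obtain k where b: "b = Suc k" using assms(1) by (cases b) auto
  have "q = k + a + c" using assms(2) b by simp
  then have "\<xi> 3 ^ q = \<xi> 3 ^ (k + a + c)" by (rule arg_cong)
  then have q: "\<xi> 3 ^ q = \<xi> 3 ^ k * \<xi> 3 ^ a * \<xi> 3 ^ c" unfolding power_add .
  show ?thesis
    unfolding \<phi>_mm dn_def mon_def xf_def yf_def b q by (simp add: power_divide power_add field_simps)
qed

lemma \<phi>_curve: "\<c> \<tau> * \<phi> (mm 1 q 0) + \<c> t2 * \<phi> (mm 0 1 q) + \<phi> (mm q 0 1) = 0"
  using \<phi>_F unfolding F_eq by (simp add: \<phi>_simps mm_def mult_ac)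

text \<open>For b positive the quotient is the monomial x^(b - 1) y^a, of weight at most N. The
  remaining form X1^q X3 is replaced by the other two terms of the curve equation.\<close>

lemma MM_T:
  assumes "MM a b c"
  shows "\<phi> (mm a b c) / dn \<in> T NN"
proof -
  have 1: "\<phi> (mm a b c) / dn \<in> T NN" if M: "MM a b c" "b \<ge> 1" for a b c
  proof -
    have s: "a + b + c = q + 1" using M by (simp add: MM_def)
    obtain r where r: "q = Suc r" using q2 by (cases q) auto
    obtain k where b: "b = Suc k" using M(2) by (cases b) auto
    have "(b - 1, a) \<in> Ai NN"
    proof (cases "a = 0")
      case True
      with M have "b = 1" by (simp add: MM_def)
      with True show ?thesis by (simp add: Ai_def wt_def)
    next
      case False
      have "k \<le> r" using s False unfolding b r by simp
      also have "r \<le> r * a" using False by simp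
      finally have "k \<le> r * a" .
      moreover have "r * k + Suc r * a \<le> r * Suc r + 1"
      proof (cases "c = 0")
        case True
        with M have "a = 1" by (simp add: MM_def)
        with s True show ?thesis unfolding b r by simp
      next
        case c: False
        then have ka: "k + a \<le> r" using s unfolding b r by simp
        then have "r * (k + a) \<le> r * r" by (rule mult_le_mono2)
        moreover have "a \<le> r" using ka by simp
        ultimately show ?thesis by (simp add: algebra_simps)
      qed
      ultimately have "k \<le> (q - 1) * a" "(q - 1) * k + q * a \<le> (q - 1) * q + 1"
        unfolding r by simp_all
      then show ?thesis unfolding Ai_def wt_def NN b by simp
    qed
    then show ?thesis
      unfolding \<phi>_mm_mon[OF M(2) s] T_def by (rule Sp_mon[OF finite_Ai])
  qed
  show ?thesis
  proof (cases "b = 0")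
    case False
    with 1[OF assms] show ?thesis by simp
  next
    case True
    with assms have abc: "a = q" "b = 0" "c = 1" by (auto simp: MM_def)
    have "\<phi> (mm q 0 1) = \<c> (- \<tau>) * \<phi> (mm 1 q 0) + \<c> (- t2) * \<phi> (mm 0 1 q)"
      using \<phi>_curve unfolding c_simps(5) by (simp add: algebra_simps eq_neg_iff_add_eq_0)
    then have e: "\<phi> (mm q 0 1) / dn = \<c> (- \<tau>) * (\<phi> (mm 1 q 0) / dn) + \<c> (- t2) * (\<phi> (mm 0 1 q) / dn)"
      by (simp only: add_divide_distrib times_divide_eq_right)
    have "MM 1 q 0" "MM 0 1 q" using q2 by (simp_all add: MM_def)
    then have "\<phi> (mm 1 q 0) / dn \<in> T NN" "\<phi> (mm 0 1 q) / dn \<in> T NN"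
      using 1 q2 by simp_all
    then show ?thesis
      unfolding abc e by (simp only: T_def Sp_add Sp_cmult)
  qed
qed

lemma sgtr_MM_T:
  assumes "MM a b c"
  shows "\<phi> (sgtr (Const \<nu> * mm a b c)) / dn \<in> T NN"
proof -
  have e: "\<phi> (sgtr (Const \<nu> * mm a b c)) / dn = \<c> \<nu> * (\<phi> (mm a b c) / dn)
      + \<c> (\<nu> ^ q^2) * (\<phi> (mm c a b) / dn) + \<c> ((\<nu> ^ q^2) ^ q^2) * (\<phi> (mm b c a) / dn)"
    unfolding sgtr_def sg_simps sg_Const sg_mm \<phi>_simps \<phi>_Const add_divide_distrib times_divide_eq_right ..
  have "\<phi> (mm a b c) / dn \<in> T NN" "\<phi> (mm c a b) / dn \<in> T NN" "\<phi> (mm b c a) / dn \<in> T NN"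
    using assms MM_cyclic MM_T by blast+
  then show ?thesis
    unfolding e by (simp only: T_def Sp_add Sp_cmult)
qed

text \<open>The relation x - w y^q made homogeneous of degree q + 1. Divided by X2 X3^q it is
  D0.\<close>

definition Bw :: "'a \<Rightarrow> 'a poly3" where
  "Bw w = mm 0 1 q - Const w * mm q 0 1"

lemma \<phi>_Bw: "\<phi> (Bw w) = D0 w * dn"
proof -
  have e: "b * c ^ q - u * (a ^ q * c) = (b / c - u * (a / c) ^ q) * (c * c ^ q)" if "c \<noteq> 0" for a b c u :: "'a fls"
  proof -
    have 1: "b / c * c = b" and 2: "(a / c) ^ q * c ^ q = a ^ q"
      using that by (simp_all add: power_divide)
    have "(b / c - u * (a / c) ^ q) * (c * c ^ q) = (b / c * c) * c ^ q - u * ((a / c) ^ q * c ^ q * c)"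
      by (simp only: left_diff_distrib right_diff_distrib mult_ac)
    then show ?thesis unfolding 1 2 ..
  qed
  have "\<phi> (Bw w) = \<xi> 2 * \<xi> 3 ^ q - \<c> w * (\<xi> 1 ^ q * \<xi> 3)"
    unfolding Bw_def \<phi>_simps \<phi>_mm \<phi>_Const by simp
  also have "\<dots> = (xf * D0 w) * (\<xi> 3 * \<xi> 3 ^ q)"
    unfolding D0_xf unfolding xf_def yf_def by (rule e[OF \<xi>_nz])
  also have "\<dots> = D0 w * dn"
    unfolding xf_def dn_def by simp
  finally show ?thesis .
qed

lemma homogeneous_Bw: "homogeneous (q + 1) (Bw w)"
  unfolding Bw_def using q2
  by (intro homogeneous_diff homogeneous_cmult homogeneous_MM) (simp_all add: MM_def)

text \<open>Frobenius turns w into v = w^(q^2) with v w^(q+1) = 1, and v times the orbit equation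
  reads \<tau> + t2 v w + v = 0. Modulo the curve this is the required proportionality, with
  \<kappa> found from the coefficient of X2 X3^q.\<close>

lemma \<phi>_sg_Bw:
  assumes "orbit_eq w"
  shows "\<exists>\<kappa>. \<phi> (sg (Bw w)) = \<c> \<kappa> * \<phi> (Bw w)"
proof -
  define v where "v = w ^ q^2"
  have "v * w ^ (q + 1) = 1"
    using orbit_norm[OF assms] by (simp add: v_def power_add mult_ac)
  moreover have "v * (\<tau> * w ^ (q + 1) + t2 * w + 1) = \<tau> * (v * w ^ (q + 1)) + t2 * v * w + v"
    by (simp add: algebra_simps)
  ultimately have e: "\<tau> + t2 * v * w + v = 0"
    using assms by (simp add: orbit_eq_def)
  define \<kappa> where "\<kappa> = v * t2 / \<tau>"
  have k: "\<kappa> * \<tau> = v * t2" "\<kappa> * w * \<tau> = - (\<tau> + v)"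
  proof -
    show 1: "\<kappa> * \<tau> = v * t2" by (simp add: \<kappa>_def)
    have "\<kappa> * w * \<tau> = (\<kappa> * \<tau>) * w" by (simp only: mult_ac)
    also have "\<dots> = - (\<tau> + v)" unfolding 1 using e by (simp add: eq_neg_iff_add_eq_0 algebra_simps)
    finally show "\<kappa> * w * \<tau> = - (\<tau> + v)" .
  qed
  define X Y Z where "X = \<phi> (mm 1 q 0)" and "Y = \<phi> (mm 0 1 q)" and "Z = \<phi> (mm q 0 1)"
  have c: "\<c> \<tau> * X = - (\<c> t2 * Y) - Z"
    using \<phi>_curve unfolding X_def[symmetric] Y_def[symmetric] Z_def[symmetric]
    by (simp add: algebra_simps eq_neg_iff_add_eq_0)
  have "\<c> \<tau> * \<phi> (sg (Bw w)) = \<c> \<tau> * Z - \<c> v * (\<c> \<tau> * X)"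
    unfolding Bw_def sg_simps sg_Const sg_mm \<phi>_simps \<phi>_Const v_def[symmetric] X_def[symmetric] Z_def[symmetric]
    by (simp only: right_diff_distrib mult_ac)
  also have "\<dots> = \<c> (v * t2) * Y + \<c> (\<tau> + v) * Z"
  proof -
    have "t * Z - v * (- (s * Y) - Z) = (v * s) * Y + (t + v) * Z" for t v s Y Z :: "'a fls"
      by (simp add: algebra_simps)
    then show ?thesis unfolding c c_simps .
  qed
  also have "\<dots> = \<c> (\<kappa> * \<tau>) * Y - \<c> (\<kappa> * w * \<tau>) * Z"
    unfolding k(1) k(2) c_simps(5) by (simp only: minus_mult_left[symmetric] diff_minus_eq_add)
  also have "\<dots> = \<c> \<tau> * (\<c> \<kappa> * \<phi> (Bw w))"
  proof -
    have "(k * t) * Y - (k * u * t) * Z = t * (k * (Y - u * Z))" for k t u Y Z :: "'a fls"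
      by (simp add: algebra_simps)
    then show ?thesis
      unfolding Bw_def \<phi>_simps \<phi>_Const Y_def[symmetric] Z_def[symmetric] c_simps .
  qed
  finally have "\<phi> (sg (Bw w)) = \<c> \<kappa> * \<phi> (Bw w)"
    by simp
  then show ?thesis by blast
qed

text \<open>A multiple of \<open>Bw w\<close> modulo the curve that is defined over \<open>\<Pi>\<close>.\<close>

lemma Pi_form_exists:
  assumes w: "orbit_eq w"
  shows "\<exists>B k. homogeneous (q + 1) B \<and> sg B = B \<and> k \<noteq> 0 \<and> \<phi> B = \<c> k * \<phi> (Bw w)"
proof -
  obtain \<kappa> where k: "\<phi> (sg (Bw w)) = \<c> \<kappa> * \<phi> (Bw w)"
    using \<phi>_sg_Bw[OF w] by blast
  have "\<phi> (sg (sg (Bw w) - Const \<kappa> * Bw w)) = 0"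
  proof (rule \<phi>_sg_0)
    show "homogeneous (q + 1) (sg (Bw w) - Const \<kappa> * Bw w)"
      by (intro homogeneous_diff homogeneous_sg homogeneous_cmult homogeneous_Bw)
    show "\<phi> (sg (Bw w) - Const \<kappa> * Bw w) = 0"
      unfolding \<phi>_simps \<phi>_Const k by simp
  qed
  then have k2: "\<phi> (sg (sg (Bw w))) = \<c> (\<kappa> ^ q^2 * \<kappa>) * \<phi> (Bw w)"
    unfolding sg_simps sg_Const \<phi>_simps \<phi>_Const k c_simps(4) by (simp only: right_minus_eq mult.assoc)
  have tr: "\<exists>k. \<phi> (sgtr (Const \<nu> * Bw w)) = \<c> k * \<phi> (Bw w)" for \<nu>
  proof
    show "\<phi> (sgtr (Const \<nu> * Bw w)) = \<c> (\<nu> + \<nu> ^ q^2 * \<kappa> + (\<nu> ^ q^2) ^ q^2 * (\<kappa> ^ q^2 * \<kappa>)) * \<phi> (Bw w)"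
      unfolding sgtr_def sg_simps sg_Const \<phi>_simps \<phi>_Const k k2 c_simps by (simp only: algebra_simps)
  qed
  have nz: "\<phi> (Bw w) \<noteq> 0"
    unfolding \<phi>_Bw using D0_nz dn_nz by simp
  \<comment> \<open>The dual basis recovers the form from its traces, so not all of them vanish
    modulo the curve.\<close>
  have "\<exists>j. \<phi> (sgtr (Const (bs j) * Bw w)) \<noteq> 0"
  proof (rule ccontr)
    assume "\<not> ?thesis"
    then have "\<phi> (Bw w) = 0" using sum_sgtr[of "Bw w"] by simp
    with nz show False by simp
  qed
  then obtain j where j: "\<phi> (sgtr (Const (bs j) * Bw w)) \<noteq> 0" by blast
  from tr[of "bs j"] obtain l where l: "\<phi> (sgtr (Const (bs j) * Bw w)) = \<c> l * \<phi> (Bw w)" by blast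
  have w6: "((w ^ q^2) ^ q^2) ^ q^2 = w"
    using norm_one_power[OF order_dvd[OF orbit_norm[OF w]]] unfolding pow_q6 .
  have "sg (sg (sg (Bw w))) = Bw w"
    unfolding Bw_def by (simp only: sg_simps sg_Const w6 sg_mm)
  then have "sg (sgtr (Const (bs j) * Bw w)) = sgtr (Const (bs j) * Bw w)"
    by (intro sg_sgtr sg3_bs)
  moreover have "homogeneous (q + 1) (sgtr (Const (bs j) * Bw w))"
    by (intro homogeneous_sgtr homogeneous_cmult homogeneous_Bw)
  moreover have "l \<noteq> 0" using j l by auto
  ultimately show ?thesis using l by blast
qed

section \<open>The spaces over the subfield and over the closure, and their values\<close>

definition Lw :: "'a \<Rightarrow> 'a fls set" where
  "Lw w = {z. Pi_rep z \<and> z * D0 w \<in> T NN}"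

definition Mw :: "'a \<Rightarrow> 'a fls set" where
  "Mw w = {z. z * D0 w \<in> T NN}"

lemma Lw_Mw: "Lw w \<subseteq> Mw w"
  by (auto simp: Lw_def Mw_def)

lemma riemann_roch_space_eq:
  assumes w: "orbit_eq w"
  shows "riemann_roch_space q F (sum_of_points (GG w)) = cls ` Lw w"
proof -
  have *: "cls z \<in> riemann_roch_space q F (sum_of_points (GG w)) \<longleftrightarrow> z \<in> Lw w" if z: "z \<in> K" for z
  proof -
    have "cls z = cls 0 \<longleftrightarrow> z = 0" using cls_inj[OF z] by blast
    moreover have "0 * D0 w \<in> T NN" unfolding T_def using Sp_0 by simp
    ultimately show ?thesis
      unfolding riemann_roch_space_def cls_0 Lw_def carrier_FF
      using z defined_over_Pi_iff[OF z] RR_condition[OF w z] by auto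
  qed
  show ?thesis
  proof (intro equalityI subsetI)
    fix f assume f: "f \<in> riemann_roch_space q F (sum_of_points (GG w))"
    then obtain z where "z \<in> K" "f = cls z"
      unfolding riemann_roch_space_def carrier_FF by (elim CollectE conjE imageE) (rule that; simp)
    with f * show "f \<in> cls ` Lw w" by simp
  next
    fix f assume "f \<in> cls ` Lw w"
    then obtain z where z: "z \<in> Lw w" "f = cls z" by (elim imageE) (rule that; simp)
    then have "z \<in> K" using Pi_rep_K by (simp add: Lw_def)
    with * z show "f \<in> riemann_roch_space q F (sum_of_points (GG w))" by simp
  qed
qed

lemma Lw_0: "0 \<in> Lw w"
  using Pi_rep_0 Sp_0 by (simp add: Lw_def T_def)

lemma Lw_add: "z \<in> Lw w \<Longrightarrow> z' \<in> Lw w \<Longrightarrow> z + z' \<in> Lw w"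
  using Pi_rep_add Sp_add by (simp add: Lw_def T_def distrib_right)

lemma Lw_cmult: "z \<in> Lw w \<Longrightarrow> a ^ q^2 = a \<Longrightarrow> \<c> a * z \<in> Lw w"
  using Pi_rep_cmult Sp_cmult by (simp add: Lw_def T_def mult.assoc)

lemma Mw_add: "z \<in> Mw w \<Longrightarrow> z' \<in> Mw w \<Longrightarrow> z + z' \<in> Mw w"
  using Sp_add by (simp add: Mw_def T_def distrib_right)

lemma Mw_0: "0 \<in> Mw w"
  using Lw_0 Lw_Mw by blast

lemma Mw_cmult: "z \<in> Mw w \<Longrightarrow> \<c> a * z \<in> Mw w"
  using Sp_cmult by (simp add: Mw_def T_def mult.assoc)

definition val :: "'a \<Rightarrow> 'a fls \<Rightarrow> 'a" where "val y = ev (vv y)"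

lemma Yw_on_curve:
  assumes "y \<in> Yw w"
  shows "y \<noteq> 0" "on_curve (vv y)" "vv y $ 3 \<noteq> 0" "pt (vv y) \<notin> GG w"
proof -
  show 0: "y \<noteq> 0" using assms orbit_eq_y_nz by (simp add: Yw_def)
  show "on_curve (vv y)" using assms on_curve_vv[OF 0] by (simp add: Yw_def)
  show "vv y $ 3 \<noteq> 0" by (simp add: vv_def)
  show "pt (vv y) \<notin> GG w" using assms by (simp add: vv_GG_iff Yw_def)
qed

lemma Mw_Ol:
  assumes "orbit_eq w" "y \<in> Yw w" "z \<in> Mw w"
  shows "z \<in> Ol (vv y)"
  using ev_quotient(1)[OF assms(1) _ Yw_on_curve(2-4)[OF assms(2)]] assms(3) by (simp add: Mw_def)

lemma val_add:
  "orbit_eq w \<Longrightarrow> y \<in> Yw w \<Longrightarrow> z \<in> Mw w \<Longrightarrow> z' \<in> Mw w \<Longrightarrow> val y (z + z') = val y z + val y z'"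
  unfolding val_def by (intro ev_add Yw_on_curve Mw_Ol)

lemma val_cmult:
  assumes "orbit_eq w" "y \<in> Yw w" "z \<in> Mw w"
  shows "val y (\<c> a * z) = a * val y z"
proof -
  note v = Yw_on_curve(2)[OF assms(2)]
  show ?thesis
    unfolding val_def ev_mult[OF v Ol_const[OF v] Mw_Ol[OF assms]] ev_const[OF v] ..
qed

text \<open>From y^(1 + q^2 + q^4) = 1 it follows that \<open>Phi\<close> multiplies
  \<open>vv y\<close> by the scalar 1 / y; \<open>Pi_rep_value\<close> then applies.\<close>

lemma val_GF:
  assumes "orbit_eq w" "y \<in> Yw w" "z \<in> Lw w"
  shows "val y z ^ q^2 = val y z"
  unfolding val_def
proof (rule Pi_rep_value)
  note y = Yw_on_curve[OF assms(2)]
  show "Pi_rep z" using assms(3) by (simp add: Lw_def)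
  show "on_curve (vv y)" by (rule y)
  show "inverse y \<noteq> 0" using y by simp
  have "y ^ (1 + q^2 + q^2 * q^2) = 1"
    unfolding norm_NN power_mult using assms(2) orbit_norm by (simp add: Yw_def)
  then have n: "y * y ^ q^2 * (y ^ q^2) ^ q^2 = 1"
    by (simp only: power_add power_mult power_one_right)
  have "inverse y = y ^ q^2 * (y ^ q^2) ^ q^2"
    using n by (intro inverse_unique) (simp only: mult_ac)
  then have a: "(y ^ (q^2 + 1)) ^ q^2 = inverse y"
    by (simp only: power_add power_one_right power_mult_distrib mult_ac)
  have b: "y ^ q^2 = inverse y * y ^ (q^2 + 1)"
    using y(1) by (simp add: mult.assoc[symmetric])
  have "Phi (vv y) = vector [1, y ^ q^2, inverse y]"
    unfolding Phi_def vv_Pi[OF y(1)] by (simp only: vector_3 a power_one)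
  moreover have "inverse y *s vv y = vector [1, inverse y * y ^ (q^2 + 1), inverse y]"
    unfolding vv_Pi[OF y(1)] using y(1) by (simp add: vec_eq_iff forall_3)
  ultimately show "Phi (vv y) = inverse y *s vv y"
    unfolding b[symmetric] by simp
  show "z \<in> Ol (vv y)"
    using Mw_Ol assms Lw_Mw by blast
qed

text \<open>A zero of z is a zero of z D0, which lies in \<open>T NN\<close>, and the evaluation
  points have distinct y.\<close>

lemma Mw_zeros:
  assumes "orbit_eq w" "z \<in> Mw w" "z \<noteq> 0"
  shows "card {y \<in> Yw w. val y z = 0} \<le> NN"
proof -
  let ?h = "z * D0 w"
  have h: "?h \<in> T NN" using assms(2) by (simp add: Mw_def)
  have "?h \<noteq> 0" using assms(3) D0_nz by simp
  from zeros_bound[OF h this] show ?thesis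
  proof (rule conjunct2)
    fix y assume "y \<in> {y \<in> Yw w. val y z = 0}"
    then have y: "y \<in> Yw w" "val y z = 0" by auto
    have "ev (vv y) ?h = 0"
      using ev_quotient(2,3)[OF assms(1) h Yw_on_curve(2-4)[OF y(1)]] y(2) by (simp add: val_def)
    with Yw_on_curve(2)[OF y(1)] show "\<exists>x. on_curve (vector [y, x, 1]) \<and> ev (vector [y, x, 1]) ?h = 0"
      unfolding vv_def by blast
  qed
qed

end

section \<open>Parameters of the code\<close>

lemma divide_mult_rearrange:
  fixes k :: "'b::field"
  assumes "k * k' = 1" "D \<noteq> 0" "d \<noteq> 0"
  shows "y / (k * (D * d)) * D = k' * (y / d)"
  unfolding inverse_unique[OF assms(1), symmetric] using assms by (auto simp: divide_simps)

lemma divide_mult_cancel: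
  fixes b :: "'b::field"
  assumes "b \<noteq> 0" "y \<noteq> 0" "d \<noteq> 0"
  shows "(a * b * (x * d)) / (b * (y * d)) * y = a * x"
  using assms by simp

lemma mult_divide_rearrange:
  fixes k :: "'b::field"
  assumes "k \<noteq> 0"
  shows "(k * x) * (y / (k * (D * d))) = x * y / (d * D)"
  using assms by (simp add: mult_ac)

lemma field_subfield_ring:
  assumes "0 \<in> S" "1 \<in> S" "\<And>x y. x \<in> S \<Longrightarrow> y \<in> S \<Longrightarrow> x + y \<in> S" "\<And>x y. x \<in> S \<Longrightarrow> y \<in> S \<Longrightarrow> x * y \<in> S"
    and "\<And>x. x \<in> S \<Longrightarrow> - x \<in> S" "\<And>x. x \<in> S \<Longrightarrow> inverse x \<in> (S :: 'b::field set)"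
  shows "Ring.field (subfield_ring S)"
proof (rule cring.cring_fieldI)
  show "cring (subfield_ring S)"
  proof (rule cringI)
    show "abelian_group (subfield_ring S)"
      using assms(1,3,5) by (intro abelian_groupI)
        (auto simp: subfield_ring_def add_ac intro: bexI[of _ "- x" for x])
    show "comm_monoid (subfield_ring S)"
      using assms(2,4) by unfold_locales (auto simp: subfield_ring_def mult_ac)
  qed (simp add: subfield_ring_def distrib_right)
  show "Units (subfield_ring S) = carrier (subfield_ring S) - {\<zero>\<^bsub>subfield_ring S\<^esub>}"
  proof -
    have "\<exists>y\<in>S. y * x = 1" if "x \<in> S" "x \<noteq> 0" for x
      using assms(6)[OF that(1)] that(2) by (intro bexI[of _ "inverse x"]) simp_all
    then show ?thesis
      by (auto simp: subfield_ring_def Units_def mult.commute)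
  qed
qed

text \<open>A bridge from explicit sums of functions to subspaces and dimensions of vector spaces
  with a carrier. Generation takes place over S, whereas independence refers to arbitrary
  coefficients from the ambient field, which is the form in which the geometry provides it.\<close>

lemma func_space_subspace_dim:
  fixes S :: "'b::field set" and I :: "'i set" and B C :: "('i \<Rightarrow> 'b) set"
  defines "K \<equiv> subfield_ring S"
  defines "V \<equiv> ring.func_space K I"
  assumes K: "Ring.field K" and C: "C \<subseteq> I \<rightarrow>\<^sub>E S"
    and zero: "(\<lambda>i\<in>I. 0) \<in> C"
    and add: "\<And>f g. f \<in> C \<Longrightarrow> g \<in> C \<Longrightarrow> (\<lambda>i\<in>I. f i + g i) \<in> C"
    and smult: "\<And>a f. a \<in> S \<Longrightarrow> f \<in> C \<Longrightarrow> (\<lambda>i\<in>I. a * f i) \<in> C"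
    and B: "finite B" "B \<subseteq> C"
    and gen: "\<And>f. f \<in> C \<Longrightarrow> \<exists>a. (\<forall>b\<in>B. a b \<in> S) \<and> f = (\<lambda>i\<in>I. \<Sum>b\<in>B. a b * b i)"
    and indep: "\<forall>a. (\<forall>i\<in>I. (\<Sum>b\<in>B. a b * b i) = 0) \<longrightarrow> (\<forall>b\<in>B. a b = 0)"
  shows "VectorSpace.subspace K C V" "vectorspace.dim K (V\<lparr>carrier := C\<rparr>) = card B"
proof -
  interpret K: Ring.field K by (rule K)
  have V: "V = \<lparr>carrier = I \<rightarrow>\<^sub>E S, mult = (\<lambda>f g. \<lambda>i\<in>I. 0), one = (\<lambda>i\<in>I. 0), zero = (\<lambda>i\<in>I. 0),
      add = (\<lambda>f g. \<lambda>i\<in>I. f i + g i), smult = (\<lambda>c f. \<lambda>i\<in>I. c * f i)\<rparr>"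
    unfolding V_def K.func_space_def by (simp add: K_def subfield_ring_def)
  have Ks: "carrier K = S" "\<zero>\<^bsub>K\<^esub> = 0" by (simp_all add: K_def subfield_ring_def)
  have "module K V" unfolding V_def by (rule K.func_space_is_module)
  then interpret V: vectorspace K V by (intro vectorspace.intro K)
  show sub: "VectorSpace.subspace K C V"
    unfolding VectorSpace.subspace_def submodule_def
    using V.vectorspace_axioms \<open>module K V\<close> C zero add smult by (auto simp: V Ks(1))
  let ?W = "V\<lparr>carrier := C\<rparr>"
  interpret W: vectorspace K ?W by (rule V.subspace_is_vs[OF sub])
  have lc: "W.lincomb a A = (\<lambda>i\<in>I. \<Sum>b\<in>A. a b * b i)" if "finite A" "A \<subseteq> C" "a \<in> A \<rightarrow> S" for a A
    using that
  proof (induction A rule: finite_induct)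
    case empty
    then show ?case by (simp add: W.lincomb_def) (simp add: V restrict_def)
  next
    case (insert b A)
    have m: "a x \<odot>\<^bsub>?W\<^esub> x \<in> carrier ?W" if "x \<in> insert b A" for x
      using that insert.prems by (intro W.smult_closed) (auto simp: Ks(1))
    have "W.lincomb a (insert b A) = a b \<odot>\<^bsub>?W\<^esub> b \<oplus>\<^bsub>?W\<^esub> W.lincomb a A"
      unfolding W.lincomb_def using insert.hyps m by (intro W.finsum_insert) auto
    also have "\<dots> = (\<lambda>i\<in>I. \<Sum>b\<in>insert b A. a b * b i)"
      using insert.IH insert.prems insert.hyps by (auto simp: V fun_eq_iff)
    finally show ?case .
  qed
  have "W.basis B"
    unfolding W.basis_def
  proof (intro conjI notI)
    show "B \<subseteq> carrier ?W" using B by simp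
    show "W.span B = carrier ?W"
    proof
      show "W.span B \<subseteq> carrier ?W" using B by (intro W.span_is_subset2) simp
      show "carrier ?W \<subseteq> W.span B"
      proof
        fix f assume "f \<in> carrier ?W"
        then obtain a where a: "\<forall>b\<in>B. a b \<in> S" "f = (\<lambda>i\<in>I. \<Sum>b\<in>B. a b * b i)"
          using gen by auto
        then have "a \<in> B \<rightarrow> carrier K" "f = W.lincomb a B"
          using lc[OF B] by (auto simp: Ks)
        then show "f \<in> W.span B" unfolding W.span_def using B by blast
      qed
    qed
  next
    assume "W.lin_dep B"
    then obtain a v where a: "a \<in> B \<rightarrow> carrier K" "W.lincomb a B = \<zero>\<^bsub>?W\<^esub>" "v \<in> B" "a v \<noteq> \<zero>\<^bsub>K\<^esub>"
      using W.finite_lin_dep[OF B(1)] B by auto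
    have "(\<Sum>b\<in>B. a b * b i) = 0" if "i \<in> I" for i
    proof -
      have "(\<lambda>i\<in>I. \<Sum>b\<in>B. a b * b i) i = (\<lambda>i\<in>I. 0 :: 'b) i"
        using a(1,2) lc[OF B, of a] by (simp add: Ks V)
      then show ?thesis using that by simp
    qed
    then have "a v = 0" using indep a(3) by blast
    with a(4) show False by (simp add: Ks)
  qed
  then show "W.dim = card B" by (rule W.dim_basis[OF B(1)])
qed

context singer
begin

lemma Pi_repI:
  "homogeneous d A \<Longrightarrow> homogeneous d B \<Longrightarrow> \<phi> B \<noteq> 0 \<Longrightarrow> sg A = A \<Longrightarrow> sg B = B \<Longrightarrow> Pi_rep (\<phi> A / \<phi> B)"
  unfolding Pi_rep_def by (rule exI[of _ A], rule exI[of _ B], rule exI[of _ d]) simp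

lemma mon_MM:
  assumes "i \<in> Bi NN"
  shows "\<exists>a b c. MM a b c \<and> mon i = \<phi> (mm a b c) / dn"
proof -
  from assms consider "i = (0, 0)" | "i = (q - 1, 1)" | b a where "i = (a, b)" "1 \<le> b" "b < q" "a < q - b"
    unfolding Bi_NN by auto
  then show ?thesis
  proof cases
    case 1
    have "MM 0 1 q" using q2 by (simp add: MM_def)
    moreover have "mon i = \<phi> (mm 0 1 q) / dn" using \<phi>_mm_mon[of 1 0 q] 1 by simp
    ultimately show ?thesis by blast
  next
    case 2
    have "MM 1 q 0" using q2 by (simp add: MM_def)
    moreover have "mon i = \<phi> (mm 1 q 0) / dn" using \<phi>_mm_mon[of q 1 0] 2 q2 by simp
    ultimately show ?thesis by blast
  next
    case 3
    have "a + b < q" using 3 by linarith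
    then have "MM b (a + 1) (q - a - b)" using 3 by (simp add: MM_def)
    moreover have "mon i = \<phi> (mm b (a + 1) (q - a - b)) / dn"
      using \<phi>_mm_mon[of "a + 1" b "q - a - b"] 3 by simp
    ultimately show ?thesis by blast
  qed
qed

text \<open>The numerators are the traces of the multiples of the monomial by 1, \<beta>, \<beta>^2,
  over a denominator defined over \<Pi> and proportional to \<open>Bw w\<close>. The dual basis
  reassembles the monomial, with coefficients from the closure.\<close>

lemma mon_Lw:
  assumes w: "orbit_eq w" and i: "i \<in> Bi NN"
  shows "\<exists>z a. (\<forall>j. z j \<in> Lw w) \<and> mon i / D0 w = (\<Sum>j\<in>(UNIV :: 3 set). \<c> (a j) * z j)"
proof -
  obtain a b c where M: "MM a b c" "mon i = \<phi> (mm a b c) / dn"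
    using mon_MM[OF i] by blast
  obtain B k where B: "homogeneous (q + 1) B" "sg B = B" "k \<noteq> 0" "\<phi> B = \<c> k * \<phi> (Bw w)"
    using Pi_form_exists[OF w] by blast
  define A where "A j = sgtr (Const (bs j) * mm a b c)" for j
  define z where "z j = \<phi> (A j) / \<phi> B" for j
  have ck: "\<c> k \<noteq> 0" using B(3) by simp
  have nz: "\<phi> B \<noteq> 0"
    unfolding B(4) \<phi>_Bw using ck D0_nz dn_nz by simp
  have "z j \<in> Lw w" for j
  proof -
    have "Pi_rep (z j)"
    proof -
      have A: "homogeneous (q + 1) (A j)" "sg (A j) = A j"
        unfolding A_def by (intro homogeneous_sgtr homogeneous_cmult homogeneous_MM M(1) sg_sgtr sg3_bs sg3_mm)+
      show ?thesis unfolding z_def by (rule Pi_repI[OF A(1) B(1) nz A(2) B(2)])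
    qed
    moreover have e: "z j * D0 w = \<c> (inverse k) * (\<phi> (A j) / dn)"
    proof -
      have k: "\<c> k * \<c> (inverse k) = 1"
        unfolding c_simps(4)[symmetric] using B(3) by (simp add: c_simps(2))
      from divide_mult_rearrange[OF k D0_nz dn_nz] show ?thesis
        unfolding z_def B(4) \<phi>_Bw .
    qed
    have "z j * D0 w \<in> T NN"
      using sgtr_MM_T[OF M(1)] unfolding e A_def T_def by (simp only: Sp_cmult)
    ultimately show ?thesis by (simp add: Lw_def)
  qed
  moreover have "mon i / D0 w = (\<Sum>j\<in>UNIV. \<c> (k * xs j) * z j)"
  proof -
    from mult_divide_rearrange[OF ck] have "\<c> (k * xs j) * z j = \<c> (xs j) * \<phi> (A j) / (dn * D0 w)" for j
      unfolding z_def B(4) \<phi>_Bw c_simps(4) .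
    then have "(\<Sum>j\<in>UNIV. \<c> (k * xs j) * z j) = \<phi> (mm a b c) / (dn * D0 w)"
      unfolding A_def by (simp only: sum_divide_distrib[symmetric] sum_sgtr)
    then show ?thesis unfolding M(2) by simp
  qed
  ultimately show ?thesis
    by (intro exI[of _ z] exI[of _ "\<lambda>j. k * xs j"] conjI allI)
qed

text \<open>Over the closure, \<open>Lw w\<close> and the quotients of monomials by D0 have the same
  span, so a basis chosen inside \<open>Lw w\<close> has as many members as there are monomials.
  Coefficients are still taken from the closure.\<close>

lemma Lw_basis:
  assumes w: "orbit_eq w"
  shows "\<exists>B. B \<subseteq> Lw w \<and> finite B \<and> card B = card (Bi NN)
    \<and> (\<forall>f. (\<Sum>b\<in>B. \<c> (f b) * b) = 0 \<longrightarrow> (\<forall>b\<in>B. f b = 0))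
    \<and> (\<forall>z\<in>Lw w. \<exists>f. z = (\<Sum>b\<in>B. \<c> (f b) * b))"
proof -
  interpret V: vector_space "\<lambda>a z. \<c> a * z"
    by unfold_locales (simp_all add: c_simps(3,4) algebra_simps del: fls_plus_const fls_const_mult_const)
  define m where "m i = mon i / D0 w" for i
  let ?I = "m ` Bi NN"
  have inj: "inj_on m (Bi NN)"
    using inj_wt_Bi D0_nz by (auto simp: m_def inj_on_def)
  have indI: "V.independent ?I"
  proof
    assume "V.dependent ?I"
    then obtain u v where u: "v \<in> ?I" "u v \<noteq> 0" "(\<Sum>v\<in>?I. \<c> (u v) * v) = 0"
      using V.dependent_finite[of ?I] by auto
    have "(\<Sum>i\<in>Bi NN. \<c> (u (m i)) * mon i) = (\<Sum>v\<in>?I. \<c> (u v) * v) * D0 w"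
    proof -
      have "m i * D0 w = mon i" for i using D0_nz by (simp add: m_def)
      then show ?thesis by (simp add: sum.reindex[OF inj] sum_distrib_right mult.assoc)
    qed
    then have "u (m i) = 0" if "i \<in> Bi NN" for i
      using u(3) that Bi_independent[of "\<lambda>i. u (m i)"] by simp
    with u(1,2) show False by auto
  qed
  have "Lw w \<subseteq> V.span ?I"
  proof
    fix z assume "z \<in> Lw w"
    then obtain f where f: "z * D0 w = (\<Sum>i\<in>Bi NN. \<c> (f i) * mon i)"
      unfolding Lw_def T_eq by (auto elim: SpE)
    have "z = (\<Sum>i\<in>Bi NN. \<c> (f i) * mon i) / D0 w"
      unfolding f[symmetric] using D0_nz by simp
    also have "\<dots> = (\<Sum>i\<in>Bi NN. \<c> (f i) * m i)"
      by (simp add: sum_divide_distrib m_def)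
    finally show "z \<in> V.span ?I"
      by (simp only:) (intro V.span_sum V.span_scale V.span_base imageI)
  qed
  moreover have "?I \<subseteq> V.span (Lw w)"
  proof
    fix x assume "x \<in> ?I"
    then obtain i where i: "x = m i" "i \<in> Bi NN" by blast
    from mon_Lw[OF w i(2)] obtain z a where "\<forall>j. z j \<in> Lw w" "m i = (\<Sum>j\<in>(UNIV :: 3 set). \<c> (a j) * z j)"
      unfolding m_def by blast
    then show "x \<in> V.span (Lw w)"
      unfolding i(1) by (simp only:) (intro V.span_sum V.span_scale V.span_base, blast)
  qed
  ultimately have span: "V.span (Lw w) = V.span ?I"
    by (simp add: V.span_eq)
  obtain B where B: "B \<subseteq> Lw w" "V.independent B" "Lw w \<subseteq> V.span B" "card B = V.dim (Lw w)"
    by (rule V.basis_exists)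
  have fin: "finite B"
    using V.independent_span_bound[of ?I B] B \<open>Lw w \<subseteq> V.span ?I\<close> by auto
  have "card B = card (Bi NN)"
    using B(4) V.span_eq_dim[OF span] V.dim_eq_card_independent[OF indI] card_image[OF inj] by simp
  moreover have "\<forall>b\<in>B. f b = 0" if "(\<Sum>b\<in>B. \<c> (f b) * b) = 0" for f
    using B(2) that unfolding V.dependent_finite[OF fin] by blast
  moreover have "\<exists>f. z = (\<Sum>b\<in>B. \<c> (f b) * b)" if "z \<in> Lw w" for z
    using B(3) that unfolding V.span_finite[OF fin] by blast
  ultimately show ?thesis using B(1) fin by blast
qed

lemma val_sum:
  assumes "orbit_eq w" "y \<in> Yw w" "B \<subseteq> Mw w"
  shows "val y (\<Sum>b\<in>B. \<c> (f b) * b) = (\<Sum>b\<in>B. f b * val y b)"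
proof -
  note v = Yw_on_curve(2)[OF assms(2)]
  have "\<c> (f b) * b \<in> Ol (vv y)" if "b \<in> B" for b
    using that assms by (intro Mw_Ol[OF assms(1,2)] Mw_cmult) blast
  then have "val y (\<Sum>b\<in>B. \<c> (f b) * b) = (\<Sum>b\<in>B. val y (\<c> (f b) * b))"
    unfolding val_def by (rule ev_sum[OF v])
  also have "\<dots> = (\<Sum>b\<in>B. f b * val y b)"
    using assms(3) by (intro sum.cong refl val_cmult[OF assms(1,2)]) blast
  finally show ?thesis .
qed

lemma Mw_sum: "B \<subseteq> Mw w \<Longrightarrow> (\<Sum>b\<in>B. \<c> (f b) * b) \<in> Mw w"
  by (induction B rule: infinite_finite_induct) (auto intro: Mw_add Mw_cmult Mw_0)

text \<open>There are q N evaluation points, more than the N zeros that a nonzero function can have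
  among them.\<close>

lemma Mw_eq_0:
  assumes "orbit_eq w" "z \<in> Mw w" "\<And>y. y \<in> Yw w \<Longrightarrow> val y z = 0"
  shows "z = 0"
proof (rule ccontr)
  assume "z \<noteq> 0"
  have "{y \<in> Yw w. val y z = 0} = Yw w" using assms(3) by auto
  with Mw_zeros[OF assms(1,2) \<open>z \<noteq> 0\<close>] have "q * NN \<le> 1 * NN"
    using card_Yw(1)[OF assms(1)] by simp
  then show False using NN_gt q2 by simp
qed

text \<open>Raising the values to the power \<open>q\<^sup>2\<close> gives the relation with coefficients \<open>f b ^ q\<^sup>2\<close>;
  by independence it is the same relation.\<close>

lemma Lw_coeffs:
  assumes w: "orbit_eq w" and B: "B \<subseteq> Lw w" and z: "(\<Sum>b\<in>B. \<c> (f b) * b) \<in> Lw w"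
    and ind: "\<And>f. (\<Sum>b\<in>B. \<c> (f b) * b) = 0 \<Longrightarrow> (\<forall>b\<in>B. f b = 0)" and b: "b \<in> B"
  shows "f b ^ q^2 = f b"
proof -
  have BM: "B \<subseteq> Mw w" using B Lw_Mw by blast
  have "(\<Sum>b\<in>B. \<c> (f b ^ q^2 - f b) * b) = 0"
  proof (rule Mw_eq_0[OF w Mw_sum[OF BM]])
    fix y assume y: "y \<in> Yw w"
    have "(\<Sum>b\<in>B. f b * val y b) ^ q^2 = (\<Sum>b\<in>B. f b * val y b)"
      using val_GF[OF w y z] unfolding val_sum[OF w y BM] .
    then have "(\<Sum>b\<in>B. f b ^ q^2 * val y b ^ q^2) = (\<Sum>b\<in>B. f b * val y b)"
      unfolding ring_morph_sum[OF frobQ] power_mult_distrib .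
    moreover have "(\<Sum>b\<in>B. f b ^ q^2 * val y b ^ q^2) = (\<Sum>b\<in>B. f b ^ q^2 * val y b)"
      using B val_GF[OF w y] by (intro sum.cong) auto
    ultimately show "val y (\<Sum>b\<in>B. \<c> (f b ^ q^2 - f b) * b) = 0"
      unfolding val_sum[OF w y BM] by (simp add: left_diff_distrib sum_subtractf)
  qed
  from ind[OF this] b show ?thesis by simp
qed

lemma field_GF: "Ring.field (subfield_ring (GF (q^2) :: 'a set))"
  using ring_morph_simps[OF frobQ] by (intro field_subfield_ring) (simp_all add: GF_eq power_inverse)

section \<open>Words, dimension and minimum distance of the code\<close>

context
  fixes w :: 'a and n :: nat and g :: "nat \<Rightarrow> 'a"
  assumes w: "orbit_eq w" and g: "bij_betw g {1..n} (Yw w)"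
begin

definition wd :: "'a fls \<Rightarrow> nat \<Rightarrow> 'a" where
  "wd z = (\<lambda>i\<in>{1..n}. val (g i) z)"

lemma n_eq: "n = q * NN"
  using bij_betw_same_card[OF g] card_Yw[OF w] by simp

lemma g_Yw: "i \<in> {1..n} \<Longrightarrow> g i \<in> Yw w"
  using g by (auto simp: bij_betw_def)

lemma wd_add: "z \<in> Mw w \<Longrightarrow> z' \<in> Mw w \<Longrightarrow> wd (z + z') = (\<lambda>i\<in>{1..n}. wd z i + wd z' i)"
  unfolding wd_def by (rule restrict_ext) (simp add: val_add[OF w g_Yw])

lemma wd_cmult: "z \<in> Mw w \<Longrightarrow> wd (\<c> a * z) = (\<lambda>i\<in>{1..n}. a * wd z i)"
  unfolding wd_def by (rule restrict_ext) (simp add: val_cmult[OF w g_Yw])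

lemma wd_sum: "B \<subseteq> Mw w \<Longrightarrow> wd (\<Sum>b\<in>B. \<c> (f b) * b) = (\<lambda>i\<in>{1..n}. \<Sum>b\<in>B. f b * wd b i)"
  unfolding wd_def by (rule restrict_ext) (simp add: val_sum[OF w g_Yw])

lemma wd_0: "wd 0 = (\<lambda>i\<in>{1..n}. 0)"
  using wd_cmult[OF Mw_0, of 0] by simp

lemma wd_eq_0:
  assumes "z \<in> Mw w" "\<And>i. i \<in> {1..n} \<Longrightarrow> wd z i = 0"
  shows "z = 0"
proof (rule Mw_eq_0[OF w assms(1)])
  fix y assume "y \<in> Yw w"
  then obtain i where "i \<in> {1..n}" "y = g i" using g unfolding bij_betw_def by blast
  with assms(2)[of i] show "val y z = 0" by (simp add: wd_def)
qed

lemma wd_diff: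
  assumes "z \<in> Mw w" "z' \<in> Mw w" "i \<in> {1..n}"
  shows "wd (z + \<c> (- 1) * z') i = wd z i - wd z' i"
  unfolding wd_add[OF assms(1) Mw_cmult[OF assms(2)]] wd_cmult[OF assms(2)] using assms(3) by simp

lemma inj_wd: "inj_on wd (Mw w)"
proof (rule inj_onI)
  fix z z' assume z: "z \<in> Mw w" "z' \<in> Mw w" "wd z = wd z'"
  have "z + \<c> (- 1) * z' = 0"
    using z wd_diff[OF z(1,2)] by (intro wd_eq_0 Mw_add Mw_cmult) simp_all
  then show "z = z'" unfolding c_simps by simp
qed

lemma code_dimension:
  defines "S \<equiv> subfield_ring (GF (q^2) :: 'a set)"
  shows "VectorSpace.subspace S (wd ` Lw w) (ring.func_space S {1..n})"
    "vectorspace.dim S ((ring.func_space S {1..n})\<lparr>carrier := wd ` Lw w\<rparr>) = (q^2 - q) div 2 + 2"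
proof -
  from Lw_basis[OF w] obtain B where B: "B \<subseteq> Lw w" "finite B" "card B = card (Bi NN)"
    and ind_all: "\<forall>f. (\<Sum>b\<in>B. \<c> (f b) * b) = 0 \<longrightarrow> (\<forall>b\<in>B. f b = 0)"
    and gen_all: "\<forall>z\<in>Lw w. \<exists>f. z = (\<Sum>b\<in>B. \<c> (f b) * b)"
    by (elim exE conjE) (rule that; assumption)
  note ind = ind_all[THEN spec, THEN mp] and gen = gen_all[THEN bspec]
  have BM: "B \<subseteq> Mw w" using B(1) Lw_Mw by blast
  have LM: "z \<in> Lw w \<Longrightarrow> z \<in> Mw w" for z using Lw_Mw by blast
  have inj: "inj_on wd B" using inj_on_subset[OF inj_wd BM] .
  \<comment> \<open>Since \<open>wd\<close> is injective, words can stand for basis functions, and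
    coefficients are indexed by words.\<close>
  have sumB: "(\<lambda>i\<in>{1..n}. \<Sum>x\<in>wd ` B. a x * x i) = wd (\<Sum>b\<in>B. \<c> (a (wd b)) * b)" for a
    unfolding wd_sum[OF BM] by (simp add: sum.reindex[OF inj])
  have C: "wd ` Lw w \<subseteq> {1..n} \<rightarrow>\<^sub>E GF (q^2)"
    using val_GF[OF w g_Yw] by (auto simp: wd_def GF_eq)
  have zero: "(\<lambda>i\<in>{1..n}. 0) \<in> wd ` Lw w"
    unfolding wd_0[symmetric] using Lw_0 by blast
  have add: "(\<lambda>i\<in>{1..n}. x i + y i) \<in> wd ` Lw w" if xy: "x \<in> wd ` Lw w" "y \<in> wd ` Lw w" for x y
  proof -
    obtain z z' where z: "x = wd z" "z \<in> Lw w" "y = wd z'" "z' \<in> Lw w" using xy by blast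
    show ?thesis
      unfolding z(1,3) wd_add[OF LM[OF z(2)] LM[OF z(4)], symmetric] by (intro imageI Lw_add z)
  qed
  have smult: "(\<lambda>i\<in>{1..n}. a * x i) \<in> wd ` Lw w" if a: "a \<in> GF (q^2)" and x: "x \<in> wd ` Lw w" for a x
  proof -
    obtain z where z: "x = wd z" "z \<in> Lw w" using x by blast
    have "a ^ q^2 = a" using a by (simp add: GF_eq)
    with z(2) have "\<c> a * z \<in> Lw w" by (rule Lw_cmult)
    then show ?thesis
      unfolding z(1) wd_cmult[OF LM[OF z(2)], symmetric] by (rule imageI)
  qed
  have fin: "finite (wd ` B)" "wd ` B \<subseteq> wd ` Lw w"
    using B by auto
  have gen': "\<exists>a. (\<forall>x\<in>wd ` B. a x \<in> GF (q^2)) \<and> y = (\<lambda>i\<in>{1..n}. \<Sum>x\<in>wd ` B. a x * x i)" if y: "y \<in> wd ` Lw w" for y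
  proof -
    obtain z where z: "z \<in> Lw w" "y = wd z" using y by blast
    obtain f where f: "z = (\<Sum>b\<in>B. \<c> (f b) * b)" using gen[OF z(1)] by blast
    \<comment> \<open>The coefficients come from the closure; membership of z in \<open>Lw w\<close>
      makes them fixed by Frobenius.\<close>
    have 1: "f b ^ q^2 = f b" if "b \<in> B" for b
      using z(1) unfolding f by (rule Lw_coeffs[OF w B(1) _ ind that])
    have inv: "the_inv_into B wd (wd b) = b" if "b \<in> B" for b
      by (rule the_inv_into_f_f[OF inj that])
    have "(\<Sum>b\<in>B. \<c> (f (the_inv_into B wd (wd b))) * b) = z"
      unfolding f using inv by (intro sum.cong) simp_all
    then have "y = (\<lambda>i\<in>{1..n}. \<Sum>x\<in>wd ` B. f (the_inv_into B wd x) * x i)"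
      unfolding sumB z(2) by (simp only:)
    moreover have "f (the_inv_into B wd (wd b)) \<in> GF (q^2)" if "b \<in> B" for b
      unfolding inv[OF that] GF_eq mem_Collect_eq by (rule 1[OF that])
    then have "\<forall>x\<in>wd ` B. f (the_inv_into B wd x) \<in> GF (q^2)"
      by (intro ballI) (elim imageE, simp only:)
    ultimately show ?thesis
      by (intro exI[of _ "\<lambda>x. f (the_inv_into B wd x)"] conjI)
  qed
  have ind': "\<forall>a. (\<forall>i\<in>{1..n}. (\<Sum>x\<in>wd ` B. a x * x i) = 0) \<longrightarrow> (\<forall>x\<in>wd ` B. a x = 0)"
  proof (intro allI impI)
    fix a assume a: "\<forall>i\<in>{1..n}. (\<Sum>x\<in>wd ` B. a x * x i) = 0"
    have "(\<Sum>b\<in>B. \<c> (a (wd b)) * b) = 0"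
    proof (rule wd_eq_0[OF Mw_sum[OF BM]])
      fix i assume i: "i \<in> {1..n}"
      show "wd (\<Sum>b\<in>B. \<c> (a (wd b)) * b) i = 0"
        unfolding sumB[symmetric] restrict_apply'[OF i] using a i by blast
    qed
    from ind[OF this] show "\<forall>x\<in>wd ` B. a x = 0" by (simp only: ball_simps)
  qed
  note main = func_space_subspace_dim[where S = "GF (q^2)" and C = "wd ` Lw w" and I = "{1..n}" and B = "wd ` B", OF field_GF C zero add smult fin gen' ind']
  show "VectorSpace.subspace S (wd ` Lw w) (ring.func_space S {1..n})"
    unfolding S_def by (rule main(1))
  show "vectorspace.dim S ((ring.func_space S {1..n})\<lparr>carrier := wd ` Lw w\<rparr>) = (q^2 - q) div 2 + 2"
    unfolding S_def by (rule main(2)[unfolded card_image[OF inj] B(3) card_Bi_NN])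
qed

lemma weight:
  "card {i \<in> {1..n}. wd z i \<noteq> 0} = q * NN - card {y \<in> Yw w. val y z = 0}"
proof -
  have "{i \<in> {1..n}. wd z i \<noteq> 0} = {i \<in> {1..n}. val (g i) z \<noteq> 0}"
    by (auto simp: wd_def)
  moreover have "card (g ` {i \<in> {1..n}. val (g i) z \<noteq> 0}) = card {i \<in> {1..n}. val (g i) z \<noteq> 0}"
    by (intro card_image inj_on_subset[OF bij_betw_imp_inj_on[OF g]]) auto
  ultimately have "card {i \<in> {1..n}. wd z i \<noteq> 0} = card (g ` {i \<in> {1..n}. val (g i) z \<noteq> 0})"
    by (simp only:)
  also have "g ` {i \<in> {1..n}. val (g i) z \<noteq> 0} = {y \<in> g ` {1..n}. val y z \<noteq> 0}"
    by blast
  also have "\<dots> = Yw w - {y \<in> Yw w. val y z = 0}"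
    using bij_betw_imp_surj_on[OF g] by auto
  finally show ?thesis
    using card_Yw[OF w] by (simp add: card_Diff_subset)
qed

text \<open>The orbit of another root of \<open>orbit_eq\<close> is the zero divisor of a function in the space.\<close>

lemma light_function:
  "\<exists>z\<in>Lw w. card {y \<in> Yw w. val y z = 0} = NN"
proof -
  have "card ({u. orbit_eq u} - {w}) = q"
    using card_orbit_eq w by simp
  then have "{u. orbit_eq u} - {w} \<noteq> {}" using q2 by (metis card.empty not_less_zero)
  then obtain u where u: "orbit_eq u" "u \<noteq> w" by blast
  obtain A k where A: "homogeneous (q + 1) A" "sg A = A" "k \<noteq> 0" "\<phi> A = \<c> k * \<phi> (Bw u)"
    using Pi_form_exists[OF u(1)] by blast
  obtain B l where B: "homogeneous (q + 1) B" "sg B = B" "l \<noteq> 0" "\<phi> B = \<c> l * \<phi> (Bw w)"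
    using Pi_form_exists[OF w] by blast
  define z where "z = \<phi> A / \<phi> B"
  have cl: "\<c> l \<noteq> 0" "\<c> k \<noteq> 0" using A(3) B(3) by simp_all
  have nz: "\<phi> B \<noteq> 0"
    unfolding B(4) \<phi>_Bw using cl D0_nz dn_nz by simp
  have zD: "z * D0 w = \<c> (k / l) * D0 u"
  proof -
    have k: "\<c> k = \<c> (k / l) * \<c> l" unfolding c_simps(4)[symmetric] using B(3) by simp
    from divide_mult_cancel[OF cl(1) D0_nz[of w] dn_nz] show ?thesis
      unfolding z_def A(4) B(4) \<phi>_Bw k .
  qed
  have zT: "z * D0 w \<in> T NN"
    unfolding zD using D0_T unfolding T_def by (rule Sp_cmult)
  have "Pi_rep z"
    unfolding z_def by (rule Pi_repI[OF A(1) B(1) nz A(2) B(2)])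
  with zT have zL: "z \<in> Lw w" by (simp add: Lw_def)
  have "val y z = 0 \<longleftrightarrow> y ^ NN = u" if y: "y \<in> Yw w" for y
  proof -
    note v = Yw_on_curve[OF y]
    have "val y z = 0 \<longleftrightarrow> ev (vv y) (z * D0 w) = 0"
      unfolding val_def using ev_quotient(2,3)[OF w zT v(2-4)] by simp
    also have "ev (vv y) (z * D0 w) = k / l * ev (vv y) (D0 u)"
      unfolding zD ev_mult[OF v(2) Ol_const[OF v(2)] affine_D0(1)[OF v(2,3)]] ev_const[OF v(2)] ..
    also have "\<dots> = 0 \<longleftrightarrow> ev (vv y) (D0 u) = 0"
      using A(3) B(3) by simp
    also have "\<dots> \<longleftrightarrow> y ^ NN = u"
      unfolding D0_zero_iff[OF v(2,3) u(1)] vv_GG_iff ..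
    finally show ?thesis .
  qed
  then have "{y \<in> Yw w. val y z = 0} = {y. y ^ NN = u}"
    using u by (auto simp: Yw_def)
  then show ?thesis
    using zL card_roots_NN(1)[OF orbit_eq_nz[OF u(1)]] by (intro bexI[of _ z]) simp
qed

text \<open>A distance is the weight of the word of a difference of functions, which has at most N
  zeros. The bound is attained between the word of \<open>light_function\<close> and the zero
  word.\<close>

lemma code_min_distance: "min_distance n (wd ` Lw w) = q * NN - NN"
  unfolding min_distance_def
proof (rule Min_eqI)
  let ?W = "{card {i \<in> {1..n}. x i \<noteq> y i} |x y. x \<in> wd ` Lw w \<and> y \<in> wd ` Lw w \<and> x \<noteq> y}"
  have "card {i \<in> {1..n}. x i \<noteq> y i} \<le> card {1..n}" for x y :: "nat \<Rightarrow> 'a"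
    by (intro card_mono) auto
  then show "finite ?W"
    by (intro finite_subset[of ?W "{..n}"]) auto
  show "q * NN - NN \<le> d" if "d \<in> ?W" for d
  proof -
    from that obtain z z' where d: "d = card {i \<in> {1..n}. wd z i \<noteq> wd z' i}" "z \<in> Lw w" "z' \<in> Lw w" "wd z \<noteq> wd z'"
      by blast
    have M: "z \<in> Mw w" "z' \<in> Mw w" using d Lw_Mw by auto
    let ?z = "z + \<c> (- 1) * z'"
    have zM: "?z \<in> Mw w" by (intro Mw_add Mw_cmult M)
    have "?z \<noteq> 0"
    proof
      assume "?z = 0"
      then have "z = z'" unfolding c_simps by simp
      with d(4) show False by simp
    qed
    then have "card {y \<in> Yw w. val y ?z = 0} \<le> NN" by (rule Mw_zeros[OF w zM])
    moreover have "{i \<in> {1..n}. wd z i \<noteq> wd z' i} = {i \<in> {1..n}. wd ?z i \<noteq> 0}"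
      using wd_diff[OF M] by auto
    ultimately show ?thesis unfolding d(1) using weight[of ?z] by simp
  qed
  obtain z where z: "z \<in> Lw w" "card {y \<in> Yw w. val y z = 0} = NN"
    using light_function by blast
  have c: "card {i \<in> {1..n}. wd z i \<noteq> wd 0 i} = q * NN - NN"
  proof -
    have "{i \<in> {1..n}. wd z i \<noteq> wd 0 i} = {i \<in> {1..n}. wd z i \<noteq> 0}"
      by (auto simp: wd_0)
    then show ?thesis using weight[of z] z(2) by simp
  qed
  have "wd z \<noteq> wd 0"
  proof
    assume "wd z = wd 0"
    with c have "q * NN \<le> 1 * NN" by simp
    then show False using NN_gt q2 by simp
  qed
  with z(1) Lw_0 c show "q * NN - NN \<in> ?W" by (intro CollectI exI[of _ "wd z"] exI[of _ "wd 0"]) auto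
qed

end

end

lemma (in singer) code_theorem:
  fixes R :: "'a point" and Q :: "nat \<Rightarrow> 'a point"
  assumes R: "R \<in> curve F \<inter> Pi_plane q" and G: "G = singer_orbit q \<beta> R"
    and Q: "bij_betw Q {1..n} (curve F \<inter> Pi_plane q - G)"
  shows "n = q * (q^2 - q + 1) \<and>
    linear_code (GF (q^2)) n ((q^2 - q) div 2 + 2) (q^3 + 1 - 2 * (q^2 - q + 1))
      (functional_code q F n Q (sum_of_points G)) \<and>
    int (min_distance n (functional_code q F n Q (sum_of_points G)))
      = int n - deg_divisor (sum_of_points G)"
proof -
  from R obtain y where y: "R = pt (vv y)" "orbit_eq (y ^ NN)"
    unfolding curve_Pi by (elim imageE) (rule that; simp)
  define w where "w = y ^ NN"
  have w: "orbit_eq w" using y(2) by (simp only: w_def)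
  have G: "G = GG w"
    unfolding G y(1) w_def by (rule singer_orbit_eq[OF orbit_eq_y_nz[OF y(2)]])
  \<comment> \<open>The enumeration of the points is pulled back to their parameters y.\<close>
  define g where "g = the_inv_into (Yw w) (\<lambda>y. pt (vv y)) \<circ> Q"
  have Qb: "bij_betw Q {1..n} ((\<lambda>y. pt (vv y)) ` Yw w)"
    using Q unfolding G curve_Pi_diff .
  have g: "bij_betw g {1..n} (Yw w)"
    unfolding g_def
    by (rule bij_betw_trans[OF Qb bij_betw_the_inv_into[OF inj_on_imp_bij_betw[OF inj_vv]]])
  have Qg: "Q i = pt (vv (g i))" if i: "i \<in> {1..n}" for i
  proof -
    have "Q i \<in> (\<lambda>y. pt (vv y)) ` Yw w"
      using bij_betw_apply[OF Qb i] .
    from f_the_inv_into_f[OF inj_vv this] show ?thesis by (simp add: g_def)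
  qed
  have code: "functional_code q F n Q (sum_of_points G) = wd n g ` Lw w"
  proof -
    have "(\<lambda>i\<in>{1..n}. fun_value (cls z) (Q i)) = wd n g z" if z: "z \<in> Lw w" for z
      unfolding wd_def[OF w g]
    proof (rule restrict_ext)
      fix i assume i: "i \<in> {1..n}"
      have y: "g i \<in> Yw w" by (rule g_Yw[OF w g i])
      have "z \<in> Mw w" using z Lw_Mw by blast
      from fun_value_eq[OF Yw_on_curve(2)[OF y] Mw_Ol[OF w y this]]
      show "fun_value (cls z) (Q i) = val (g i) z"
        unfolding Qg[OF i] val_def .
    qed
    moreover have "functional_code q F n Q (sum_of_points G)
        = (\<lambda>f. \<lambda>i\<in>{1..n}. fun_value f (Q i)) ` cls ` Lw w"
      unfolding functional_code_def G riemann_roch_space_eq[OF w] by blast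
    ultimately show ?thesis
      unfolding image_image by simp
  qed
  have n: "n = q * NN" by (rule n_eq[OF w g])
  have d: "min_distance n (wd n g ` Lw w) = q * NN - NN"
    by (rule code_min_distance[OF w g])
  \<comment> \<open>The points of the curve in \<Pi>, counted as q + 1 orbits of length N.\<close>
  have "q^3 + 1 = (q + 1) * NN"
    unfolding NN using q2 by (cases q) (simp_all add: power3_eq_cube algebra_simps)
  then have d': "q^3 + 1 - 2 * (q^2 - q + 1) = q * NN - NN"
    unfolding NN_def[symmetric] by simp
  have "int (q * NN - NN) = int n - deg_divisor (sum_of_points G)"
    unfolding G deg_divisor_GG[OF orbit_eq_nz[OF w]] n using q2 by (simp add: of_nat_diff)
  with n d d' code_dimension[OF w g] show ?thesis
    unfolding code linear_code_def Let_def NN_def[symmetric] by simp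
qed

theorem theorem4p1:
  fixes p e q n :: nat
    and \<tau> \<beta> :: "'a::alg_closed_field"
    and R :: "'a point" and G :: "'a point set"
    and Q :: "nat \<Rightarrow> 'a point"
  assumes "prime p" and "e > 0" and "q = p ^ e" and "q > 2"
    and "CHAR('a) = p"
    and "\<tau> ^ (q^2 + q + 1) = 1"
    and "\<beta> \<in> GF (q^6)" and "primitive_root_of_unity (q^2 - q + 1) \<beta>"
    and "R \<in> curve (hermitian q \<tau>) \<inter> Pi_plane q"
    and "G = singer_orbit q \<beta> R"
    and "bij_betw Q {1..n} (curve (hermitian q \<tau>) \<inter> Pi_plane q - G)"
  shows "n = q * (q^2 - q + 1) \<and>
    linear_code (GF (q^2)) n ((q^2 - q) div 2 + 2) (q^3 + 1 - 2 * (q^2 - q + 1))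
      (functional_code q (hermitian q \<tau>) n Q (sum_of_points G)) \<and>
    int (min_distance n (functional_code q (hermitian q \<tau>) n Q (sum_of_points G)))
      = int n - deg_divisor (sum_of_points G)"
proof -
  interpret singer p e q \<tau> \<beta>
    using assms(1-8) by unfold_locales
  show ?thesis
    by (rule code_theorem[OF assms(9-11)])
qed

end
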